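(* Let $\sigma>-1$ with $\sigma\ne0,2,4,\dots$ and let $g_\sigma(x)=\gamma(-\sigma)|x|^\sigma$. (i) There exists a unique extremal minorant $l_\sigma(z)$ of exponential type $2\pi$ for $g_\sigma(x)$. The function $l_\sigma(x)$ interpolates the values of $g_\sigma(x)$ at $\mathbb{Z}+\frac12$ and satisfies $$\int_{-\infty}^\infty\{g_\sigma(x)-l_\sigma(x)\}\,dx=\bigl(2-2^{1-\sigma}\bigr)\,\gamma(1+\sigma)\,\zeta(1+\sigma).$$ (ii) If $0<\sigma$, there exists a unique extremal majorant $m_\sigma(z)$ of exponential type $2\pi$ for $g_\sigma(x)$. The function $m_\sigma(x)$ interpolates the values of $g_\sigma(x)$ at $\mathbb{Z}$ and satisfies $$\int_{-\infty}^\infty\{m_\sigma(x)-g_\sigma(x)\}\,dx=2\,\gamma(1+\sigma)\,\zeta(1+\sigma).$$ (iii) There exists a unique best approximation $k_\sigma(z)$ of exponential type $\pi$ for $g_\sigma(x)$. The function $k_\sigma(x)$ interpolates the values of $g_\sigma(x)$ at $\mathbb{Z}+\frac12$, satisfying $$\mathrm{sgn}(\cos\pi x)\{g_\sigma(x)-k_\sigma(x)\}\ge0$$ and $$\int_{-\infty}^\infty|g_\sigma(x)-k_\sigma(x)|\,dx=\Bigl(\frac4\pi\Bigr)^{\frac{3+\sigma}2}\Gamma\Bigl(\frac{1+\sigma}2\Bigr)L(2+\sigma,\chi).$$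
   Context: $\gamma(s)=\pi^{-s/2}\Gamma(s/2)$; $\zeta$ is the Riemann zeta-function; $\chi$ is the nonprincipal Dirichlet character modulo $4$, with $L(s,\chi)=\sum_{n=0}^\infty(-1)^n(2n+1)^{-s}$ for $\Re s>1$. An entire function $F$ is of exponential type (at most) $2\pi\delta$ if for every $\epsilon>0$ there is $C>0$ with $|F(z)|\le Ce^{(2\pi\delta+\epsilon)|z|}$ for all $z\in\mathbb{C}$. An extremal minorant (resp. majorant) of exponential type $2\pi$ for $g$ is an entire function $F$ of exponential type at most $2\pi$, real valued on $\mathbb{R}$, with $F(x)\le g(x)$ (resp. $F(x)\ge g(x)$) for all real $x$, minimizing $\int_{-\infty}^\infty|g(x)-F(x)|\,dx$ among all such functions. A best approximation of exponential type $\pi$ for $g$ is an entire function $F$ of exponential type at most $\pi$ minimizing $\int_{-\infty}^\infty|g(x)-F(x)|\,dx$ among all such functions. When $-1<\sigma<0$, $g_\sigma(0)=+\infty$, so pointwise inequalities at $x=0$ hold trivially (they are conditions at $x\neq0$). *)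

theory Defs
  imports "HOL-Complex_Analysis.Complex_Analysis"
begin

definition gamma_factor :: "real \<Rightarrow> real" where
  "gamma_factor s = pi powr (- s / 2) * Gamma (s / 2)"

(* The value at s of the analytic continuation of the Dirichlet series to some punctured
   half-plane {z. Re z > c} - {1} containing s.  By the identity theorem the value depends
   neither on c nor on f (see riemann_zeta_eqI); the value at the pole s = 1 is unspecified. *)
definition riemann_zeta :: "complex \<Rightarrow> complex" where
  "riemann_zeta s = (THE w. \<exists>c f. c < Re s \<and> f holomorphic_on {z. Re z > c} - {1} \<and>
     (\<forall>z. Re z > 1 \<longrightarrow> (\<lambda>n. of_nat (Suc n) powr (- z)) sums f z) \<and> w = f s)"

(* Only meaningful for Re s > 1. *)
definition L_chi4 :: "complex \<Rightarrow> complex" where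
  "L_chi4 s = (\<Sum>n. (- 1) ^ n * of_nat (2 * n + 1) powr (- s))"

definition exp_type_le :: "(complex \<Rightarrow> complex) \<Rightarrow> real \<Rightarrow> bool" where
  "exp_type_le F \<tau> \<longleftrightarrow> F holomorphic_on UNIV \<and>
     (\<forall>\<epsilon>>0. \<exists>C>0. \<forall>z. cmod (F z) \<le> C * exp ((\<tau> + \<epsilon>) * cmod z))"

definition real_on_reals :: "(complex \<Rightarrow> complex) \<Rightarrow> bool" where
  "real_on_reals F \<longleftrightarrow> (\<forall>x::real. F (of_real x) \<in> \<real>)"

(* Target functions are ereal-valued because they may be infinite at isolated points.
   The distance lives in ennreal, so a competitor F with g - F not integrable has
   distance \<infinity> instead of a spurious 0. *)
definition L1_distance :: "(real \<Rightarrow> ereal) \<Rightarrow> (complex \<Rightarrow> complex) \<Rightarrow> ennreal" where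
  "L1_distance g F = (\<integral>\<^sup>+x. (if \<bar>g x\<bar> = \<infinity> then \<infinity>
     else ennreal (cmod (of_real (real_of_ereal (g x)) - F (of_real x)))) \<partial>lborel)"

definition minorant :: "real \<Rightarrow> (real \<Rightarrow> ereal) \<Rightarrow> (complex \<Rightarrow> complex) \<Rightarrow> bool" where
  "minorant \<tau> g F \<longleftrightarrow> exp_type_le F \<tau> \<and> real_on_reals F \<and>
     (\<forall>x. ereal (Re (F (of_real x))) \<le> g x)"

definition majorant :: "real \<Rightarrow> (real \<Rightarrow> ereal) \<Rightarrow> (complex \<Rightarrow> complex) \<Rightarrow> bool" where
  "majorant \<tau> g F \<longleftrightarrow> exp_type_le F \<tau> \<and> real_on_reals F \<and>
     (\<forall>x. g x \<le> ereal (Re (F (of_real x))))"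

definition extremal_minorant :: "real \<Rightarrow> (real \<Rightarrow> ereal) \<Rightarrow> (complex \<Rightarrow> complex) \<Rightarrow> bool" where
  "extremal_minorant \<tau> g F \<longleftrightarrow> minorant \<tau> g F \<and>
     (\<forall>G. minorant \<tau> g G \<longrightarrow> L1_distance g F \<le> L1_distance g G)"

definition extremal_majorant :: "real \<Rightarrow> (real \<Rightarrow> ereal) \<Rightarrow> (complex \<Rightarrow> complex) \<Rightarrow> bool" where
  "extremal_majorant \<tau> g F \<longleftrightarrow> majorant \<tau> g F \<and>
     (\<forall>G. majorant \<tau> g G \<longrightarrow> L1_distance g F \<le> L1_distance g G)"

(* Competitors are not required to be real on the real line here. *)
definition best_approximation :: "real \<Rightarrow> (real \<Rightarrow> ereal) \<Rightarrow> (complex \<Rightarrow> complex) \<Rightarrow> bool" where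
  "best_approximation \<tau> g F \<longleftrightarrow> exp_type_le F \<tau> \<and>
     (\<forall>G. exp_type_le G \<tau> \<longrightarrow> L1_distance g F \<le> L1_distance g G)"

definition interpolates_on :: "(complex \<Rightarrow> complex) \<Rightarrow> (real \<Rightarrow> ereal) \<Rightarrow> real set \<Rightarrow> bool" where
  "interpolates_on F g S \<longleftrightarrow> (\<forall>x\<in>S. \<exists>y. F (of_real x) = of_real y \<and> g x = ereal y)"

definition half_integers :: "real set" where
  "half_integers = {of_int n + 1 / 2 | n :: int. True}"

(* 0 powr \<sigma> = 0 in HOL, so the singularity at 0 for negative \<sigma> is put in by hand. *)
definition g_pow :: "real \<Rightarrow> real \<Rightarrow> ereal" where
  "g_pow \<sigma> x = (if x = 0 \<and> \<sigma> < 0 then \<infinity>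
     else ereal (gamma_factor (- \<sigma>) * \<bar>x\<bar> powr \<sigma>))"

lemma riemann_zeta_eqI:
  assumes c: "c < Re s" and f: "f holomorphic_on {z. Re z > c} - {1}"
    and sums: "\<And>z. Re z > 1 \<Longrightarrow> (\<lambda>n. of_nat (Suc n) powr (- z)) sums f z"
    and s: "s \<noteq> 1"
  shows "riemann_zeta s = f s"
  unfolding riemann_zeta_def
proof (rule the_equality)
  show "\<exists>c f'. c < Re s \<and> f' holomorphic_on {z. Re z > c} - {1} \<and>
     (\<forall>z. Re z > 1 \<longrightarrow> (\<lambda>n. of_nat (Suc n) powr (- z)) sums f' z) \<and> f s = f' s"
    using c f sums by blast
next
  fix w
  assume "\<exists>c f. c < Re s \<and> f holomorphic_on {z. Re z > c} - {1} \<and>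
     (\<forall>z. Re z > 1 \<longrightarrow> (\<lambda>n. of_nat (Suc n) powr (- z)) sums f z) \<and> w = f s"
  then obtain d h where d: "d < Re s" and h: "h holomorphic_on {z. Re z > d} - {1}"
    and hsums: "\<And>z. Re z > 1 \<Longrightarrow> (\<lambda>n. of_nat (Suc n) powr (- z)) sums h z"
    and w: "w = h s" by blast
  define e where "e = max c d"
  define S where "S = {z. Re z > e} - {1::complex}"
  define T where "T = {z. Re z > max 1 e}"
  have open_half: "open {z. Re z > a}" for a
    by (rule open_halfspace_Re_gt)
  have S: "connected S" "open S"
    unfolding S_def
    by (intro connected_open_delete open_delete open_half convex_connected
          convex_halfspace_Re_gt; simp)+
  have T: "open T" unfolding T_def by (rule open_half)
  have "of_real (max 1 e + 1) \<in> T" by (auto simp: T_def max_def)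
  then have ne: "T \<noteq> {}" by blast
  have TS: "T \<subseteq> S" by (auto simp: S_def T_def)
  have hol: "h holomorphic_on S" "f holomorphic_on S"
    by (rule holomorphic_on_subset[OF h] holomorphic_on_subset[OF f]; force simp: S_def e_def)+
  have eq: "h z = f z" if "z \<in> T" for z
  proof -
    have "Re z > 1" using that by (simp add: T_def)
    then show ?thesis using hsums sums sums_unique2 by blast
  qed
  have sS: "s \<in> S" using c d s by (simp add: S_def e_def)
  have "h s = f s"
    by (rule analytic_continuation_open[OF T S(2) ne S(1) TS hol eq sS])
  then show "w = f s" by (simp add: w)
qed

end

theory Submission
  imports Defs "HOL-Real_Asymp.Real_Asymp" "HOL-Probability.Probability"
begin

text \<open>Write g for the function \<gamma>(-\<sigma>) |x|^\<sigma>. All three parts are instances of one explicit formula.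
Let S(z) be cos^2 \<pi>z, sin^2 \<pi>z or cos \<pi>z. On the imaginary axis S(it) = \<epsilon> w(t) with w positive and
\<epsilon> = 1, -1, 1, and S has exponential type 2\<pi>, 2\<pi>, \<pi>. Choose the natural number m with
2m - 2 < \<sigma> < 2m and put, with \<kappa> = 2 \<pi>^(\<sigma>/2) / \<Gamma>(1 + \<sigma>/2),

  F(z) = \<kappa> \<integral>_0^\<infinity> t^(\<sigma>+1-2m) [(-1)^m z^(2m) - t^(2m) S(z)/S(it)] / (z^2 + t^2) dt.

The bracket vanishes at z = it and z = -it, so the integrand is entire in z and F is entire of the type of S.
For real x \<noteq> 0 the two terms may be integrated separately; the first gives \<gamma>(-\<sigma>) |x|^\<sigma> by the
Beta integral and the reflection formula, hence

  g(x) - F(x) = \<kappa> \<epsilon> S(x) p(x),   p(x) = \<integral>_0^\<infinity> t^(\<sigma>+1) / ((x^2 + t^2) w(t)) dt \<ge> 0.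

Thus S decides the sign of the gap g - F, and F interpolates g at the zeros of S: cos^2 gives the minorant,
sin^2 the majorant (where \<sigma> > 0 makes p converge), cos the function with sgn(cos \<pi>x) (g - F) \<ge> 0.
This is the locale sign_pattern, with entire_part_real and entire_part_exp_type.

The integral of |g - F| is computed by exchanging the order of integration. The inner integrals
\<integral> |S(x)| / (x^2 + t^2) dx are Poisson integrals of bounded holomorphic functions on the upper half plane
(for |cos \<pi>x| the function is (4/\<pi>) cos(\<pi>z) arctan(e^(i\<pi>z))). What remains are Mellin transforms of
e^(-2\<pi>t)/(1 \<plusminus> e^(-2\<pi>t)) and of arctan(e^(-\<pi>t)), which expand into the Dirichlet series for \<zeta>(1+\<sigma>) and
L(2+\<sigma>, \<chi>). For the minorant the series is the alternating one of (1 - 2^(1-s)) \<zeta>(s), which converges for all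
\<sigma> > -1.

Optimality and uniqueness rest on two facts about an integrable D of exponential type 2\<pi>: the quadrature
formula \<integral> D = \<Sum>_k D(x + k) for every real x (integer_translates_quadrature), and the fact that D = 0 if D
vanishes at all integers and D' at all integers except possibly 0 (exp_type_L1_double_zeros_eq_0).
If G is another minorant with integrable gap, then D = G - F is nonpositive at the half-integers, so
\<integral> D \<le> 0; equality forces D = 0 there, and since G - F \<le> g - F, which vanishes to second order there, D' = 0 too.
For type \<pi> the quadrature formula implies that sgn(cos \<pi>x) is orthogonal to every integrable D of type \<pi>,
which gives \<integral> |g - G| \<ge> |\<integral> sgn(cos \<pi>x) (g - G)| = \<integral> |g - F|; equality forces g - G to change
phase at each half-integer, so G interpolates there, and the squared difference has double zeros.
The quadrature formula is proved by periodizing D times a squared sinc factor: the sum over integer translates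
is a 1-periodic entire function of small type, hence a trigonometric polynomial of degree 1 whose coefficients
are values of the Fourier transform.\<close>

section \<open>Phragmen-Lindelof bounds for functions of exponential type\<close>

text \<open>The first condition confines u^2 to the sector |arg| \<le> \<pi>/4, so |arg u| \<le> \<pi>/8 and |arg u^3| \<le> 3\<pi>/8 < \<pi>/2.
The constants come from the weaker elementary consequence |Im u| \<le> Re u / 2. This makes exp(-d u^3) decay like
exp(-c |u|^3), faster than any exponential in |u^2|.\<close>

lemma Re_cube_ge_of_abs_arg_le:
  assumes "\<bar>Im (u^2)\<bar> \<le> Re (u^2)" "Re u > 0"
  shows "Re (u^3) \<ge> (Re u)^3 / 4" "(Re u)^2 \<ge> 4/5 * cmod (u^2)"
proof -
  define a b where "a = Re u" "b = \<bar>Im u\<bar>"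
  have a: "a > 0" and b: "b \<ge> 0" using assms by (auto simp: a_b_def)
  have ab: "2*a*b \<le> a^2 - b^2"
    using assms a by (auto simp: a_b_def power2_eq_square abs_mult ac_simps)
  have "b \<le> a/2"
  proof (rule ccontr)
    assume "\<not> b \<le> a/2"
    then have h: "b > a/2" by simp
    have "2*a*b > a^2" using h a by (simp add: power2_eq_square)
    then show False using ab by (smt (verit) zero_le_power2)
  qed
  then have b4: "b^2 \<le> a^2/4" using power_mono[of b "a/2" 2] b by (simp add: power_divide)
  have "Re (u^3) = a^3 - 3*a*b^2"
    by (simp add: a_b_def power3_eq_cube power2_eq_square algebra_simps)
  also have "\<dots> \<ge> a^3 - 3*a*(a^2/4)" using b4 a by (simp add: mult_left_mono)
  finally show "Re (u^3) \<ge> (Re u)^3 / 4"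
    by (simp add: a_b_def power3_eq_cube power2_eq_square)
  have "cmod (u^2) = a^2 + b^2"
    by (simp add: a_b_def norm_power cmod_power2)
  then show "(Re u)^2 \<ge> 4/5 * cmod (u^2)" using b4 by (simp add: a_b_def)
qed

lemma entire_compose:
  assumes "f holomorphic_on UNIV" "g holomorphic_on UNIV"
  shows "(\<lambda>z. f (g z)) holomorphic_on UNIV"
  using holomorphic_on_compose_gen[of g UNIV f UNIV] assms by (simp add: o_def)

text \<open>The quadrant has opening \<pi>/2, so order-one growth is below the critical order 2. The factor exp(-d w^(3/2)),
where w is z rotated by -\<pi>/4 and shifted away from the branch point, has modulus at most 1 on the quadrant and beats exp(B|z|)
on large arcs; the maximum principle on a sector followed by d \<rightarrow> 0 gives the bound.\<close>

lemma Phragmen_Lindelof_quadrant: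
  fixes H :: "complex \<Rightarrow> complex"
  assumes H: "H holomorphic_on UNIV" and M: "M > 0"
    and re: "\<And>x. x \<ge> 0 \<Longrightarrow> cmod (H (of_real x)) \<le> M"
    and im: "\<And>y. y \<ge> 0 \<Longrightarrow> cmod (H (\<i> * of_real y)) \<le> M"
    and growth: "\<And>z. cmod (H z) \<le> C * exp (B * cmod z)"
    and z: "Re z \<ge> 0" "Im z \<ge> 0"
  shows "cmod (H z) \<le> M"
proof -
  (* The shift by 1 + i keeps the square root u of w holomorphic on a neighbourhood of the closed quadrant. *)
  define w where "w = (\<lambda>z::complex. (z + 1 + \<i>) * (1 - \<i>))"
  define u where "u = (\<lambda>z. csqrt (w z))"
  have Rew: "Re (w z) = Re z + Im z + 2" and Imw: "Im (w z) = Im z - Re z" for z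
    by (auto simp: w_def)
  have wz: "cmod (w z) \<ge> cmod z" if "Re z \<ge> 0" "Im z \<ge> 0" for z
  proof -
    have "cmod z \<le> cmod (z + 1 + \<i>)"
      using that by (auto simp: cmod_def intro!: add_mono power_mono)
    also have "\<dots> = cmod (z + 1 + \<i>) * 1" by simp
    also have "\<dots> \<le> cmod (z + 1 + \<i>) * cmod (1 - \<i>)"
      by (intro mult_left_mono) (auto simp: cmod_def)
    finally show ?thesis by (simp add: w_def norm_mult)
  qed
  have u2: "u z ^ 2 = w z" for z by (simp add: u_def)
  have uRe: "Re (u z) > 0" if "Re z \<ge> 0" "Im z \<ge> 0" for z
  proof -
    have "Re (w z) > 0" using that by (simp add: Rew)
    then have "Re (u z ^ 2) > 0" by (simp only: u2)
    then have "(Re (u z))^2 > (Im (u z))^2" by (simp add: Re_power2)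
    then have "Re (u z) \<noteq> 0" by auto
    then show ?thesis using csqrt_principal[of "w z"] by (auto simp: u_def)
  qed
  have ucube: "Re (u z ^ 3) \<ge> (Re (u z))^3 / 4" "(Re (u z))^2 \<ge> 4/5 * cmod z"
    if "Re z \<ge> 0" "Im z \<ge> 0" for z
  proof -
    have "\<bar>Im (u z ^2)\<bar> \<le> Re (u z ^2)" unfolding u2 using that by (simp add: Rew Imw)
    from Re_cube_ge_of_abs_arg_le[OF this uRe[OF that]] wz[OF that]
    show "Re (u z ^ 3) \<ge> (Re (u z))^3 / 4" "(Re (u z))^2 \<ge> 4/5 * cmod z"
      unfolding u2 by auto
  qed
  have main: "cmod (H z * exp (- of_real d * u z ^ 3)) \<le> M" if d: "d > 0" for d
  proof -
    define B' where "B' = \<bar>B\<bar> + 1"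
    define C' where "C' = \<bar>C\<bar> + 1"
    have "B' > 0" "C' > 0" by (auto simp: B'_def C'_def)
    have gr: "cmod (H z) \<le> C' * exp (B' * cmod z)" for z
    proof -
      have "cmod (H z) \<le> C * exp (B * cmod z)" by (rule growth)
      also have "\<dots> \<le> C' * exp (B * cmod z)" by (intro mult_right_mono) (auto simp: C'_def)
      also have "\<dots> \<le> C' * exp (B' * cmod z)" using \<open>C' > 0\<close>
        by (intro mult_left_mono) (auto simp: B'_def intro!: mult_right_mono)
      finally show ?thesis .
    qed
    (* The radius of the arc is R = 5/4 s^2, so that Re u \<ge> s on it; s is so large that the
       cubic decay d s^3/4 outweighs both the growth 5/4 B s^2 and the constant. *)
    define s where "s = cmod z + 2 + (5 * B' + 4) / d + \<bar>ln (C' / M)\<bar>"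
    have q: "(5 * B' + 4) / d > 0" using d \<open>B' > 0\<close> by simp
    have s2: "s > cmod z + 1" "s \<ge> (5 * B' + 4) / d" "s > ln (C' / M)"
      using q norm_ge_zero[of z] unfolding s_def by linarith+
    have s1: "s > 1" using s2(1) by (smt (verit) norm_ge_zero)
    have "5 * B' + 4 \<le> s * d" using s2(2) d by (simp add: pos_divide_le_eq)
    then have "(s^2) * (5 * B' + 4) \<le> s^2 * (s * d)" by (intro mult_left_mono) auto
    then have "B' * (5/4 * s^2) - d * (s^3/4) \<le> - (s^2)"
      by (simp add: power2_eq_square power3_eq_cube algebra_simps)
    also have "- (s^2) \<le> - s" using s1 mult_left_mono[of 1 s s] by (simp add: power2_eq_square)
    also have "- s < - ln (C' / M)" using s2 by simp
    finally have "exp (B' * (5/4 * s^2) - d * (s^3/4)) < exp (- ln (C' / M))" by simp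
    also have "\<dots> = M / C'" using M \<open>C' > 0\<close> by (simp add: exp_minus field_simps)
    finally have s: "C' * exp (B' * (5/4 * s^2) - d * (s^3/4)) < M" "s > cmod z + 1"
      using \<open>C' > 0\<close> s2 by (auto simp: field_simps)
    define R where "R = 5/4 * s^2"
    then have R: "R > cmod z"
    proof -
      have "s * 1 \<le> s * s" using s1 by (intro mult_left_mono) auto
      then show ?thesis using s(2) s1 unfolding R_def power2_eq_square by linarith
    qed
    define S where "S = {z. Re z \<ge> 0 \<and> Im z \<ge> 0 \<and> cmod z \<le> R}"
    have S_closed: "closed S" unfolding S_def
      by (intro closed_Collect_conj closed_Collect_le continuous_intros)
    define V where "V = {z. Re z > -1 \<and> Im z > -1}"
    have V: "u holomorphic_on V" unfolding u_def
    proof (rule holomorphic_on_csqrt')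
      show "w holomorphic_on V" unfolding w_def by (intro holomorphic_intros)
      show "w z \<notin> \<real>\<^sub>\<le>\<^sub>0" if "z \<in> V" for z
        using that by (auto simp: complex_nonpos_Reals_iff Rew V_def)
    qed
    have KV: "(\<lambda>z. H z * exp (- of_real d * u z ^ 3)) holomorphic_on V"
      by (intro holomorphic_intros V holomorphic_on_subset[OF H]) auto
    have SV: "S \<subseteq> V" by (auto simp: S_def V_def)
    have front: "frontier S \<subseteq> {z\<in>S. Re z = 0 \<or> Im z = 0 \<or> cmod z = R}"
    proof
      fix v assume v: "v \<in> frontier S"
      have vS: "v \<in> S" using v S_closed frontier_subset_closed by blast
      have "\<not> (Re v > 0 \<and> Im v > 0 \<and> cmod v < R)"
      proof
        assume "Re v > 0 \<and> Im v > 0 \<and> cmod v < R"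
        then have "v \<in> {v. Re v > 0 \<and> Im v > 0 \<and> cmod v < R}" by simp
        moreover have "open {v. Re v > 0 \<and> Im v > 0 \<and> cmod v < R}"
          by (intro open_Collect_conj open_Collect_less continuous_intros)
        moreover have "{v. Re v > 0 \<and> Im v > 0 \<and> cmod v < R} \<subseteq> S" by (auto simp: S_def)
        ultimately have "v \<in> interior S" by (meson interiorI)
        then show False using v by (simp add: frontier_def)
      qed
      then show "v \<in> {z\<in>S. Re z = 0 \<or> Im z = 0 \<or> cmod z = R}" using vS by (force simp: S_def)
    qed
    have nrm: "cmod (exp (- of_real d * u v ^ 3)) = exp (- d * Re (u v ^ 3))" for v
      by (simp add: norm_exp_eq_Re)
    have nrm1: "cmod (exp (- of_real d * u v ^ 3)) \<le> exp (- d * ((Re (u v))^3/4))" if "v \<in> S" for v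
      unfolding nrm using ucube(1)[of v] d that by (auto simp: S_def)
    have nrm2: "cmod (exp (- of_real d * u v ^ 3)) \<le> 1" if "v \<in> S" for v
    proof -
      have "Re (u v) \<ge> 0" using uRe[of v] that by (simp add: S_def)
      then have "- d * ((Re (u v))^3/4) \<le> 0" using d by simp
      then show ?thesis using nrm1[OF that] by (meson exp_le_one_iff order_trans)
    qed
    show ?thesis
    proof (rule maximum_modulus_frontier[where S=S and f="\<lambda>z. H z * exp (- of_real d * u z ^ 3)"])
      show "(\<lambda>z. H z * exp (- of_real d * u z ^ 3)) holomorphic_on interior S"
        by (rule holomorphic_on_subset[OF KV]) (use SV interior_subset in blast)
      show "continuous_on (closure S) (\<lambda>z. H z * exp (- of_real d * u z ^ 3))"
        unfolding closure_closed[OF S_closed]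
        by (rule holomorphic_on_imp_continuous_on[OF holomorphic_on_subset[OF KV SV]])
      show "bounded S" by (rule boundedI[of _ R]) (auto simp: S_def)
      show "z \<in> S" using z R by (auto simp: S_def)
      fix v assume "v \<in> frontier S"
      then have v: "v \<in> S" "Re v = 0 \<or> Im v = 0 \<or> cmod v = R" using front by auto
      have le: "cmod (H v * exp (- of_real d * u v ^ 3)) \<le> cmod (H v)"
        using nrm2[OF v(1)] by (simp add: norm_mult mult_left_le)
      consider "Re v = 0" | "Im v = 0" | "cmod v = R" using v by blast
      then show "cmod (H v * exp (- of_real d * u v ^ 3)) \<le> M"
      proof cases
        case 1
        then have "v = \<i> * of_real (Im v)" by (simp add: complex_eq_iff)
        moreover have "Im v \<ge> 0" using v by (simp add: S_def)
        ultimately have "cmod (H v) \<le> M" using im[of "Im v"] by metis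
        then show ?thesis using le by linarith
      next
        case 2
        then have "v = of_real (Re v)" by (simp add: complex_eq_iff)
        moreover have "Re v \<ge> 0" using v by (simp add: S_def)
        ultimately have "cmod (H v) \<le> M" using re[of "Re v"] by metis
        then show ?thesis using le by linarith
      next
        case 3
        have v0: "Re v \<ge> 0" "Im v \<ge> 0" using v(1) by (auto simp: S_def)
        have "s^2 \<le> (Re (u v))^2"
          using ucube(2)[OF v0] 3 by (simp add: R_def)
        then have "s \<le> Re (u v)" using uRe[OF v0] by (rule power2_le_imp_le[OF _ less_imp_le])
        then have "s^3 \<le> (Re (u v))^3" using s1 by (intro power_mono) auto
        then have "cmod (exp (- of_real d * u v ^ 3)) \<le> exp (- d * (s^3/4))"
          using d by (intro order_trans[OF nrm1[OF v(1)]]) (simp add: mult_left_mono)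
        then have "cmod (H v * exp (- of_real d * u v ^ 3)) \<le> (C' * exp (B' * R)) * exp (- d * (s^3/4))"
          unfolding norm_mult using gr[of v] 3 \<open>C' > 0\<close> by (intro mult_mono) auto
        also have "\<dots> = C' * exp (B' * (5/4 * s^2) - d * (s^3/4))"
          by (simp add: R_def exp_add[symmetric] mult.assoc)
        finally show ?thesis using s by simp
      qed
    qed
  qed
  have "((\<lambda>d. cmod (H z * exp (- of_real d * u z ^ 3))) \<longlongrightarrow> cmod (H z * exp (- of_real 0 * u z ^ 3))) (at_right (0::real))"
    by (intro tendsto_intros)
  moreover have "eventually (\<lambda>d. cmod (H z * exp (- of_real d * u z ^ 3)) \<le> M) (at_right (0::real))"
    using eventually_at_right_less[of "0::real"] by (rule eventually_mono) (rule main)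
  ultimately have "cmod (H z * exp (- of_real 0 * u z ^ 3)) \<le> M"
    by (rule tendsto_upperbound) auto
  then show ?thesis by simp
qed

text \<open>Dividing by 1 - idz, which has modulus at least 1 and tends to infinity in the half plane, makes
the function small on large arcs; then d \<rightarrow> 0.\<close>

lemma bounded_upper_half_plane_max_principle:
  fixes H :: "complex \<Rightarrow> complex"
  assumes H: "H holomorphic_on UNIV" and M: "M > 0"
    and re: "\<And>x. cmod (H (of_real x)) \<le> M"
    and bd: "\<And>z. Im z \<ge> 0 \<Longrightarrow> cmod (H z) \<le> C"
    and z: "Im z \<ge> 0"
  shows "cmod (H z) \<le> M"
proof -
  have C: "C \<ge> 0" using bd[of 0] norm_ge_zero[of "H 0"] by (simp del: norm_ge_zero)
  have ge: "cmod (1 - \<i> * of_real d * v) \<ge> d * cmod v" "cmod (1 - \<i> * of_real d * v) \<ge> 1"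
    if "Im v \<ge> 0" "d > 0" for d v
  proof -
    have e: "(cmod (1 - \<i> * of_real d * v))^2 = (1 + d * Im v)^2 + (d * Re v)^2"
      by (simp add: cmod_power2)
    have "(d * cmod v)^2 = (d * Im v)^2 + (d * Re v)^2"
      by (simp add: cmod_power2 power_mult_distrib algebra_simps)
    also have "\<dots> \<le> (cmod (1 - \<i> * of_real d * v))^2" unfolding e using that
      by (intro add_right_mono power_mono) auto
    finally show "cmod (1 - \<i> * of_real d * v) \<ge> d * cmod v" by (rule power2_le_imp_le) auto
    have "1^2 \<le> (1 + d * Im v)^2" using that by (intro power_mono) auto
    also have "\<dots> \<le> (cmod (1 - \<i> * of_real d * v))^2" unfolding e by simp
    finally show "cmod (1 - \<i> * of_real d * v) \<ge> 1" by (rule power2_le_imp_le) auto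
  qed
  have main: "cmod (H z / (1 - \<i> * of_real d * z)) \<le> M" if d: "d > 0" for d
  proof -
    define R where "R = cmod z + C / (M * d) + 1"
    have R: "R > cmod z" "R \<ge> C / (M * d)" "R > 0" using C M d
      by (auto simp: R_def intro!: add_nonneg_pos)
    define S where "S = {z. Im z \<ge> 0 \<and> cmod z \<le> R}"
    have S_closed: "closed S" unfolding S_def
      by (intro closed_Collect_conj closed_Collect_le continuous_intros)
    have hol: "(\<lambda>z. H z / (1 - \<i> * of_real d * z)) holomorphic_on S"
    proof (intro holomorphic_intros holomorphic_on_subset[OF H])
      fix v assume "v \<in> S"
      then have "cmod (1 - \<i> * of_real d * v) \<ge> 1" using ge(2)[of v d] d by (auto simp: S_def)
      then show "1 - \<i> * of_real d * v \<noteq> 0" by auto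
    qed auto
    have front: "frontier S \<subseteq> {z\<in>S. Im z = 0 \<or> cmod z = R}"
    proof
      fix v assume v: "v \<in> frontier S"
      have vS: "v \<in> S" using v S_closed frontier_subset_closed by blast
      have "\<not> (Im v > 0 \<and> cmod v < R)"
      proof
        assume "Im v > 0 \<and> cmod v < R"
        then have "v \<in> {v. Im v > 0 \<and> cmod v < R}" by simp
        moreover have "open {v. Im v > 0 \<and> cmod v < R}"
          by (intro open_Collect_conj open_Collect_less continuous_intros)
        moreover have "{v. Im v > 0 \<and> cmod v < R} \<subseteq> S" by (auto simp: S_def)
        ultimately have "v \<in> interior S" by (meson interiorI)
        then show False using v by (simp add: frontier_def)
      qed
      then show "v \<in> {z\<in>S. Im z = 0 \<or> cmod z = R}" using vS by (force simp: S_def)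
    qed
    show ?thesis
    proof (rule maximum_modulus_frontier[where S=S and f="\<lambda>z. H z / (1 - \<i> * of_real d * z)"])
      show "(\<lambda>z. H z / (1 - \<i> * of_real d * z)) holomorphic_on interior S"
        by (rule holomorphic_on_subset[OF hol interior_subset])
      show "continuous_on (closure S) (\<lambda>z. H z / (1 - \<i> * of_real d * z))"
        unfolding closure_closed[OF S_closed] by (rule holomorphic_on_imp_continuous_on[OF hol])
      show "bounded S" by (rule boundedI[of _ R]) (auto simp: S_def)
      show "z \<in> S" using z R by (auto simp: S_def)
      fix v assume "v \<in> frontier S"
      then have v: "Im v \<ge> 0" "Im v = 0 \<or> cmod v = R" using front by (auto simp: S_def)
      have gt0: "cmod (1 - \<i> * of_real d * v) > 0" using ge(2)[OF v(1) d] by linarith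
      have "cmod (H v) \<le> M * cmod (1 - \<i> * of_real d * v)"
        using v(2)
      proof
        assume "Im v = 0"
        then have "v = of_real (Re v)" by (simp add: complex_eq_iff)
        then have "cmod (H v) \<le> M * 1" using re[of "Re v"] by simp
        also have "\<dots> \<le> M * cmod (1 - \<i> * of_real d * v)"
          using ge(2)[OF v(1) d] M by (intro mult_left_mono) auto
        finally show ?thesis .
      next
        assume vR: "cmod v = R"
        have "cmod (H v) \<le> C" using bd v by simp
        also have "\<dots> \<le> M * (d * R)" using R(2) M d by (simp add: field_simps)
        also have "\<dots> \<le> M * cmod (1 - \<i> * of_real d * v)"
          using ge(1)[OF v(1) d] M vR by (intro mult_left_mono) auto
        finally show ?thesis .
      qed
      then show "cmod (H v / (1 - \<i> * of_real d * v)) \<le> M"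
        using gt0 by (simp add: norm_divide pos_divide_le_eq)
    qed
  qed
  have "((\<lambda>d. cmod (H z / (1 - \<i> * of_real d * z))) \<longlongrightarrow> cmod (H z / (1 - \<i> * of_real 0 * z))) (at_right (0::real))"
    by (intro tendsto_intros) auto
  moreover have "eventually (\<lambda>d. cmod (H z / (1 - \<i> * of_real d * z)) \<le> M) (at_right (0::real))"
    using eventually_at_right_less[of "0::real"] by (rule eventually_mono) (rule main)
  ultimately have "cmod (H z / (1 - \<i> * of_real 0 * z)) \<le> M"
    by (rule tendsto_upperbound) auto
  then show ?thesis by simp
qed

text \<open>The factor exp(i(\<tau>+e)z) makes F bounded on the imaginary axis while keeping its modulus on the real axis.
The two quadrants then give boundedness on the half plane by a bad constant, and the maximum principle
for bounded functions replaces it by the bound on the real axis.\<close>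

lemma Phragmen_Lindelof_upper:
  assumes F: "exp_type_le F \<tau>" and M: "M \<ge> 0"
    and re: "\<And>x. cmod (F (of_real x)) \<le> M" and z: "Im z \<ge> 0"
  shows "cmod (F z) \<le> M * exp (\<tau> * Im z)"
proof -
  have main: "cmod (F z) \<le> (M + e) * exp ((\<tau> + e) * Im z)" if e: "e > 0" for e :: real
  proof -
    define H where "H = (\<lambda>z. F z * exp (\<i> * of_real (\<tau> + e) * z))"
    have nH: "cmod (H z) = cmod (F z) * exp (- (\<tau> + e) * Im z)" for z
      by (simp add: H_def norm_mult algebra_simps)
    from F e obtain C where C: "C > 0" "\<And>z. cmod (F z) \<le> C * exp ((\<tau> + e) * cmod z)"
      unfolding exp_type_le_def by blast
    have holF: "F holomorphic_on UNIV" using F by (simp add: exp_type_le_def)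
    have holH: "H holomorphic_on UNIV" unfolding H_def by (intro holomorphic_intros holF)
    have re': "cmod (H (of_real x)) \<le> M" for x using re by (simp add: nH)
    have im: "cmod (H (\<i> * of_real y)) \<le> C" if "y \<ge> 0" for y
    proof -
      have "cmod (H (\<i> * of_real y)) \<le> C * exp ((\<tau> + e) * y) * exp (- (\<tau> + e) * y)"
        unfolding nH using C(2)[of "\<i> * of_real y"] that by (simp add: norm_mult)
      also have "\<dots> = C" by (simp add: mult.assoc exp_add[symmetric] algebra_simps)
      finally show ?thesis .
    qed
    have gr: "cmod (H z) \<le> C * exp ((2 * \<bar>\<tau> + e\<bar>) * cmod z)" for z
    proof -
      have "cmod (H z) \<le> C * exp ((\<tau> + e) * cmod z) * exp (- (\<tau> + e) * Im z)"
        unfolding nH using C(2)[of z] by simp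
      also have "\<dots> = C * exp ((\<tau> + e) * cmod z - (\<tau> + e) * Im z)" by (simp add: exp_add[symmetric] mult.assoc algebra_simps)
      also have "\<dots> \<le> C * exp ((2 * \<bar>\<tau> + e\<bar>) * cmod z)"
      proof -
        have "(\<tau> + e) * cmod z \<le> \<bar>\<tau> + e\<bar> * cmod z" by (intro mult_right_mono) auto
        moreover have "- ((\<tau> + e) * Im z) \<le> \<bar>\<tau> + e\<bar> * cmod z"
        proof -
          have "- ((\<tau> + e) * Im z) \<le> \<bar>\<tau> + e\<bar> * \<bar>Im z\<bar>"
            by (metis abs_ge_minus_self abs_mult)
          also have "\<dots> \<le> \<bar>\<tau> + e\<bar> * cmod z" by (intro mult_left_mono abs_Im_le_cmod) auto
          finally show ?thesis .
        qed
        ultimately show ?thesis using C(1) by simp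
      qed
      finally show ?thesis .
    qed
    (* Only the finiteness of K matters: the maximum principle below improves it to M + e. *)
    define K where "K = max (M + e) C"
    have K: "K > 0" "M \<le> K" "C \<le> K" using M e C by (auto simp: K_def)
    have bd: "cmod (H z) \<le> K" if "Im z \<ge> 0" for z
    proof (cases "Re z \<ge> 0")
      case True
      show ?thesis
        by (rule Phragmen_Lindelof_quadrant[OF holH K(1) _ _ gr True that])
           (use order_trans[OF re' K(2)] order_trans[OF im K(3)] in auto)
    next
      case False
      have "cmod ((\<lambda>z. H (\<i> * z)) (- \<i> * z)) \<le> K"
      proof (rule Phragmen_Lindelof_quadrant[of "\<lambda>z. H (\<i> * z)" _ C "2 * \<bar>\<tau> + e\<bar>"])
        show "(\<lambda>z. H (\<i> * z)) holomorphic_on UNIV"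
          by (intro entire_compose[OF holH] holomorphic_intros)
        show "cmod (H (\<i> * (\<i> * complex_of_real y))) \<le> K" for y
          using re'[of "-y"] K by (simp add: mult.assoc[symmetric])
        show "cmod (H (\<i> * z)) \<le> C * exp (2 * \<bar>\<tau> + e\<bar> * cmod z)" for z
          using gr[of "\<i> * z"] by (simp add: norm_mult)
      qed (use False that K order_trans[OF im K(3)] in auto)
      then show ?thesis by (simp add: mult.assoc[symmetric])
    qed
    have "cmod (H (of_real x)) \<le> M + e" for x using re'[of x] e by linarith
    then have "cmod (H z) \<le> M + e"
      by (intro bounded_upper_half_plane_max_principle[OF holH _ _ bd z])
         (use M e in auto)
    then have "cmod (F z) * exp (- (\<tau> + e) * Im z) * exp ((\<tau> + e) * Im z) \<le> (M + e) * exp ((\<tau> + e) * Im z)"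
      unfolding nH by (intro mult_right_mono) auto
    then show ?thesis by (simp add: mult.assoc exp_add[symmetric] algebra_simps)
  qed
  have "((\<lambda>e. (M + e) * exp ((\<tau> + e) * Im z)) \<longlongrightarrow> (M + 0) * exp ((\<tau> + 0) * Im z)) (at_right (0::real))"
    by (intro tendsto_intros)
  moreover have "eventually (\<lambda>e. cmod (F z) \<le> (M + e) * exp ((\<tau> + e) * Im z)) (at_right (0::real))"
    using eventually_at_right_less[of "0::real"] by (rule eventually_mono) (rule main)
  ultimately have "cmod (F z) \<le> (M + 0) * exp ((\<tau> + 0) * Im z)"
    by (rule tendsto_lowerbound) auto
  then show ?thesis by simp
qed

lemma exp_type_le_compose_linear:
  assumes F: "exp_type_le F \<tau>" and \<tau>: "\<tau> \<ge> 0" and c: "c \<noteq> 0"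
  shows "exp_type_le (\<lambda>z. F (c * z + b)) (cmod c * \<tau>)"
  unfolding exp_type_le_def
proof (intro conjI allI impI)
  have holF: "F holomorphic_on UNIV" using F by (simp add: exp_type_le_def)
  show "(\<lambda>z. F (c * z + b)) holomorphic_on UNIV"
    by (intro entire_compose[OF holF] holomorphic_intros)
  fix e :: real assume e: "e > 0"
  then have "e / cmod c > 0" using c by simp
  then obtain C where C: "C > 0" "\<And>z. cmod (F z) \<le> C * exp ((\<tau> + e / cmod c) * cmod z)"
    using F unfolding exp_type_le_def by blast
  show "\<exists>C>0. \<forall>z. cmod (F (c * z + b)) \<le> C * exp ((cmod c * \<tau> + e) * cmod z)"
  proof (intro exI conjI allI)
    show "C * exp ((\<tau> + e / cmod c) * cmod b) > 0" using C by simp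
    fix z
    have "cmod (F (c * z + b)) \<le> C * exp ((\<tau> + e / cmod c) * cmod (c * z + b))" by (rule C(2))
    also have "\<dots> \<le> C * exp ((\<tau> + e / cmod c) * (cmod c * cmod z + cmod b))"
    proof -
      have "cmod (c * z + b) \<le> cmod c * cmod z + cmod b"
        by (metis norm_mult norm_triangle_ineq)
      moreover have "\<tau> + e / cmod c \<ge> 0" using \<tau> e by simp
      ultimately show ?thesis using C(1) by (simp add: mult_left_mono)
    qed
    also have "\<dots> = C * exp ((\<tau> + e / cmod c) * cmod b) * exp ((cmod c * \<tau> + e) * cmod z)"
    proof -
      have "(\<tau> + e / cmod c) * (cmod c * cmod z + cmod b)
          = (\<tau> + e / cmod c) * cmod b + (cmod c * \<tau> + e) * cmod z"
        using c by (simp add: ring_distribs)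
      then show ?thesis by (simp add: exp_add)
    qed
    finally show "cmod (F (c * z + b)) \<le> C * exp ((\<tau> + e / cmod c) * cmod b) * exp ((cmod c * \<tau> + e) * cmod z)" .
  qed
qed

theorem Phragmen_Lindelof_exp_type:
  assumes F: "exp_type_le F \<tau>" and \<tau>: "\<tau> \<ge> 0" and M: "M \<ge> 0"
    and re: "\<And>x. cmod (F (of_real x)) \<le> M"
  shows "cmod (F z) \<le> M * exp (\<tau> * \<bar>Im z\<bar>)"
proof (cases "Im z \<ge> 0")
  case True
  then show ?thesis using Phragmen_Lindelof_upper[OF F M re True] by simp
next
  case False
  have t: "exp_type_le (\<lambda>z. F (-1 * z + 0)) (cmod (-1) * \<tau>)"
    by (rule exp_type_le_compose_linear[OF F \<tau>]) auto
  show ?thesis using Phragmen_Lindelof_upper[OF t M, of "-z"] False re[of "- x" for x] by simp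
qed

section \<open>Integrable functions of exponential type\<close>

lemma exp_type_le_holomorphic: "exp_type_le F \<tau> \<Longrightarrow> F holomorphic_on S"
  using holomorphic_on_subset[of F UNIV S] by (simp add: exp_type_le_def)

lemma exp_type_le_isCont: "exp_type_le F \<tau> \<Longrightarrow> isCont F z"
  using holomorphic_on_imp_continuous_on[OF exp_type_le_holomorphic[of F \<tau> UNIV]]
  by (simp add: continuous_on_eq_continuous_at)

lemma exp_type_le_continuous_on:
  assumes "exp_type_le F \<tau>" "continuous_on S f"
  shows "continuous_on S (\<lambda>x. F (f x))"
  using continuous_on_compose2[OF holomorphic_on_imp_continuous_on[OF exp_type_le_holomorphic[OF assms(1), of UNIV]] assms(2)]
  by simp

lemma exp_type_le_borel_measurable [measurable_dest]:
  assumes "exp_type_le F \<tau>" shows "F \<in> borel_measurable borel"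
  using exp_type_le_continuous_on[OF assms continuous_on_id] by (rule borel_measurable_continuous_onI)

text \<open>Unlike |D|, the function G(z) = \<integral>_{-a}^a D(z+s) \<theta>(s) ds is entire of the same type as D, and it is bounded by the L1-norm of D on the
real axis. Phragmen-Lindelof therefore bounds G(z0). The weight \<theta> is a regularized conjugate phase of
D on the horizontal line through z0, for which G(z0) is almost the integral of |D|.\<close>

lemma window_integral_bound:
  assumes D: "exp_type_le D \<tau>" and \<tau>: "\<tau> \<ge> 0"
    and int: "integrable lborel (\<lambda>x. D (of_real x))" and a: "a \<ge> 0"
  shows "integral {-a..a} (\<lambda>s. cmod (D (z0 + of_real s)))
           \<le> (\<integral>x. cmod (D (of_real x)) \<partial>lborel) * exp (\<tau> * \<bar>Im z0\<bar>)"
proof (rule field_le_epsilon)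
  fix \<epsilon> :: real assume \<epsilon>: "\<epsilon> > 0"
  define e where "e = \<epsilon> / (2 * a + 1)"
  have e: "e > 0" "2 * a * e \<le> \<epsilon>" using \<epsilon> a by (auto simp: e_def field_simps)
  define N where "N = (\<integral>x. cmod (D (of_real x)) \<partial>lborel)"
  have N0: "N \<ge> 0" unfolding N_def by simp
  (* The summand e in the denominator keeps the weight continuous at zeros of D. *)
  define \<theta> where "\<theta> = (\<lambda>s::real. cnj (D (z0 + of_real s)) / of_real (cmod (D (z0 + of_real s)) + e))"
  have nz: "cmod (D w) + e \<noteq> 0" for w using e(1) norm_ge_zero[of "D w"] by linarith
  have nz': "complex_of_real (cmod (D w) + e) \<noteq> 0" for w using nz of_real_eq_0_iff by blast
  have contD: "continuous_on S (\<lambda>s. D (f s))" if "continuous_on S f" for f :: "'b::t2_space \<Rightarrow> complex" and S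
    using exp_type_le_continuous_on[OF D that] .
  have cont\<theta>: "continuous_on S \<theta>" for S
    unfolding \<theta>_def by (intro continuous_intros contD ballI nz')
  have \<theta>1: "cmod (\<theta> s) \<le> 1" for s
  proof -
    have "cmod (D (z0 + of_real s)) + e > 0" using e(1) norm_ge_zero[of "D (z0 + of_real s)"] by linarith
    then show ?thesis unfolding \<theta>_def norm_divide norm_of_real using e(1) by simp
  qed
  define G where "G = (\<lambda>z. integral (cbox (-a) a) (\<lambda>s::real. D (z + of_real s) * \<theta> s))"
  have holG: "G holomorphic_on UNIV" unfolding G_def
  proof (rule leibniz_rule_holomorphic[where fx="\<lambda>z t. deriv D (z + of_real t) * \<theta> t"])
    fix z t
    have "(D has_field_derivative deriv D (z + of_real t)) (at (z + of_real t))"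
      using exp_type_le_holomorphic[OF D, of UNIV] holomorphic_derivI by blast
    note d = DERIV_chain2[where f=D and g="\<lambda>z. z + of_real t" and x=z, OF this, of 1]
    have "((\<lambda>z. D (z + of_real t)) has_field_derivative deriv D (z + of_real t)) (at z)"
    proof -
      have "((\<lambda>z. z + complex_of_real t) has_field_derivative 1) (at z)"
        by (auto intro!: derivative_eq_intros)
      from d[OF this] show ?thesis by simp
    qed
    then show "((\<lambda>z. D (z + of_real t) * \<theta> t) has_field_derivative deriv D (z + of_real t) * \<theta> t) (at z within UNIV)"
      by (rule DERIV_cmult_right)
  next
    fix z show "(\<lambda>t. D (z + of_real t) * \<theta> t) integrable_on cbox (-a) a"
      by (intro integrable_continuous continuous_intros contD cont\<theta>)
  next
    have "deriv D holomorphic_on UNIV"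
      using exp_type_le_holomorphic[OF D, of UNIV] by (intro holomorphic_deriv) auto
    then have c: "continuous_on UNIV (deriv D)" by (rule holomorphic_on_imp_continuous_on)
    show "continuous_on (UNIV \<times> cbox (-a) a) (\<lambda>(z, t). deriv D (z + of_real t) * \<theta> t)"
      unfolding case_prod_unfold
      by (intro continuous_intros continuous_on_compose2[OF c] continuous_on_compose2[OF cont\<theta>]) auto
  qed auto
  have normG: "cmod (G z) \<le> integral {-a..a} (\<lambda>s. cmod (D (z + of_real s)))" for z
    unfolding G_def interval_cbox
  proof (rule integral_norm_bound_integral)
    show "(\<lambda>s. D (z + complex_of_real s) * \<theta> s) integrable_on cbox (- a) a"
      by (intro integrable_continuous continuous_intros contD cont\<theta>)
    show "(\<lambda>s. cmod (D (z + complex_of_real s))) integrable_on cbox (- a) a"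
      by (intro integrable_continuous continuous_intros contD)
    show "cmod (D (z + complex_of_real s) * \<theta> s) \<le> cmod (D (z + complex_of_real s))" for s
      using \<theta>1[of s] by (simp add: norm_mult mult_left_le)
  qed
  have "exp_type_le G \<tau>" unfolding exp_type_le_def
  proof (intro conjI allI impI holG)
    fix \<epsilon>' :: real assume "\<epsilon>' > 0"
    then obtain C where C: "C > 0" "\<And>z. cmod (D z) \<le> C * exp ((\<tau> + \<epsilon>') * cmod z)"
      using D unfolding exp_type_le_def by blast
    have "cmod (G z) \<le> ((2 * a + 1) * C * exp ((\<tau> + \<epsilon>') * a)) * exp ((\<tau> + \<epsilon>') * cmod z)" for z
    proof -
      have "cmod (G z) \<le> integral {-a..a} (\<lambda>s. cmod (D (z + of_real s)))" by (rule normG)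
      also have "\<dots> \<le> integral {-a..a} (\<lambda>s. C * exp ((\<tau> + \<epsilon>') * (cmod z + a)))"
      proof (rule integral_le)
        show "(\<lambda>s. cmod (D (z + complex_of_real s))) integrable_on {- a.. a}"
          by (intro integrable_continuous_interval continuous_intros contD)
        fix s assume s: "s \<in> {-a..a}"
        have "cmod (z + of_real s) \<le> cmod z + a"
          using norm_triangle_ineq[of z "of_real s"] s by auto
        then have "C * exp ((\<tau> + \<epsilon>') * cmod (z + of_real s)) \<le> C * exp ((\<tau> + \<epsilon>') * (cmod z + a))"
          using C(1) \<tau> \<open>\<epsilon>' > 0\<close> by (simp add: mult_left_mono)
        then show "cmod (D (z + complex_of_real s)) \<le> C * exp ((\<tau> + \<epsilon>') * (cmod z + a))"
          using C(2) order_trans by blast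
      qed auto
      also have "\<dots> = 2 * a * (C * exp ((\<tau> + \<epsilon>') * (cmod z + a)))" using a by simp
      also have "\<dots> \<le> (2 * a + 1) * (C * exp ((\<tau> + \<epsilon>') * (cmod z + a)))"
        using C(1) by (intro mult_right_mono) auto
      also have "\<dots> = ((2 * a + 1) * C * exp ((\<tau> + \<epsilon>') * a)) * exp ((\<tau> + \<epsilon>') * cmod z)"
        by (simp add: exp_add ring_distribs)
      finally show ?thesis .
    qed
    moreover have "(2 * a + 1) * C * exp ((\<tau> + \<epsilon>') * a) > 0" using C(1) a by simp
    ultimately show "\<exists>C>0. \<forall>z. cmod (G z) \<le> C * exp ((\<tau> + \<epsilon>') * cmod z)" by blast
  qed
  moreover have "cmod (G (of_real x)) \<le> N" for x
  proof -
    have i: "integrable lborel (\<lambda>s. cmod (D (of_real x + of_real s)))"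
      using lborel_integrable_real_affine[OF integrable_norm[OF int], of 1 x] by simp
    have "cmod (G (of_real x)) \<le> integral {-a..a} (\<lambda>s. cmod (D (of_real x + of_real s)))" by (rule normG)
    also have "\<dots> = (LINT s:{-a..a}|lborel. cmod (D (of_real x + of_real s)))"
      by (rule set_borel_integral_eq_integral(2)[symmetric])
         (intro borel_integrable_atLeastAtMost' continuous_intros contD)
    also have "\<dots> \<le> (LINT s|lborel. cmod (D (of_real x + of_real s)))"
      unfolding set_lebesgue_integral_def
      by (rule integral_mono'[OF i]) (auto simp: indicator_def)
    also have "\<dots> = N" unfolding N_def
      using lborel_integral_real_affine[of 1 "\<lambda>s. cmod (D (of_real s))" x] by simp
    finally show ?thesis .
  qed
  ultimately have "cmod (G z0) \<le> N * exp (\<tau> * \<bar>Im z0\<bar>)"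
    by (intro Phragmen_Lindelof_exp_type \<tau> N0) auto
  moreover have "integral {-a..a} (\<lambda>s. cmod (D (z0 + of_real s)) - e) \<le> cmod (G z0)"
  proof -
    have "integral {-a..a} (\<lambda>s. cmod (D (z0 + of_real s)) - e) \<le> integral {-a..a} (\<lambda>s. Re (D (z0 + of_real s) * \<theta> s))"
    proof (rule integral_le)
      show "(\<lambda>s. cmod (D (z0 + complex_of_real s)) - e) integrable_on {- a..a}"
        by (intro integrable_continuous_interval continuous_intros contD)
      show "(\<lambda>s. Re (D (z0 + complex_of_real s) * \<theta> s)) integrable_on {- a..a}"
        by (intro integrable_continuous_interval continuous_intros contD cont\<theta>)
      fix s :: real
      define d where "d = cmod (D (z0 + of_real s))"
      have d: "d \<ge> 0" by (simp add: d_def)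
      have "D (z0 + of_real s) * \<theta> s = of_real (d^2 / (d + e))"
      proof -
        have "D (z0 + of_real s) * cnj (D (z0 + of_real s)) = of_real (d^2)"
          unfolding d_def by (rule complex_norm_square[symmetric])
        then show ?thesis by (simp add: \<theta>_def d_def flip: of_real_add)
      qed
      then have "Re (D (z0 + of_real s) * \<theta> s) = d^2 / (d + e)" by (metis Re_complex_of_real)
      moreover have "(d - e) * (d + e) \<le> d^2" by (simp add: algebra_simps power2_eq_square)
      then have "d - e \<le> d^2 / (d + e)" using d e(1) by (simp add: pos_le_divide_eq)
      ultimately show "cmod (D (z0 + complex_of_real s)) - e \<le> Re (D (z0 + complex_of_real s) * \<theta> s)"
        by (simp add: d_def)
    qed
    also have "\<dots> = Re (G z0)" unfolding G_def interval_cbox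
      by (intro integral_unique has_integral_Re integrable_integral integrable_continuous continuous_intros contD cont\<theta>)
    also have "\<dots> \<le> cmod (G z0)" by (rule complex_Re_le_cmod)
    finally show ?thesis .
  qed
  moreover have "integral {-a..a} (\<lambda>s. cmod (D (z0 + of_real s)) - e) = integral {-a..a} (\<lambda>s. cmod (D (z0 + of_real s))) - 2 * a * e"
    using a by (subst integral_diff) (auto intro!: integrable_continuous_interval continuous_intros contD)
  ultimately show "integral {-a..a} (\<lambda>s. cmod (D (z0 + of_real s)))
           \<le> (\<integral>x. cmod (D (of_real x)) \<partial>lborel) * exp (\<tau> * \<bar>Im z0\<bar>) + \<epsilon>"
    using e(2) unfolding N_def by linarith
qed

text \<open>The bound for finite windows does not depend on the window.\<close>

lemma Plancherel_Polya_L1: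
  assumes D: "exp_type_le D \<tau>" and \<tau>: "\<tau> \<ge> 0"
    and int: "integrable lborel (\<lambda>x. D (of_real x))"
  shows "(\<integral>\<^sup>+x. ennreal (cmod (D (z0 + of_real x))) \<partial>lborel)
           \<le> ennreal ((\<integral>x. cmod (D (of_real x)) \<partial>lborel) * exp (\<tau> * \<bar>Im z0\<bar>))" (is "?L \<le> ennreal ?B")
proof -
  have cont: "continuous_on S (\<lambda>x::real. cmod (D (z0 + of_real x)))" for S
    by (intro continuous_intros exp_type_le_continuous_on[OF D])
  have win: "(\<integral>\<^sup>+x. ennreal (cmod (D (z0 + of_real x))) * indicator {- real n..real n} x \<partial>lborel) \<le> ennreal ?B" for n
  proof -
    have si: "set_integrable lborel {- real n..real n} (\<lambda>x. cmod (D (z0 + of_real x)))"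
      by (intro borel_integrable_atLeastAtMost' cont)
    have "(\<integral>\<^sup>+x. ennreal (cmod (D (z0 + of_real x))) * indicator {- real n..real n} x \<partial>lborel)
        = (\<integral>\<^sup>+x. ennreal (indicator {- real n..real n} x *\<^sub>R cmod (D (z0 + of_real x))) \<partial>lborel)"
      by (intro nn_integral_cong) (auto simp: indicator_def)
    also have "\<dots> = ennreal (LINT x:{- real n..real n}|lborel. cmod (D (z0 + of_real x)))"
      using si unfolding set_lebesgue_integral_def set_integrable_def
      by (intro nn_integral_eq_integral) auto
    also have "(LINT x:{- real n..real n}|lborel. cmod (D (z0 + of_real x))) = integral {- real n..real n} (\<lambda>x. cmod (D (z0 + of_real x)))"
      by (rule set_borel_integral_eq_integral(2)[OF si])
    also have "ennreal \<dots> \<le> ennreal ?B"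
      by (intro ennreal_leI window_integral_bound[OF D \<tau> int]) simp
    finally show ?thesis .
  qed
  have [measurable]: "(\<lambda>x::real. cmod (D (z0 + of_real x))) \<in> borel_measurable borel"
    using cont by (rule borel_measurable_continuous_onI)
  have "?L = (\<integral>\<^sup>+x. (SUP n. ennreal (cmod (D (z0 + of_real x))) * indicator {- real n..real n} x) \<partial>lborel)"
  proof (rule nn_integral_cong)
    fix x :: real
    obtain n where n: "real n > \<bar>x\<bar>" using reals_Archimedean2 by blast
    have "ennreal (cmod (D (z0 + of_real x))) = ennreal (cmod (D (z0 + of_real x))) * indicator {- real n..real n} x"
      using n by (auto simp: indicator_def)
    also have "\<dots> \<le> (SUP n. ennreal (cmod (D (z0 + of_real x))) * indicator {- real n..real n} x)"
      by (rule SUP_upper) auto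
    finally have 1: "ennreal (cmod (D (z0 + of_real x))) \<le> (SUP n. ennreal (cmod (D (z0 + of_real x))) * indicator {- real n..real n} x)" .
    have 2: "(SUP n. ennreal (cmod (D (z0 + of_real x))) * indicator {- real n..real n} x) \<le> ennreal (cmod (D (z0 + of_real x)))"
      by (rule SUP_least) (auto simp: indicator_def)
    show "ennreal (cmod (D (z0 + of_real x))) = (SUP n. ennreal (cmod (D (z0 + of_real x))) * indicator {- real n..real n} x)"
      using 1 2 by (rule antisym)
  qed
  also have "\<dots> = (SUP n. (\<integral>\<^sup>+x. ennreal (cmod (D (z0 + of_real x))) * indicator {- real n..real n} x \<partial>lborel))"
    by (rule nn_integral_monotone_convergence_SUP)
       (auto simp: incseq_def le_fun_def indicator_def)
  also have "\<dots> \<le> ennreal ?B" by (rule SUP_least) (rule win)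
  finally show ?thesis .
qed

text \<open>Cauchy's formula for the derivative on the unit circle around w, in modulus.\<close>

lemma deriv_circle_mean_bound:
  assumes D: "D holomorphic_on UNIV"
  shows "ennreal (cmod (deriv D w)) \<le> (\<integral>\<^sup>+s. ennreal (cmod (D (w + exp (2 * pi * \<i> * of_real s)))) * indicator {0..1} s \<partial>lborel)"
proof -
  have contD: "continuous_on UNIV D" by (rule holomorphic_on_imp_continuous_on[OF D])
  define e where "e = (\<lambda>s::real. exp (2 * pi * \<i> * of_real s))"
  have e1: "cmod (e s) = 1" for s by (simp add: e_def norm_exp_eq_Re)
  have cont: "continuous_on {0..1} (\<lambda>s. cmod (D (w + e s)))"
    unfolding e_def by (intro continuous_intros continuous_on_compose2[OF contD]) auto
  have "((\<lambda>u. D u / (u - w) ^ (Suc 1)) has_contour_integral ((2 * pi * \<i>) / (fact 1) * (deriv ^^ 1) D w)) (circlepath w 1)"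
    by (rule Cauchy_has_contour_integral_higher_derivative_circlepath)
       (use D contD in \<open>auto intro: continuous_on_subset holomorphic_on_subset\<close>)
  then have "((\<lambda>s. D (circlepath w 1 s) / (circlepath w 1 s - w) ^ 2 * vector_derivative (circlepath w 1) (at s within {0..1})) has_integral (2 * pi * \<i> * deriv D w)) {0..1}"
    by (simp add: has_contour_integral_def numeral_2_eq_2)
  then have "((\<lambda>s. D (w + e s) / (e s) ^ 2 * (2 * pi * \<i> * e s)) has_integral (2 * pi * \<i> * deriv D w)) {0..1}"
  proof (rule has_integral_eq[rotated])
    fix s :: real assume s: "s \<in> {0..1}"
    have "circlepath w 1 s = w + e s" by (simp add: circlepath e_def)
    moreover have "vector_derivative (circlepath w 1) (at s within {0..1}) = 2 * pi * \<i> * e s"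
      using s by (simp add: vector_derivative_circlepath01 e_def)
    ultimately show "D (circlepath w 1 s) / (circlepath w 1 s - w) ^ 2 * vector_derivative (circlepath w 1) (at s within {0..1})
       = D (w + e s) / (e s) ^ 2 * (2 * pi * \<i> * e s)" by simp
  qed
  then have hi: "((\<lambda>s. (1 / (2 * pi * \<i>)) * (D (w + e s) / (e s) ^ 2 * (2 * pi * \<i> * e s))) has_integral ((1 / (2 * pi * \<i>)) * (2 * pi * \<i> * deriv D w))) {0..1}"
    by (rule has_integral_mult_right)
  have "cmod ((1 / (2 * pi * \<i>)) * (2 * pi * \<i> * deriv D w)) \<le> integral {0..1} (\<lambda>s. cmod (D (w + e s)))"
    unfolding integral_unique[OF hi, symmetric]
  proof (rule integral_norm_bound_integral)
    show "(\<lambda>s. 1 / (2 * pi * \<i>) * (D (w + e s) / (e s)\<^sup>2 * (2 * pi * \<i> * e s))) integrable_on {0..1}"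
      using hi by (rule has_integral_integrable)
    show "(\<lambda>s. cmod (D (w + e s))) integrable_on {0..1}"
      by (rule integrable_continuous_interval[OF cont])
    show "cmod (1 / (2 * pi * \<i>) * (D (w + e s) / (e s)\<^sup>2 * (2 * pi * \<i> * e s))) \<le> cmod (D (w + e s))" for s
      by (simp add: norm_mult norm_divide norm_power e1)
  qed
  then have le: "cmod (deriv D w) \<le> integral {0..1} (\<lambda>s. cmod (D (w + e s)))" by simp
  have si: "set_integrable lborel {0..1} (\<lambda>s. cmod (D (w + e s)))"
    by (rule borel_integrable_atLeastAtMost'[OF cont])
  have "ennreal (integral {0..1} (\<lambda>s. cmod (D (w + e s)))) = ennreal (LINT s:{0..1}|lborel. cmod (D (w + e s)))"
    by (simp add: set_borel_integral_eq_integral(2)[OF si])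
  also have "\<dots> = (\<integral>\<^sup>+s. ennreal (indicator {0..1} s *\<^sub>R cmod (D (w + e s))) \<partial>lborel)"
    using si unfolding set_lebesgue_integral_def set_integrable_def
    by (intro nn_integral_eq_integral[symmetric]) auto
  also have "\<dots> = (\<integral>\<^sup>+s. ennreal (cmod (D (w + e s))) * indicator {0..1} s \<partial>lborel)"
    by (intro nn_integral_cong) (auto simp: indicator_def)
  finally show ?thesis using le unfolding e_def by (metis ennreal_leI)
qed

text \<open>Averaging over the unit circle moves the line of integration by at most 1, where the previous bound
applies with one extra factor exp(\<tau>).\<close>

lemma deriv_L1_bound:
  assumes D: "exp_type_le D \<tau>" and \<tau>: "\<tau> \<ge> 0"
    and int: "integrable lborel (\<lambda>x. D (of_real x))"
  shows "(\<integral>\<^sup>+x. ennreal (cmod (deriv D (z0 + of_real x))) \<partial>lborel)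
           \<le> ennreal ((\<integral>x. cmod (D (of_real x)) \<partial>lborel) * exp (\<tau> * (\<bar>Im z0\<bar> + 1)))"
proof -
  note [measurable] = exp_type_le_borel_measurable[OF D]
  have "(\<lambda>p::real \<times> real. D (z0 + of_real (fst p) + exp (2 * pi * \<i> * of_real (snd p)))) \<in> borel_measurable borel"
    by (intro borel_measurable_continuous_onI exp_type_le_continuous_on[OF D] continuous_intros)
  then have [measurable]: "(\<lambda>p::real \<times> real. D (z0 + of_real (fst p) + exp (2 * pi * \<i> * of_real (snd p)))) \<in> borel_measurable (lborel \<Otimes>\<^sub>M lborel)"
    by (simp add: lborel_prod)
  define N where "N = (\<integral>x. cmod (D (of_real x)) \<partial>lborel)"
  have N0: "N \<ge> 0" unfolding N_def by simp
  have "(\<integral>\<^sup>+x. ennreal (cmod (deriv D (z0 + of_real x))) \<partial>lborel)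
     \<le> (\<integral>\<^sup>+x. (\<integral>\<^sup>+s. ennreal (cmod (D (z0 + of_real x + exp (2 * pi * \<i> * of_real s)))) * indicator {0..1} s \<partial>lborel) \<partial>lborel)"
    by (intro nn_integral_mono deriv_circle_mean_bound exp_type_le_holomorphic[OF D])
  also have "\<dots> = (\<integral>\<^sup>+s. (\<integral>\<^sup>+x. ennreal (cmod (D (z0 + of_real x + exp (2 * pi * \<i> * of_real s)))) * indicator {0..1} s \<partial>lborel) \<partial>lborel)"
  proof (rule lborel_pair.Fubini'[symmetric])
    show "(\<lambda>(x, s). ennreal (cmod (D (z0 + of_real x + exp (2 * pi * \<i> * of_real s)))) * indicator {0..1} s)
        \<in> borel_measurable (lborel \<Otimes>\<^sub>M lborel)"
      unfolding case_prod_unfold by measurable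
  qed
  also have "\<dots> \<le> (\<integral>\<^sup>+s. ennreal (N * exp (\<tau> * (\<bar>Im z0\<bar> + 1))) * indicator {0..1::real} s \<partial>lborel)"
  proof (rule nn_integral_mono)
    fix s :: real
    define e where "e = exp (2 * pi * \<i> * of_real s)"
    have e1: "cmod e = 1" by (simp add: e_def norm_exp_eq_Re)
    have "(\<integral>\<^sup>+x. ennreal (cmod (D (z0 + of_real x + e))) * indicator {0..1} s \<partial>lborel)
      = (\<integral>\<^sup>+x. ennreal (cmod (D ((z0 + e) + of_real x))) \<partial>lborel) * indicator {0..1} s"
      by (subst nn_integral_multc[symmetric]) (auto simp: add_ac)
    also have "\<dots> \<le> ennreal (N * exp (\<tau> * \<bar>Im (z0 + e)\<bar>)) * indicator {0..1} s"
      unfolding N_def by (intro mult_right_mono Plancherel_Polya_L1[OF D \<tau> int]) auto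
    also have "\<dots> \<le> ennreal (N * exp (\<tau> * (\<bar>Im z0\<bar> + 1))) * indicator {0..1} s"
    proof (intro mult_right_mono ennreal_leI mult_left_mono N0)
      have "\<bar>Im (z0 + e)\<bar> \<le> \<bar>Im z0\<bar> + 1" using abs_Im_le_cmod[of e] e1 by simp
      then show "exp (\<tau> * \<bar>Im (z0 + e)\<bar>) \<le> exp (\<tau> * (\<bar>Im z0\<bar> + 1))" using \<tau> by (simp add: mult_left_mono)
    qed auto
    finally show "(\<integral>\<^sup>+x. ennreal (cmod (D (z0 + of_real x + exp (2 * pi * \<i> * of_real s)))) * indicator {0..1} s \<partial>lborel)
       \<le> ennreal (N * exp (\<tau> * (\<bar>Im z0\<bar> + 1))) * indicator {0..1} s" by (simp add: e_def)
  qed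
  also have "\<dots> = ennreal (N * exp (\<tau> * (\<bar>Im z0\<bar> + 1)))"
    by (simp add: nn_integral_cmult)
  finally show ?thesis unfolding N_def .
qed

text \<open>D(z) = D(z+u) - \<integral>_0^u D'; averaging over u in the unit interval turns point values into window integrals, which
add up over integer translates. The half-open window makes the translates disjoint.\<close>

lemma pointwise_bound_unit_window:
  assumes D: "D holomorphic_on UNIV"
  shows "ennreal (cmod (D z)) \<le> (\<integral>\<^sup>+u. (ennreal (cmod (D (z + of_real u))) + ennreal (cmod (deriv D (z + of_real u)))) * indicator {0..<1} u \<partial>lborel)"
proof -
  have contD: "continuous_on UNIV D" by (rule holomorphic_on_imp_continuous_on[OF D])
  have "deriv D holomorphic_on UNIV" by (rule holomorphic_deriv[OF D]) auto
  then have contD': "continuous_on UNIV (deriv D)" by (rule holomorphic_on_imp_continuous_on)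
  have c1: "continuous_on S (\<lambda>u::real. D (z + of_real u))" for S
    by (intro continuous_on_compose2[OF contD] continuous_intros) auto
  have c2: "continuous_on S (\<lambda>u::real. deriv D (z + of_real u))" for S
    by (intro continuous_on_compose2[OF contD'] continuous_intros) auto
  define J where "J = integral {0..1} (\<lambda>u. cmod (deriv D (z + of_real u)))"
  have pt: "cmod (D z) \<le> cmod (D (z + of_real u)) + J" if u: "u \<in> {0..1}" for u :: real
  proof -
    have "((\<lambda>u. deriv D (z + of_real u)) has_integral (D (z + of_real u) - D (z + of_real 0))) {0..u}"
    proof (rule fundamental_theorem_of_calculus)
      fix s :: real
      have "((\<lambda>z'. D (z + z')) has_field_derivative deriv D (z + of_real s)) (at (of_real s))"
      proof -
        have "(D has_field_derivative deriv D (z + of_real s)) (at (z + of_real s))"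
          by (rule holomorphic_derivI[OF D]) auto
        moreover have "((\<lambda>z'. z + z') has_field_derivative 1) (at (of_real s))"
          by (auto intro!: derivative_eq_intros)
        ultimately show ?thesis
          using DERIV_chain2[where f=D and g="\<lambda>z'. z + z'" and x="of_real s"] by fastforce
      qed
      then show "((\<lambda>s. D (z + of_real s)) has_vector_derivative deriv D (z + of_real s)) (at s within {0..u})"
        by (rule has_vector_derivative_real_field[where f="\<lambda>z'. D (z + z')"])
    qed (use u in auto)
    then have "D (z + of_real u) - D z = integral {0..u} (\<lambda>u. deriv D (z + of_real u))"
      by (simp add: integral_unique)
    also have "cmod \<dots> \<le> integral {0..u} (\<lambda>u. cmod (deriv D (z + of_real u)))"
      by (rule integral_norm_bound_integral) (auto intro!: integrable_continuous_interval continuous_intros c2)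
    also have "\<dots> \<le> J" unfolding J_def using u
      by (intro integral_subset_le) (auto intro!: integrable_continuous_interval continuous_intros c2)
    finally show ?thesis using norm_triangle_ineq2[of "D z" "D (z + of_real u)"]
      by (simp add: norm_minus_commute)
  qed
  have "cmod (D z) = integral {0..1::real} (\<lambda>u. cmod (D z))" by simp
  also have "\<dots> \<le> integral {0..1} (\<lambda>u. cmod (D (z + of_real u)) + J)"
    by (rule integral_le) (auto intro!: integrable_continuous_interval continuous_intros c1 pt)
  also have "\<dots> = integral {0..1} (\<lambda>u. cmod (D (z + of_real u)) + cmod (deriv D (z + of_real u)))"
    unfolding J_def
    by (subst (1 2) integral_add) (auto intro!: integrable_continuous_interval continuous_intros c1 c2)
  finally have le: "cmod (D z) \<le> integral {0..1} (\<lambda>u. cmod (D (z + of_real u)) + cmod (deriv D (z + of_real u)))" .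
  let ?h = "\<lambda>u. cmod (D (z + of_real u)) + cmod (deriv D (z + of_real u))"
  have si: "set_integrable lborel {0..1} ?h"
    by (intro borel_integrable_atLeastAtMost' continuous_intros c1 c2)
  have "ennreal (integral {0..1} ?h) = ennreal (LINT s:{0..1}|lborel. ?h s)"
    by (simp add: set_borel_integral_eq_integral(2)[OF si])
  also have "\<dots> = (\<integral>\<^sup>+s. ennreal (indicator {0..1} s *\<^sub>R ?h s) \<partial>lborel)"
    using si unfolding set_lebesgue_integral_def set_integrable_def
    by (intro nn_integral_eq_integral[symmetric]) auto
  also have "\<dots> = (\<integral>\<^sup>+s. (ennreal (cmod (D (z + of_real s))) + ennreal (cmod (deriv D (z + of_real s)))) * indicator {0..<1} s \<partial>lborel)"
  proof (rule nn_integral_cong_AE)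
    have "AE s in lborel. s \<noteq> (1::real)" by (rule AE_lborel_singleton)
    then show "AE s in lborel. ennreal (indicator {0..1} s *\<^sub>R ?h s) = (ennreal (cmod (D (z + of_real s))) + ennreal (cmod (deriv D (z + of_real s)))) * indicator {0..<1} s"
      by eventually_elim (auto simp: indicator_def ennreal_plus)
  qed
  finally show ?thesis using le by (metis ennreal_leI)
qed

lemma sum_unit_windows_le:
  fixes f :: "real \<Rightarrow> ennreal"
  assumes [measurable]: "f \<in> borel_measurable borel" and K: "finite K"
  shows "(\<Sum>k\<in>K. \<integral>\<^sup>+u. f (of_int k + u) * indicator {0..<1} u \<partial>lborel) \<le> (\<integral>\<^sup>+u. f u \<partial>lborel)"
proof -
  have "(\<integral>\<^sup>+u. f (of_int k + u) * indicator {0..<1} u \<partial>lborel) = (\<integral>\<^sup>+u. f u * indicator {of_int k..<of_int k + 1} u \<partial>lborel)" for k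
  proof -
    have "(\<integral>\<^sup>+u. f u * indicator {of_int k..<of_int k + 1} u \<partial>lborel) = (\<integral>\<^sup>+u. f (of_int k + u) * indicator {of_int k..<of_int k + 1} (of_int k + u) \<partial>lborel)"
      using nn_integral_real_affine[of "\<lambda>u. f u * indicator {of_int k..<of_int k + 1} u" 1 "of_int k"] by simp
    also have "\<dots> = (\<integral>\<^sup>+u. f (of_int k + u) * indicator {0..<1} u \<partial>lborel)"
      by (intro nn_integral_cong) (auto simp: indicator_def)
    finally show ?thesis by simp
  qed
  then have "(\<Sum>k\<in>K. \<integral>\<^sup>+u. f (of_int k + u) * indicator {0..<1} u \<partial>lborel)
     = (\<integral>\<^sup>+u. (\<Sum>k\<in>K. f u * indicator {of_int k..<of_int k + 1} u) \<partial>lborel)"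
    by (subst nn_integral_sum) auto
  also have "\<dots> \<le> (\<integral>\<^sup>+u. f u \<partial>lborel)"
  proof (rule nn_integral_mono)
    fix u :: real
    have "(\<Sum>k\<in>K. f u * indicator {of_int k..<of_int k + 1} u) = (\<Sum>k\<in>K \<inter> {\<lfloor>u\<rfloor>}. f u * indicator {of_int k..<of_int k + 1} u)"
    proof (rule sum.mono_neutral_right[OF K])
      show "\<forall>k\<in>K - K \<inter> {\<lfloor>u\<rfloor>}. f u * indicator {of_int k..<of_int k + 1} u = 0"
        by (auto simp: indicator_def floor_unique)
    qed auto
    also have "\<dots> \<le> f u" by (cases "\<lfloor>u\<rfloor> \<in> K") (auto simp: indicator_def)
    finally show "(\<Sum>k\<in>K. f u * indicator {of_int k..<of_int k + 1} u) \<le> f u" .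
  qed
  finally show ?thesis .
qed

text \<open>Sums over integer translates of an integrable function of exponential type are controlled by the L1-norms of D
and D' along the horizontal line. The uniformity in the finite set K yields summability and, for one
point, boundedness on horizontal lines.\<close>

lemma sum_integer_translates_bound:
  assumes D: "exp_type_le D \<tau>" and \<tau>: "\<tau> \<ge> 0"
    and int: "integrable lborel (\<lambda>x. D (of_real x))" and K: "finite K"
  shows "(\<Sum>k\<in>K. cmod (D (z + of_int k))) \<le> (\<integral>x. cmod (D (of_real x)) \<partial>lborel) * (1 + exp \<tau>) * exp (\<tau> * \<bar>Im z\<bar>)"
proof -
  define N where "N = (\<integral>x. cmod (D (of_real x)) \<partial>lborel)"
  have N0: "N \<ge> 0" unfolding N_def by simp
  note [measurable] = exp_type_le_borel_measurable[OF D]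
  have "deriv D holomorphic_on UNIV" by (rule holomorphic_deriv[OF exp_type_le_holomorphic[OF D]]) auto
  then have [measurable]: "deriv D \<in> borel_measurable borel"
    by (intro borel_measurable_continuous_onI holomorphic_on_imp_continuous_on)
  define f where "f = (\<lambda>u::real. ennreal (cmod (D (z + of_real u))) + ennreal (cmod (deriv D (z + of_real u))))"
  have f: "f \<in> borel_measurable borel" unfolding f_def by measurable
  have "ennreal (\<Sum>k\<in>K. cmod (D (z + of_int k))) = (\<Sum>k\<in>K. ennreal (cmod (D (z + of_int k))))" by simp
  also have "\<dots> \<le> (\<Sum>k\<in>K. \<integral>\<^sup>+u. f (of_int k + u) * indicator {0..<1} u \<partial>lborel)"
  proof (rule sum_mono)
    fix k
    show "ennreal (cmod (D (z + of_int k))) \<le> (\<integral>\<^sup>+u. f (of_int k + u) * indicator {0..<1} u \<partial>lborel)"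
      using pointwise_bound_unit_window[OF exp_type_le_holomorphic[OF D], of "z + of_int k"]
      by (simp add: f_def add.assoc)
  qed
  also have "\<dots> \<le> (\<integral>\<^sup>+u. f u \<partial>lborel)" by (rule sum_unit_windows_le[OF f K])
  also have "\<dots> = (\<integral>\<^sup>+u. ennreal (cmod (D (z + of_real u))) \<partial>lborel) + (\<integral>\<^sup>+u. ennreal (cmod (deriv D (z + of_real u))) \<partial>lborel)"
    unfolding f_def by (rule nn_integral_add) auto
  also have "\<dots> \<le> ennreal (N * exp (\<tau> * \<bar>Im z\<bar>)) + ennreal (N * exp (\<tau> * (\<bar>Im z\<bar> + 1)))"
    unfolding N_def by (intro add_mono Plancherel_Polya_L1[OF D \<tau> int] deriv_L1_bound[OF D \<tau> int])
  also have "\<dots> = ennreal (N * (1 + exp \<tau>) * exp (\<tau> * \<bar>Im z\<bar>))"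
    using N0 by (subst ennreal_plus[symmetric]) (auto simp: exp_add algebra_simps)
  finally show ?thesis unfolding N_def[symmetric] using N0
    by (subst (asm) ennreal_le_iff) auto
qed

lemma exp_type_L1_bounded:
  assumes D: "exp_type_le D \<tau>" and \<tau>: "\<tau> \<ge> 0"
    and int: "integrable lborel (\<lambda>x. D (of_real x))"
  shows "cmod (D z) \<le> (\<integral>x. cmod (D (of_real x)) \<partial>lborel) * (1 + exp \<tau>) * exp (\<tau> * \<bar>Im z\<bar>)"
  using sum_integer_translates_bound[OF D \<tau> int, of "{0}" z] by simp

lemma exp_type_L1_summable_on_int:
  assumes D: "exp_type_le D \<tau>" and \<tau>: "\<tau> \<ge> 0"
    and int: "integrable lborel (\<lambda>x. D (of_real x))"
  shows "(\<lambda>k::int. cmod (D (z + of_int k))) summable_on UNIV"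
proof (rule nonneg_bdd_above_summable_on)
  show "bdd_above (sum (\<lambda>k::int. cmod (D (z + of_int k))) ` {F. F \<subseteq> UNIV \<and> finite F})"
    using sum_integer_translates_bound[OF D \<tau> int] by (auto simp: bdd_above_def)
qed auto

section \<open>Entire functions vanishing at the integers and periodic entire functions\<close>

lemma entire_divide_simple_zero:
  assumes F: "F holomorphic_on UNIV" and a: "F a = 0"
  obtains R where "R holomorphic_on UNIV" "\<And>z. F z = (z - a) * R z" "R a = deriv F a"
proof
  show "(\<lambda>z. if z = a then deriv F a else (F z - F a) / (z - a)) holomorphic_on UNIV"
    by (rule pole_lemma_open[OF F]) simp
qed (auto simp: a)

lemma sin_pi_complex_eq_0_iff: "sin (of_real pi * z) = 0 \<longleftrightarrow> z \<in> \<int>" for z :: complex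
proof -
  have "sin (of_real pi * z) = 0 \<longleftrightarrow> (\<exists>n::int. of_real pi * z = of_real (of_int n * pi))"
    by (rule sin_eq_0)
  also have "\<dots> \<longleftrightarrow> (\<exists>n::int. z = of_int n)"
  proof (rule ex_cong1)
    fix n :: int
    have "of_real pi * z = of_real (of_int n * pi) \<longleftrightarrow> of_real pi * z = of_real pi * of_int n" by (simp add: mult.commute)
    then show "of_real pi * z = of_real (of_int n * pi) \<longleftrightarrow> z = of_int n" by (simp add: mult_cancel_left)
  qed
  finally show ?thesis by (auto simp: Ints_def)
qed

lemma cos_pi_int_nonzero: "cos (of_real pi * of_int n) \<noteq> (0::complex)"
proof
  assume "cos (of_real pi * of_int n) = (0::complex)"
  moreover have "sin (of_real pi * of_int n) = (0::complex)" by (simp add: sin_pi_complex_eq_0_iff)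
  ultimately show False using sin_cos_squared_add[of "of_real pi * of_int n :: complex"] by simp
qed

text \<open>The zeros of sin \<pi>z are simple and are exactly the integers, so all singularities of the quotient are removable.\<close>

lemma entire_divide_sin_pi:
  assumes F: "F holomorphic_on UNIV" and zero: "\<And>n::int. F (of_int n) = 0"
  obtains R where "R holomorphic_on UNIV" "\<And>z. F z = R z * sin (of_real pi * z)"
proof
  define q where "q = (\<lambda>z. F z / sin (of_real pi * z))"
  have ana: "q analytic_on {z}" if "z \<notin> \<int>" for z
  proof -
    have "open (- \<int> :: complex set)" using closed_Ints by auto
    moreover have "q holomorphic_on - \<int>" unfolding q_def
      by (intro holomorphic_intros holomorphic_on_subset[OF F]) (auto simp: sin_pi_complex_eq_0_iff)
    ultimately show ?thesis using that by (metis ComplI analytic_at)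
  qed
  have "remove_sings q analytic_on {z}" for z
  proof (cases "z \<in> \<int>")
    case False
    then show ?thesis by (intro remove_sings_analytic_on ana)
  next
    case True
    then obtain n where n: "z = of_int n" by (auto simp: Ints_def)
    obtain R1 where R1: "R1 holomorphic_on UNIV" "\<And>w. F w = (w - z) * R1 w"
      using entire_divide_simple_zero[OF F, of z] zero n by metis
    have "(\<lambda>z. sin (of_real pi * z)) holomorphic_on UNIV" by (intro holomorphic_intros)
    moreover have "sin (of_real pi * z) = 0" using True sin_pi_complex_eq_0_iff by blast
    ultimately obtain R2 where R2: "R2 holomorphic_on UNIV" "\<And>w. sin (of_real pi * w) = (w - z) * R2 w"
         "R2 z = deriv (\<lambda>z. sin (of_real pi * z)) z"
      using entire_divide_simple_zero[of "\<lambda>z. sin (of_real pi * z)" z] by metis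
    have "deriv (\<lambda>z. sin (of_real pi * z)) z = cos (of_real pi * z) * of_real pi"
      by (rule DERIV_imp_deriv) (auto intro!: derivative_eq_intros)
    then have R2z: "R2 z \<noteq> 0" using R2(3) cos_pi_int_nonzero[of n] n by simp
    have "isCont R1 z" "isCont R2 z"
      using holomorphic_on_imp_continuous_on[OF R1(1)] holomorphic_on_imp_continuous_on[OF R2(1)]
      by (simp_all add: continuous_on_eq_continuous_at)
    then have "(\<lambda>w. R1 w / R2 w) \<midarrow>z\<rightarrow> R1 z / R2 z"
      using R2z by (intro tendsto_divide) (auto simp: isCont_def)
    moreover have "eventually (\<lambda>w. R1 w / R2 w = q w) (at z)"
      by (auto simp: eventually_at_filter q_def R1(2) R2(2))
    ultimately have lim: "q \<midarrow>z\<rightarrow> R1 z / R2 z" by (rule Lim_transform_eventually)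
    have "isolated_singularity_at q z" unfolding q_def
      by (intro isolated_singularity_at_divide isolated_singularity_at_holomorphic[of _ UNIV]
          not_essential_holomorphic[of _ UNIV] holomorphic_intros holomorphic_on_subset[OF F]) auto
    then show ?thesis using lim by (rule remove_sings_analytic_at)
  qed
  then have "remove_sings q analytic_on UNIV" using analytic_on_analytic_at by blast
  then show "remove_sings q holomorphic_on UNIV" by (rule analytic_imp_holomorphic)
  show "F z = remove_sings q z * sin (of_real pi * z)" for z
  proof (cases "z \<in> \<int>")
    case True
    then show ?thesis using zero sin_pi_complex_eq_0_iff[of z] by (auto simp: Ints_def)
  next
    case False
    then show ?thesis using remove_sings_at_analytic[OF ana[OF False]] sin_pi_complex_eq_0_iff[of z]
      by (simp add: q_def)
  qed
qed

text \<open>These identities separate the real and imaginary parts: the modulus of sin \<pi>z is periodic in Re z and grows like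
exp(\<pi> |Im z|), uniformly away from the integers.\<close>

lemma norm_sin_cos_squared:
  "(cmod (sin z))^2 = (sin (Re z))^2 + (sinh (Im z))^2"
  "(cmod (cos z))^2 = (cos (Re z))^2 + (sinh (Im z))^2"
proof -
  have c: "(cosh (Im z))^2 = 1 + (sinh (Im z))^2" by (simp add: cosh_square_eq)
  have s: "(cos (Re z))^2 = 1 - (sin (Re z))^2" by (simp add: cos_squared_eq)
  have 1: "Re (sin z) = sin (Re z) * cosh (Im z)" "Im (sin z) = cos (Re z) * sinh (Im z)"
          "Re (cos z) = cos (Re z) * cosh (Im z)" "Im (cos z) = - (sin (Re z) * sinh (Im z))"
    by (simp_all add: Re_sin Im_sin Re_cos Im_cos cosh_def sinh_def field_simps)
  show "(cmod (sin z))^2 = (sin (Re z))^2 + (sinh (Im z))^2"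
    unfolding cmod_power2 1 power_mult_distrib c s by (simp add: algebra_simps)
  show "(cmod (cos z))^2 = (cos (Re z))^2 + (sinh (Im z))^2"
    unfolding cmod_power2 1 power_mult_distrib power2_minus c s by (simp add: algebra_simps)
qed

lemma norm_sin_ge_sinh: "cmod (sin z) \<ge> \<bar>sinh (Im z)\<bar>"
proof -
  have "\<bar>sinh (Im z)\<bar>^2 \<le> (cmod (sin z))^2" by (simp add: norm_sin_cos_squared)
  then show ?thesis by (rule power2_le_imp_le) auto
qed

lemma norm_sin_cos_le_exp: "cmod (sin z) \<le> exp \<bar>Im z\<bar>" "cmod (cos z) \<le> exp \<bar>Im z\<bar>"
proof -
  have "(cosh (Im z))^2 = 1 + (sinh (Im z))^2" by (simp add: cosh_square_eq)
  moreover have "(sin (Re z))^2 \<le> 1" "(cos (Re z))^2 \<le> 1" by (auto simp: abs_square_le_1)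
  ultimately have "(cmod (sin z))^2 \<le> (cosh (Im z))^2" "(cmod (cos z))^2 \<le> (cosh (Im z))^2"
    by (simp_all add: norm_sin_cos_squared)
  then have "cmod (sin z) \<le> cosh (Im z)" "cmod (cos z) \<le> cosh (Im z)"
    by (auto intro: power2_le_imp_le)
  moreover have "cosh (Im z) \<le> exp \<bar>Im z\<bar>"
  proof -
    have "cosh (Im z) = cosh \<bar>Im z\<bar>" by simp
    also have "\<dots> = (exp \<bar>Im z\<bar> + exp (- \<bar>Im z\<bar>)) / 2" by (simp add: cosh_def)
    also have "\<dots> \<le> exp \<bar>Im z\<bar>" by simp
    finally show ?thesis .
  qed
  ultimately show "cmod (sin z) \<le> exp \<bar>Im z\<bar>" "cmod (cos z) \<le> exp \<bar>Im z\<bar>" by linarith+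
qed

lemma abs_sinh_ge_exp:
  fixes y :: real
  assumes "\<bar>y\<bar> \<ge> 1"
  shows "\<bar>sinh y\<bar> \<ge> exp \<bar>y\<bar> / 4"
proof -
  have *: "sinh r \<ge> exp r / 4" if "r \<ge> 1" for r :: real
  proof -
    have "2 \<le> exp r" using exp_ge_add_one_self[of r] that by linarith
    moreover have "exp (- r) \<le> 1" using that by simp
    moreover have "sinh r = (exp r - exp (- r)) / 2" by (simp add: sinh_def)
    moreover have "x / 4 \<le> (x - v) / 2" if "2 \<le> x" "v \<le> 1" for x v :: real using that by simp
    ultimately show ?thesis by metis
  qed
  have "\<bar>sinh y\<bar> = sinh \<bar>y\<bar>" by (cases "y \<ge> 0") auto
  then show ?thesis using *[OF assms] by simp
qed

lemma periodic_add_of_int: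
  fixes f :: "complex \<Rightarrow> 'a"
  assumes per: "\<And>z. f (z + 1) = f z"
  shows "f (z + of_int n) = f z"
proof -
  have nat: "f (z + of_nat k) = f z" for k z
  proof (induction k)
    case (Suc k)
    have "f (z + of_nat (Suc k)) = f (z + of_nat k + 1)" by (simp add: add_ac)
    then show ?case using Suc by (simp only: per)
  qed simp
  show ?thesis
  proof (cases "n \<ge> 0")
    case True
    then show ?thesis using nat[of z "nat n"] by (simp add: of_nat_nat)
  next
    case False
    then show ?thesis using nat[of "z + of_int n" "nat (- n)"] by (simp add: of_nat_nat)
  qed
qed

text \<open>The interpolating trigonometric polynomial at 0, 1/3, 2/3 agrees with P on all multiples of 1/3. The difference T,
rescaled by 3, is divisible by sin \<pi>z, and the quotient R has period 3 in modulus and decays as |Im z| \<rightarrow> \<infinity>,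
because the type a of P is less than 3\<pi>. By Liouville's theorem R is constant, hence zero.\<close>

lemma periodic_entire_trig_polynomial:
  assumes P: "P holomorphic_on UNIV" and per: "\<And>z. P (z + 1) = P z"
    and bound: "\<And>z. cmod (P z) \<le> C * exp (a * \<bar>Im z\<bar>)" and a: "0 \<le> a" "a < 3 * pi"
  obtains c0 c1 c2 where "\<And>z. P z = c0 + c1 * exp (2 * pi * \<i> * z) + c2 * exp (- (2 * pi * \<i> * z))"
proof -
  have C: "C \<ge> 0" using bound[of 0] norm_ge_zero[of "P 0"] by (simp del: norm_ge_zero)
  (* The coefficients below are the discrete Fourier transform of the three values, with w a primitive cube root of unity. *)
  define w where "w = exp (2 * pi * \<i> / 3)"
  have w3: "w ^ 3 = 1"
  proof -
    have "w ^ 3 = exp (of_nat 3 * (2 * pi * \<i> / 3))" unfolding w_def by (rule exp_of_nat_mult[symmetric])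
    also have "of_nat 3 * (2 * pi * \<i> / 3) = 2 * complex_of_real pi * \<i>" by simp
    finally show ?thesis by (simp only: exp_two_pi_i)
  qed
  have w1: "w \<noteq> 1"
  proof
    assume "w = 1"
    then obtain n :: int where "2 * pi / 3 = of_int (2 * n) * pi" unfolding w_def exp_eq_1 by auto
    then have "1 = 3 * real_of_int n" by (simp add: field_simps)
    then have "(1::int) = 3 * n" by (metis of_int_1 of_int_eq_iff of_int_mult of_int_numeral)
    then show False by presburger
  qed
  have "(w - 1) * (1 + w + w^2) = w ^ 3 - 1" by (simp add: algebra_simps power2_eq_square power3_eq_cube)
  then have w2: "1 + w + w^2 = 0" using w3 w1 by simp
  have wm: "exp (- (2 * pi * \<i> / 3)) = w ^ 2"
  proof -
    have "w * exp (- (2 * pi * \<i> / 3)) = 1" unfolding w_def by (simp add: exp_add[symmetric])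
    moreover have "w * w^2 = 1" using w3 by (simp add: power3_eq_cube power2_eq_square mult.assoc)
    moreover have "w \<noteq> 0" by (simp add: w_def)
    ultimately show ?thesis by (metis mult_left_cancel)
  qed
  define p0 p1 p2 where "p0 = P 0" and "p1 = P (1/3)" and "p2 = P (2/3)"
  define c0 c1 c2 where "c0 = (p0 + p1 + p2) / 3" and "c1 = (p0 + w^2 * p1 + w * p2) / 3" and "c2 = (p0 + w * p1 + w^2 * p2) / 3"
  define T where "T = (\<lambda>z. P z - (c0 + c1 * exp (2 * pi * \<i> * z) + c2 * exp (- (2 * pi * \<i> * z))))"
  have Tper: "T (z + 1) = T z" for z
    by (simp add: T_def per distrib_left exp_add exp_diff exp_minus)
  have Tper': "T (z + of_int n) = T z" for z n
    using Tper by (rule periodic_add_of_int)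
  have holT: "T holomorphic_on UNIV" unfolding T_def by (intro holomorphic_intros P)
  have T0: "T 0 = 0"
  proof -
    have "c0 + c1 + c2 = p0 + (p1 + p2) * (1 + w + w^2) / 3" by (simp add: c0_def c1_def c2_def field_simps)
    then show ?thesis using w2 by (simp add: T_def p0_def)
  qed
  have w2': "1 + (w + w^2) = 0" using w2 by (simp add: add.assoc)
  have w4: "w ^ 4 = w" using w3 by (simp add: power4_eq_xxxx power3_eq_cube)
  have T1: "T (1/3) = 0"
  proof -
    have "c0 + c1 * w + c2 * w^2 = (p0 * (1 + w + w^2) + p1 * (1 + w^3 + w^3) + p2 * (1 + w^2 + w^4)) / 3"
      by (simp add: c0_def c1_def c2_def field_simps power2_eq_square power3_eq_cube power4_eq_xxxx)
    also have "\<dots> = p1" using w2 w2' w3 w4 by (simp add: add.commute add.left_commute)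
    finally show ?thesis using wm by (simp add: T_def p1_def w_def)
  qed
  have T2: "T (2/3) = 0"
  proof -
    have e1: "exp (2 * pi * \<i> * (2/3)) = w^2" unfolding w_def by (simp add: exp_of_nat_mult[symmetric] exp_double[symmetric])
    have e2: "exp (- (2 * pi * \<i> * (2/3))) = w"
    proof -
      have "exp (- (2 * pi * \<i> * (2/3))) = exp (- (2 * pi * \<i> / 3)) ^ 2" by (simp add: exp_of_nat_mult[symmetric] exp_double[symmetric])
      also have "\<dots> = w ^ 4" unfolding wm by (simp add: power_mult[symmetric])
      finally show ?thesis using w4 by simp
    qed
    have "c0 + c1 * w^2 + c2 * w = (p0 * (1 + w + w^2) + p1 * (1 + w^2 + w^4) + p2 * (1 + w^3 + w^3)) / 3"
      by (simp add: c0_def c1_def c2_def field_simps power2_eq_square power3_eq_cube power4_eq_xxxx)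
    also have "\<dots> = p2" using w2 w2' w3 w4 by (simp add: add.commute add.left_commute)
    finally show ?thesis using e1 e2 by (simp add: T_def p2_def)
  qed
  have zeros: "T (of_int n / 3) = 0" for n :: int
  proof -
    have n: "of_int n / 3 = of_int (n mod 3) / 3 + (of_int (n div 3) :: complex)"
      by (metis (no_types) add.commute mult_div_mod_eq of_int_add of_int_mult of_int_numeral add_divide_distrib nonzero_mult_div_cancel_left zero_neq_numeral)
    consider "n mod 3 = 0" | "n mod 3 = 1" | "n mod 3 = 2" by linarith
    then show ?thesis unfolding n Tper' by cases (simp_all add: T0 T1 T2)
  qed
  have "(\<lambda>z. T (z / 3)) holomorphic_on UNIV" by (intro entire_compose[OF holT] holomorphic_intros) auto
  then obtain R where R: "R holomorphic_on UNIV" "\<And>z. T (z / 3) = R z * sin (of_real pi * z)"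
    using entire_divide_sin_pi[of "\<lambda>z. T (z / 3)"] zeros by metis
  have perR: "cmod (R (z + of_int (3 * n))) = cmod (R z)" if "z \<notin> \<int>" for z n
  proof -
    have s: "cmod (sin (of_real pi * (z + of_int (3 * n)))) = cmod (sin (of_real pi * z))"
    proof -
      have "sin (pi * (Re z + of_int (3 * n)))^2 = sin (pi * Re z)^2"
      proof -
        have "sin (pi * of_int (3 * n)) = 0" using sin_zero_iff_int2 by (metis mult.commute)
        moreover have "cos (pi * of_int (3 * n)) ^ 2 = 1" using calculation by (simp add: cos_squared_eq)
        ultimately show ?thesis by (simp add: distrib_left sin_add power_mult_distrib)
      qed
      then have "(cmod (sin (of_real pi * (z + of_int (3 * n)))))^2 = (cmod (sin (of_real pi * z)))^2"
        by (simp add: norm_sin_cos_squared)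
      then show ?thesis by simp
    qed
    have "T ((z + of_int (3 * n)) / 3) = T (z / 3)" using Tper'[of "z / 3" n] by (simp add: add_divide_distrib)
    then have "R (z + of_int (3 * n)) * sin (of_real pi * (z + of_int (3 * n))) = R z * sin (of_real pi * z)"
      unfolding R(2) .
    then have "cmod (R (z + of_int (3 * n))) * cmod (sin (of_real pi * z)) = cmod (R z) * cmod (sin (of_real pi * z))"
      by (metis norm_mult s)
    moreover have "sin (of_real pi * z) \<noteq> 0" using that sin_pi_complex_eq_0_iff by blast
    ultimately show ?thesis by simp
  qed
  (* T carries the growth both of P and of exp(2 pi i z). *)
  define b where "b = max a (2 * pi)"
  have b: "b < 3 * pi" "a \<le> b" "2 * pi \<le> b" "b \<ge> 0" using a by (auto simp: b_def)
  define C' where "C' = C + cmod c0 + cmod c1 + cmod c2"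
  have Tb: "cmod (T z) \<le> C' * exp (b * \<bar>Im z\<bar>)" for z
  proof -
    have "exp (a * \<bar>Im z\<bar>) \<le> exp (b * \<bar>Im z\<bar>)" using b by (simp add: mult_right_mono)
    then have 1: "cmod (P z) \<le> C * exp (b * \<bar>Im z\<bar>)" using bound[of z] C by (meson mult_left_mono order_trans)
    have E: "exp (2 * pi * \<bar>Im z\<bar>) \<le> exp (b * \<bar>Im z\<bar>)" using b by (simp add: mult_right_mono)
    have 2: "cmod (exp (2 * pi * \<i> * z)) \<le> exp (b * \<bar>Im z\<bar>)" "cmod (exp (- (2 * pi * \<i> * z))) \<le> exp (b * \<bar>Im z\<bar>)"
    proof -
      have "2 * pi * (- Im z) \<le> 2 * pi * \<bar>Im z\<bar>" "2 * pi * Im z \<le> 2 * pi * \<bar>Im z\<bar>"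
        by (intro mult_left_mono; simp)+
      then show "cmod (exp (2 * pi * \<i> * z)) \<le> exp (b * \<bar>Im z\<bar>)" "cmod (exp (- (2 * pi * \<i> * z))) \<le> exp (b * \<bar>Im z\<bar>)"
        by (intro order_trans[OF _ E]; simp add: norm_exp_eq_Re)+
    qed
    have 3: "1 \<le> exp (b * \<bar>Im z\<bar>)" using b by simp
    have "cmod (T z) \<le> cmod (P z) + (cmod c0 * 1 + cmod c1 * cmod (exp (2 * pi * \<i> * z)) + cmod c2 * cmod (exp (- (2 * pi * \<i> * z))))"
      unfolding T_def by (simp only: norm_mult[symmetric] mult_1_right) (meson add_mono norm_triangle_ineq norm_triangle_ineq4 order_refl order_trans)
    also have "\<dots> \<le> C * exp (b * \<bar>Im z\<bar>) + (cmod c0 * exp (b * \<bar>Im z\<bar>) + cmod c1 * exp (b * \<bar>Im z\<bar>) + cmod c2 * exp (b * \<bar>Im z\<bar>))"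
      by (intro add_mono mult_left_mono 1 2 3) auto
    finally show ?thesis by (simp add: C'_def algebra_simps)
  qed
  have C'0: "C' \<ge> 0" using C by (simp add: C'_def)
  have Rdecay: "cmod (R z) \<le> 4 * C' * exp ((b / 3 - pi) * \<bar>Im z\<bar>)" if y: "\<bar>Im z\<bar> \<ge> 1" for z
  proof -
    have "\<bar>Im (of_real pi * z)\<bar> = pi * \<bar>Im z\<bar>" by (simp add: abs_mult)
    moreover have "1 * 1 \<le> pi * \<bar>Im z\<bar>" using y pi_gt3 by (intro mult_mono) auto
    ultimately have "cmod (sin (of_real pi * z)) \<ge> exp (pi * \<bar>Im z\<bar>) / 4"
      using norm_sin_ge_sinh[of "of_real pi * z"] abs_sinh_ge_exp[of "Im (of_real pi * z)"] by simp
    then have "cmod (R z) * (exp (pi * \<bar>Im z\<bar>) / 4) \<le> cmod (T (z / 3))"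
      unfolding R(2) norm_mult by (intro mult_left_mono) auto
    also have "\<dots> \<le> C' * exp (b / 3 * \<bar>Im z\<bar>)" using Tb[of "z / 3"] by simp
    finally have "cmod (R z) \<le> 4 * (C' * exp (b / 3 * \<bar>Im z\<bar>)) / exp (pi * \<bar>Im z\<bar>)"
      by (simp add: field_simps)
    also have "\<dots> = 4 * C' * exp ((b / 3 - pi) * \<bar>Im z\<bar>)" by (simp add: left_diff_distrib exp_diff)
    finally show ?thesis .
  qed
  have contR: "continuous_on UNIV R" by (rule holomorphic_on_imp_continuous_on[OF R(1)])
  have "bounded (R ` cbox (Complex 0 (-1)) (Complex 3 1))"
    by (intro compact_imp_bounded compact_continuous_image continuous_on_subset[OF contR]) auto
  then obtain B where B: "\<And>z. z \<in> cbox (Complex 0 (-1)) (Complex 3 1) \<Longrightarrow> cmod (R z) \<le> B"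
    by (auto simp: bounded_iff)
  define B' where "B' = max B (4 * C')"
  have RB: "cmod (R z) \<le> B'" if "z \<notin> \<int>" for z
  proof (cases "\<bar>Im z\<bar> \<ge> 1")
    case True
    have "(b / 3 - pi) * \<bar>Im z\<bar> \<le> 0" using b by (intro mult_nonpos_nonneg) auto
    then have "4 * C' * exp ((b / 3 - pi) * \<bar>Im z\<bar>) \<le> 4 * C' * 1"
      using C'0 by (intro mult_left_mono) auto
    then show ?thesis using Rdecay[OF True] by (simp add: B'_def)
  next
    case False
    define n where "n = \<lfloor>Re z / 3\<rfloor>"
    have n: "of_int n \<le> Re z / 3" "Re z / 3 < of_int n + 1" unfolding n_def by linarith+
    have "cmod (R z) = cmod (R (z + of_int (3 * (- n))))" using perR[OF that, of "- n"] by simp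
    also have "\<dots> \<le> B" using n False by (intro B) (auto simp: in_cbox_complex_iff)
    finally show ?thesis by (simp add: B'_def)
  qed
  have RB': "cmod (R z) \<le> B'" for z
  proof (cases "z \<in> \<int>")
    case True
    have "((\<lambda>s::real. cmod (R (z + \<i> * of_real s))) \<longlongrightarrow> cmod (R (z + \<i> * of_real 0))) (at_right 0)"
    proof (intro tendsto_norm)
      have "continuous_on UNIV (\<lambda>s::real. R (z + \<i> * of_real s))"
        by (intro continuous_on_compose2[OF contR] continuous_intros) auto
      then have "isCont (\<lambda>s::real. R (z + \<i> * of_real s)) 0" by (simp add: continuous_on_eq_continuous_at)
      then show "((\<lambda>s::real. R (z + \<i> * of_real s)) \<longlongrightarrow> R (z + \<i> * of_real 0)) (at_right 0)"
        unfolding isCont_def by (rule filterlim_at_split[THEN iffD1, THEN conjunct2])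
    qed
    moreover have "eventually (\<lambda>s::real. cmod (R (z + \<i> * of_real s)) \<le> B') (at_right 0)"
      using eventually_at_right_less[of "0::real"]
    proof eventually_elim
      case (elim s)
      have "Im z = 0" using True by (auto simp: Ints_def)
      then have "z + \<i> * of_real s \<notin> \<int>" using elim by (auto simp: Ints_def complex_eq_iff)
      then show ?case by (rule RB)
    qed
    ultimately have "cmod (R (z + \<i> * of_real 0)) \<le> B'" by (rule tendsto_upperbound) auto
    then show ?thesis by simp
  qed (rule RB)
  have "bounded (range R)" using RB' by (auto simp: bounded_iff)
  then obtain c where c: "\<And>z. R z = c"
    using Liouville_theorem[OF R(1)] by (auto simp: constant_on_def)
  have "c = 0"
  proof -
    have "((\<lambda>y. 4 * C' * exp ((b / 3 - pi) * y)) \<longlongrightarrow> 0) at_top"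
    proof -
      have "filterlim (\<lambda>y. (b / 3 - pi) * y) at_bot at_top"
        using b by (intro filterlim_tendsto_neg_mult_at_bot[OF tendsto_const _ filterlim_ident]) auto
      then have "((\<lambda>y. exp ((b / 3 - pi) * y)) \<longlongrightarrow> 0) at_top"
        by (rule filterlim_compose[OF exp_at_bot])
      from tendsto_mult_left[OF this, of "4 * C'"] show ?thesis by simp
    qed
    moreover have "eventually (\<lambda>y. cmod c \<le> 4 * C' * exp ((b / 3 - pi) * y)) at_top"
      using eventually_ge_at_top[of "1::real"]
    proof eventually_elim
      case (elim y)
      then show ?case using Rdecay[of "\<i> * of_real y"] by (simp add: c)
    qed
    ultimately have "cmod c \<le> 0" by (rule tendsto_lowerbound) auto
    then show ?thesis by simp
  qed
  then have "T (z / 3) = 0" for z using R(2) c by simp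
  then have "T z = 0" for z by (metis nonzero_mult_div_cancel_left times_divide_eq_right zero_neq_numeral)
  then have "P z = c0 + c1 * exp (2 * pi * \<i> * z) + c2 * exp (- (2 * pi * \<i> * z))" for z
    unfolding T_def by (metis eq_iff_diff_eq_0)
  then show thesis by (rule that)
qed

section \<open>Periodization of decaying entire functions\<close>

lemma inverse_square_summable_on_int: "(\<lambda>k::int. 1 / (1 + (real_of_int k)^2)) summable_on UNIV"
proof -
  have s: "summable (\<lambda>n. norm (1 / (1 + (real n)^2)))"
  proof (rule summable_comparison_test_ev)
    show "eventually (\<lambda>n. norm (norm (1 / (1 + (real n)^2))) \<le> 1 / (real n)^2) sequentially"
      using eventually_gt_at_top[of "0::nat"] by eventually_elim (auto intro!: frac_le)
    show "summable (\<lambda>n. 1 / (real n)^2)" using inverse_power_summable[of 2] by (simp add: inverse_eq_divide)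
  qed
  have n: "(\<lambda>n::nat. 1 / (1 + (real n)^2)) summable_on UNIV"
    by (rule norm_summable_imp_summable_on[OF s])
  have "(\<lambda>k::int. 1 / (1 + (real_of_int k)^2)) summable_on range int"
    using n by (subst summable_on_reindex) (auto simp: o_def)
  moreover have "(\<lambda>k::int. 1 / (1 + (real_of_int k)^2)) summable_on range (\<lambda>n. - int n)"
    using n by (subst summable_on_reindex) (auto simp: o_def inj_on_def)
  ultimately have "(\<lambda>k::int. 1 / (1 + (real_of_int k)^2)) summable_on (range int \<union> range (\<lambda>n. - int n))"
    by (rule summable_on_union)
  moreover have "range int \<union> range (\<lambda>n. - int n) = UNIV"
  proof -
    have "k \<in> range int \<union> range (\<lambda>n. - int n)" for k :: int
      by (cases k rule: int_cases2) auto
    then show ?thesis by blast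
  qed
  ultimately show ?thesis by simp
qed

lemma integrable_inverse_1_plus_square_lborel: "integrable lborel (\<lambda>x::real. 1 / (1 + x^2))"
  using integrable_inverse_1_plus_square by (simp add: set_integrable_def inverse_eq_divide)

lemma one_plus_square_translate_le:
  fixes x :: real
  assumes "\<bar>x\<bar> \<le> R"
  shows "1 / (1 + (x + k)^2) \<le> (2 + 2 * R^2) * (1 / (1 + k^2))"
proof -
  have "x^2 \<le> R^2" using assms by (metis abs_ge_zero power2_abs power_mono)
  moreover have "k^2 \<le> 2 * (x + k)^2 + 2 * x^2"
  proof -
    have "2 * (x + k)^2 + 2 * x^2 - k^2 = (2 * x + k)^2" by (simp add: power2_eq_square algebra_simps)
    then show ?thesis by (metis diff_ge_0_iff_ge zero_le_power2)
  qed
  moreover have "0 \<le> R^2 * (x + k)^2" by simp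
  moreover have "(2 + 2 * R^2) * (1 + (x + k)^2) = 2 + 2 * (x + k)^2 + 2 * R^2 + 2 * (R^2 * (x + k)^2)"
    by (simp add: algebra_simps)
  ultimately have "1 + k^2 \<le> (2 + 2 * R^2) * (1 + (x + k)^2)" using zero_le_power2[of "x+k"] by linarith
  moreover have "1 + k^2 > 0" "1 + (x + k)^2 > 0" by (auto intro: add_pos_nonneg)
  ultimately show ?thesis by (simp add: divide_simps mult.commute)
qed

text \<open>Integrating the periodization over one period unfolds to an integral over a long symmetric interval.\<close>

lemma sum_unit_interval_integrals:
  fixes f :: "real \<Rightarrow> complex"
  assumes f: "continuous_on UNIV f"
  shows "(\<Sum>k\<in>{- int N..<int N}. integral {0..1} (\<lambda>x. f (x + of_int k))) = integral {- real N..real N} f"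
proof -
  have int: "f integrable_on {a..b}" for a b
    by (intro integrable_continuous_interval continuous_on_subset[OF f]) auto
  have sh: "integral {0..1} (\<lambda>x. f (x + of_int k)) = integral {of_int k..of_int k + 1} f" for k
    using integral_shift_Icc_real[of 0 1 f "of_int k"] by (simp add: o_def add.commute)
  have "(\<Sum>k\<in>{- int N..<int N}. integral {of_int k..of_int k + 1} f) = integral {- real N..real N} f"
  proof (induction N)
    case (Suc N)
    have "{- int (Suc N)..<int (Suc N)} = insert (- int (Suc N)) (insert (int N) {- int N..<int N})" by auto
    then have "(\<Sum>k\<in>{- int (Suc N)..<int (Suc N)}. integral {of_int k..of_int k + 1} f)
      = integral {- real (Suc N)..- real N} f + (integral {real N..real (Suc N)} f + integral {- real N..real N} f)"
      using Suc.IH by (simp add: add.commute)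
    also have "\<dots> = integral {- real (Suc N)..- real N} f + integral {- real N..real (Suc N)} f"
      using Henstock_Kurzweil_Integration.integral_combine[OF _ _ int, of "- real N" "real N" "real (Suc N)"] by (simp add: add.commute)
    also have "\<dots> = integral {- real (Suc N)..real (Suc N)} f"
      using Henstock_Kurzweil_Integration.integral_combine[OF _ _ int, of "- real (Suc N)" "- real N" "real (Suc N)"] by simp
    finally show ?case .
  qed simp
  then show ?thesis by (simp add: sh)
qed

lemma integral_symmetric_intervals_tendsto:
  fixes f :: "real \<Rightarrow> complex"
  assumes f: "integrable lborel f" and c: "continuous_on UNIV f"
  shows "(\<lambda>N. integral {- real N..real N} f) \<longlonglongrightarrow> (\<integral>x. f x \<partial>lborel)"
proof -
  have "(\<lambda>N. \<integral>x. indicator {- real N..real N} x *\<^sub>R f x \<partial>lborel) \<longlonglongrightarrow> (\<integral>x. f x \<partial>lborel)"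
  proof (rule integral_dominated_convergence[where w="\<lambda>x. norm (f x)"])
    show "AE x in lborel. (\<lambda>N. indicator {- real N..real N} x *\<^sub>R f x) \<longlonglongrightarrow> f x"
    proof (rule AE_I2)
      fix x :: real
      obtain n where n: "real n > \<bar>x\<bar>" using reals_Archimedean2 by blast
      have "eventually (\<lambda>N. indicator {- real N..real N} x *\<^sub>R f x = f x) sequentially"
        using eventually_ge_at_top[of n] by eventually_elim (use n in \<open>auto simp: indicator_def\<close>)
      then show "(\<lambda>N. indicator {- real N..real N} x *\<^sub>R f x) \<longlonglongrightarrow> f x" by (rule tendsto_eventually)
    qed
  qed (use f in \<open>auto simp: indicator_def\<close>)
  moreover have "(\<integral>x. indicator {- real N..real N} x *\<^sub>R f x \<partial>lborel) = integral {- real N..real N} f" for N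
    using set_borel_integral_eq_integral(2)[OF borel_integrable_atLeastAtMost'[OF continuous_on_subset[OF c]], of "- real N" "real N"]
    by (simp add: set_lebesgue_integral_def)
  ultimately show ?thesis by simp
qed

lemma filterlim_symmetric_int_intervals: "filterlim (\<lambda>N. {- int N..<int N}) (finite_subsets_at_top UNIV) sequentially"
  unfolding filterlim_finite_subsets_at_top
proof (intro allI impI)
  fix X :: "int set" assume X: "finite X \<and> X \<subseteq> UNIV"
  then obtain B where B: "\<And>k. k \<in> X \<Longrightarrow> \<bar>k\<bar> \<le> B" by (metis finite_int_iff_bounded_le subset_eq lessThan_iff abs_le_iff bdd_above_def finite_imageI bdd_above_finite image_eqI)
  show "\<forall>\<^sub>F N in sequentially. finite {- int N..<int N} \<and> X \<subseteq> {- int N..<int N} \<and> {- int N..<int N} \<subseteq> UNIV"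
    using eventually_gt_at_top[of "nat B"]
  proof eventually_elim
    case (elim N)
    have "k \<in> {- int N..<int N}" if "k \<in> X" for k using B[OF that] elim by auto
    then show ?case by auto
  qed
qed

lemma periodization_integral:
  fixes f :: "real \<Rightarrow> complex"
  assumes c: "continuous_on UNIV f" and b: "\<And>x. cmod (f x) \<le> C / (1 + x^2)"
  shows "integrable lborel f"
    and "((\<lambda>x. \<Sum>\<^sub>\<infinity>k::int. f (x + of_int k)) has_integral (\<integral>x. f x \<partial>lborel)) {0..1}"
proof -
  have C: "C \<ge> 0" using b[of 0] norm_ge_zero[of "f 0"] by (simp del: norm_ge_zero)
  have [measurable]: "f \<in> borel_measurable borel" using c by (rule borel_measurable_continuous_onI)
  show int: "integrable lborel f"
  proof (rule Bochner_Integration.integrable_bound)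
    show "integrable lborel (\<lambda>x. C * (1 / (1 + x^2)))" by (intro integrable_mult_right integrable_inverse_1_plus_square_lborel)
    show "AE x in lborel. norm (f x) \<le> norm (C * (1 / (1 + x\<^sup>2)))" using b C by auto
  qed measurable
  have M: "cmod (f (x + of_int k)) \<le> C * (4 * (1 / (1 + (real_of_int k)^2)))" if "x \<in> {0..1}" for x k
  proof -
    have "cmod (f (x + of_int k)) \<le> C * (1 / (1 + (x + of_int k)^2))" using b[of "x + of_int k"] by simp
    also have "\<dots> \<le> C * ((2 + 2 * 1^2) * (1 / (1 + (real_of_int k)^2)))"
      using that C by (intro mult_left_mono one_plus_square_translate_le) auto
    finally show ?thesis by simp
  qed
  have "(\<lambda>k::int. C * (4 * (1 / (1 + (real_of_int k)^2)))) summable_on UNIV"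
    by (intro summable_on_cmult_right inverse_square_summable_on_int)
  then have ul: "uniform_limit {0..1} (\<lambda>X x. \<Sum>k\<in>X. f (x + of_int k)) (\<lambda>x. \<Sum>\<^sub>\<infinity>k. f (x + of_int k)) (finite_subsets_at_top UNIV)"
    by (rule Weierstrass_m_test_general[rotated]) (rule M)
  have cc: "continuous_on S (\<lambda>x. f (x + of_int k))" for S k
    by (intro continuous_on_compose2[OF c] continuous_intros) auto
  from ul obtain I J where IJ: "\<And>X. ((\<lambda>x. \<Sum>k\<in>X. f (x + of_int k)) has_integral I X) {0..1}"
      "((\<lambda>x. \<Sum>\<^sub>\<infinity>k. f (x + of_int k)) has_integral J) {0..1}" "(I \<longlongrightarrow> J) (finite_subsets_at_top UNIV)"
    by (rule uniform_limit_integral) (auto intro!: continuous_intros cc)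
  have "(\<lambda>N. I {- int N..<int N}) \<longlonglongrightarrow> J"
    using IJ(3) filterlim_symmetric_int_intervals by (rule filterlim_compose)
  moreover have "I {- int N..<int N} = integral {- real N..real N} f" for N
  proof -
    have "I {- int N..<int N} = integral {0..1} (\<lambda>x. \<Sum>k\<in>{- int N..<int N}. f (x + of_int k))"
      using IJ(1) by (rule integral_unique[symmetric])
    also have "\<dots> = (\<Sum>k\<in>{- int N..<int N}. integral {0..1} (\<lambda>x. f (x + of_int k)))"
      by (intro integral_sum integrable_continuous_interval cc) auto
    finally show ?thesis using sum_unit_interval_integrals[OF c] by simp
  qed
  ultimately have "J = (\<integral>x. f x \<partial>lborel)"
    using integral_symmetric_intervals_tendsto[OF int c] LIMSEQ_unique by auto
  then show "((\<lambda>x. \<Sum>\<^sub>\<infinity>k::int. f (x + of_int k)) has_integral (\<integral>x. f x \<partial>lborel)) {0..1}" using IJ(2) by simp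
qed

lemma integral_exp_period:
  assumes "m \<noteq> (0::int)"
  shows "((\<lambda>x::real. exp (2 * pi * \<i> * of_int m * of_real x)) has_integral 0) {0..1}"
proof -
  define c where "c = 2 * pi * \<i> * of_int m"
  have c0: "c \<noteq> 0" using assms by (simp add: c_def)
  have "((\<lambda>x. exp (c * of_real x)) has_integral (exp (c * of_real 1) / c - exp (c * of_real 0) / c)) {0..1}"
  proof (rule fundamental_theorem_of_calculus)
    fix x :: real
    have "((\<lambda>z. exp (c * z) / c) has_field_derivative exp (c * of_real x)) (at (of_real x))"
      using c0 by (auto intro!: derivative_eq_intros)
    then show "((\<lambda>x. exp (c * of_real x) / c) has_vector_derivative exp (c * of_real x)) (at x within {0..1})"
      by (rule has_vector_derivative_real_field[where f="\<lambda>z. exp (c * z) / c"])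
  qed simp
  moreover have "exp (c * of_real 1) = 1"
  proof -
    have "c * of_real 1 = of_int (2 * m) * of_real pi * \<i>" by (simp add: c_def)
    then show ?thesis by (auto simp: exp_eq_1)
  qed
  ultimately show ?thesis by (simp add: c_def)
qed

text \<open>The periodization P of E is 1-periodic and entire, and it inherits the growth exp(a |Im z|), so it is a
trigonometric polynomial of degree 1. Its coefficients are found by integrating over a period and unfolding. If
a < 2\<pi>, then P grows more slowly than exp(2\<pi> |Im z|), which kills the two nonconstant terms.\<close>

lemma periodization_decaying:
  assumes E: "E holomorphic_on UNIV"
    and bound: "\<And>z. cmod (E z) \<le> C * exp (a * \<bar>Im z\<bar>) / (1 + (Re z)^2)" and a: "0 \<le> a" "a < 3 * pi"
  defines "h \<equiv> \<lambda>j::int. (\<integral>x. E (of_real x) * exp (2 * pi * \<i> * of_int j * of_real x) \<partial>lborel)"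
  shows "(\<Sum>\<^sub>\<infinity>k::int. E (z + of_int k)) = h 0 + h (-1) * exp (2 * pi * \<i> * z) + h 1 * exp (- (2 * pi * \<i> * z))"
    and "a < 2 * pi \<Longrightarrow> h 1 = 0" and "a < 2 * pi \<Longrightarrow> h (-1) = 0"
proof -
  have C: "C \<ge> 0" using bound[of 0] norm_ge_zero[of "E 0"] by (simp del: norm_ge_zero)
  define P where "P = (\<lambda>z. \<Sum>\<^sub>\<infinity>k::int. E (z + of_int k))"
  have contE: "continuous_on UNIV E" by (rule holomorphic_on_imp_continuous_on[OF E])
  have M: "cmod (E (z + of_int k)) \<le> (C * exp (a * \<bar>Im z\<bar>)) * ((2 + 2 * R^2) * (1 / (1 + (real_of_int k)^2)))"
    if "\<bar>Re z\<bar> \<le> R" for z k R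
  proof -
    have "cmod (E (z + of_int k)) \<le> (C * exp (a * \<bar>Im z\<bar>)) * (1 / (1 + (Re z + of_int k)^2))"
      using bound[of "z + of_int k"] by simp
    also have "\<dots> \<le> (C * exp (a * \<bar>Im z\<bar>)) * ((2 + 2 * R^2) * (1 / (1 + (real_of_int k)^2)))"
      using that C by (intro mult_left_mono one_plus_square_translate_le) auto
    finally show ?thesis .
  qed
  have sm: "(\<lambda>k::int. c * (d * (1 / (1 + (real_of_int k)^2)))) summable_on UNIV" for c d
    by (intro summable_on_cmult_right inverse_square_summable_on_int)
  have holP: "P holomorphic_on UNIV"
  proof -
    have "P holomorphic_on ball 0 R" for R
    proof -
      have ul: "uniform_limit (cball 0 R) (\<lambda>X z. \<Sum>k\<in>X. E (z + of_int k)) (\<lambda>z. \<Sum>\<^sub>\<infinity>k. E (z + of_int k)) (finite_subsets_at_top UNIV)"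
      proof (rule Weierstrass_m_test_general[OF _ sm[of "C * exp (a * R)" "2 + 2 * R^2"]])
        fix k z assume z: "z \<in> cball (0::complex) R"
        then have R: "\<bar>Re z\<bar> \<le> R" "\<bar>Im z\<bar> \<le> R" using abs_Re_le_cmod[of z] abs_Im_le_cmod[of z] by auto
        have "cmod (E (z + of_int k)) \<le> (C * exp (a * \<bar>Im z\<bar>)) * ((2 + 2 * R^2) * (1 / (1 + (real_of_int k)^2)))"
          by (rule M[OF R(1)])
        also have "\<dots> \<le> (C * exp (a * R)) * ((2 + 2 * R^2) * (1 / (1 + (real_of_int k)^2)))"
          using C R a by (intro mult_right_mono mult_left_mono) (auto intro: mult_left_mono)
        finally show "cmod (E (z + of_int k)) \<le> (C * exp (a * R)) * ((2 + 2 * R^2) * (1 / (1 + (real_of_int k)^2)))" .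
      qed
      have ev: "eventually (\<lambda>X. continuous_on (cball 0 R) (\<lambda>z. \<Sum>k\<in>X. E (z + of_int k)) \<and> (\<lambda>z. \<Sum>k\<in>X. E (z + of_int k)) holomorphic_on ball 0 R) (finite_subsets_at_top (UNIV :: int set))"
      proof (intro always_eventually allI)
        fix X :: "int set"
        have "(\<lambda>z. \<Sum>k\<in>X. E (z + of_int k)) holomorphic_on UNIV"
          by (intro holomorphic_on_sum entire_compose[OF E] holomorphic_intros)
        then show "continuous_on (cball 0 R) (\<lambda>z. \<Sum>k\<in>X. E (z + of_int k)) \<and> (\<lambda>z. \<Sum>k\<in>X. E (z + of_int k)) holomorphic_on ball 0 R"
          by (intro conjI holomorphic_on_imp_continuous_on) (erule holomorphic_on_subset; simp)+
      qed
      show ?thesis unfolding P_def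
        by (rule holomorphic_uniform_limit[OF ev ul]) simp_all
    qed
    then have "P field_differentiable at z" for z
      using holomorphic_on_imp_differentiable_at[of P "ball 0 (cmod z + 1)" z] by simp
    then show ?thesis by (simp add: holomorphic_on_def field_differentiable_at_within)
  qed
  have per: "P (z + 1) = P z" for z
  proof -
    have "bij_betw (\<lambda>k::int. k + 1) UNIV UNIV" by (rule bij_betwI[of _ _ _ "\<lambda>k. k - 1"]) auto
    from infsum_reindex_bij_betw[OF this, of "\<lambda>k. E (z + of_int k)"]
    show ?thesis by (simp add: P_def add_ac)
  qed
  have per': "P (z + of_int n) = P z" for z n
    using per by (rule periodic_add_of_int)
  define S where "S = (\<Sum>\<^sub>\<infinity>k::int. C * (4 * (1 / (1 + (real_of_int k)^2))))"
  have Pb: "cmod (P z) \<le> S * exp (a * \<bar>Im z\<bar>)" for z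
  proof -
    define w where "w = z + of_int (- \<lfloor>Re z\<rfloor>)"
    have w: "\<bar>Re w\<bar> \<le> 1" "Im w = Im z" unfolding w_def by (simp; linarith)+
    have "((\<lambda>k. E (w + of_int k)) has_sum P w) UNIV"
    proof -
      have "(\<lambda>k. cmod (E (w + of_int k))) summable_on UNIV"
        by (rule summable_on_comparison_test[OF sm[of "C * exp (a * \<bar>Im w\<bar>)" "2 + 2 * 1^2"]]) (rule M[OF w(1)], simp)
      then have "(\<lambda>k. E (w + of_int k)) summable_on UNIV" by (rule abs_summable_summable)
      then show ?thesis unfolding P_def by (rule has_sum_infsum)
    qed
    moreover have "((\<lambda>k::int. (C * (4 * (1 / (1 + (real_of_int k)^2)))) * exp (a * \<bar>Im w\<bar>)) has_sum (S * exp (a * \<bar>Im w\<bar>))) UNIV"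
      unfolding S_def by (intro has_sum_cmult_left has_sum_infsum sm)
    ultimately have "cmod (P w) \<le> S * exp (a * \<bar>Im w\<bar>)"
    proof (rule norm_infsum_le)
      show "cmod (E (w + of_int k)) \<le> C * (4 * (1 / (1 + (real_of_int k)\<^sup>2))) * exp (a * \<bar>Im w\<bar>)" for k
        using M[OF w(1), of k] by (simp add: mult_ac)
    qed
    then show ?thesis using per'[of z "- \<lfloor>Re z\<rfloor>"] w by (simp add: w_def)
  qed
  obtain c0 c1 c2 where c: "\<And>z. P z = c0 + c1 * exp (2 * pi * \<i> * z) + c2 * exp (- (2 * pi * \<i> * z))"
    using periodic_entire_trig_polynomial[OF holP per Pb a] by metis
  have e: "exp (2 * pi * \<i> * of_int j * (z + of_int k)) = exp (2 * pi * \<i> * of_int j * z)" for z j k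
  proof -
    have "exp (2 * pi * \<i> * of_int j * (z + of_int k)) = exp (2 * pi * \<i> * of_int j * z) * exp (of_int (2 * (j * k)) * of_real pi * \<i>)"
      by (simp add: exp_add[symmetric] algebra_simps)
    also have "exp (of_int (2 * (j * k)) * of_real pi * \<i>) = 1"
      unfolding exp_eq_1 by (intro conjI exI[of _ "j * k"]) auto
    finally show ?thesis by simp
  qed
  have hP: "((\<lambda>x. P (of_real x) * exp (2 * pi * \<i> * of_int j * of_real x)) has_integral h j) {0..1}" for j
  proof -
    define f where "f = (\<lambda>x::real. E (of_real x) * exp (2 * pi * \<i> * of_int j * of_real x))"
    have cf: "continuous_on UNIV f" unfolding f_def
      by (intro continuous_intros continuous_on_compose2[OF contE]) auto
    have bf: "cmod (f x) \<le> C / (1 + x^2)" for x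
      using bound[of "of_real x"] by (simp add: f_def norm_mult norm_exp_eq_Re)
    have "((\<lambda>x. \<Sum>\<^sub>\<infinity>k::int. f (x + of_int k)) has_integral h j) {0..1}"
      unfolding h_def f_def[symmetric] using periodization_integral(2)[OF cf bf] by (simp add: f_def)
    moreover have "(\<Sum>\<^sub>\<infinity>k::int. f (x + of_int k)) = P (of_real x) * exp (2 * pi * \<i> * of_int j * of_real x)" for x
    proof -
      have "(\<Sum>\<^sub>\<infinity>k::int. f (x + of_int k)) = (\<Sum>\<^sub>\<infinity>k::int. E (of_real x + of_int k) * exp (2 * pi * \<i> * of_int j * of_real x))"
        using e[of j "of_real x"] by (simp add: f_def)
      also have "\<dots> = P (of_real x) * exp (2 * pi * \<i> * of_int j * of_real x)" unfolding P_def by (rule infsum_cmult_left')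
      finally show ?thesis .
    qed
    ultimately show ?thesis by simp
  qed
  have J: "((\<lambda>x::real. b * exp (2 * pi * \<i> * of_int m * of_real x)) has_integral (if m = 0 then b else 0)) {0..1}" for m :: int and b
    using has_integral_mult_right[OF integral_exp_period[of m], of b] has_integral_const_real[of b 0 1] by (cases "m = 0") auto
  have coeff: "h j = (if j = 0 then c0 else 0) + (if j + 1 = 0 then c1 else 0) + (if j - 1 = 0 then c2 else 0)" for j
  proof (rule has_integral_unique[OF hP])
    have "((\<lambda>x::real. c0 * exp (2 * pi * \<i> * of_int j * of_real x) + c1 * exp (2 * pi * \<i> * of_int (j + 1) * of_real x) + c2 * exp (2 * pi * \<i> * of_int (j - 1) * of_real x))
       has_integral ((if j = 0 then c0 else 0) + (if j + 1 = 0 then c1 else 0) + (if j - 1 = 0 then c2 else 0))) {0..1}"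
      by (intro has_integral_add J)
    moreover have "c0 * exp (2 * pi * \<i> * of_int j * of_real x) + c1 * exp (2 * pi * \<i> * of_int (j + 1) * of_real x) + c2 * exp (2 * pi * \<i> * of_int (j - 1) * of_real x)
       = P (of_real x) * exp (2 * pi * \<i> * of_int j * of_real x)" for x :: real
      by (simp add: c distrib_right distrib_left left_diff_distrib right_diff_distrib exp_add exp_diff exp_minus field_simps)
    ultimately show "((\<lambda>x::real. P (of_real x) * exp (2 * pi * \<i> * of_int j * of_real x)) has_integral
       ((if j = 0 then c0 else 0) + (if j + 1 = 0 then c1 else 0) + (if j - 1 = 0 then c2 else 0))) {0..1}" by simp
  qed
  have hc: "h 0 = c0" "h 1 = c2" "h (-1) = c1" using coeff[of 0] coeff[of 1] coeff[of "-1"] by auto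
  show "(\<Sum>\<^sub>\<infinity>k::int. E (z + of_int k)) = h 0 + h (-1) * exp (2 * pi * \<i> * z) + h 1 * exp (- (2 * pi * \<i> * z))"
    using c[of z] unfolding hc P_def .
  have lim: "b = 0" if le: "\<And>y. y > 0 \<Longrightarrow> cmod b \<le> A * exp ((a - 2 * pi) * y) + B * exp (- 2 * pi * y)" and "a < 2 * pi" for b :: complex and A B
  proof -
    have t: "((\<lambda>y. exp (d * y)) \<longlongrightarrow> 0) at_top" if "d < 0" for d :: real
      by (rule filterlim_compose[OF exp_at_bot]) (intro filterlim_tendsto_neg_mult_at_bot[OF tendsto_const _ filterlim_ident] that)
    have "((\<lambda>y. A * exp ((a - 2 * pi) * y) + B * exp (- 2 * pi * y)) \<longlongrightarrow> A * 0 + B * 0) at_top"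
      by (intro tendsto_intros t) (use \<open>a < 2 * pi\<close> in auto)
    moreover have "eventually (\<lambda>y. cmod b \<le> A * exp ((a - 2 * pi) * y) + B * exp (- 2 * pi * y)) at_top"
      using eventually_gt_at_top[of 0] by eventually_elim (rule le)
    ultimately have "cmod b \<le> A * 0 + B * 0" by (rule tendsto_lowerbound) auto
    then show ?thesis by simp
  qed
  have key: "cmod b \<le> S * exp ((a - 2 * pi) * y) + (cmod c0 + cmod b') * exp (- 2 * pi * y)"
    if y: "y > 0" and eq: "p = c0 + b * of_real (exp (2 * pi * y)) + b' * of_real (exp (- (2 * pi * y)))" and p: "cmod p \<le> S * exp (a * y)" for b b' p and y :: real
  proof -
    have "cmod b * exp (2 * pi * y) = cmod (p - c0 - b' * of_real (exp (- (2 * pi * y))))"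
      using eq by (simp add: norm_mult)
    also have "\<dots> \<le> cmod p + cmod c0 + cmod (b' * of_real (exp (- (2 * pi * y))))"
      by (meson norm_triangle_ineq4 add_right_mono order_trans)
    also have "cmod (b' * of_real (exp (- (2 * pi * y)))) \<le> cmod b'"
      using y by (simp add: norm_mult mult_left_le)
    finally have "cmod b * exp (2 * pi * y) \<le> S * exp (a * y) + (cmod c0 + cmod b')" using p by simp
    then have "cmod b * exp (2 * pi * y) * exp (- 2 * pi * y) \<le> (S * exp (a * y) + (cmod c0 + cmod b')) * exp (- 2 * pi * y)"
      by (intro mult_right_mono) auto
    then show ?thesis by (simp add: mult.assoc exp_add[symmetric] algebra_simps)
  qed
  show "h 1 = 0" if "a < 2 * pi" unfolding hc
  proof (rule lim[OF key that])
    fix y :: real assume "y > 0"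
    then show "y > 0" .
    have e1: "2 * pi * \<i> * (\<i> * of_real y) = of_real (- (2 * pi * y))" by (simp add: mult.assoc[symmetric])
    then show "P (\<i> * of_real y) = c0 + c2 * of_real (exp (2 * pi * y)) + c1 * of_real (exp (- (2 * pi * y)))"
      unfolding c e1 of_real_minus[symmetric] minus_minus exp_of_real by (simp add: add_ac)
    show "cmod (P (\<i> * of_real y)) \<le> S * exp (a * y)" using Pb[of "\<i> * of_real y"] \<open>y > 0\<close> by simp
  qed
  show "h (-1) = 0" if "a < 2 * pi" unfolding hc
  proof (rule lim[OF key that])
    fix y :: real assume "y > 0"
    then show "y > 0" .
    have e1: "2 * pi * \<i> * (- \<i> * of_real y) = of_real (2 * pi * y)" by (simp add: mult.assoc[symmetric])
    then show "P (- \<i> * of_real y) = c0 + c1 * of_real (exp (2 * pi * y)) + c2 * of_real (exp (- (2 * pi * y)))"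
      unfolding c e1 of_real_minus[symmetric] minus_minus exp_of_real by (simp add: add_ac)
    show "cmod (P (- \<i> * of_real y)) \<le> S * exp (a * y)" using Pb[of "- \<i> * of_real y"] \<open>y > 0\<close> by simp
  qed
qed

section \<open>The quadrature formula for integrable functions of type 2\<pi>\<close>

definition csinc :: "complex \<Rightarrow> complex" where
  "csinc z = (if z = 0 then 1 else sin z / z)"

lemma csinc_holomorphic: "csinc holomorphic_on UNIV"
proof -
  have "(\<lambda>z. if z = 0 then deriv sin 0 else (sin z - sin 0) / (z - 0)) holomorphic_on (UNIV :: complex set)"
    by (rule pole_lemma_open) (auto intro: holomorphic_intros)
  moreover have "deriv sin (0 :: complex) = 1"
    by (rule DERIV_imp_deriv) (auto intro!: derivative_eq_intros)
  ultimately have "(\<lambda>z. if z = 0 then 1 else (sin z - sin 0) / (z - 0)) holomorphic_on (UNIV :: complex set)"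
    by (simp only:)
  moreover have "(\<lambda>z. if z = 0 then 1 else (sin z - sin 0) / (z - 0)) = csinc"
    by (auto simp: csinc_def fun_eq_iff)
  ultimately show ?thesis by argo
qed

lemma csinc_continuous: "continuous_on UNIV csinc"
  by (rule holomorphic_on_imp_continuous_on[OF csinc_holomorphic])

lemma csinc_bound: obtains K where "K \<ge> 0" "\<And>z. cmod (csinc z) \<le> K * exp \<bar>Im z\<bar> / (1 + cmod z)"
proof -
  have "bounded (csinc ` cball 0 1)"
    by (intro compact_imp_bounded compact_continuous_image continuous_on_subset[OF csinc_continuous]) auto
  then obtain B where "\<forall>w \<in> csinc ` cball 0 1. cmod w \<le> B" unfolding bounded_iff by blast
  then have B: "cmod (csinc z) \<le> B" if "cmod z \<le> 1" for z using that by simp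
  have B0: "B \<ge> 0" using B[of 0] norm_ge_zero[of "csinc 0"] by (simp del: norm_ge_zero)
  define K where "K = 2 * max B 1"
  have "cmod (csinc z) \<le> K * exp \<bar>Im z\<bar> / (1 + cmod z)" for z
  proof (cases "cmod z \<le> 1")
    case True
    have "cmod (csinc z) * (1 + cmod z) \<le> B * 2" using True B[OF True] B0 by (intro mult_mono) auto
    also have "\<dots> \<le> K * exp \<bar>Im z\<bar>" using B0 mult_mono[of "2 * B" K 1 "exp \<bar>Im z\<bar>"] by (simp add: K_def)
    finally show ?thesis by (simp add: pos_le_divide_eq add_pos_nonneg)
  next
    case False
    then have z: "z \<noteq> 0" "cmod z > 1" by auto
    have "cmod (csinc z) * (1 + cmod z) = cmod (sin z) * ((1 + cmod z) / cmod z)"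
      using z by (simp add: csinc_def norm_divide)
    also have "\<dots> \<le> exp \<bar>Im z\<bar> * 2" using z
      by (intro mult_mono norm_sin_cos_le_exp) (auto simp: divide_le_eq)
    also have "\<dots> \<le> K * exp \<bar>Im z\<bar>" by (simp add: K_def)
    finally show ?thesis by (simp add: pos_le_divide_eq add_pos_nonneg)
  qed
  moreover have "K \<ge> 0" by (simp add: K_def)
  ultimately show ?thesis using that by blast
qed

lemma csinc_real_le_1: "cmod (csinc (of_real x)) \<le> 1"
proof (cases "x = 0")
  case False
  have "cmod (csinc (of_real x)) = \<bar>sin x\<bar> / \<bar>x\<bar>"
    using False by (simp add: csinc_def norm_divide sin_of_real)
  then show ?thesis using abs_sin_x_le_abs_x[of x] False by (simp add: divide_le_eq)
qed (simp add: csinc_def)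

lemma csinc_0 [simp]: "csinc 0 = 1"
  by (simp add: csinc_def)

text \<open>The factor csinc^2 supplies quadratic decay on the real axis at the price of 2\<epsilon> in the type. The dilation by \<rho> < 1
compensates for this when the total type has to stay below 2\<pi>.\<close>

lemma damped_exp_type_bound:
  assumes D: "exp_type_le D (2 * pi)" and int: "integrable lborel (\<lambda>x. D (of_real x))"
    and \<rho>: "0 < \<rho>" and \<epsilon>: "0 < \<epsilon>" "\<epsilon> \<le> 1"
  obtains C where "\<And>z. cmod (D (of_real \<rho> * z) * csinc (of_real \<epsilon> * z)^2) \<le> C * exp ((2 * pi * \<rho> + 2 * \<epsilon>) * \<bar>Im z\<bar>) / (1 + (Re z)^2)"
proof -
  obtain K where K: "K \<ge> 0" "\<And>z. cmod (csinc z) \<le> K * exp \<bar>Im z\<bar> / (1 + cmod z)" using csinc_bound by metis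
  define B where "B = (\<integral>x. cmod (D (of_real x)) \<partial>lborel) * (1 + exp (2 * pi))"
  have B0: "B \<ge> 0" unfolding B_def by simp
  have "cmod (D (of_real \<rho> * z) * csinc (of_real \<epsilon> * z)^2) \<le> B * K^2 / \<epsilon>^2 * exp ((2 * pi * \<rho> + 2 * \<epsilon>) * \<bar>Im z\<bar>) / (1 + (Re z)^2)" for z
  proof -
    have 1: "cmod (D (of_real \<rho> * z)) \<le> B * exp (2 * pi * \<rho> * \<bar>Im z\<bar>)"
      using exp_type_L1_bounded[OF D _ int, of "of_real \<rho> * z"] \<rho> by (simp add: B_def abs_mult mult.assoc)
    have "cmod (csinc (of_real \<epsilon> * z)) \<le> K * exp (\<epsilon> * \<bar>Im z\<bar>) / (1 + \<epsilon> * cmod z)"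
      using K(2)[of "of_real \<epsilon> * z"] \<epsilon> by (simp add: norm_mult abs_mult)
    then have "cmod (csinc (of_real \<epsilon> * z)) ^ 2 \<le> (K * exp (\<epsilon> * \<bar>Im z\<bar>) / (1 + \<epsilon> * cmod z)) ^ 2"
      by (intro power_mono) auto
    also have "\<dots> = K^2 * exp (2 * \<epsilon> * \<bar>Im z\<bar>) / (1 + \<epsilon> * cmod z)^2"
      by (simp add: power_divide power_mult_distrib exp_of_nat_mult[symmetric] exp_double[symmetric] mult.assoc)
    also have "\<dots> \<le> K^2 * exp (2 * \<epsilon> * \<bar>Im z\<bar>) / (\<epsilon>^2 * (1 + (Re z)^2))"
    proof (rule divide_left_mono)
      have "\<epsilon>^2 \<le> 1" using \<epsilon> by (simp add: power_le_one)
      moreover have "(Re z)^2 \<le> (cmod z)^2" by (simp add: cmod_power2)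
      then have "\<epsilon>^2 * (Re z)^2 \<le> \<epsilon>^2 * (cmod z)^2" by (intro mult_left_mono) auto
      moreover have "(1 + \<epsilon> * cmod z)^2 = 1 + 2 * (\<epsilon> * cmod z) + \<epsilon>^2 * (cmod z)^2" by (simp add: power2_eq_square algebra_simps)
      moreover have "\<epsilon> * cmod z \<ge> 0" using \<epsilon> by simp
      ultimately show "\<epsilon>\<^sup>2 * (1 + (Re z)\<^sup>2) \<le> (1 + \<epsilon> * cmod z)\<^sup>2" by (simp add: distrib_left)
      have "1 + \<epsilon> * cmod z > 0" "1 + (Re z)^2 > 0" using \<epsilon> by (auto intro: add_pos_nonneg)
      then show "0 < (1 + \<epsilon> * cmod z)\<^sup>2 * (\<epsilon>\<^sup>2 * (1 + (Re z)\<^sup>2))" using \<epsilon> by simp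
    qed simp
    finally have 2: "cmod (csinc (of_real \<epsilon> * z)) ^ 2 \<le> K^2 * exp (2 * \<epsilon> * \<bar>Im z\<bar>) / (\<epsilon>^2 * (1 + (Re z)^2))" .
    have "cmod (D (of_real \<rho> * z) * csinc (of_real \<epsilon> * z)^2) = cmod (D (of_real \<rho> * z)) * cmod (csinc (of_real \<epsilon> * z)) ^ 2"
      by (simp add: norm_mult norm_power)
    also have "\<dots> \<le> (B * exp (2 * pi * \<rho> * \<bar>Im z\<bar>)) * (K^2 * exp (2 * \<epsilon> * \<bar>Im z\<bar>) / (\<epsilon>^2 * (1 + (Re z)^2)))"
      by (intro mult_mono 1 2) (use B0 in auto)
    also have "\<dots> = B * K^2 / \<epsilon>^2 * (exp (2 * pi * \<rho> * \<bar>Im z\<bar>) * exp (2 * \<epsilon> * \<bar>Im z\<bar>)) / (1 + (Re z)^2)"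
      by (simp add: field_simps)
    also have "exp (2 * pi * \<rho> * \<bar>Im z\<bar>) * exp (2 * \<epsilon> * \<bar>Im z\<bar>) = exp ((2 * pi * \<rho> + 2 * \<epsilon>) * \<bar>Im z\<bar>)"
      by (simp add: exp_add[symmetric] algebra_simps)
    finally show ?thesis .
  qed
  then show ?thesis by (rule that)
qed

lemma damped_integral_tendsto:
  fixes D :: "complex \<Rightarrow> complex" and a r :: "nat \<Rightarrow> real"
  assumes int: "integrable lborel (\<lambda>x. D (of_real x))"
    and a: "a \<longlonglongrightarrow> 0" and r: "r \<longlonglongrightarrow> s"
  shows "(\<lambda>n. \<integral>x. D (of_real x) * csinc (of_real (a n * x))^2 * exp (\<i> * of_real (r n * x)) \<partial>lborel)
     \<longlonglongrightarrow> (\<integral>x. D (of_real x) * exp (\<i> * of_real (s * x)) \<partial>lborel)"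
proof (rule integral_dominated_convergence[where w="\<lambda>x. norm (D (of_real x))"])
  have [measurable]: "(\<lambda>x. D (of_real x)) \<in> borel_measurable lborel" using int by auto
  have m1: "(\<lambda>x::real. csinc (of_real (b * x))) \<in> borel_measurable borel" for b
    by (intro borel_measurable_continuous_onI continuous_on_compose2[OF csinc_continuous] continuous_intros) auto
  have m2: "(\<lambda>x::real. exp (\<i> * of_real (b * x))) \<in> borel_measurable borel" for b
    by (intro borel_measurable_continuous_onI continuous_intros)
  note [measurable] = m1 m2
  show "(\<lambda>x. D (of_real x) * exp (\<i> * of_real (s * x))) \<in> borel_measurable lborel" by measurable
  show "(\<lambda>x. D (of_real x) * csinc (of_real (a n * x))^2 * exp (\<i> * of_real (r n * x))) \<in> borel_measurable lborel" for n by measurable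
  show "integrable lborel (\<lambda>x. cmod (D (of_real x)))" using int by simp
  show "AE x in lborel. (\<lambda>n. D (of_real x) * csinc (of_real (a n * x))^2 * exp (\<i> * of_real (r n * x))) \<longlonglongrightarrow> D (of_real x) * exp (\<i> * of_real (s * x))"
  proof (rule AE_I2)
    fix x :: real
    have "isCont csinc 0" using csinc_continuous by (simp add: continuous_on_eq_continuous_at)
    moreover have "(\<lambda>n. complex_of_real (a n * x)) \<longlonglongrightarrow> 0" using tendsto_of_real[OF tendsto_mult_right[OF a, of x]] by simp
    ultimately have "(\<lambda>n. csinc (of_real (a n * x))) \<longlonglongrightarrow> csinc 0" by (rule isCont_tendsto_compose)
    then have "(\<lambda>n. D (of_real x) * csinc (of_real (a n * x))^2 * exp (\<i> * of_real (r n * x))) \<longlonglongrightarrow> D (of_real x) * (csinc 0)^2 * exp (\<i> * of_real (s * x))"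
      by (intro tendsto_intros r)
    then show "(\<lambda>n. D (of_real x) * csinc (of_real (a n * x))^2 * exp (\<i> * of_real (r n * x))) \<longlonglongrightarrow> D (of_real x) * exp (\<i> * of_real (s * x))" by simp
  qed
  show "AE x in lborel. norm (D (of_real x) * csinc (of_real (a n * x))^2 * exp (\<i> * of_real (r n * x))) \<le> cmod (D (of_real x))" for n
  proof (rule AE_I2)
    fix x :: real
    have "cmod (csinc (of_real (a n * x))) ^ 2 \<le> 1" using csinc_real_le_1[of "a n * x"] by (simp add: power_le_one)
    then show "norm (D (of_real x) * csinc (of_real (a n * x))^2 * exp (\<i> * of_real (r n * x))) \<le> cmod (D (of_real x))"
      by (simp add: norm_mult norm_power norm_exp_eq_Re mult_left_le)
  qed
qed

text \<open>The Fourier transform of D is supported in [-1, 1] and continuous, so it vanishes at the end points. Concretely: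
shrinking D by \<rho> = 1 - \<epsilon> and damping by csinc(\<epsilon>z)^2 gives type 2\<pi>\<rho> + 2\<epsilon> < 2\<pi>, for which periodization_decaying yields the
value 0; dominated convergence removes the damping.\<close>

lemma Fourier_transform_vanishes_at_type:
  assumes D: "exp_type_le D (2 * pi)" and int: "integrable lborel (\<lambda>x. D (of_real x))"
    and j: "j = 1 \<or> j = (-1::int)"
  shows "(\<integral>x. D (of_real x) * exp (\<i> * of_real (2 * pi * of_int j * x)) \<partial>lborel) = 0"
proof -
  define \<epsilon> where "\<epsilon> = (\<lambda>n::nat. 1 / (real n + 2))"
  define \<rho> where "\<rho> = (\<lambda>n. 1 - \<epsilon> n)"
  have \<epsilon>: "0 < \<epsilon> n" "\<epsilon> n \<le> 1/2" for n by (auto simp: \<epsilon>_def field_simps)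
  have \<rho>: "0 < \<rho> n" "\<rho> n < 1" for n using \<epsilon>[of n] by (auto simp: \<rho>_def)
  have \<epsilon>lim: "\<epsilon> \<longlonglongrightarrow> 0" unfolding \<epsilon>_def by real_asymp
  have \<rho>lim: "\<rho> \<longlonglongrightarrow> 1" unfolding \<rho>_def using tendsto_diff[OF tendsto_const \<epsilon>lim, of 1] by simp
  have zero: "(\<integral>x. D (of_real x) * csinc (of_real (\<epsilon> n / \<rho> n * x))^2 * exp (\<i> * of_real (2 * pi * of_int j / \<rho> n * x)) \<partial>lborel) = 0" for n
  proof -
    define E where "E = (\<lambda>z. D (of_real (\<rho> n) * z) * csinc (of_real (\<epsilon> n) * z)^2)"
    have holE: "E holomorphic_on UNIV" unfolding E_def
      by (intro holomorphic_intros entire_compose[OF exp_type_le_holomorphic[OF D]] entire_compose[OF csinc_holomorphic])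
    have "\<epsilon> n \<le> 1" using \<epsilon>(2)[of n] by simp
    then obtain C where C: "\<And>z. cmod (E z) \<le> C * exp ((2 * pi * \<rho> n + 2 * \<epsilon> n) * \<bar>Im z\<bar>) / (1 + (Re z)^2)"
      unfolding E_def using damped_exp_type_bound[OF D int \<rho>(1)[of n] \<epsilon>(1)[of n]] by metis
    have a: "0 \<le> 2 * pi * \<rho> n + 2 * \<epsilon> n" using \<rho>[of n] \<epsilon>[of n] by simp
    have "2 * \<epsilon> n < 2 * pi * \<epsilon> n" using \<epsilon>(1)[of n] pi_gt3 by simp
    then have a2: "2 * pi * \<rho> n + 2 * \<epsilon> n < 2 * pi" by (simp add: \<rho>_def right_diff_distrib)
    then have a3: "2 * pi * \<rho> n + 2 * \<epsilon> n < 3 * pi" by (simp add: order.strict_trans)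
    have h: "(\<integral>x. E (of_real x) * exp (2 * pi * \<i> * of_int j * of_real x) \<partial>lborel) = 0"
      using periodization_decaying(2,3)[OF holE C a a3 a2] j by auto
    define f where "f = (\<lambda>x. D (of_real x) * csinc (of_real (\<epsilon> n / \<rho> n * x))^2 * exp (\<i> * of_real (2 * pi * of_int j / \<rho> n * x)))"
    have "(\<integral>x. f x \<partial>lborel) = \<bar>\<rho> n\<bar> *\<^sub>R (\<integral>x. f (0 + \<rho> n * x) \<partial>lborel)"
      by (rule lborel_integral_real_affine) (use \<rho>(1)[of n] in simp)
    also have "(\<integral>x. f (0 + \<rho> n * x) \<partial>lborel) = (\<integral>x. E (of_real x) * exp (2 * pi * \<i> * of_int j * of_real x) \<partial>lborel)"
    proof (rule Bochner_Integration.integral_cong[OF refl])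
      fix x :: real
      have 1: "\<epsilon> n / \<rho> n * (0 + \<rho> n * x) = \<epsilon> n * x" "2 * pi * of_int j / \<rho> n * (0 + \<rho> n * x) = 2 * pi * of_int j * x"
        using \<rho>(1)[of n] by auto
      show "f (0 + \<rho> n * x) = E (of_real x) * exp (2 * pi * \<i> * of_int j * of_real x)"
        unfolding f_def 1 E_def by (simp add: mult_ac)
    qed
    finally show ?thesis using h by (simp add: f_def)
  qed
  have "(\<lambda>n. \<epsilon> n / \<rho> n) \<longlonglongrightarrow> 0 / 1" by (intro tendsto_divide \<epsilon>lim \<rho>lim) simp
  then have l1: "(\<lambda>n. \<epsilon> n / \<rho> n) \<longlonglongrightarrow> 0" by simp
  have "(\<lambda>n. 2 * pi * of_int j / \<rho> n) \<longlonglongrightarrow> 2 * pi * of_int j / 1" by (intro tendsto_divide tendsto_const \<rho>lim) simp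
  then have l2: "(\<lambda>n. 2 * pi * of_int j / \<rho> n) \<longlonglongrightarrow> 2 * pi * of_int j" by simp
  from damped_integral_tendsto[OF int l1 l2] show ?thesis unfolding zero by (simp add: LIMSEQ_const_iff)
qed

text \<open>Poisson summation: the damped function satisfies the formula with two extra terms at the frequencies 1 and -1, since
its type slightly exceeds 2\<pi>. As \<epsilon> \<rightarrow> 0 these terms tend to the Fourier coefficients that vanish, and the damped
sums converge because the sum of the |D(x+k)| is finite.\<close>

theorem integer_translates_quadrature:
  assumes D: "exp_type_le D (2 * pi)" and int: "integrable lborel (\<lambda>x. D (of_real x))"
  shows "((\<lambda>k::int. D (of_real x + of_int k)) has_sum (\<integral>x. D (of_real x) \<partial>lborel)) UNIV"
proof -
  define \<epsilon> where "\<epsilon> = (\<lambda>n::nat. 1 / (real n + 2))"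
  have \<epsilon>: "0 < \<epsilon> n" "\<epsilon> n \<le> 1/2" for n by (auto simp: \<epsilon>_def field_simps)
  have \<epsilon>lim: "\<epsilon> \<longlonglongrightarrow> 0" unfolding \<epsilon>_def by real_asymp
  have abs: "(\<lambda>k::int. cmod (D (of_real x + of_int k))) summable_on UNIV"
    by (rule exp_type_L1_summable_on_int[OF D _ int]) simp
  define h where "h = (\<lambda>n (j::int). \<integral>x. D (of_real x) * csinc (of_real (\<epsilon> n * x))^2 * exp (\<i> * of_real (2 * pi * of_int j * x)) \<partial>lborel)"
  have sumn: "(\<Sum>\<^sub>\<infinity>k::int. D (of_real x + of_int k) * csinc (of_real (\<epsilon> n * (x + of_int k)))^2)
     = h n 0 + h n (-1) * exp (2 * pi * \<i> * of_real x) + h n 1 * exp (- (2 * pi * \<i> * of_real x))" for n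
  proof -
    define E where "E = (\<lambda>z. D (of_real 1 * z) * csinc (of_real (\<epsilon> n) * z)^2)"
    have holE: "E holomorphic_on UNIV" unfolding E_def
      by (intro holomorphic_intros entire_compose[OF exp_type_le_holomorphic[OF D]] entire_compose[OF csinc_holomorphic])
    have "\<epsilon> n \<le> 1" using \<epsilon>(2)[of n] by simp
    then obtain C where C: "\<And>z. cmod (E z) \<le> C * exp ((2 * pi * 1 + 2 * \<epsilon> n) * \<bar>Im z\<bar>) / (1 + (Re z)^2)"
      unfolding E_def using damped_exp_type_bound[OF D int zero_less_one \<epsilon>(1)[of n]] by metis
    (* Without dilation the type exceeds 2 pi, but it stays below the bound 3 pi of periodization_decaying. *)
    have a: "0 \<le> 2 * pi * 1 + 2 * \<epsilon> n" "2 * pi * 1 + 2 * \<epsilon> n < 3 * pi" using \<epsilon>[of n] pi_gt3 by auto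
    have hj: "(\<integral>x. E (of_real x) * exp (2 * pi * \<i> * of_int j * of_real x) \<partial>lborel) = h n j" for j
      unfolding h_def E_def by (intro Bochner_Integration.integral_cong) (auto simp: mult_ac)
    show ?thesis using periodization_decaying(1)[OF holE C a, of "of_real x"] unfolding hj
      by (simp add: E_def)
  qed
  define I where "I = (\<integral>x. D (of_real x) \<partial>lborel)"
  have hlim: "(\<lambda>n. h n j) \<longlonglongrightarrow> (\<integral>x. D (of_real x) * exp (\<i> * of_real (2 * pi * of_int j * x)) \<partial>lborel)" for j
    unfolding h_def by (rule damped_integral_tendsto[OF int \<epsilon>lim tendsto_const])
  have h0: "(\<lambda>n. h n 0) \<longlonglongrightarrow> I" using hlim[of 0] by (simp add: I_def)
  have h1: "(\<lambda>n. h n 1) \<longlonglongrightarrow> 0" "(\<lambda>n. h n (-1)) \<longlonglongrightarrow> 0"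
    using hlim[of 1] hlim[of "-1"] Fourier_transform_vanishes_at_type[OF D int, of 1] Fourier_transform_vanishes_at_type[OF D int, of "-1"] by simp_all
  have "(\<lambda>n. h n 0 + h n (-1) * exp (2 * pi * \<i> * of_real x) + h n 1 * exp (- (2 * pi * \<i> * of_real x)))
     \<longlonglongrightarrow> I + 0 * exp (2 * pi * \<i> * of_real x) + 0 * exp (- (2 * pi * \<i> * of_real x))"
    by (intro tendsto_intros h0 h1)
  then have lim1: "(\<lambda>n. \<Sum>\<^sub>\<infinity>k::int. D (of_real x + of_int k) * csinc (of_real (\<epsilon> n * (x + of_int k)))^2) \<longlonglongrightarrow> I"
    unfolding sumn by simp
  have ul: "uniform_limit {0..1} (\<lambda>X e. \<Sum>k\<in>X. D (of_real x + of_int k) * csinc (of_real (e * (x + of_int k)))^2)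
        (\<lambda>e. \<Sum>\<^sub>\<infinity>k::int. D (of_real x + of_int k) * csinc (of_real (e * (x + of_int k)))^2) (finite_subsets_at_top UNIV)"
  proof (rule Weierstrass_m_test_general[OF _ abs])
    fix k :: int and e :: real
    have "cmod (csinc (of_real (e * (x + of_int k)))) ^ 2 \<le> 1" using csinc_real_le_1[of "e * (x + of_int k)"] by (simp add: power_le_one)
    then show "norm (D (of_real x + of_int k) * csinc (of_real (e * (x + of_int k)))^2) \<le> cmod (D (of_real x + of_int k))"
      unfolding norm_mult norm_power by (simp add: mult_left_le)
  qed
  have "continuous_on {0..1} (\<lambda>e. \<Sum>\<^sub>\<infinity>k::int. D (of_real x + of_int k) * csinc (of_real (e * (x + of_int k)))^2)"
  proof (rule uniform_limit_theorem[OF _ ul])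
    show "\<forall>\<^sub>F X in finite_subsets_at_top UNIV. continuous_on {0..1} (\<lambda>e::real. \<Sum>k\<in>X. D (of_real x + of_int k) * csinc (of_real (e * (x + of_int k)))^2)"
      by (intro always_eventually allI continuous_intros continuous_on_compose2[OF csinc_continuous]) auto
  qed simp
  then have "(\<lambda>n. \<Sum>\<^sub>\<infinity>k::int. D (of_real x + of_int k) * csinc (of_real (\<epsilon> n * (x + of_int k)))^2)
     \<longlonglongrightarrow> (\<Sum>\<^sub>\<infinity>k::int. D (of_real x + of_int k) * csinc (of_real (0 * (x + of_int k)))^2)"
  proof (rule continuous_on_tendsto_compose[OF _ \<epsilon>lim])
    show "\<forall>\<^sub>F n in sequentially. \<epsilon> n \<in> {0..1}" using \<epsilon> by (intro always_eventually allI) (simp add: less_imp_le order_trans[of _ "1/2"])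
  qed simp
  then have "(\<Sum>\<^sub>\<infinity>k::int. D (of_real x + of_int k)) = I" using LIMSEQ_unique[OF lim1] by simp
  moreover have "(\<lambda>k::int. D (of_real x + of_int k)) summable_on UNIV" using abs by (rule abs_summable_summable)
  ultimately show ?thesis unfolding I_def by (metis has_sum_infsum)
qed

section \<open>Uniqueness from zeros and orthogonality to sgn(cos \<pi>x)\<close>

lemma exp_type_le_mult:
  assumes "exp_type_le F a" "exp_type_le G b"
  shows "exp_type_le (\<lambda>z. F z * G z) (a + b)"
  unfolding exp_type_le_def
proof (intro conjI allI impI)
  show "(\<lambda>z. F z * G z) holomorphic_on UNIV"
    by (intro holomorphic_intros exp_type_le_holomorphic[OF assms(1)] exp_type_le_holomorphic[OF assms(2)])
  fix e :: real assume e: "e > 0"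
  then have "e / 2 > 0" by simp
  then obtain C1 C2 where C: "C1 > 0" "C2 > 0" "\<And>z. cmod (F z) \<le> C1 * exp ((a + e/2) * cmod z)" "\<And>z. cmod (G z) \<le> C2 * exp ((b + e/2) * cmod z)"
    using assms unfolding exp_type_le_def by meson
  have "cmod (F z * G z) \<le> C1 * C2 * exp ((a + b + e) * cmod z)" for z
  proof -
    have "cmod (F z * G z) \<le> (C1 * exp ((a + e/2) * cmod z)) * (C2 * exp ((b + e/2) * cmod z))"
      unfolding norm_mult using C by (intro mult_mono) auto
    also have "\<dots> = C1 * C2 * (exp ((a + e/2) * cmod z) * exp ((b + e/2) * cmod z))" by (simp add: mult_ac)
    also have "exp ((a + e/2) * cmod z) * exp ((b + e/2) * cmod z) = exp ((a + b + e) * cmod z)"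
      by (simp add: exp_add[symmetric] algebra_simps)
    finally show ?thesis .
  qed
  moreover have "C1 * C2 > 0" using C by simp
  ultimately show "\<exists>C>0. \<forall>z. cmod (F z * G z) \<le> C * exp ((a + b + e) * cmod z)" by blast
qed

lemma exp_type_le_diff:
  assumes "exp_type_le F a" "exp_type_le G a"
  shows "exp_type_le (\<lambda>z. F z - G z) a"
  unfolding exp_type_le_def
proof (intro conjI allI impI)
  show "(\<lambda>z. F z - G z) holomorphic_on UNIV"
    by (intro holomorphic_intros exp_type_le_holomorphic[OF assms(1)] exp_type_le_holomorphic[OF assms(2)])
  fix e :: real assume e: "e > 0"
  then obtain C1 C2 where C: "C1 > 0" "C2 > 0" "\<And>z. cmod (F z) \<le> C1 * exp ((a + e) * cmod z)" "\<And>z. cmod (G z) \<le> C2 * exp ((a + e) * cmod z)"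
    using assms unfolding exp_type_le_def by meson
  have "cmod (F z - G z) \<le> (C1 + C2) * exp ((a + e) * cmod z)" for z
    using norm_triangle_ineq4[of "F z" "G z"] C(3)[of z] C(4)[of z] by (simp add: distrib_right)
  moreover have "C1 + C2 > 0" using C by simp
  ultimately show "\<exists>C>0. \<forall>z. cmod (F z - G z) \<le> C * exp ((a + e) * cmod z)" by blast
qed

text \<open>The function z D(z) has double zeros at all integers, so z D(z) = R(z) sin^2 \<pi>z with R entire. Comparing the growth of D
and sin^2 off the integers gives |R(z)| = O(|z|), hence R(z) = a + bz. At the half-integers p this reads
D(p) = a/p + b; since the sum of the |D(p)| converges and that of the 1/p does not, a = b = 0.
The missing condition on D'(0) is what the factor z pays for.\<close>

lemma exp_type_L1_double_zeros_eq_0: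
  assumes D: "exp_type_le D (2 * pi)" and int: "integrable lborel (\<lambda>x. D (of_real x))"
    and zero: "\<And>n::int. D (of_int n) = 0" and dzero: "\<And>n::int. n \<noteq> 0 \<Longrightarrow> deriv D (of_int n) = 0"
  shows "D z = 0"
proof -
  have holD: "D holomorphic_on UNIV" by (rule exp_type_le_holomorphic[OF D])
  define F where "F = (\<lambda>z. z * D z)"
  have holF: "F holomorphic_on UNIV" unfolding F_def by (intro holomorphic_intros holD)
  have "F (of_int n) = 0" for n by (simp add: F_def zero)
  then obtain R1 where R1: "R1 holomorphic_on UNIV" "\<And>z. F z = R1 z * sin (of_real pi * z)"
    using entire_divide_sin_pi[OF holF] by metis
  have "R1 (of_int n) = 0" for n
  proof -
    have "(D has_field_derivative deriv D (of_int n)) (at (of_int n))" using holomorphic_derivI[OF holD] by simp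
    then have "(F has_field_derivative (D (of_int n) + of_int n * deriv D (of_int n))) (at (of_int n))"
      unfolding F_def by (auto intro!: derivative_eq_intros)
    moreover have "D (of_int n) + of_int n * deriv D (of_int n) = 0" using zero[of n] dzero[of n] by (cases "n = 0") auto
    ultimately have 1: "(F has_field_derivative 0) (at (of_int n))" by simp
    have d: "(R1 has_field_derivative deriv R1 (of_int n)) (at (of_int n))"
      by (rule holomorphic_derivI[OF R1(1)]) auto
    have s: "sin (of_real pi * of_int n) = (0::complex)" by (simp add: sin_pi_complex_eq_0_iff)
    have "((\<lambda>z. R1 z * sin (of_real pi * z)) has_field_derivative (deriv R1 (of_int n) * sin (of_real pi * of_int n) + (cos (of_real pi * of_int n) * of_real pi) * R1 (of_int n))) (at (of_int n))"
    proof (rule DERIV_mult[OF d])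
      show "((\<lambda>z. sin (of_real pi * z)) has_field_derivative cos (of_real pi * of_int n) * of_real pi) (at (of_int n :: complex))"
        by (auto intro!: derivative_eq_intros)
    qed
    then have "(F has_field_derivative ((cos (of_real pi * of_int n) * of_real pi) * R1 (of_int n))) (at (of_int n))"
      using R1(2) s by (simp add: fun_eq_iff[symmetric] ext[of F "\<lambda>z. R1 z * sin (of_real pi * z)"])
    with 1 have "(cos (of_real pi * of_int n) * of_real pi) * R1 (of_int n) = 0" using DERIV_unique by blast
    then show ?thesis using cos_pi_int_nonzero[of n] by simp
  qed
  then obtain R where R: "R holomorphic_on UNIV" "\<And>z. R1 z = R z * sin (of_real pi * z)"
    using entire_divide_sin_pi[OF R1(1)] by metis
  have fac: "z * D z = R z * (sin (of_real pi * z))^2" for z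
    using R1(2)[of z] R(2)[of z] by (simp add: F_def power2_eq_square mult.assoc)
  define B where "B = (\<integral>x. cmod (D (of_real x)) \<partial>lborel) * (1 + exp (2 * pi))"
  have B0: "B \<ge> 0" unfolding B_def by simp
  have Db: "cmod (D z) \<le> B * exp (2 * pi * \<bar>Im z\<bar>)" for z
    using exp_type_L1_bounded[OF D _ int, of z] by (simp add: B_def)
  have Rb: "cmod (R z) \<le> 16 * B * cmod z" if s: "cmod (sin (of_real pi * z)) \<ge> exp (pi * \<bar>Im z\<bar>) / 4" for z
  proof -
    have "(exp (pi * \<bar>Im z\<bar>) / 4)^2 \<le> cmod (sin (of_real pi * z))^2" using s by (intro power_mono) auto
    then have e: "exp (2 * pi * \<bar>Im z\<bar>) / 16 \<le> cmod (sin (of_real pi * z))^2"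
      by (simp add: power_divide exp_of_nat_mult[symmetric] exp_double[symmetric] mult.assoc)
    have "cmod (R z) * (exp (2 * pi * \<bar>Im z\<bar>) / 16) \<le> cmod (R z) * cmod (sin (of_real pi * z))^2"
      by (intro mult_left_mono e) auto
    also have "\<dots> = cmod (z * D z)" unfolding fac by (simp add: norm_mult norm_power)
    also have "\<dots> \<le> cmod z * (B * exp (2 * pi * \<bar>Im z\<bar>))" unfolding norm_mult by (intro mult_left_mono Db) auto
    finally have "cmod (R z) * exp (2 * pi * \<bar>Im z\<bar>) \<le> (16 * B * cmod z) * exp (2 * pi * \<bar>Im z\<bar>)" by (simp add: mult_ac)
    then show ?thesis by simp
  qed
  have s1: "cmod (sin (of_real pi * z)) \<ge> exp (pi * \<bar>Im z\<bar>) / 4" if y: "\<bar>Im z\<bar> \<ge> 1" for z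
  proof -
    have "\<bar>Im (of_real pi * z)\<bar> = pi * \<bar>Im z\<bar>" by (simp add: abs_mult)
    moreover have "1 * 1 \<le> pi * \<bar>Im z\<bar>" using y pi_gt3 by (intro mult_mono) auto
    ultimately show ?thesis
      using norm_sin_ge_sinh[of "of_real pi * z"] abs_sinh_ge_exp[of "Im (of_real pi * z)"] by simp
  qed
  have s2: "cmod (sin (of_real pi * z)) \<ge> exp (pi * \<bar>Im z\<bar>) / 4" if y: "Re z = of_int n + 1/2" for z n
  proof -
    have "sin (pi * Re z) ^ 2 = 1"
    proof -
      have "sin (pi * of_int n) = 0" unfolding sin_zero_iff_int2 by (metis mult.commute)
      then have "cos (pi * Re z) = 0" unfolding y by (simp add: distrib_left cos_add)
      then show ?thesis by (simp add: sin_squared_eq)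
    qed
    then have "(cmod (sin (of_real pi * z)))^2 = 1 + (sinh (pi * Im z))^2" by (simp add: norm_sin_cos_squared)
    also have "\<dots> = (cosh (pi * \<bar>Im z\<bar>))^2" by (cases "Im z \<ge> 0") (simp_all add: cosh_square_eq)
    finally have "cmod (sin (of_real pi * z)) = cosh (pi * \<bar>Im z\<bar>)" by (simp add: power2_eq_iff_nonneg)
    also have "\<dots> = (exp (pi * \<bar>Im z\<bar>) + exp (- (pi * \<bar>Im z\<bar>))) / 2" by (simp add: cosh_def)
    also have "\<dots> \<ge> exp (pi * \<bar>Im z\<bar>) / 4"
    proof -
      have "x / 4 \<le> (x + v) / 2" if "x > 0" "v > 0" for x v :: real using that by simp
      then show ?thesis by simp
    qed
    finally show ?thesis .
  qed
  have RB: "cmod (R z) \<le> 16 * B * (cmod z + 3)" for z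
  proof (cases "\<bar>Im z\<bar> \<ge> 1")
    case True
    have "cmod (R z) \<le> 16 * B * cmod z" by (rule Rb[OF s1[OF True]])
    also have "\<dots> \<le> 16 * B * (cmod z + 3)" using B0 by (intro mult_left_mono) auto
    finally show ?thesis .
  next
    case False
    define n where "n = \<lfloor>Re z - 1/2\<rfloor>"
    have n: "of_int n + 1/2 \<le> Re z" "Re z < of_int n + 3/2" unfolding n_def by linarith+
    (* Near the real axis the bound for 1/sin^2 fails close to the integers. The maximum principle
       on a rectangle whose vertical sides pass through half-integers covers this strip. *)
    define Q where "Q = cbox (Complex (of_int n + 1/2) (-1)) (Complex (of_int n + 3/2) 1)"
    show ?thesis
    proof (rule maximum_modulus_frontier[of R Q])
      show "R holomorphic_on interior Q" using R(1) by (rule holomorphic_on_subset) simp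
      show "continuous_on (closure Q) R"
        by (rule holomorphic_on_imp_continuous_on, rule holomorphic_on_subset[OF R(1)]) simp
      show "bounded Q" by (simp add: Q_def)
      show "z \<in> Q" using n False by (auto simp: Q_def in_cbox_complex_iff)
      fix w assume w: "w \<in> frontier Q"
      then have wQ: "w \<in> Q" "w \<notin> box (Complex (of_int n + 1/2) (-1)) (Complex (of_int n + 3/2) 1)"
        by (auto simp: Q_def frontier_def)
      then have "\<bar>Im w\<bar> \<ge> 1 \<or> Re w = of_int n + 1/2 \<or> Re w = of_int (n + 1) + 1/2"
        by (auto simp: Q_def in_cbox_complex_iff in_box_complex_iff)
      then have "cmod (R w) \<le> 16 * B * cmod w" using Rb[OF s1] Rb[OF s2] by blast
      also have "cmod w \<le> cmod z + 3"
      proof -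
        have "\<bar>Re (w - z)\<bar> \<le> 1" "\<bar>Im (w - z)\<bar> \<le> 2" using wQ(1) n False by (auto simp: Q_def in_cbox_complex_iff)
        then have "cmod (w - z) \<le> 3" using cmod_le[of "w - z"] by linarith
        then show ?thesis using norm_triangle_sub[of w z] by linarith
      qed
      then have "16 * B * cmod w \<le> 16 * B * (cmod z + 3)" using B0 by (intro mult_left_mono) auto
      finally show "cmod (R w) \<le> 16 * B * (cmod z + 3)" .
    qed
  qed
  have "\<exists>a b. \<forall>z. R z = a + b * z"
  proof -
    have "R \<xi> = (\<Sum>k\<le>1. (deriv^^k) R 0 / fact k * \<xi> ^ k)" for \<xi>
    proof (rule Liouville_polynomial[OF R(1), of 3 "32 * B"])
      fix z :: complex assume z: "3 \<le> cmod z"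
      have "16 * B * (cmod z + 3) \<le> 16 * B * (2 * cmod z)" using z B0 by (intro mult_left_mono) auto
      then show "cmod (R z) \<le> 32 * B * cmod z ^ 1" using RB[of z] by simp
    qed
    moreover have "(\<Sum>k\<le>1. (deriv^^k) R 0 / fact k * \<xi> ^ k) = R 0 + deriv R 0 * \<xi>" for \<xi> by simp
    ultimately have "\<forall>z. R z = R 0 + deriv R 0 * z" by metis
    then show ?thesis by blast
  qed
  then obtain a b where ab: "\<And>z. R z = a + b * z" by blast
  define p where "p = (\<lambda>n::nat. complex_of_real (real n + 1/2))"
  have p0: "p n \<noteq> 0" for n
  proof -
    have "real n + 1/2 \<noteq> 0" by linarith
    then show ?thesis unfolding p_def of_real_eq_0_iff .
  qed
  have Dp: "D (p n) = a / p n + b" for n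
  proof -
    have "sin (of_real pi * p n) ^ 2 = 1"
    proof -
      have "sin (pi * (real n + 1/2)) ^ 2 = 1"
        by (simp add: distrib_left sin_add power2_eq_square flip: power_mult_distrib)
      moreover have "sin (of_real pi * p n) = of_real (sin (pi * (real n + 1/2)))"
        by (simp only: p_def sin_of_real[symmetric] of_real_mult)
      ultimately show ?thesis by (metis of_real_1 of_real_power)
    qed
    then have "p n * D (p n) = a + b * p n" using fac[of "p n"] ab by simp
    then show ?thesis using p0[of n] by (simp add: field_simps)
  qed
  have sD: "summable (\<lambda>n. cmod (D (p n)))"
  proof (rule summableI_nonneg_bounded)
    fix N
    have "(\<Sum>n<N. cmod (D (p n))) = (\<Sum>k\<in>int ` {..<N}. cmod (D (1/2 + of_int k)))"
      by (subst sum.reindex) (auto simp: p_def add.commute)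
    also have "\<dots> \<le> (\<integral>x. cmod (D (of_real x)) \<partial>lborel) * (1 + exp (2 * pi)) * exp (2 * pi * \<bar>Im (1/2)\<bar>)"
      by (rule sum_integer_translates_bound[OF D _ int]) auto
    finally show "(\<Sum>n<N. cmod (D (p n))) \<le> (\<integral>x. cmod (D (of_real x)) \<partial>lborel) * (1 + exp (2 * pi)) * exp (2 * pi * \<bar>Im (1/2)\<bar>)" .
  qed auto
  have pinv: "(\<lambda>n. 1 / p n) \<longlonglongrightarrow> 0"
  proof -
    have "(\<lambda>n. 1 / (real n + 1/2)) \<longlonglongrightarrow> 0" by real_asymp
    then have "(\<lambda>n. complex_of_real (1 / (real n + 1/2))) \<longlonglongrightarrow> of_real 0" by (rule tendsto_of_real)
    then show ?thesis by (simp add: p_def)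
  qed
  have "(\<lambda>n. D (p n)) \<longlonglongrightarrow> 0" using summable_LIMSEQ_zero[OF sD] by (simp add: tendsto_norm_zero_iff)
  moreover have "(\<lambda>n. D (p n)) \<longlonglongrightarrow> b"
    unfolding Dp using tendsto_add[OF tendsto_mult_left[OF pinv, of a] tendsto_const[of b]] by simp
  ultimately have b0: "b = 0" using LIMSEQ_unique by blast
  have a0: "a = 0"
  proof (rule ccontr)
    assume a: "a \<noteq> 0"
    have s: "summable (\<lambda>n. cmod (D (p n)) / cmod a)" using sD by (rule summable_divide)
    have le: "norm (inverse (real (Suc n))) \<le> cmod (D (p n)) / cmod a" for n
    proof -
      have "cmod (D (p n)) / cmod a = 1 / cmod (p n)" using a by (simp add: Dp b0 norm_divide)
      also have "cmod (p n) = real n + 1/2" unfolding p_def norm_of_real by simp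
      finally show ?thesis by (simp add: inverse_eq_divide frac_le)
    qed
    have "summable (\<lambda>n. inverse (real (Suc n)))" by (rule summable_comparison_test[OF _ s]) (use le in blast)
    then show False using not_summable_harmonic[where 'a=real] summable_Suc_iff[of "\<lambda>n. inverse (real n)"] by (simp add: inverse_eq_divide)
  qed
  have z0: "D z = 0" if "z \<noteq> 0" for z using fac[of z] that by (simp add: ab a0 b0)
  show ?thesis using z0 zero[of 0] by (cases "z = 0") auto
qed

text \<open>D^2, shifted by 1/2, has type 2\<pi>, is integrable because D is bounded, and has double zeros at all integers.\<close>

lemma exp_type_L1_simple_zeros_eq_0:
  assumes D: "exp_type_le D pi" and int: "integrable lborel (\<lambda>x. D (of_real x))"
    and zero: "\<And>n::int. D (of_int n + 1/2) = 0"
  shows "D z = 0"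
proof -
  define E where "E = (\<lambda>z. D (1 * z + 1/2) * D (1 * z + 1/2))"
  have t: "exp_type_le (\<lambda>z. D (1 * z + 1/2)) (cmod 1 * pi)"
    by (rule exp_type_le_compose_linear[OF D]) auto
  have E: "exp_type_le E (2 * pi)"
    using exp_type_le_mult[OF t t] by (simp add: E_def)
  have holD: "D holomorphic_on UNIV" by (rule exp_type_le_holomorphic[OF D])
  define B where "B = (\<integral>x. cmod (D (of_real x)) \<partial>lborel) * (1 + exp pi)"
  have Db: "cmod (D (of_real x)) \<le> B" for x
    using exp_type_L1_bounded[OF D _ int, of "of_real x"] by (simp add: B_def)
  have i1: "integrable lborel (\<lambda>x. D (of_real x * 1 + 1/2))"
    using lborel_integrable_real_affine[OF int, of 1 "1/2"] by (simp add: add.commute)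
  have intE: "integrable lborel (\<lambda>x. E (of_real x))"
  proof (rule Bochner_Integration.integrable_bound)
    show "integrable lborel (\<lambda>x. of_real B * D (of_real x * 1 + 1/2))" by (rule integrable_mult_right[OF i1])
    show "(\<lambda>x. E (of_real x)) \<in> borel_measurable lborel"
      using exp_type_le_borel_measurable[OF E] by measurable
    show "AE x in lborel. norm (E (of_real x)) \<le> norm (of_real B * D (of_real x * 1 + 1/2))"
    proof (rule AE_I2)
      fix x :: real
      have "cmod (D (of_real x + 1/2)) \<le> B" using Db[of "x + 1/2"] by simp
      then show "norm (E (of_real x)) \<le> norm (of_real B * D (of_real x * 1 + 1/2))"
        unfolding E_def by (simp add: norm_mult mult_right_mono)
    qed
  qed
  have z1: "E (of_int n) = 0" for n by (simp add: E_def zero)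
  have z2: "deriv E (of_int n) = 0" for n
  proof (rule DERIV_imp_deriv)
    have "(D has_field_derivative deriv D (of_int n + 1/2)) (at (of_int n + 1/2))"
      using holomorphic_derivI[OF holD] by simp
    then have d: "((\<lambda>z. D (z + 1/2)) has_field_derivative deriv D (of_int n + 1/2)) (at (of_int n))"
      using DERIV_shift[of D _ "of_int n" "1/2"] by (simp add: add.commute)
    have "((\<lambda>z. D (z + 1/2) * D (z + 1/2)) has_field_derivative (deriv D (of_int n + 1/2) * D (of_int n + 1/2) + deriv D (of_int n + 1/2) * D (of_int n + 1/2))) (at (of_int n))"
      by (rule DERIV_mult[OF d d])
    then show "(E has_field_derivative 0) (at (of_int n))" by (simp add: E_def[abs_def] zero)
  qed
  have "E (z - 1/2) = 0" by (rule exp_type_L1_double_zeros_eq_0[OF E intE z1 z2])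
  then show ?thesis by (simp add: E_def)
qed

lemma sum_indicator_unit_intervals:
  "(\<Sum>k\<in>{- int N..<int N}. indicator {of_int k..<of_int k + 1} x) = (indicator {- real N..<real N} x :: real)"
proof -
  have "(\<Sum>k\<in>{- int N..<int N}. indicator {of_int k..<of_int k + 1} x :: real) = (\<Sum>k\<in>{- int N..<int N} \<inter> {\<lfloor>x\<rfloor>}. indicator {of_int k..<of_int k + 1} x)"
  proof (rule sum.mono_neutral_right)
    show "\<forall>k\<in>{- int N..<int N} - {- int N..<int N} \<inter> {\<lfloor>x\<rfloor>}. indicator {of_int k..<of_int k + 1} x = (0::real)"
      by (auto simp: indicator_def floor_unique)
  qed auto
  also have "\<dots> = indicator {- real N..<real N} x"
  proof (cases "\<lfloor>x\<rfloor> \<in> {- int N..<int N}")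
    case True
    then have "- real N \<le> x" "x < real N" by (auto simp: le_floor_iff floor_less_iff)
    then show ?thesis using True by (simp add: indicator_def)
  next
    case False
    then have "\<not> (- real N \<le> x \<and> x < real N)" by (auto simp: le_floor_iff floor_less_iff)
    then show ?thesis using False by (auto simp: indicator_def)
  qed
  finally show ?thesis .
qed

text \<open>Unfold the integral to one period and apply the quadrature formula under the integral sign; the partial sums are
dominated by sum_integer_translates_bound.\<close>

lemma integral_periodic_weight:
  fixes w :: "real \<Rightarrow> real"
  assumes E: "exp_type_le E (2 * pi)" and int: "integrable lborel (\<lambda>x. E (of_real x))"
    and [measurable]: "w \<in> borel_measurable borel" and w1: "\<And>x. \<bar>w x\<bar> \<le> 1"
    and per: "\<And>x k. w (x + of_int k) = w x"
  shows "(\<integral>x. of_real (w x) * E (of_real x) \<partial>lborel)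
    = of_real (\<integral>x. indicator {0..<1} x * w x \<partial>lborel) * (\<integral>x. E (of_real x) \<partial>lborel)"
proof -
  note [measurable] = exp_type_le_borel_measurable[OF E]
  define I where "I = (\<integral>x. E (of_real x) \<partial>lborel)"
  define f where "f = (\<lambda>x. of_real (w x) * E (of_real x))"
  have fm [measurable]: "f \<in> borel_measurable borel" unfolding f_def by measurable
  have fint: "integrable lborel f"
  proof (rule Bochner_Integration.integrable_bound[OF int])
    show "AE x in lborel. norm (f x) \<le> norm (E (of_real x))"
      using w1 by (auto simp: f_def norm_mult intro!: mult_right_le_one_le[where y="\<bar>w _\<bar>", simplified] mult_left_le_one_le)
  qed measurable
  have gint: "(\<integral>u. indicator {0..<1} u *\<^sub>R (\<Sum>k\<in>{- int N..<int N}. f (u + of_int k)) \<partial>lborel) = (\<integral>u. indicator {- real N..<real N} u *\<^sub>R f u \<partial>lborel)" for N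
  proof -
    have s: "(\<integral>u. indicator {0..<1} u *\<^sub>R f (u + of_int k) \<partial>lborel) = (\<integral>u. indicator {of_int k..<of_int k + 1} u *\<^sub>R f u \<partial>lborel)" for k
    proof -
      have "(\<integral>u. indicator {of_int k..<of_int k + 1} u *\<^sub>R f u \<partial>lborel) = (\<integral>u. indicator {of_int k..<of_int k + 1} (of_int k + u) *\<^sub>R f (of_int k + u) \<partial>lborel)"
        using lborel_integral_real_affine[of 1 "\<lambda>u. indicator {of_int k..<of_int k + 1} u *\<^sub>R f u" "of_int k"] by simp
      also have "\<dots> = (\<integral>u. indicator {0..<1} u *\<^sub>R f (u + of_int k) \<partial>lborel)"
        by (intro Bochner_Integration.integral_cong) (auto simp: indicator_def add.commute)
      finally show ?thesis by simp
    qed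
    have i: "integrable lborel (\<lambda>u. indicator {0..<1} u *\<^sub>R f (u + of_int k))" for k
    proof -
      have "integrable lborel (\<lambda>u. f (u + of_int k))"
        using lborel_integrable_real_affine[OF fint, of 1 "of_int k"] by (simp add: add.commute)
      then show ?thesis by (rule integrable_mult_indicator[rotated]) simp
    qed
    have i2: "integrable lborel (\<lambda>u. indicator {of_int k..<of_int k + 1} u *\<^sub>R f u)" for k :: int
      by (rule integrable_mult_indicator[OF _ fint]) simp
    have "(\<integral>u. indicator {0..<1} u *\<^sub>R (\<Sum>k\<in>{- int N..<int N}. f (u + of_int k)) \<partial>lborel) = (\<Sum>k\<in>{- int N..<int N}. (\<integral>u. indicator {0..<1} u *\<^sub>R f (u + of_int k) \<partial>lborel))"
      unfolding scaleR_sum_right by (rule Bochner_Integration.integral_sum[OF i])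
    also have "\<dots> = (\<integral>u. (\<Sum>k\<in>{- int N..<int N}. indicator {of_int k..<of_int k + 1} u *\<^sub>R f u) \<partial>lborel)"
      unfolding s by (rule Bochner_Integration.integral_sum[OF i2, symmetric])
    also have "\<dots> = (\<integral>u. indicator {- real N..<real N} u *\<^sub>R f u \<partial>lborel)"
      by (simp add: scaleR_sum_left[symmetric] sum_indicator_unit_intervals)
    finally show ?thesis .
  qed
  have lim1: "(\<lambda>N. \<integral>u. indicator {- real N..<real N} u *\<^sub>R f u \<partial>lborel) \<longlonglongrightarrow> (\<integral>u. f u \<partial>lborel)"
  proof (rule integral_dominated_convergence[where w="\<lambda>x. norm (f x)"])
    show "AE x in lborel. (\<lambda>N. indicator {- real N..<real N} x *\<^sub>R f x) \<longlonglongrightarrow> f x"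
    proof (rule AE_I2)
      fix x :: real
      obtain n where n: "real n > \<bar>x\<bar>" using reals_Archimedean2 by blast
      have "eventually (\<lambda>N. indicator {- real N..<real N} x *\<^sub>R f x = f x) sequentially"
        using eventually_ge_at_top[of n] by eventually_elim (use n in \<open>auto simp: indicator_def\<close>)
      then show "(\<lambda>N. indicator {- real N..<real N} x *\<^sub>R f x) \<longlonglongrightarrow> f x" by (rule tendsto_eventually)
    qed
  qed (use fint in \<open>auto simp: indicator_def\<close>)
  define K where "K = (\<integral>x. cmod (E (of_real x)) \<partial>lborel) * (1 + exp (2 * pi))"
  have K0: "K \<ge> 0" unfolding K_def by simp
  have fper: "f (u + of_int k) = of_real (w u) * E (of_real u + of_int k)" for u k
    by (simp add: f_def per)
  have lim2: "(\<lambda>N. \<integral>u. indicator {0..<1} u *\<^sub>R (\<Sum>k\<in>{- int N..<int N}. f (u + of_int k)) \<partial>lborel) \<longlonglongrightarrow> (\<integral>u. indicator {0..<1} u *\<^sub>R (of_real (w u) * I) \<partial>lborel)"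
  proof (rule integral_dominated_convergence[where w="\<lambda>u. indicator {0..<1} u *\<^sub>R K"])
    show "integrable lborel (\<lambda>u. indicator {0..<1::real} u *\<^sub>R K)" by (intro integrable_scaleR_left integrable_real_indicator) auto
    show "AE u in lborel. (\<lambda>N. indicator {0..<1} u *\<^sub>R (\<Sum>k\<in>{- int N..<int N}. f (u + of_int k))) \<longlonglongrightarrow> indicator {0..<1} u *\<^sub>R (of_real (w u) * I)"
    proof (rule AE_I2)
      fix u :: real
      have "((\<lambda>k::int. E (of_real u + of_int k)) has_sum I) UNIV" unfolding I_def by (rule integer_translates_quadrature[OF E int])
      then have "((\<lambda>k::int. f (u + of_int k)) has_sum (of_real (w u) * I)) UNIV" unfolding fper by (rule has_sum_cmult_right)
      then have "((\<lambda>X. \<Sum>k\<in>X. f (u + of_int k)) \<longlongrightarrow> of_real (w u) * I) (finite_subsets_at_top UNIV)" by (simp add: has_sum_def)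
      from filterlim_compose[OF this filterlim_symmetric_int_intervals]
      show "(\<lambda>N. indicator {0..<1} u *\<^sub>R (\<Sum>k\<in>{- int N..<int N}. f (u + of_int k))) \<longlonglongrightarrow> indicator {0..<1} u *\<^sub>R (of_real (w u) * I)"
        by (intro tendsto_intros)
    qed
    show "AE u in lborel. norm (indicator {0..<1} u *\<^sub>R (\<Sum>k\<in>{- int N..<int N}. f (u + of_int k))) \<le> indicator {0..<1} u *\<^sub>R K" for N
    proof (rule AE_I2)
      fix u :: real
      have "norm (\<Sum>k\<in>{- int N..<int N}. f (u + of_int k)) \<le> (\<Sum>k\<in>{- int N..<int N}. cmod (E (of_real u + of_int k)))"
        using w1[of u] by (intro sum_norm_le) (auto simp: fper norm_mult intro: mult_left_le_one_le)
      also have "\<dots> \<le> K" using sum_integer_translates_bound[OF E _ int, of "{- int N..<int N}" "of_real u"] by (simp add: K_def)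
      finally show "norm (indicator {0..<1} u *\<^sub>R (\<Sum>k\<in>{- int N..<int N}. f (u + of_int k))) \<le> indicator {0..<1} u *\<^sub>R K"
        by (simp add: indicator_def)
    qed
    show "(\<lambda>u. indicator {0..<1} u *\<^sub>R (of_real (w u) * I)) \<in> borel_measurable lborel" by measurable
    show "(\<lambda>u. indicator {0..<1} u *\<^sub>R (\<Sum>k\<in>{- int N..<int N}. f (u + of_int k))) \<in> borel_measurable lborel" for N by measurable
  qed
  have "(\<integral>u. f u \<partial>lborel) = (\<integral>u. indicator {0..<1} u *\<^sub>R (of_real (w u) * I) \<partial>lborel)"
    using lim1 lim2 unfolding gint by (rule LIMSEQ_unique)
  also have "\<dots> = (\<integral>u. of_real (indicator {0..<1} u * w u) * I \<partial>lborel)"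
    by (intro Bochner_Integration.integral_cong) (auto simp: indicator_def)
  also have "\<dots> = (\<integral>u. of_real (indicator {0..<1} u * w u) \<partial>lborel) * I"
    by (cases "I = 0") (simp_all del: of_real_mult)
  also have "(\<integral>u. complex_of_real (indicator {0..<1} u * w u) \<partial>lborel) = of_real (\<integral>x. indicator {0..<1} x * w x \<partial>lborel)"
    by (rule integral_complex_of_real)
  finally show ?thesis by (simp add: f_def I_def)
qed

text \<open>Rescaled by 2, D has type 2\<pi> and the weight has period 1 and mean zero.\<close>

lemma integral_sgn_cos_exp_type_pi:
  assumes D: "exp_type_le D pi" and int: "integrable lborel (\<lambda>x. D (of_real x))"
  shows "(\<integral>x. of_real (sgn (cos (pi * x))) * D (of_real x) \<partial>lborel) = 0"
proof -
  define E where "E = (\<lambda>z. D (2 * z + 0))"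
  have E: "exp_type_le E (2 * pi)"
    using exp_type_le_compose_linear[OF D, of 2 0] by (simp add: E_def)
  have intE: "integrable lborel (\<lambda>x. E (of_real x))"
    using lborel_integrable_real_affine[OF int, of 2 0] by (simp add: E_def)
  define w where "w = (\<lambda>x. sgn (cos (2 * pi * x)))"
  have wm [measurable]: "w \<in> borel_measurable borel" unfolding w_def by measurable
  have w1: "\<bar>w x\<bar> \<le> 1" for x by (simp add: w_def sgn_if)
  have wp: "w (x + of_int k) = w x" for x k
  proof -
    have "cos (2 * pi * (x + of_int k)) = cos (2 * pi * x)"
      by (simp add: distrib_left cos_add cos_int_2pin sin_int_2pin mult.assoc[symmetric] mult.commute[of pi])
    then show ?thesis by (simp add: w_def)
  qed
  have wh: "w (x + 1/2) = - w x" for x by (simp add: w_def distrib_left sgn_minus)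
  have i: "integrable lborel (\<lambda>x. indicator {a..<b} x * w x)" for a b
  proof (rule Bochner_Integration.integrable_bound[of lborel "indicator {a..<b} :: real \<Rightarrow> real"])
    show "integrable lborel (indicator {a..<b} :: real \<Rightarrow> real)" by (cases "a \<le> b") simp_all
    show "AE x in lborel. norm (indicator {a..<b} x * w x) \<le> norm (indicator {a..<b} x :: real)"
      using w1 by (auto simp: indicator_def)
  qed measurable
  have "(\<integral>x. indicator {0..<1} x * w x \<partial>lborel) = (\<integral>x. indicator {0..<1/2} x * w x + indicator {1/2..<1} x * w x \<partial>lborel)"
    by (intro Bochner_Integration.integral_cong) (auto simp: indicator_def)
  also have "\<dots> = (\<integral>x. indicator {0..<1/2} x * w x \<partial>lborel) + (\<integral>x. indicator {1/2..<1} x * w x \<partial>lborel)"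
    by (rule Bochner_Integration.integral_add[OF i i])
  also have "(\<integral>x. indicator {1/2..<1} x * w x \<partial>lborel) = (\<integral>x. indicator {1/2..<1} (1/2 + x) * w (1/2 + x) \<partial>lborel)"
    using lborel_integral_real_affine[of 1 "\<lambda>x. indicator {1/2..<1} x * w x" "1/2"] by simp
  also have "\<dots> = (\<integral>x. - (indicator {0..<1/2} x * w x) \<partial>lborel)"
    using wh by (intro Bochner_Integration.integral_cong) (auto simp: indicator_def add.commute)
  finally have w0: "(\<integral>x. indicator {0..<1} x * w x \<partial>lborel) = 0" by simp
  have "(\<integral>x. of_real (sgn (cos (pi * x))) * D (of_real x) \<partial>lborel) = \<bar>2\<bar> *\<^sub>R (\<integral>x. of_real (sgn (cos (pi * (0 + 2 * x)))) * D (of_real (0 + 2 * x)) \<partial>lborel)"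
    by (rule lborel_integral_real_affine) simp
  also have "(\<integral>x. of_real (sgn (cos (pi * (0 + 2 * x)))) * D (of_real (0 + 2 * x)) \<partial>lborel) = (\<integral>x. of_real (w x) * E (of_real x) \<partial>lborel)"
    by (intro Bochner_Integration.integral_cong) (auto simp: w_def E_def mult_ac)
  also have "\<dots> = 0" using integral_periodic_weight[OF E intE wm w1 wp] w0 by simp
  finally show ?thesis by simp
qed

text \<open>By the quadrature formula the integral is a sum of nonpositive terms, hence at most each of them. In the equality case
of the extremal problem this forces every term to vanish.\<close>

lemma quadrature_nonpos_integral:
  assumes D: "exp_type_le D (2 * pi)" and int: "integrable lborel (\<lambda>x. D (of_real x))"
    and np: "\<And>k::int. Re (D (of_real x + of_int k)) \<le> 0"
  shows "Re (\<integral>x. D (of_real x) \<partial>lborel) \<le> Re (D (of_real x + of_int k))"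
proof -
  have "((\<lambda>k::int. - Re (D (of_real x + of_int k))) has_sum - Re (\<integral>x. D (of_real x) \<partial>lborel)) UNIV"
    using has_sum_Re[OF integer_translates_quadrature[OF D int, of x]] by (simp add: has_sum_uminus)
  from finite_sum_le_has_sum[OF this, of "{k}"] np show ?thesis by auto
qed

section \<open>Holomorphic parameter integrals and Gamma integrals\<close>

text \<open>The dominating function also controls the derivatives on a smaller disc, by Cauchy's inequality, and thereby the
difference quotients; dominated convergence differentiates under the integral sign.\<close>

lemma holomorphic_lebesgue_integral:
  fixes f :: "complex \<Rightarrow> real \<Rightarrow> complex"
  assumes hol: "\<And>t. (\<lambda>z. f z t) holomorphic_on UNIV"
    and meas: "\<And>z. f z \<in> borel_measurable lborel"
    and bound: "\<And>R. \<exists>g. integrable lborel g \<and> (\<forall>z t. cmod z \<le> R \<longrightarrow> cmod (f z t) \<le> g t)"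
  shows "(\<lambda>z. \<integral>t. f z t \<partial>lborel) holomorphic_on UNIV"
proof -
  have "((\<lambda>z. \<integral>t. f z t \<partial>lborel) has_field_derivative (\<integral>t. deriv (\<lambda>z. f z t) z0 \<partial>lborel)) (at z0)" for z0
  proof -
    obtain g where g: "integrable lborel g" "\<And>z t. cmod z \<le> cmod z0 + 2 \<Longrightarrow> cmod (f z t) \<le> g t"
      using bound[of "cmod z0 + 2"] by blast
    have int: "integrable lborel (f z)" if "cmod z \<le> cmod z0 + 2" for z
      by (rule Bochner_Integration.integrable_bound[OF g(1) meas]) (use g(2)[OF that] in \<open>auto intro: order_trans[OF _ abs_ge_self]\<close>)
    have deriv: "((\<lambda>z. f z t) has_field_derivative deriv (\<lambda>z. f z t) z) (at z within A)" for z t A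
      by (rule has_field_derivative_at_within, rule holomorphic_derivI[OF hol]) auto
    have derivb: "cmod (deriv (\<lambda>z. f z t) z) \<le> g t" if "z \<in> cball z0 1" for z t
    proof -
      have "norm ((deriv ^^ 1) (\<lambda>z. f z t) z) \<le> fact 1 * g t / 1 ^ 1"
      proof (rule Cauchy_inequality)
        show "(\<lambda>z. f z t) holomorphic_on ball z 1" by (rule holomorphic_on_subset[OF hol]) auto
        show "continuous_on (cball z 1) (\<lambda>z. f z t)"
          by (rule holomorphic_on_imp_continuous_on, rule holomorphic_on_subset[OF hol]) auto
        fix w assume w: "cmod (z - w) = 1"
        have "cmod w \<le> cmod z0 + (dist z0 z + dist z w)"
          using norm_triangle_ineq2[of w z0] dist_triangle[of z0 w z] by (simp add: dist_norm norm_minus_commute)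
        then show "cmod (f w t) \<le> g t" using w that by (intro g(2)) (simp add: dist_norm)
      qed simp
      then show ?thesis by simp
    qed
    have quot: "cmod ((f (z0 + h) t - f z0 t) / h) \<le> g t" if "h \<noteq> 0" "cmod h < 1" for h t
    proof -
      have "cmod (f (z0 + h) t - f z0 t) \<le> g t * cmod (z0 + h - z0)"
        by (rule field_differentiable_bound[where S="cball z0 1" and f="\<lambda>z. f z t" and f'="deriv (\<lambda>z. f z t)"])
           (use that deriv derivb in \<open>auto simp: dist_norm\<close>)
      then show ?thesis using that(1) by (simp add: norm_divide divide_le_eq)
    qed
    show ?thesis unfolding has_field_derivative_iff
    proof (subst tendsto_at_iff_sequentially, intro allI impI)
      fix X :: "nat \<Rightarrow> complex" assume X: "\<forall>i. X i \<in> UNIV - {z0}" "X \<longlonglongrightarrow> z0"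
      have "eventually (\<lambda>n. dist (X n) z0 < 1) sequentially" using X(2) by (rule tendstoD) simp
      then obtain N where N: "\<And>n. n \<ge> N \<Longrightarrow> dist (X n) z0 < 1" by (auto simp: eventually_sequentially)
      have L: "(\<lambda>n. \<integral>t. (f (X (n + N)) t - f z0 t) / (X (n + N) - z0) \<partial>lborel) \<longlonglongrightarrow> (\<integral>t. deriv (\<lambda>z. f z t) z0 \<partial>lborel)"
      proof (rule integral_dominated_convergence[where w=g])
        have XN: "(\<lambda>n. X (n + N)) \<longlonglongrightarrow> z0" using X(2) by (rule LIMSEQ_ignore_initial_segment)
        have lim: "(\<lambda>n. (f (X (n + N)) t - f z0 t) / (X (n + N) - z0)) \<longlonglongrightarrow> deriv (\<lambda>z. f z t) z0" for t
        proof -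
          have "((\<lambda>z. (f z t - f z0 t) / (z - z0)) \<longlongrightarrow> deriv (\<lambda>z. f z t) z0) (at z0)"
            using deriv[of t z0 UNIV] by (simp add: has_field_derivative_iff)
          then show ?thesis by (rule filterlim_compose) (use X(1) XN in \<open>auto simp: filterlim_at\<close>)
        qed
        show "AE t in lborel. (\<lambda>n. (f (X (n + N)) t - f z0 t) / (X (n + N) - z0)) \<longlonglongrightarrow> deriv (\<lambda>z. f z t) z0"
          using lim by simp
        show m: "(\<lambda>t. (f (X (n + N)) t - f z0 t) / (X (n + N) - z0)) \<in> borel_measurable lborel" for n
          using meas[of "X (n + N)"] meas[of z0] by measurable
        show "(\<lambda>t. deriv (\<lambda>z. f z t) z0) \<in> borel_measurable lborel"
          by (rule borel_measurable_LIMSEQ_metric[OF m lim])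
        show "integrable lborel g" by (rule g(1))
        show "AE t in lborel. norm ((f (X (n + N)) t - f z0 t) / (X (n + N) - z0)) \<le> g t" for n
          using quot[of "X (n + N) - z0"] X(1) N[of "n + N"] by (simp add: dist_norm)
      qed
      have eq: "(\<integral>t. (f (X (n + N)) t - f z0 t) / (X (n + N) - z0) \<partial>lborel)
          = ((\<integral>t. f (X (n + N)) t \<partial>lborel) - (\<integral>t. f z0 t \<partial>lborel)) / (X (n + N) - z0)" for n
      proof -
        have "cmod (X (n + N)) \<le> cmod z0 + 2" using N[of "n + N"] norm_triangle_ineq2[of "X (n + N)" z0] by (simp add: dist_norm)
        then show ?thesis using int[of "X (n + N)"] int[of z0] by simp
      qed
      show "((\<lambda>z. ((\<integral>t. f z t \<partial>lborel) - (\<integral>t. f z0 t \<partial>lborel)) / (z - z0)) \<circ> X) \<longlonglongrightarrow> (\<integral>t. deriv (\<lambda>z. f z t) z0 \<partial>lborel)"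
        unfolding o_def by (rule LIMSEQ_offset[where k=N]) (use L in \<open>simp only: eq\<close>)
    qed
  qed
  then show ?thesis by (meson holomorphic_on_open open_UNIV)
qed

lemma ennreal_mult_indicator:
  "a \<ge> 0 \<Longrightarrow> b \<ge> 0 \<Longrightarrow> ennreal (a * b) * i = ennreal a * (ennreal b * i)"
  by (simp add: ennreal_mult mult.assoc)

lemma nn_integral_substitution_square:
  fixes f :: "real \<Rightarrow> real"
  assumes [measurable]: "f \<in> borel_measurable borel" and f0: "\<And>x. f x \<ge> 0"
  shows "(\<integral>\<^sup>+v. ennreal (f v) * indicator {0<..} v \<partial>lborel) = (\<integral>\<^sup>+t. ennreal (f (t^2) * (2 * t)) * indicator {0<..} t \<partial>lborel)"
proof -
  have fin: "(\<integral>\<^sup>+v. ennreal (f v) * indicator {0..(real n)^2} v \<partial>lborel) = (\<integral>\<^sup>+t. ennreal (f (t^2) * (2 * t)) * indicator {0..real n} t \<partial>lborel)" for n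
  proof -
    have "(\<integral>\<^sup>+v. ennreal (f v * indicator {0\<^sup>2..(real n)\<^sup>2} v) \<partial>lborel) = (\<integral>\<^sup>+t. ennreal (f (t\<^sup>2) * (2 * t) * indicator {0..real n} t) \<partial>lborel)"
      by (rule nn_integral_substitution[where g="\<lambda>x. x^2" and g'="\<lambda>x. 2 * x"])
         (auto intro!: derivative_eq_intros continuous_intros simp: set_borel_measurable_def)
    moreover have "ennreal (f v * indicator A v) = ennreal (f v) * indicator A v" for v and A :: "real set" by (simp add: indicator_def)
    moreover have "ennreal (c * indicator A v) = ennreal c * indicator A v" for c v and A :: "real set" by (simp add: indicator_def)
    ultimately show ?thesis by simp
  qed
  have sup: "(\<integral>\<^sup>+v. g v * indicator {0<..} v \<partial>lborel) = (SUP n. \<integral>\<^sup>+v. g v * indicator {0..a n} v \<partial>lborel)"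
    if [measurable]: "g \<in> borel_measurable borel" and a: "incseq a" "filterlim a at_top sequentially" for g :: "real \<Rightarrow> ennreal" and a :: "nat \<Rightarrow> real"
  proof -
    have "(\<integral>\<^sup>+v. g v * indicator {0<..} v \<partial>lborel) = (\<integral>\<^sup>+v. (SUP n. g v * indicator {0..a n} v) \<partial>lborel)"
    proof (rule nn_integral_cong_AE)
      have "AE v in lborel. v \<noteq> (0::real)" by (rule AE_lborel_singleton)
      then show "AE v in lborel. g v * indicator {0<..} v = (SUP n. g v * indicator {0..a n} v)"
      proof eventually_elim
        case (elim v)
        show ?case
        proof (cases "v > 0")
          case True
          obtain n where n: "a n \<ge> v" using a(2) by (auto simp: filterlim_at_top eventually_sequentially)
          have "g v * indicator {0<..} v \<le> g v * indicator {0..a n} v" using n True by (simp add: indicator_def)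
          also have "\<dots> \<le> (SUP n. g v * indicator {0..a n} v)" by (rule SUP_upper) simp
          finally have 1: "g v * indicator {0<..} v \<le> (SUP n. g v * indicator {0..a n} v)" .
          have 2: "(SUP n. g v * indicator {0..a n} v) \<le> g v * indicator {0<..} v"
            by (rule SUP_least) (use True in \<open>auto simp: indicator_def\<close>)
          show ?thesis using 1 2 by (rule antisym)
        qed (use elim in \<open>auto simp: indicator_def\<close>)
      qed
    qed
    also have "\<dots> = (SUP n. \<integral>\<^sup>+v. g v * indicator {0..a n} v \<partial>lborel)"
    proof (rule nn_integral_monotone_convergence_SUP)
      show "incseq (\<lambda>n v. g v * indicator {0..a n} v)"
        using a(1) unfolding incseq_def le_fun_def by (auto simp: indicator_def intro: order_trans)
    qed measurable
    finally show ?thesis .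
  qed
  have a1: "incseq (\<lambda>n. (real n)^2)" "filterlim (\<lambda>n. (real n)^2) at_top sequentially"
    by (auto simp: incseq_def power_mono) real_asymp
  have a2: "incseq real" "filterlim real at_top sequentially"
    by (auto simp: incseq_def filterlim_real_sequentially)
  show ?thesis
    unfolding sup[of "\<lambda>v. ennreal (f v)", OF _ a1, simplified] sup[of "\<lambda>t. ennreal (f (t^2) * (2 * t))", OF _ a2, simplified] fin ..
qed

lemma nn_integral_Gamma_scaled:
  assumes b: "b > 0" and y: "y > 0"
  shows "(\<integral>\<^sup>+v. ennreal (v powr (b - 1) * exp (- y * v)) * indicator {0<..} v \<partial>lborel) = ennreal (Gamma b * y powr (- b))"
proof -
  have "ennreal (Gamma b) = (\<integral>\<^sup>+t. ennreal (indicator {0..} t * t powr (b - 1) / exp t) \<partial>lborel)"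
    using Gamma_conv_nn_integral_real[OF b] .
  also have "\<dots> = ennreal \<bar>y\<bar> * (\<integral>\<^sup>+t. ennreal (indicator {0..} (0 + y * t) * (0 + y * t) powr (b - 1) / exp (0 + y * t)) \<partial>lborel)"
    by (rule nn_integral_real_affine) (use y in auto)
  also have "\<dots> = (\<integral>\<^sup>+t. ennreal y * ennreal (indicator {0..} (y * t) * (y * t) powr (b - 1) / exp (y * t)) \<partial>lborel)"
    using y by (subst nn_integral_cmult) auto
  also have "\<dots> = (\<integral>\<^sup>+v. ennreal (y powr b) * (ennreal (v powr (b - 1) * exp (- y * v)) * indicator {0<..} v) \<partial>lborel)"
  proof (rule nn_integral_cong_AE)
    have "AE v in lborel. v \<noteq> (0::real)" by (rule AE_lborel_singleton)
    then show "AE v in lborel. ennreal y * ennreal (indicator {0..} (y * v) * (y * v) powr (b - 1) / exp (y * v)) = ennreal (y powr b) * (ennreal (v powr (b - 1) * exp (- y * v)) * indicator {0<..} v)"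
    proof eventually_elim
      case (elim v)
      show ?case
      proof (cases "v > 0")
        case True
        have "y * ((y * v) powr (b - 1) / exp (y * v)) = y powr b * (v powr (b - 1) * exp (- y * v))"
          using True y by (simp add: powr_mult powr_diff exp_minus field_simps)
        then show ?thesis using True y by (simp add: ennreal_mult[symmetric])
      next
        case False
        then have "v < 0" using elim by simp
        then have "y * v < 0" using y by (simp add: mult_pos_neg)
        then show ?thesis using False by (simp add: indicator_def)
      qed
    qed
  qed
  also have "\<dots> = ennreal (y powr b) * (\<integral>\<^sup>+v. ennreal (v powr (b - 1) * exp (- y * v)) * indicator {0<..} v \<partial>lborel)"
    by (rule nn_integral_cmult) measurable
  finally have "ennreal (y powr (-b)) * ennreal (Gamma b) = ennreal (y powr (-b)) * (ennreal (y powr b) * (\<integral>\<^sup>+v. ennreal (v powr (b - 1) * exp (- y * v)) * indicator {0<..} v \<partial>lborel))"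
    by simp
  also have "\<dots> = (ennreal (y powr (-b)) * ennreal (y powr b)) * (\<integral>\<^sup>+v. ennreal (v powr (b - 1) * exp (- y * v)) * indicator {0<..} v \<partial>lborel)"
    by (rule mult.assoc[symmetric])
  also have "ennreal (y powr (-b)) * ennreal (y powr b) = 1"
    using y by (simp add: ennreal_mult[symmetric] powr_add[symmetric])
  finally show ?thesis using b y by (simp add: ennreal_mult[symmetric] mult.commute)
qed

text \<open>Write 1/(1+t^2) as the integral of exp(-(1+t^2)y) over y > 0 and exchange the integrals: the t-integral is a Gamma integral after the
substitution v = t^2, and so is the remaining y-integral.\<close>

lemma nn_integral_powr_over_one_plus_square:
  assumes s: "-2 < s" "s < 0"
  shows "(\<integral>\<^sup>+t. ennreal (t powr (s + 1) / (1 + t^2)) * indicator {0<..} t \<partial>lborel) = ennreal (Gamma (- s / 2) * Gamma (1 + s / 2) / 2)"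
proof -
  have inner: "ennreal (1 / (1 + t^2)) = (\<integral>\<^sup>+y. ennreal (exp (- (1 + t^2) * y)) * indicator {0<..} y \<partial>lborel)" for t :: real
  proof -
    have "1 + t^2 > 0" by (simp add: add_pos_nonneg)
    from nn_integral_Gamma_scaled[OF zero_less_one this]
    have "ennreal (1 / (1 + t^2)) = (\<integral>\<^sup>+y. ennreal (y powr 0 * exp (- (1 + t^2) * y)) * indicator {0<..} y \<partial>lborel)"
      using \<open>1 + t^2 > 0\<close> by (simp add: powr_minus inverse_eq_divide)
    also have "\<dots> = (\<integral>\<^sup>+y. ennreal (exp (- (1 + t^2) * y)) * indicator {0<..} y \<partial>lborel)"
      by (intro nn_integral_cong) (auto simp: indicator_def)
    finally show ?thesis .
  qed
  have gauss: "(\<integral>\<^sup>+t. ennreal (t powr (s + 1) * exp (- y * t^2)) * indicator {0<..} t \<partial>lborel) = ennreal (Gamma (1 + s/2) / 2 * y powr (- (1 + s/2)))"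
    if y: "y > 0" for y
  proof -
    have b: "1 + s/2 > 0" using s by simp
    have "(\<integral>\<^sup>+t. ennreal (t powr (s + 1) * exp (- y * t^2)) * indicator {0<..} t \<partial>lborel)
        = (\<integral>\<^sup>+t. ennreal ((1/2 * ((t^2) powr ((1 + s/2) - 1) * exp (- y * t^2))) * (2 * t)) * indicator {0<..} t \<partial>lborel)"
    proof (rule nn_integral_cong)
      fix t :: real
      show "ennreal (t powr (s + 1) * exp (- y * t^2)) * indicator {0<..} t = ennreal ((1/2 * ((t^2) powr ((1 + s/2) - 1) * exp (- y * t^2))) * (2 * t)) * indicator {0<..} t"
      proof (cases "t > 0")
        case True
        then have "t^2 = t powr 2" by simp
        then have "(t^2) powr (s/2) = t powr (2 * (s/2))" by (simp only: powr_powr)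
        then have "(t^2) powr (s/2) = t powr s" by simp
        moreover have "t powr (s + 1) = t powr s * t" using True by (simp add: powr_add)
        ultimately show ?thesis using True by simp
      qed simp
    qed
    also have "\<dots> = (\<integral>\<^sup>+v. ennreal (1/2 * (v powr ((1 + s/2) - 1) * exp (- y * v))) * indicator {0<..} v \<partial>lborel)"
      by (rule nn_integral_substitution_square[symmetric]) auto
    also have "\<dots> = (\<integral>\<^sup>+v. ennreal (1/2) * (ennreal (v powr ((1 + s/2) - 1) * exp (- y * v)) * indicator {0<..} v) \<partial>lborel)"
      by (intro nn_integral_cong ennreal_mult_indicator) auto
    also have "\<dots> = ennreal (1/2) * (\<integral>\<^sup>+v. ennreal (v powr ((1 + s/2) - 1) * exp (- y * v)) * indicator {0<..} v \<partial>lborel)"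
      by (rule nn_integral_cmult) measurable
    also have "\<dots> = ennreal (1/2) * ennreal (Gamma (1 + s/2) * y powr (- (1 + s/2)))"
      by (subst nn_integral_Gamma_scaled[OF b y]) simp
    also have "\<dots> = ennreal (1/2 * (Gamma (1 + s/2) * y powr (- (1 + s/2))))"
      using b by (intro ennreal_mult[symmetric]) auto
    finally show ?thesis by simp
  qed
  have "(\<integral>\<^sup>+t. ennreal (t powr (s + 1) / (1 + t^2)) * indicator {0<..} t \<partial>lborel)
     = (\<integral>\<^sup>+t. (\<integral>\<^sup>+y. ennreal (t powr (s + 1)) * indicator {0<..} t * (ennreal (exp (- (1 + t^2) * y)) * indicator {0<..} y) \<partial>lborel) \<partial>lborel)"
  proof (rule nn_integral_cong)
    fix t :: real
    have "ennreal (t powr (s + 1) / (1 + t^2)) * indicator {0<..} t = ennreal (t powr (s + 1)) * indicator {0<..} t * ennreal (1 / (1 + t^2))"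
      by (simp add: ennreal_mult[symmetric] indicator_def add_pos_nonneg)
    also have "\<dots> = (\<integral>\<^sup>+y. ennreal (t powr (s + 1)) * indicator {0<..} t * (ennreal (exp (- (1 + t^2) * y)) * indicator {0<..} y) \<partial>lborel)"
      unfolding inner by (rule nn_integral_cmult[symmetric]) measurable
    finally show "ennreal (t powr (s + 1) / (1 + t^2)) * indicator {0<..} t = (\<integral>\<^sup>+y. ennreal (t powr (s + 1)) * indicator {0<..} t * (ennreal (exp (- (1 + t^2) * y)) * indicator {0<..} y) \<partial>lborel)" .
  qed
  also have "\<dots> = (\<integral>\<^sup>+y. (\<integral>\<^sup>+t. ennreal (t powr (s + 1)) * indicator {0<..} t * (ennreal (exp (- (1 + t^2) * y)) * indicator {0<..} y) \<partial>lborel) \<partial>lborel)"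
    by (rule lborel_pair.Fubini'[symmetric]) measurable
  also have "\<dots> = (\<integral>\<^sup>+y. ennreal (Gamma (1 + s/2) / 2) * (ennreal (y powr (- s/2 - 1) * exp (- 1 * y)) * indicator {0<..} y) \<partial>lborel)"
  proof (rule nn_integral_cong)
    fix y :: real
    show "(\<integral>\<^sup>+t. ennreal (t powr (s + 1)) * indicator {0<..} t * (ennreal (exp (- (1 + t^2) * y)) * indicator {0<..} y) \<partial>lborel)
      = ennreal (Gamma (1 + s/2) / 2) * (ennreal (y powr (- s/2 - 1) * exp (- 1 * y)) * indicator {0<..} y)"
    proof (cases "y > 0")
      case True
      have "(\<integral>\<^sup>+t. ennreal (t powr (s + 1)) * indicator {0<..} t * (ennreal (exp (- (1 + t^2) * y)) * indicator {0<..} y) \<partial>lborel)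
        = (\<integral>\<^sup>+t. ennreal (exp (- y)) * (ennreal (t powr (s + 1) * exp (- y * t^2)) * indicator {0<..} t) \<partial>lborel)"
      proof (rule nn_integral_cong)
        fix t :: real
        have "exp (- (1 + t^2) * y) = exp (- y) * exp (- y * t^2)" by (simp add: exp_add[symmetric] algebra_simps)
        then show "ennreal (t powr (s + 1)) * indicator {0<..} t * (ennreal (exp (- (1 + t^2) * y)) * indicator {0<..} y)
          = ennreal (exp (- y)) * (ennreal (t powr (s + 1) * exp (- y * t^2)) * indicator {0<..} t)"
          using True by (simp add: ennreal_mult[symmetric] indicator_def mult_ac)
      qed
      also have "\<dots> = ennreal (exp (- y)) * (\<integral>\<^sup>+t. ennreal (t powr (s + 1) * exp (- y * t^2)) * indicator {0<..} t \<partial>lborel)"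
        by (rule nn_integral_cmult) measurable
      also have "\<dots> = ennreal (exp (- y)) * ennreal (Gamma (1 + s/2) / 2 * y powr (- (1 + s/2)))" unfolding gauss[OF True] ..
      also have "- (1 + s/2) = - s/2 - 1" by simp
      finally show ?thesis using True s by (simp add: ennreal_mult[symmetric] mult_ac)
    qed simp
  qed
  also have "\<dots> = ennreal (Gamma (1 + s/2) / 2) * (\<integral>\<^sup>+y. ennreal (y powr (- s/2 - 1) * exp (- 1 * y)) * indicator {0<..} y \<partial>lborel)"
    by (rule nn_integral_cmult) measurable
  also have "\<dots> = ennreal (Gamma (1 + s/2) / 2) * ennreal (Gamma (- s/2) * 1 powr (- (- s/2)))"
    using s by (subst nn_integral_Gamma_scaled) auto
  finally show ?thesis using s by (simp add: ennreal_mult[symmetric] mult_ac)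
qed

section \<open>Entire functions with a prescribed sign of the gap\<close>

text \<open>Moving the two arguments by m in opposite directions costs one sign per step. This is how the Beta integral with exponent
\<sigma> - 2m is related to \<gamma>(-\<sigma>).\<close>

lemma Gamma_reflection_shift:
  fixes x :: real
  assumes x: "x \<notin> \<int>"
  shows "Gamma (real m - x) * Gamma (1 + x - real m) = (-1) ^ m * (Gamma (- x) * Gamma (1 + x))"
proof (induction m)
  case (Suc m)
  have nz: "real m - x \<notin> \<int>"
  proof
    assume "real m - x \<in> \<int>"
    then have "real m - (real m - x) \<in> \<int>" by (intro Ints_diff) auto
    then show False using x by simp
  qed
  then have n1: "real m - x \<notin> \<int>\<^sub>\<le>\<^sub>0" by (auto dest: nonpos_Ints_Int)
  have nz': "x - real m \<notin> \<int>" using nz Ints_minus[of "x - real m"] by auto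
  then have n2: "x - real m \<notin> \<int>\<^sub>\<le>\<^sub>0" by (auto dest: nonpos_Ints_Int)
  have "Gamma ((real m - x) + 1) = (real m - x) * Gamma (real m - x)" by (rule Gamma_plus1[OF n1])
  moreover have "Gamma ((x - real m) + 1) = (x - real m) * Gamma (x - real m)" by (rule Gamma_plus1[OF n2])
  moreover have "x - real m \<noteq> 0" using nz' by auto
  moreover have "real (Suc m) - x = (real m - x) + 1" "1 + x - real (Suc m) = x - real m" "1 + x - real m = (x - real m) + 1"
    by auto
  ultimately have "Gamma (real (Suc m) - x) * Gamma (1 + x - real (Suc m)) = - (Gamma (real m - x) * Gamma (1 + x - real m))"
    by (simp only:) (simp add: left_diff_distrib right_diff_distrib mult_ac)
  then show ?case using Suc by simp
qed simp

lemma abs_le_abs_of_nonneg: "(0::real) \<le> a \<Longrightarrow> a \<le> b \<Longrightarrow> \<bar>a\<bar> \<le> \<bar>b\<bar>"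
  by simp

lemma add_power_le_exp:
  fixes e R :: real
  assumes "e > 0" "R \<ge> 0" "n > 0"
  shows "(R + 3) ^ n \<le> ((real n / e) ^ n * exp (e * 3)) * exp (e * R)"
proof -
  have "e * (R + 3) / real n \<le> exp (e * (R + 3) / real n)"
    using exp_ge_add_one_self[of "e * (R + 3) / real n"] by linarith
  then have "(e * (R + 3) / real n) ^ n \<le> exp (e * (R + 3) / real n) ^ n"
    using assms by (intro power_mono) auto
  also have "\<dots> = exp (e * (R + 3))" using assms by (simp add: exp_of_nat_mult[symmetric])
  finally have "(real n / e) ^ n * (e * (R + 3) / real n) ^ n \<le> (real n / e) ^ n * exp (e * (R + 3))"
    using assms by (intro mult_left_mono) auto
  moreover have "(real n / e) ^ n * (e * (R + 3) / real n) ^ n = (R + 3) ^ n"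
    unfolding power_mult_distrib[symmetric] using assms by simp
  ultimately show ?thesis by (simp add: distrib_left exp_add mult_ac)
qed

text \<open>S is the sign pattern: an even entire function of type \<tau> that on the imaginary axis is \<epsilon> times a positive function w.
The three cases of interest are cos^2 \<pi>z, sin^2 \<pi>z and cos \<pi>z. The last assumption is the convergence of the
potential below; for sin^2 it needs \<sigma> > 0 because of the double zero of sinh^2 at 0.\<close>

locale sign_pattern =
  fixes S :: "complex \<Rightarrow> complex" and \<tau> K \<epsilon> :: real and w :: "real \<Rightarrow> real" and \<sigma> :: real and m :: nat
  assumes S_hol: "S holomorphic_on UNIV" and \<tau>: "\<tau> \<ge> 0"
    and S_bound: "\<And>z. cmod (S z) \<le> K * exp (\<tau> * cmod z)"
    and S_even: "\<And>z. S (- z) = S z" and S_real: "\<And>x. S (of_real x) \<in> \<real>"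
    and S_imag: "\<And>t. t > 0 \<Longrightarrow> S (\<i> * of_real t) = of_real (\<epsilon> * w t)"
    and w_pos: "\<And>t. t > 0 \<Longrightarrow> w t > 0" and w_meas [measurable]: "w \<in> borel_measurable borel"
    and eps: "\<epsilon> = 1 \<or> \<epsilon> = -1"
    and \<sigma>: "2 * real m - 2 < \<sigma>" "\<sigma> < 2 * real m" "\<sigma> > -1"
    and w_int: "integrable lborel (\<lambda>t. indicator {0<..} t *\<^sub>R (t powr (\<sigma> + 1) / w t))"
begin

text \<open>The normalization for which the gap formula produces exactly the factor \<gamma>(-\<sigma>); see Gamma_kappa.\<close>

definition kappa :: real where "kappa = 2 * pi powr (\<sigma> / 2) / Gamma (1 + \<sigma> / 2)"

definition potential :: "real \<Rightarrow> real" where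
  "potential x = (\<integral>t. indicator {0<..} t *\<^sub>R (t powr (\<sigma> + 1) / ((x^2 + t^2) * w t)) \<partial>lborel)"

text \<open>The numerator of the integrand of F, a polynomial minus a multiple of S. Since S(it) = S(-it) = \<epsilon> w(t), it vanishes at
z = it and z = -it, and it is divisible by z^2 + t^2.\<close>

definition numer :: "real \<Rightarrow> complex \<Rightarrow> complex" where
  "numer t z = (-1) ^ m * z ^ (2 * m) - of_real (t ^ (2 * m) / (\<epsilon> * w t)) * S z"

lemma numer_divisible:
  assumes t: "t > 0"
  shows "\<exists>E. E holomorphic_on UNIV \<and> (\<forall>z. numer t z = (z^2 + of_real t ^ 2) * E z)"
proof -
  define a where "a = \<i> * complex_of_real t"
  have hol: "numer t holomorphic_on UNIV" unfolding numer_def[abs_def] by (intro holomorphic_intros S_hol)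
  have ne: "\<epsilon> * w t \<noteq> 0" using w_pos[OF t] eps by auto
  have "a ^ (2 * m) = (-1) ^ m * of_real (t ^ (2 * m))"
  proof -
    have "a ^ (2 * m) = (a^2) ^ m" by (rule power_mult)
    also have "a^2 = - (of_real t ^ 2)" by (simp add: a_def power_mult_distrib)
    also have "(- (of_real t ^ 2)) ^ m = (-1) ^ m * (complex_of_real t ^ 2) ^ m" by (rule power_minus)
    finally show ?thesis by (simp add: power_mult)
  qed
  moreover have "S a = of_real (\<epsilon> * w t)" using S_imag[OF t] by (simp add: a_def)
  ultimately have "numer t a = ((-1) ^ m * (-1) ^ m) * of_real (t ^ (2 * m)) - of_real (t ^ (2 * m) / (\<epsilon> * w t) * (\<epsilon> * w t))"
    by (simp only: numer_def of_real_mult mult.assoc)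
  also have "t ^ (2 * m) / (\<epsilon> * w t) * (\<epsilon> * w t) = t ^ (2 * m)" using ne by simp
  also have "(-1) ^ m * (-1) ^ m = (1::complex)" by (simp flip: power_mult_distrib)
  finally have na: "numer t a = 0" by simp
  have even: "numer t (- z) = numer t z" for z by (simp add: numer_def S_even)
  obtain E1 where E1: "E1 holomorphic_on UNIV" "\<And>z. numer t z = (z - a) * E1 z"
    using entire_divide_simple_zero[OF hol na] by metis
  have a0: "a \<noteq> 0" using t by (simp add: a_def)
  have "E1 (- a) = 0" using E1(2)[of "- a"] even[of a] na a0 by simp
  then obtain E where E: "E holomorphic_on UNIV" "\<And>z. E1 z = (z - - a) * E z"
    using entire_divide_simple_zero[OF E1(1), of "- a"] by metis
  have "numer t z = (z^2 + of_real t ^ 2) * E z" for z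
  proof -
    have "numer t z = ((z - a) * (z - - a)) * E z" unfolding E1(2) E(2) by simp
    also have "(z - a) * (z - - a) = z^2 + of_real t ^ 2"
      by (simp add: a_def algebra_simps power2_eq_square)
    finally show ?thesis .
  qed
  then show ?thesis using E(1) by blast
qed

text \<open>The entire quotient of the numerator by z^2 + t^2. Choosing it by its defining equation avoids a case distinction at
the removable singularities.\<close>

definition quot_kernel :: "real \<Rightarrow> complex \<Rightarrow> complex" where
  "quot_kernel t = (SOME E. E holomorphic_on UNIV \<and> (\<forall>z. numer t z = (z^2 + of_real t ^ 2) * E z))"

lemma quot_kernel: "quot_kernel t holomorphic_on UNIV" "numer t z = (z^2 + of_real t ^ 2) * quot_kernel t z" if "t > 0"
  using someI_ex[OF numer_divisible[OF that]] unfolding quot_kernel_def by blast+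

definition integrand :: "complex \<Rightarrow> real \<Rightarrow> complex" where
  "integrand z t = (if t > 0 then of_real (t powr (\<sigma> + 1 - 2 * real m)) * quot_kernel t z else 0)"

definition dominator :: "real \<Rightarrow> real" where
  "dominator t = indicator {0<..} t * (t powr (\<sigma> + 1 - 2 * real m) / (1 + t^2)) + indicator {0<..} t *\<^sub>R (t powr (\<sigma> + 1) / w t)"

lemma powr_times_power: "t > 0 \<Longrightarrow> t powr (\<sigma> + 1 - 2 * real m) * t ^ (2 * m) = t powr (\<sigma> + 1)"
  by (simp add: powr_realpow[symmetric] powr_add[symmetric] del: powr_realpow)

lemma K_nonneg: "K \<ge> 0"
proof -
  have "0 \<le> K * exp (\<tau> * cmod 0)" using S_bound[of 0] norm_ge_zero order_trans by blast
  then show ?thesis by simp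
qed

lemma numer_bound:
  assumes t: "t > 0" and z: "cmod z \<le> r"
  shows "cmod (numer t z) \<le> r ^ (2 * m) + t ^ (2 * m) / w t * (K * exp (\<tau> * r))"
proof -
  have e: "cmod (of_real (t ^ (2 * m) / (\<epsilon> * w t))) = t ^ (2 * m) / w t"
    using w_pos[OF t] t eps by (auto simp: norm_divide norm_mult norm_power)
  have "cmod (numer t z) \<le> cmod ((-1) ^ m * z ^ (2 * m)) + cmod (of_real (t ^ (2 * m) / (\<epsilon> * w t)) * S z)"
    unfolding numer_def by (rule norm_triangle_ineq4)
  also have "\<dots> = cmod z ^ (2 * m) + t ^ (2 * m) / w t * cmod (S z)"
    by (simp only: norm_mult e norm_power norm_minus_cancel norm_one power_one mult_1_left)
  also have "\<dots> \<le> r ^ (2 * m) + t ^ (2 * m) / w t * (K * exp (\<tau> * r))"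
  proof (intro add_mono power_mono mult_left_mono z)
    have "K * exp (\<tau> * cmod z) \<le> K * exp (\<tau> * r)"
      using z \<tau> K_nonneg by (intro mult_left_mono) (auto intro: mult_left_mono)
    then show "cmod (S z) \<le> K * exp (\<tau> * r)" using S_bound[of z] by linarith
    show "0 \<le> t ^ (2 * m) / w t" using t w_pos[OF t] by simp
  qed simp
  finally show ?thesis .
qed

text \<open>For t > R + 2 the denominator z^2 + t^2 is bounded below directly. For t \<le> R + 2 the singularities may lie in the disc
|z| \<le> R, and the bound is transported from the circle of radius R + 3 by the maximum principle. Both cases give a factor that
grows in R like exp(\<tau>R) up to a polynomial, times an integrable function of t.\<close>

lemma integrand_bound:
  assumes z: "cmod z \<le> R"
  shows "cmod (integrand z t) \<le> ((R + 3) ^ (2 * m + 2) + K * exp (\<tau> * (R + 3))) * dominator t"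
proof (cases "t > 0")
  case t: True
  have R: "R \<ge> 0" using z norm_ge_zero order_trans by blast
  define p where "p = t powr (\<sigma> + 1 - 2 * real m)"
  have p: "p > 0" using t by (simp add: p_def)
  have t2: "1 + t^2 > 0" by (simp add: add_pos_nonneg)
  have wt: "w t > 0" by (rule w_pos[OF t])
  have kb: "cmod (quot_kernel t z) \<le> (R + 3) ^ (2 * m) * ((R + 3)^2 / (1 + t^2)) + t ^ (2 * m) / w t * (K * exp (\<tau> * (R + 3)))"
  proof (cases "t \<le> R + 2")
    case True
    have sph: "cmod (quot_kernel t v) \<le> (R + 3) ^ (2 * m) + t ^ (2 * m) / w t * (K * exp (\<tau> * (R + 3)))" if v: "cmod v = R + 3" for v
    proof -
      have "t^2 \<le> (R + 2)^2" using True t by (intro power_mono) auto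
      then have "1 \<le> (R + 3)^2 - t^2" using R by (simp add: power2_eq_square algebra_simps)
      also have "\<dots> = cmod (v^2) - cmod (- (of_real t ^ 2))" using v by (simp add: norm_power)
      also have "\<dots> \<le> cmod (v^2 - - (of_real t ^ 2))" by (rule norm_triangle_ineq2)
      finally have "1 * cmod (quot_kernel t v) \<le> cmod (v^2 + of_real t ^ 2) * cmod (quot_kernel t v)" by (intro mult_right_mono) auto
      also have "\<dots> = cmod (numer t v)" unfolding quot_kernel(2)[OF t, of v] by (rule norm_mult[symmetric])
      also have "\<dots> \<le> (R + 3) ^ (2 * m) + t ^ (2 * m) / w t * (K * exp (\<tau> * (R + 3)))"
        using numer_bound[OF t, of v "R + 3"] v by simp
      finally show ?thesis by simp
    qed
    have "cmod (quot_kernel t z) \<le> (R + 3) ^ (2 * m) + t ^ (2 * m) / w t * (K * exp (\<tau> * (R + 3)))"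
    proof (rule maximum_modulus_frontier[of "quot_kernel t" "cball 0 (R + 3)"])
      show "quot_kernel t holomorphic_on interior (cball 0 (R + 3))" by (rule holomorphic_on_subset[OF quot_kernel(1)[OF t]]) simp
      show "continuous_on (closure (cball 0 (R + 3))) (quot_kernel t)"
        by (rule holomorphic_on_imp_continuous_on, rule holomorphic_on_subset[OF quot_kernel(1)[OF t]]) simp
    qed (use sph z R in \<open>auto simp: dist_norm\<close>)
    also have "(R + 3) ^ (2 * m) \<le> (R + 3) ^ (2 * m) * ((R + 3)^2 / (1 + t^2))"
    proof -
      have "t^2 \<le> (R + 2)^2" using True t by (intro power_mono) auto
      then have "1 + t^2 \<le> (R + 3)^2" using R by (simp add: power2_eq_square algebra_simps)
      then have "1 \<le> (R + 3)^2 / (1 + t^2)" using t2 by simp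
      then show ?thesis using R mult_left_mono[of 1 "(R + 3)^2 / (1 + t^2)" "(R + 3) ^ (2 * m)"] by simp
    qed
    finally show ?thesis by simp
  next
    case False
    then have tR: "t > R + 2" by simp
    have tt: "t^2 \<ge> (R + 2)^2" using tR R by (intro power_mono) auto
    have d1: "1 \<le> t^2 - R^2" using tt R by (simp add: power2_eq_square algebra_simps)
    have d2: "1 + t^2 \<le> (R + 3)^2 * (t^2 - R^2)"
    proof -
      have "(R + 2)^2 * ((R + 3)^2 - 1) \<le> t^2 * ((R + 3)^2 - 1)"
        using tt R by (intro mult_right_mono) (auto simp: power2_eq_square algebra_simps)
      moreover have "R^2 * (R + 3)^2 + 1 \<le> (R + 2)^2 * ((R + 3)^2 - 1)"
      proof -
        have "(R + 2)^2 * ((R + 3)^2 - 1) - R^2 * (R + 3)^2 - 1 = 4 * (R * R * R) + 27 * (R * R) + 56 * R + 31"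
          by (simp add: power2_eq_square algebra_simps)
        moreover have "4 * (R * R * R) + 27 * (R * R) + 56 * R + 31 \<ge> 0" using R by simp
        ultimately show ?thesis by linarith
      qed
      moreover have "(R + 3)^2 * (t^2 - R^2) = t^2 * ((R + 3)^2 - 1) - R^2 * (R + 3)^2 + t^2" by (simp add: algebra_simps)
      ultimately show ?thesis by linarith
    qed
    have "cmod z ^ 2 \<le> R^2" using z by (intro power_mono) auto
    then have "t^2 - R^2 \<le> cmod (of_real t ^ 2) - cmod (- (z^2))" by (simp add: norm_power)
    also have "\<dots> \<le> cmod (of_real t ^ 2 - - (z^2))" by (rule norm_triangle_ineq2)
    finally have d3: "t^2 - R^2 \<le> cmod (z^2 + of_real t ^ 2)" by (simp add: add.commute)
    have A: "0 \<le> t ^ (2 * m) / w t * (K * exp (\<tau> * R))" using t wt K_nonneg by simp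
    have "(t^2 - R^2) * cmod (quot_kernel t z) \<le> cmod (z^2 + of_real t ^ 2) * cmod (quot_kernel t z)" using d3 by (intro mult_right_mono) auto
    also have "\<dots> = cmod (numer t z)" unfolding quot_kernel(2)[OF t, of z] by (rule norm_mult[symmetric])
    also have "\<dots> \<le> R ^ (2 * m) + t ^ (2 * m) / w t * (K * exp (\<tau> * R))" by (rule numer_bound[OF t z])
    finally have "cmod (quot_kernel t z) \<le> (R ^ (2 * m) + t ^ (2 * m) / w t * (K * exp (\<tau> * R))) / (t^2 - R^2)"
      using d1 by (simp add: pos_le_divide_eq mult.commute)
    also have "\<dots> = R ^ (2 * m) * (1 / (t^2 - R^2)) + t ^ (2 * m) / w t * (K * exp (\<tau> * R)) * (1 / (t^2 - R^2))" by (simp add: add_divide_distrib)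
    also have "\<dots> \<le> (R + 3) ^ (2 * m) * ((R + 3)^2 / (1 + t^2)) + t ^ (2 * m) / w t * (K * exp (\<tau> * R)) * 1"
    proof (intro add_mono mult_mono power_mono mult_left_mono A)
      show "1 / (t\<^sup>2 - R\<^sup>2) \<le> (R + 3)\<^sup>2 / (1 + t\<^sup>2)" using d1 d2 t2 by (simp add: divide_simps mult.commute)
      show "1 / (t\<^sup>2 - R\<^sup>2) \<le> 1" using d1 by simp
    qed (use R d1 K_nonneg t tR wt in auto)
    also have "t ^ (2 * m) / w t * (K * exp (\<tau> * R)) * 1 \<le> t ^ (2 * m) / w t * (K * exp (\<tau> * (R + 3)))"
    proof -
      have "exp (\<tau> * R) \<le> exp (\<tau> * (R + 3))" using \<tau> by (simp add: mult_left_mono)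
      then show ?thesis using t wt K_nonneg unfolding mult_1_right by (intro mult_left_mono) auto
    qed
    finally show ?thesis by simp
  qed
  have "cmod (integrand z t) = p * cmod (quot_kernel t z)" using t p by (simp add: integrand_def norm_mult p_def)
  also have "\<dots> \<le> p * ((R + 3) ^ (2 * m) * ((R + 3)^2 / (1 + t^2)) + t ^ (2 * m) / w t * (K * exp (\<tau> * (R + 3))))"
    using p by (intro mult_left_mono kb) auto
  also have "\<dots> = (R + 3) ^ (2 * m + 2) * (p / (1 + t^2)) + (K * exp (\<tau> * (R + 3))) * (p * t ^ (2 * m) / w t)"
  proof -
    have e: "a * (A * (B / Y) + T / W * Q) = A * B * (a / Y) + Q * (a * T / W)" for a A B Y T W Q :: real
    proof -
      have "a * (A * (B / Y)) = A * B * (a / Y)" "a * (T / W * Q) = Q * (a * T / W)" by (simp_all add: mult_ac)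
      then show ?thesis by (simp only: distrib_left)
    qed
    from e[of p "(R + 3) ^ (2 * m)"] show ?thesis by (simp only: power_add)
  qed
  also have "p * t ^ (2 * m) = t powr (\<sigma> + 1)" unfolding p_def by (rule powr_times_power[OF t])
  also have "(R + 3) ^ (2 * m + 2) * (p / (1 + t^2)) + (K * exp (\<tau> * (R + 3))) * (t powr (\<sigma> + 1) / w t)
     \<le> ((R + 3) ^ (2 * m + 2) + K * exp (\<tau> * (R + 3))) * (p / (1 + t^2) + t powr (\<sigma> + 1) / w t)"
  proof -
    have le: "A * x + B * y \<le> (A + B) * (x + y)" if "A \<ge> 0" "B \<ge> 0" "x \<ge> 0" "y \<ge> 0" for A B x y :: real
    proof -
      have "0 \<le> A * y" "0 \<le> B * x" using that by auto
      then show ?thesis by (simp add: algebra_simps)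
    qed
    show ?thesis by (rule le) (use R K_nonneg p wt t2 in auto)
  qed
  finally show ?thesis using t by (simp add: dominator_def p_def)
qed (simp add: integrand_def dominator_def)

text \<open>The bounds 2m - 2 < \<sigma> < 2m put the exponent into the range where this Beta integral converges.\<close>

lemma kernel_integral:
  "(\<integral>\<^sup>+t. ennreal (t powr (\<sigma> + 1 - 2 * real m) / (1 + t^2)) * indicator {0<..} t \<partial>lborel)
   = ennreal (Gamma (real m - \<sigma> / 2) * Gamma (1 + \<sigma> / 2 - real m) / 2)"
proof -
  have "- (\<sigma> - 2 * real m) / 2 = real m - \<sigma> / 2" "1 + (\<sigma> - 2 * real m) / 2 = 1 + \<sigma> / 2 - real m" "\<sigma> - 2 * real m + 1 = \<sigma> + 1 - 2 * real m"
    by (auto simp: field_simps)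
  moreover have "-2 < \<sigma> - 2 * real m" "\<sigma> - 2 * real m < 0" using \<sigma> by auto
  ultimately show ?thesis using nn_integral_powr_over_one_plus_square[of "\<sigma> - 2 * real m"] by (simp only:)
qed

lemma dominator_integrable: "integrable lborel dominator"
proof -
  have "integrable lborel (\<lambda>t. indicator {0<..} t * (t powr (\<sigma> + 1 - 2 * real m) / (1 + t^2)))"
  proof (rule integrableI_nonneg)
    have "(\<integral>\<^sup>+t. ennreal (indicator {0<..} t * (t powr (\<sigma> + 1 - 2 * real m) / (1 + t^2))) \<partial>lborel)
       = (\<integral>\<^sup>+t. ennreal (t powr (\<sigma> + 1 - 2 * real m) / (1 + t^2)) * indicator {0<..} t \<partial>lborel)"
      by (intro nn_integral_cong) (auto simp: indicator_def)
    then show "(\<integral>\<^sup>+t. ennreal (indicator {0<..} t * (t powr (\<sigma> + 1 - 2 * real m) / (1 + t^2))) \<partial>lborel) < \<infinity>"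
      unfolding kernel_integral by simp
  qed (auto simp: indicator_def)
  then show ?thesis unfolding dominator_def[abs_def] using w_int by (rule Bochner_Integration.integrable_add)
qed

lemma integrand_eq:
  assumes t: "t > 0" and nz: "z^2 + of_real t ^ 2 \<noteq> 0"
  shows "integrand z t = of_real (t powr (\<sigma> + 1 - 2 * real m)) * (numer t z / (z^2 + of_real t ^ 2))"
  using quot_kernel(2)[OF t, of z] nz t by (simp add: integrand_def)

lemma integrand_measurable: "integrand z \<in> borel_measurable lborel"
proof -
  define g where "g = (\<lambda>t. if t > 0 then of_real (t powr (\<sigma> + 1 - 2 * real m)) * (numer t z / (z^2 + of_real t ^ 2)) else 0)"
  have [measurable]: "g \<in> borel_measurable lborel" unfolding g_def numer_def by measurable
  define c where "c = integrand z (cmod z)"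
  have eq: "integrand z = (\<lambda>t. if t = cmod z then c else g t)"
  proof (rule ext)
    fix t
    show "integrand z t = (if t = cmod z then c else g t)"
    proof (cases "t = cmod z \<or> t \<le> 0")
      case False
      have "z^2 + of_real t ^ 2 \<noteq> 0"
      proof
        assume "z^2 + of_real t ^ 2 = 0"
        then have "z^2 = - (of_real t ^ 2)" by (simp add: eq_neg_iff_add_eq_0)
        then have "cmod (z^2) = cmod (of_real t ^ 2)" by simp
        then have "cmod z ^ 2 = t ^ 2" by (simp add: norm_power)
        then show False using False by (simp add: power2_eq_iff_nonneg)
      qed
      then show ?thesis using False integrand_eq[of t z] by (simp add: g_def)
    qed (auto simp: integrand_def g_def c_def)
  qed
  show ?thesis unfolding eq by measurable
qed

definition entire_part :: "complex \<Rightarrow> complex" where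
  "entire_part z = of_real kappa * (\<integral>t. integrand z t \<partial>lborel)"

lemma integrand_integrable: "integrable lborel (integrand z)"
  by (rule Bochner_Integration.integrable_bound[OF integrable_mult_right[OF dominator_integrable] integrand_measurable])
     (intro AE_I2, unfold real_norm_def, rule order_trans[OF integrand_bound[OF order_refl] abs_ge_self])

lemma entire_part_exp_type: "exp_type_le entire_part \<tau>"
  unfolding exp_type_le_def
proof (intro conjI allI impI)
  have "(\<lambda>z. \<integral>t. integrand z t \<partial>lborel) holomorphic_on UNIV"
  proof (rule holomorphic_lebesgue_integral)
    show "(\<lambda>z. integrand z t) holomorphic_on UNIV" for t
      by (cases "t > 0") (auto simp: integrand_def intro!: holomorphic_intros quot_kernel(1))
    show "integrand z \<in> borel_measurable lborel" for z by (rule integrand_measurable)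
    show "\<exists>g. integrable lborel g \<and> (\<forall>z t. cmod z \<le> R \<longrightarrow> cmod (integrand z t) \<le> g t)" for R
      using integrand_bound integrable_mult_right[OF dominator_integrable] by blast
  qed
  then show "entire_part holomorphic_on UNIV" unfolding entire_part_def[abs_def] by (intro holomorphic_intros)
  fix e :: real assume e: "e > 0"
  define I where "I = (\<integral>t. dominator t \<partial>lborel)"
  have dom0: "dominator t \<ge> 0" for t using w_pos[of t] by (auto simp: dominator_def indicator_def add_nonneg_nonneg)
  have I0: "I \<ge> 0" unfolding I_def by (rule Bochner_Integration.integral_nonneg) (rule dom0)
  define C1 where "C1 = (real (2 * m + 2) / e) ^ (2 * m + 2) * exp (e * 3)"
  define C where "C = \<bar>kappa\<bar> * ((C1 + K * exp (\<tau> * 3)) * I) + 1"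
  have C1: "C1 \<ge> 0" using e by (simp add: C1_def)
  have bd: "cmod (entire_part z) \<le> C * exp ((\<tau> + e) * cmod z)" for z
  proof -
    define R where "R = cmod z"
    have R: "R \<ge> 0" by (simp add: R_def)
    have "cmod (\<integral>t. integrand z t \<partial>lborel) \<le> (\<integral>t. cmod (integrand z t) \<partial>lborel)" by (rule integral_norm_bound)
    also have "\<dots> \<le> (\<integral>t. ((R + 3) ^ (2 * m + 2) + K * exp (\<tau> * (R + 3))) * dominator t \<partial>lborel)"
      unfolding R_def
      by (intro integral_mono integrable_norm integrand_integrable integrable_mult_right dominator_integrable integrand_bound order_refl)
    also have "\<dots> = ((R + 3) ^ (2 * m + 2) + K * exp (\<tau> * (R + 3))) * I" by (simp add: I_def)
    also have "\<dots> \<le> ((C1 + K * exp (\<tau> * 3)) * exp ((\<tau> + e) * R)) * I"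
    proof (rule mult_right_mono[OF _ I0])
      have "(R + 3) ^ (2 * m + 2) \<le> C1 * exp (e * R)" unfolding C1_def by (rule add_power_le_exp[OF e R]) simp
      also have "\<dots> \<le> C1 * exp ((\<tau> + e) * R)" using C1 \<tau> R by (intro mult_left_mono) (auto simp: distrib_right)
      finally have 1: "(R + 3) ^ (2 * m + 2) \<le> C1 * exp ((\<tau> + e) * R)" .
      have "K * exp (\<tau> * (R + 3)) = K * exp (\<tau> * 3) * exp (\<tau> * R)" by (simp add: distrib_left exp_add)
      also have "\<dots> \<le> K * exp (\<tau> * 3) * exp ((\<tau> + e) * R)" using K_nonneg e R by (intro mult_left_mono) (auto simp: distrib_right)
      finally show "(R + 3) ^ (2 * m + 2) + K * exp (\<tau> * (R + 3)) \<le> (C1 + K * exp (\<tau> * 3)) * exp ((\<tau> + e) * R)"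
        using 1 by (simp add: distrib_right)
    qed
    finally have "cmod (entire_part z) \<le> \<bar>kappa\<bar> * (((C1 + K * exp (\<tau> * 3)) * exp ((\<tau> + e) * R)) * I)"
      unfolding entire_part_def norm_mult norm_of_real by (rule mult_left_mono) simp
    also have "\<dots> \<le> C * exp ((\<tau> + e) * R)" by (simp add: C_def algebra_simps)
    finally show ?thesis by (simp add: R_def)
  qed
  moreover have "C > 0" unfolding C_def using C1 K_nonneg I0 by (intro add_nonneg_pos mult_nonneg_nonneg) auto
  ultimately show "\<exists>C>0. \<forall>z. cmod (entire_part z) \<le> C * exp ((\<tau> + e) * cmod z)" by blast
qed

lemma kappa_pos: "kappa > 0"
  using \<sigma> unfolding kappa_def by (intro divide_pos_pos mult_pos_pos Gamma_real_pos) auto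

text \<open>Since \<sigma>/2 is not an integer, the reflection shift applies and leaves \<Gamma>(-\<sigma>/2) \<Gamma>(1 + \<sigma>/2), whose second factor cancels
against \<kappa>.\<close>

lemma Gamma_kappa: "kappa * (-1) ^ m * (Gamma (real m - \<sigma> / 2) * Gamma (1 + \<sigma> / 2 - real m) / 2) = gamma_factor (- \<sigma>)"
proof -
  have "\<sigma> / 2 \<notin> \<int>"
  proof
    assume "\<sigma> / 2 \<in> \<int>"
    then obtain n :: int where n: "\<sigma> / 2 = of_int n" by (auto simp: Ints_def)
    then have "of_int (int m - 1) < (of_int n :: real)" "(of_int n :: real) < of_int (int m)" using \<sigma> by auto
    then have "int m - 1 < n" "n < int m" by (simp_all only: of_int_less_iff)
    then show False by linarith
  qed
  then have "Gamma (real m - \<sigma> / 2) * Gamma (1 + \<sigma> / 2 - real m) = (-1) ^ m * (Gamma (- (\<sigma> / 2)) * Gamma (1 + \<sigma> / 2))"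
    by (rule Gamma_reflection_shift)
  moreover have "(-1) ^ m * (-1) ^ m = (1::real)" by (simp flip: power_mult_distrib)
  moreover have "Gamma (1 + \<sigma> / 2) > 0" using \<sigma> by (intro Gamma_real_pos) auto
  ultimately show ?thesis
    by (simp add: kappa_def gamma_factor_def)
qed

lemma powr_kernel_integral:
  assumes x: "x \<noteq> 0"
  shows "has_bochner_integral lborel (\<lambda>t. indicator {0<..} t *\<^sub>R (t powr (\<sigma> + 1 - 2 * real m) / (x^2 + t^2)))
     (\<bar>x\<bar> powr (\<sigma> - 2 * real m) * (Gamma (real m - \<sigma> / 2) * Gamma (1 + \<sigma> / 2 - real m) / 2))"
proof (rule has_bochner_integral_nn_integral)
  let ?q = "\<sigma> + 1 - 2 * real m"
  have ax: "\<bar>x\<bar> > 0" using x by simp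
  have G: "Gamma (real m - \<sigma> / 2) * Gamma (1 + \<sigma> / 2 - real m) / 2 \<ge> 0"
    using \<sigma> by (intro divide_nonneg_nonneg mult_nonneg_nonneg Gamma_real_nonneg) auto
  then show "0 \<le> \<bar>x\<bar> powr (\<sigma> - 2 * real m) * (Gamma (real m - \<sigma> / 2) * Gamma (1 + \<sigma> / 2 - real m) / 2)" by simp
  show "AE t in lborel. 0 \<le> indicator {0<..} t *\<^sub>R (t powr ?q / (x^2 + t^2))" by (auto simp: indicator_def)
  have "(\<integral>\<^sup>+t. ennreal (indicator {0<..} t *\<^sub>R (t powr ?q / (x^2 + t^2))) \<partial>lborel)
     = ennreal \<bar>\<bar>x\<bar>\<bar> * (\<integral>\<^sup>+u. ennreal (indicator {0<..} (0 + \<bar>x\<bar> * u) *\<^sub>R ((0 + \<bar>x\<bar> * u) powr ?q / (x^2 + (0 + \<bar>x\<bar> * u)^2))) \<partial>lborel)"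
    by (rule nn_integral_real_affine) (use x in auto)
  also have "\<dots> = (\<integral>\<^sup>+u. ennreal \<bar>x\<bar> * ennreal (indicator {0<..} (\<bar>x\<bar> * u) *\<^sub>R ((\<bar>x\<bar> * u) powr ?q / (x^2 + (\<bar>x\<bar> * u)^2))) \<partial>lborel)"
    by (subst nn_integral_cmult) auto
  also have "\<dots> = (\<integral>\<^sup>+u. ennreal (\<bar>x\<bar> powr (\<sigma> - 2 * real m)) * (ennreal (u powr ?q / (1 + u^2)) * indicator {0<..} u) \<partial>lborel)"
  proof (rule nn_integral_cong)
    fix u :: real
    show "ennreal \<bar>x\<bar> * ennreal (indicator {0<..} (\<bar>x\<bar> * u) *\<^sub>R ((\<bar>x\<bar> * u) powr ?q / (x^2 + (\<bar>x\<bar> * u)^2)))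
       = ennreal (\<bar>x\<bar> powr (\<sigma> - 2 * real m)) * (ennreal (u powr ?q / (1 + u^2)) * indicator {0<..} u)"
    proof (cases "u > 0")
      case True
      have "\<bar>x\<bar> powr ?q = \<bar>x\<bar> powr (\<sigma> - 2 * real m) * \<bar>x\<bar>"
      proof -
        have "\<bar>x\<bar> powr ?q = \<bar>x\<bar> powr ((\<sigma> - 2 * real m) + 1)" by (simp add: algebra_simps)
        then show ?thesis using ax by (simp add: powr_add)
      qed
      moreover have "x^2 + (\<bar>x\<bar> * u)^2 = \<bar>x\<bar> * \<bar>x\<bar> * (1 + u^2)" by (simp add: power_mult_distrib algebra_simps power2_eq_square)
      moreover have "1 + u^2 > 0" by (simp add: add_pos_nonneg)
      moreover have "(\<bar>x\<bar> * u) powr ?q = \<bar>x\<bar> powr ?q * u powr ?q" using ax True by (simp add: powr_mult)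
      moreover have "X * ((p * X * U) / (X * X * Y)) = p * (U / Y)" if "X > 0" for X p U Y :: real
        using that by simp
      ultimately have "\<bar>x\<bar> * ((\<bar>x\<bar> * u) powr ?q / (x^2 + (\<bar>x\<bar> * u)^2)) = \<bar>x\<bar> powr (\<sigma> - 2 * real m) * (u powr ?q / (1 + u^2))"
        using ax by metis
      then show ?thesis using ax True by (simp add: ennreal_mult[symmetric])
    next
      case False
      then have "\<not> \<bar>x\<bar> * u > 0" using ax by (simp add: zero_less_mult_iff)
      then show ?thesis using False by simp
    qed
  qed
  also have "\<dots> = ennreal (\<bar>x\<bar> powr (\<sigma> - 2 * real m)) * ennreal (Gamma (real m - \<sigma> / 2) * Gamma (1 + \<sigma> / 2 - real m) / 2)"
    unfolding kernel_integral[symmetric] by (rule nn_integral_cmult) measurable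
  also have "\<dots> = ennreal (\<bar>x\<bar> powr (\<sigma> - 2 * real m) * (Gamma (real m - \<sigma> / 2) * Gamma (1 + \<sigma> / 2 - real m) / 2))"
    by (rule ennreal_mult[symmetric]) (use G in auto)
  finally show "(\<integral>\<^sup>+t. ennreal (indicator {0<..} t *\<^sub>R (t powr ?q / (x^2 + t^2))) \<partial>lborel) = \<dots>" .
qed measurable

lemma potential_integrable:
  assumes x: "x \<noteq> 0"
  shows "integrable lborel (\<lambda>t. indicator {0<..} t *\<^sub>R (t powr (\<sigma> + 1) / ((x^2 + t^2) * w t)))"
    and "0 \<le> potential x" and "potential x \<le> (\<integral>t. indicator {0<..} t *\<^sub>R (t powr (\<sigma> + 1) / w t) \<partial>lborel) / x^2"
proof -
  let ?W = "\<lambda>t. indicator {0<..} t *\<^sub>R (t powr (\<sigma> + 1) / w t)"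
  have le: "indicator {0<..} t *\<^sub>R (t powr (\<sigma> + 1) / ((x^2 + t^2) * w t)) \<le> ?W t / x^2" for t
  proof (cases "t > 0")
    case True
    have "x^2 > 0" using x by simp
    then have "1 / (x^2 + t^2) \<le> 1 / x^2" by (intro divide_left_mono mult_pos_pos add_pos_nonneg) auto
    then have "(t powr (\<sigma> + 1) / w t) * (1 / (x^2 + t^2)) \<le> (t powr (\<sigma> + 1) / w t) * (1 / x^2)"
      using w_pos[OF True] by (intro mult_left_mono) auto
    then show ?thesis using True by (simp add: mult.commute)
  qed simp
  have ge: "0 \<le> indicator {0<..} t *\<^sub>R (t powr (\<sigma> + 1) / ((x^2 + t^2) * w t))" for t
    using w_pos[of t] by (auto simp: indicator_def less_imp_le)
  have iW: "integrable lborel (\<lambda>t. ?W t / x^2)" by (intro integrable_divide_zero w_int)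
  show i: "integrable lborel (\<lambda>t. indicator {0<..} t *\<^sub>R (t powr (\<sigma> + 1) / ((x^2 + t^2) * w t)))"
  proof (rule Bochner_Integration.integrable_bound[OF iW])
    show "AE t in lborel. norm (indicator {0<..} t *\<^sub>R (t powr (\<sigma> + 1) / ((x^2 + t^2) * w t))) \<le> norm (?W t / x^2)"
      unfolding real_norm_def by (intro AE_I2 abs_le_abs_of_nonneg le ge)
  qed measurable
  show "0 \<le> potential x" unfolding potential_def by (rule Bochner_Integration.integral_nonneg) (rule ge)
  have "potential x \<le> (\<integral>t. ?W t / x^2 \<partial>lborel)" unfolding potential_def
    by (rule integral_mono[OF i iW]) (rule le)
  also have "(\<integral>t. ?W t / x^2 \<partial>lborel) = (\<integral>t. ?W t \<partial>lborel) / x^2" by (rule integral_divide_zero)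
  finally show "potential x \<le> (\<integral>t. ?W t \<partial>lborel) / x^2" .
qed

text \<open>For real x \<noteq> 0 the integrals of the two parts of the numerator converge separately. The polynomial part gives the power of |x| by
scaling, and the other one gives the potential.\<close>

lemma entire_part_real:
  assumes x: "x \<noteq> 0"
  shows "entire_part (of_real x) = of_real (gamma_factor (- \<sigma>) * \<bar>x\<bar> powr \<sigma> - kappa * \<epsilon> * Re (S (of_real x)) * potential x)"
proof -
  let ?q = "\<sigma> + 1 - 2 * real m"
  let ?G = "Gamma (real m - \<sigma> / 2) * Gamma (1 + \<sigma> / 2 - real m) / 2"
  define r where "r = Re (S (of_real x))"
  have Sr: "S (of_real x) = of_real r" using S_real[of x] by (simp add: r_def)
  define h1 where "h1 = (\<lambda>t. indicator {0<..} t *\<^sub>R (t powr ?q / (x^2 + t^2)))"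
  define h2 where "h2 = (\<lambda>t. indicator {0<..} t *\<^sub>R (t powr (\<sigma> + 1) / ((x^2 + t^2) * w t)))"
  have dens: "integrand (of_real x) t = of_real ((-1) ^ m * x ^ (2 * m) * h1 t - \<epsilon> * r * h2 t)" for t
  proof (cases "t > 0")
    case True
    have pos: "x^2 + t^2 > 0" using True by (simp add: add_nonneg_pos)
    have "(of_real x)^2 + of_real t ^ 2 = complex_of_real (x^2 + t^2)" by simp
    then have nz: "(of_real x)^2 + of_real t ^ 2 \<noteq> (0::complex)" using pos by (metis of_real_eq_0_iff less_irrefl)
    have "numer t (of_real x) = of_real ((-1) ^ m * x ^ (2 * m) - t ^ (2 * m) / (\<epsilon> * w t) * r)"
      by (simp add: numer_def Sr)
    then have "integrand (of_real x) t = of_real (t powr ?q * (((-1) ^ m * x ^ (2 * m) - t ^ (2 * m) / (\<epsilon> * w t) * r) / (x^2 + t^2)))"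
      using integrand_eq[OF True nz] by simp
    also have "t powr ?q * (((-1) ^ m * x ^ (2 * m) - t ^ (2 * m) / (\<epsilon> * w t) * r) / (x^2 + t^2))
       = (-1) ^ m * x ^ (2 * m) * (t powr ?q / (x^2 + t^2)) - \<epsilon> * r * ((t powr ?q * t ^ (2 * m)) / ((x^2 + t^2) * w t))"
    proof -
      have "a * ((A - T / (\<epsilon> * W) * r) / Y) = A * (a / Y) - \<epsilon> * r * ((a * T) / (Y * W))" if "W > 0" "Y > 0" for a A T W Y :: real
        using eps that by (auto simp: field_simps)
      then show ?thesis using w_pos[OF True] pos by blast
    qed
    also have "t powr ?q * t ^ (2 * m) = t powr (\<sigma> + 1)" by (rule powr_times_power[OF True])
    finally show ?thesis using True by (simp add: h1_def h2_def)
  qed (simp add: integrand_def h1_def h2_def)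
  have hb1: "has_bochner_integral lborel h1 (\<bar>x\<bar> powr (\<sigma> - 2 * real m) * ?G)"
    unfolding h1_def by (rule powr_kernel_integral[OF x])
  have i2: "integrable lborel h2" unfolding h2_def by (rule potential_integrable(1)[OF x])
  have "(\<integral>t. integrand (of_real x) t \<partial>lborel) = of_real (\<integral>t. (-1) ^ m * x ^ (2 * m) * h1 t - \<epsilon> * r * h2 t \<partial>lborel)"
    unfolding dens by (rule integral_complex_of_real)
  also have "(\<integral>t. (-1) ^ m * x ^ (2 * m) * h1 t - \<epsilon> * r * h2 t \<partial>lborel)
     = (-1) ^ m * x ^ (2 * m) * (\<bar>x\<bar> powr (\<sigma> - 2 * real m) * ?G) - \<epsilon> * r * potential x"
  proof -
    have i1: "integrable lborel h1" and e1: "(\<integral>t. h1 t \<partial>lborel) = \<bar>x\<bar> powr (\<sigma> - 2 * real m) * ?G"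
      using hb1 unfolding has_bochner_integral_iff by auto
    have e2: "(\<integral>t. h2 t \<partial>lborel) = potential x" by (simp only: potential_def h2_def)
    have "(\<integral>t. (-1) ^ m * x ^ (2 * m) * h1 t - \<epsilon> * r * h2 t \<partial>lborel) = (-1) ^ m * x ^ (2 * m) * (\<integral>t. h1 t \<partial>lborel) - \<epsilon> * r * (\<integral>t. h2 t \<partial>lborel)"
      using i1 i2 by simp
    then show ?thesis unfolding e1 e2 .
  qed
  also have "\<dots> = (-1) ^ m * ?G * (x ^ (2 * m) * \<bar>x\<bar> powr (\<sigma> - 2 * real m)) - \<epsilon> * r * potential x" by simp
  also have "x ^ (2 * m) * \<bar>x\<bar> powr (\<sigma> - 2 * real m) = \<bar>x\<bar> powr \<sigma>"
  proof -
    have "x ^ (2 * m) = \<bar>x\<bar> powr real (2 * m)" using x by (subst powr_realpow) (auto simp: power_even_abs)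
    then show ?thesis by (simp add: powr_add[symmetric])
  qed
  finally have "entire_part (of_real x) = of_real (kappa * ((-1) ^ m * ?G * \<bar>x\<bar> powr \<sigma> - \<epsilon> * r * potential x))"
    by (simp add: entire_part_def)
  also have "kappa * ((-1) ^ m * ?G * \<bar>x\<bar> powr \<sigma> - \<epsilon> * r * potential x) = (kappa * (-1) ^ m * ?G) * \<bar>x\<bar> powr \<sigma> - kappa * \<epsilon> * r * potential x"
    by (simp add: algebra_simps)
  finally show ?thesis unfolding Gamma_kappa r_def .
qed

text \<open>At 0 the gap formula is not available, and for \<sigma> > 0, that is m > 0, the sign of F(0) has to be read off the integral directly:
the monomial z^(2m) vanishes there.\<close>

lemma entire_part_0:
  assumes m: "m > 0"
  shows "\<exists>c\<ge>0. entire_part 0 = of_real (- (\<epsilon> * Re (S 0) * c))"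
proof -
  define r where "r = Re (S 0)"
  have Sr: "S 0 = of_real r" using S_real[of 0] by (simp add: r_def)
  define h where "h = (\<lambda>t. indicator {0<..} t *\<^sub>R (t powr (\<sigma> + 1 - 2 * real m) * t ^ (2 * m) / (t^2 * w t)))"
  have h0: "h t \<ge> 0" for t using w_pos[of t] by (auto simp: h_def indicator_def less_imp_le)
  have dens: "integrand 0 t = of_real (- (\<epsilon> * r) * h t)" for t
  proof (cases "t > 0")
    case True
    have "numer t 0 = of_real (- (t ^ (2 * m) / (\<epsilon> * w t) * r))"
      using m by (simp add: numer_def Sr power_0_left)
    then have "integrand 0 t = of_real (t powr (\<sigma> + 1 - 2 * real m) * (- (t ^ (2 * m) / (\<epsilon> * w t) * r) / t^2))"
      using integrand_eq[OF True, of 0] True by simp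
    also have "t powr (\<sigma> + 1 - 2 * real m) * (- (t ^ (2 * m) / (\<epsilon> * w t) * r) / t^2) = - (\<epsilon> * r) * h t"
      using eps True by (auto simp: h_def field_simps)
    finally show ?thesis .
  qed (simp add: integrand_def h_def)
  have "(\<integral>t. integrand 0 t \<partial>lborel) = of_real (- (\<epsilon> * r) * (\<integral>t. h t \<partial>lborel))"
    unfolding dens by (subst integral_complex_of_real) simp
  then have "entire_part 0 = of_real (- (\<epsilon> * r * (kappa * (\<integral>t. h t \<partial>lborel))))" by (simp add: entire_part_def)
  moreover have "kappa * (\<integral>t. h t \<partial>lborel) \<ge> 0" using kappa_pos h0 by (simp add: Bochner_Integration.integral_nonneg)
  ultimately show ?thesis unfolding r_def by blast
qed

text \<open>Tonelli's theorem reduces the L1-norm of the gap to the Poisson integrals of |S|.\<close>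

lemma gap_nn_integral:
  "(\<integral>\<^sup>+x. ennreal \<bar>kappa * \<epsilon> * Re (S (of_real x)) * potential x\<bar> \<partial>lborel)
   = (\<integral>\<^sup>+t. ennreal (kappa * (t powr (\<sigma> + 1) / w t)) * (\<integral>\<^sup>+x. ennreal (\<bar>Re (S (of_real x))\<bar> / (x^2 + t^2)) \<partial>lborel) * indicator {0<..} t \<partial>lborel)"
proof -
  have [measurable]: "S \<in> borel_measurable borel"
    using S_hol by (intro borel_measurable_continuous_onI holomorphic_on_imp_continuous_on)
  have "(\<integral>\<^sup>+x. ennreal \<bar>kappa * \<epsilon> * Re (S (of_real x)) * potential x\<bar> \<partial>lborel)
    = (\<integral>\<^sup>+x. (\<integral>\<^sup>+t. ennreal (kappa * (t powr (\<sigma> + 1) / w t)) * ennreal (\<bar>Re (S (of_real x))\<bar> / (x^2 + t^2)) * indicator {0<..} t \<partial>lborel) \<partial>lborel)"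
  proof (rule nn_integral_cong_AE)
    have "AE x in lborel. x \<noteq> (0::real)" by (rule AE_lborel_singleton)
    then show "AE x in lborel. ennreal \<bar>kappa * \<epsilon> * Re (S (of_real x)) * potential x\<bar>
       = (\<integral>\<^sup>+t. ennreal (kappa * (t powr (\<sigma> + 1) / w t)) * ennreal (\<bar>Re (S (of_real x))\<bar> / (x^2 + t^2)) * indicator {0<..} t \<partial>lborel)"
    proof eventually_elim
      case (elim x)
      let ?h = "\<lambda>t. indicator {0<..} t *\<^sub>R (t powr (\<sigma> + 1) / ((x^2 + t^2) * w t))"
      have h0: "?h t \<ge> 0" for t using w_pos[of t] by (auto simp: indicator_def less_imp_le)
      define b where "b = kappa * \<bar>Re (S (of_real x))\<bar>"
      have b: "b \<ge> 0" using kappa_pos by (simp add: b_def)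
      have "\<bar>kappa * \<epsilon> * Re (S (of_real x)) * potential x\<bar> = b * potential x"
        using kappa_pos eps potential_integrable(2)[OF elim] by (auto simp: abs_mult b_def)
      then have "ennreal \<bar>kappa * \<epsilon> * Re (S (of_real x)) * potential x\<bar> = ennreal b * ennreal (potential x)"
        using b potential_integrable(2)[OF elim] by (simp add: ennreal_mult)
      also have "ennreal (potential x) = (\<integral>\<^sup>+t. ennreal (?h t) \<partial>lborel)"
        unfolding potential_def using potential_integrable(1)[OF elim] h0 by (intro nn_integral_eq_integral[symmetric]) auto
      also have "ennreal b * \<dots> = (\<integral>\<^sup>+t. ennreal b * ennreal (?h t) \<partial>lborel)"
        by (rule nn_integral_cmult[symmetric]) measurable
      also have "\<dots> = (\<integral>\<^sup>+t. ennreal (kappa * (t powr (\<sigma> + 1) / w t)) * ennreal (\<bar>Re (S (of_real x))\<bar> / (x^2 + t^2)) * indicator {0<..} t \<partial>lborel)"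
      proof (rule nn_integral_cong)
        fix t :: real
        show "ennreal b * ennreal (?h t) = ennreal (kappa * (t powr (\<sigma> + 1) / w t)) * ennreal (\<bar>Re (S (of_real x))\<bar> / (x^2 + t^2)) * indicator {0<..} t"
        proof (cases "t > 0")
          case True
          have "b * ?h t = kappa * (t powr (\<sigma> + 1) / w t) * (\<bar>Re (S (of_real x))\<bar> / (x^2 + t^2))"
            using True by (simp add: b_def mult_ac)
          then show ?thesis using True b h0[of t] kappa_pos w_pos[OF True] by (simp add: ennreal_mult[symmetric] del: ennreal_mult)
        qed simp
      qed
      finally show ?case .
    qed
  qed
  also have "\<dots> = (\<integral>\<^sup>+t. (\<integral>\<^sup>+x. ennreal (kappa * (t powr (\<sigma> + 1) / w t)) * ennreal (\<bar>Re (S (of_real x))\<bar> / (x^2 + t^2)) * indicator {0<..} t \<partial>lborel) \<partial>lborel)"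
    by (rule lborel_pair.Fubini'[symmetric]) measurable
  also have "\<dots> = (\<integral>\<^sup>+t. ennreal (kappa * (t powr (\<sigma> + 1) / w t)) * (\<integral>\<^sup>+x. ennreal (\<bar>Re (S (of_real x))\<bar> / (x^2 + t^2)) \<partial>lborel) * indicator {0<..} t \<partial>lborel)"
  proof (rule nn_integral_cong)
    fix t :: real
    have m: "(\<lambda>x. ennreal (\<bar>Re (S (of_real x))\<bar> / (x^2 + t^2))) \<in> borel_measurable lborel" by measurable
    show "(\<integral>\<^sup>+x. ennreal (kappa * (t powr (\<sigma> + 1) / w t)) * ennreal (\<bar>Re (S (of_real x))\<bar> / (x^2 + t^2)) * indicator {0<..} t \<partial>lborel)
      = ennreal (kappa * (t powr (\<sigma> + 1) / w t)) * (\<integral>\<^sup>+x. ennreal (\<bar>Re (S (of_real x))\<bar> / (x^2 + t^2)) \<partial>lborel) * indicator {0<..} t"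
      using m by (simp add: nn_integral_multc nn_integral_cmult)
  qed
  finally show ?thesis .
qed

end

section \<open>Poisson integrals on the upper half plane\<close>

lemma has_bochner_integral_Cauchy_kernel:
  fixes t :: real
  assumes t: "t > 0"
  shows "has_bochner_integral lborel (\<lambda>x. 1 / (x^2 + t^2)) (pi / t)"
proof -
  have "(\<integral>x. 1 / (1 + x^2) \<partial>lborel) = pi"
    using LBINT_inverse_1_plus_square
    by (simp add: interval_lebesgue_integral_def set_lebesgue_integral_def inverse_eq_divide)
  then have h: "has_bochner_integral lborel (\<lambda>x::real. 1 / (1 + x^2)) pi"
    using integrable_inverse_1_plus_square_lborel by (simp add: has_bochner_integral_iff)
  have "has_bochner_integral lborel (\<lambda>x. 1 / (1 + (0 + (1 / t) * x)^2)) (pi /\<^sub>R \<bar>1 / t\<bar>)"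
    by (rule lborel_has_bochner_integral_real_affine_iff[THEN iffD1, OF _ h]) (use t in simp)
  then have "has_bochner_integral lborel (\<lambda>x. (1 / t^2) * (1 / (1 + (0 + (1 / t) * x)^2))) ((1 / t^2) * (pi /\<^sub>R \<bar>1 / t\<bar>))"
    by (rule has_bochner_integral_mult_right)
  moreover have "(1 / t^2) * (1 / (1 + (0 + (1 / t) * x)^2)) = 1 / (x^2 + t^2)" for x
    using t by (simp add: power_divide field_simps)
  moreover have "(1 / t^2) * (pi /\<^sub>R \<bar>1 / t\<bar>) = pi / t" using t by (simp add: power2_eq_square)
  ultimately show ?thesis by simp
qed

text \<open>The quotient k(z) = (H(z) - H(it)) / (z^2 + t^2) is holomorphic in a neighbourhood of the closed upper half plane and O(|z|^-2), so
its integral over the real axis vanishes by Cauchy's theorem on large half discs. What is left is H(it) times the integral of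
1/(x^2 + t^2).\<close>

lemma upper_half_plane_Poisson:
  fixes H :: "complex \<Rightarrow> complex"
  assumes hol: "H holomorphic_on {z. Im z > - \<delta>}" and \<delta>: "\<delta> > 0"
    and B: "\<And>z. Im z \<ge> 0 \<Longrightarrow> cmod (H z) \<le> B" and t: "t > 0"
  shows "has_bochner_integral lborel (\<lambda>x. H (of_real x) / of_real (x^2 + t^2)) (of_real (pi / t) * H (\<i> * of_real t))"
proof -
  define a where "a = \<i> * complex_of_real t"
  define U where "U = {z::complex. Im z > - min \<delta> t}"
  define q where "q = (\<lambda>z. if z = a then deriv H a else (H z - H a) / (z - a))"
  define k where "k = (\<lambda>z. q z / (z + a))"
  have op: "open {z::complex. Im z > - \<delta>}" by (rule open_halfspace_Im_gt)
  have "q holomorphic_on {z. Im z > - \<delta>}" unfolding q_def by (rule pole_lemma_open[OF hol op])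
  then have "q holomorphic_on U" by (rule holomorphic_on_subset) (auto simp: U_def)
  moreover have "z + a \<noteq> 0" if "z \<in> U" for z
  proof
    assume "z + a = 0"
    then have "Im (z + a) = 0" by simp
    then show False using that by (simp add: U_def a_def)
  qed
  ultimately have hk: "k holomorphic_on U" unfolding k_def by (intro holomorphic_intros) auto
  have U: "convex U" unfolding U_def by (rule convex_halfspace_Im_gt)
  have B0: "B \<ge> 0" using B[of 0] norm_ge_zero[of "H 0"] by (simp del: norm_ge_zero)
  have aIm: "Im a \<ge> 0" using t by (simp add: a_def)
  have k_eq: "k z = (H z - H a) / (z^2 + of_real t ^ 2)" if "z \<noteq> a" for z
  proof -
    have "(z - a) * (z + a) = z^2 + of_real t ^ 2" by (simp add: a_def algebra_simps power2_eq_square)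
    then show ?thesis using that by (simp add: k_def q_def)
  qed
  have kx: "k (of_real x) = (H (of_real x) - H a) / of_real (x^2 + t^2)" for x
  proof -
    have "complex_of_real x \<noteq> a"
    proof
      assume "complex_of_real x = a"
      then have "Im (complex_of_real x) = Im a" by simp
      then show False using t by (simp add: a_def)
    qed
    then show ?thesis using k_eq[of "of_real x"] by simp
  qed
  have contH: "continuous_on UNIV (\<lambda>x::real. H (of_real x))"
    by (intro continuous_on_compose2[OF holomorphic_on_imp_continuous_on[OF hol]] continuous_intros) (use \<delta> in auto)
  have contk: "continuous_on UNIV (\<lambda>x::real. k (of_real x))"
    by (intro continuous_on_compose2[OF holomorphic_on_imp_continuous_on[OF hk]] continuous_intros) (use \<delta> t in \<open>auto simp: U_def\<close>)
  have Ck: "has_bochner_integral lborel (\<lambda>x. 1 / (x^2 + t^2)) (pi / t)" by (rule has_bochner_integral_Cauchy_kernel[OF t])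
  have pos: "x^2 + t^2 > 0" for x using t by (simp add: add_nonneg_pos)
  have iH: "integrable lborel (\<lambda>x. H (of_real x) / of_real (x^2 + t^2))"
  proof (rule Bochner_Integration.integrable_bound)
    show "integrable lborel (\<lambda>x. B * (1 / (x^2 + t^2)))"
      using Ck by (intro integrable_mult_right) (simp add: has_bochner_integral_iff)
    show "(\<lambda>x. H (of_real x) / of_real (x^2 + t^2)) \<in> borel_measurable lborel"
      using borel_measurable_continuous_onI[OF contH] by measurable
    show "AE x in lborel. norm (H (of_real x) / of_real (x^2 + t^2)) \<le> norm (B * (1 / (x^2 + t^2)))"
    proof (rule AE_I2)
      fix x :: real
      have "cmod (H (of_real x)) \<le> B" by (rule B) simp
      then have "cmod (H (of_real x)) / (x^2 + t^2) \<le> B / (x^2 + t^2)" using pos[of x] by (intro divide_right_mono) auto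
      then show "norm (H (of_real x) / of_real (x^2 + t^2)) \<le> norm (B * (1 / (x^2 + t^2)))"
        using pos[of x] B0 by (simp add: norm_divide del: of_real_add of_real_power)
    qed
  qed
  have iC: "integrable lborel (\<lambda>x. H a * of_real (1 / (x^2 + t^2)))"
    using Ck by (intro integrable_mult_right integrable_of_real) (simp add: has_bochner_integral_iff)
  have k_split: "k (of_real x) = H (of_real x) / of_real (x^2 + t^2) - H a * of_real (1 / (x^2 + t^2))" for x
    unfolding kx by (simp add: diff_divide_distrib)
  have ik: "integrable lborel (\<lambda>x. k (of_real x))" unfolding k_split by (rule Bochner_Integration.integrable_diff[OF iH iC])
  have bound: "cmod (integral {- real n..real n} (\<lambda>x. k (of_real x))) \<le> 2 * B / ((real n)^2 - t^2) * real n * pi" if n: "real n > t" for n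
  proof -
    define R where "R = real n"
    have R: "R > t" "R > 0" using n t by (auto simp: R_def)
    define \<gamma> where "\<gamma> = linepath (of_real (- R)) (of_real R) +++ part_circlepath 0 R 0 pi"
    have arc: "z \<in> U" "Im z \<ge> 0" "cmod z = R" if z: "z \<in> path_image (part_circlepath 0 R 0 pi)" for z
    proof -
      from z R obtain x where x: "0 \<le> x" "x \<le> pi" "z = of_real R * exp (\<i> * of_real x)"
        by (auto simp: path_image_part_circlepath)
      show "cmod z = R" using x R by (simp add: norm_mult)
      have "Im z = R * sin x" using x(3) by (simp add: cis_conv_exp[symmetric])
      then show i: "Im z \<ge> 0" using x R sin_ge_zero[of x] by simp
      show "z \<in> U" using i \<delta> t by (simp add: U_def)
    qed
    have line: "closed_segment (of_real (- R)) (of_real R) \<subseteq> U"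
    proof -
      have "closed_segment (complex_of_real (- R)) (of_real R) = of_real ` closed_segment (- R) R" by (rule closed_segment_of_real)
      then show ?thesis using \<delta> t by (auto simp: U_def)
    qed
    have ends: "pathfinish (linepath (of_real (- R)) (of_real R)) = pathstart (part_circlepath 0 R 0 pi)"
      by simp
    have hkl: "k contour_integrable_on linepath (of_real (- R)) (of_real R)"
      by (intro contour_integrable_continuous_linepath continuous_on_subset[OF holomorphic_on_imp_continuous_on[OF hk] line])
    have hka: "k contour_integrable_on part_circlepath 0 R 0 pi"
      by (intro contour_integrable_continuous_part_circlepath continuous_on_subset[OF holomorphic_on_imp_continuous_on[OF hk]]) (use arc in auto)
    have "(k has_contour_integral 0) \<gamma>"
    proof (rule Cauchy_theorem_convex_simple[OF hk U])
      show "valid_path \<gamma>" unfolding \<gamma>_def by (intro valid_path_join ends) auto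
      have "path_image \<gamma> \<subseteq> closed_segment (of_real (- R)) (of_real R) \<union> path_image (part_circlepath 0 R 0 pi)"
        unfolding \<gamma>_def using path_image_join_subset[of "linepath (complex_of_real (- R)) (of_real R)"] by simp
      then show "path_image \<gamma> \<subseteq> U" using line arc(1) by blast
      show "pathfinish \<gamma> = pathstart \<gamma>" by (simp add: \<gamma>_def)
    qed
    moreover have "contour_integral \<gamma> k = contour_integral (linepath (of_real (- R)) (of_real R)) k + contour_integral (part_circlepath 0 R 0 pi) k"
      unfolding \<gamma>_def by (rule contour_integral_join[OF hkl hka]) auto
    ultimately have sum0: "contour_integral (linepath (of_real (- R)) (of_real R)) k = - contour_integral (part_circlepath 0 R 0 pi) k"
      using contour_integral_unique by (simp add: eq_neg_iff_add_eq_0)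
    have "cmod (contour_integral (part_circlepath 0 R 0 pi) k) \<le> (2 * B / (R^2 - t^2)) * R * \<bar>pi - 0\<bar>"
    proof (rule contour_integral_bound_part_circlepath[OF hka])
      show "0 \<le> 2 * B / (R^2 - t^2)" using B0 R t by (intro divide_nonneg_nonneg) (auto intro: power_mono)
      show "0 \<le> R" using R(2) by simp
      fix z assume z: "z \<in> path_image (part_circlepath 0 R 0 pi)"
      have za: "z \<noteq> a" using arc(3)[OF z] R t by (auto simp: a_def norm_mult)
      have "t^2 < R^2" using R t by (intro power_strict_mono) auto
      moreover have "cmod (z^2) - cmod (- (of_real t ^ 2)) \<le> cmod (z^2 - - (of_real t ^ 2))" by (rule norm_triangle_ineq2)
      then have "R^2 - t^2 \<le> cmod (z^2 + of_real t ^ 2)" using arc(3)[OF z] by (simp add: norm_power)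
      moreover have "cmod (H z - H a) \<le> 2 * B"
        using norm_triangle_ineq4[of "H z" "H a"] B[OF arc(2)[OF z]] B[OF aIm] by linarith
      ultimately show "cmod (k z) \<le> 2 * B / (R^2 - t^2)"
        unfolding k_eq[OF za] norm_divide using B0 by (intro frac_le) auto
    qed
    moreover have "contour_integral (linepath (of_real (- R)) (of_real R)) k = integral {- R..R} (\<lambda>x. k (of_real x))"
      using contour_integral_linepath_Reals_eq[of "of_real (- R)" "of_real R" k] R by simp
    ultimately show ?thesis unfolding R_def[symmetric] using sum0 by simp
  qed
  have "(\<lambda>n. integral {- real n..real n} (\<lambda>x. k (of_real x))) \<longlonglongrightarrow> 0"
  proof (rule Lim_null_comparison)
    show "eventually (\<lambda>n. cmod (integral {- real n..real n} (\<lambda>x. k (of_real x))) \<le> 2 * B / ((real n)^2 - t^2) * real n * pi) sequentially"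
      using eventually_gt_at_top[of "nat \<lceil>t\<rceil>"]
    proof eventually_elim
      case (elim n)
      then have "real n > t" by linarith
      then show ?case by (rule bound)
    qed
    have "(\<lambda>n. real n / ((real n)^2 - t^2)) \<longlonglongrightarrow> 0" by real_asymp
    then have "(\<lambda>n. (2 * B * pi) * (real n / ((real n)^2 - t^2))) \<longlonglongrightarrow> (2 * B * pi) * 0" by (rule tendsto_mult_left)
    then show "(\<lambda>n. 2 * B / ((real n)^2 - t^2) * real n * pi) \<longlonglongrightarrow> 0" by (simp add: mult_ac)
  qed
  then have "(\<integral>x. k (of_real x) \<partial>lborel) = 0"
    using integral_symmetric_intervals_tendsto[OF ik contk] LIMSEQ_unique by blast
  then have "(\<integral>x. H (of_real x) / of_real (x^2 + t^2) \<partial>lborel) = (\<integral>x. H a * of_real (1 / (x^2 + t^2)) \<partial>lborel)"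
    unfolding k_split using iH iC by simp
  also have "\<dots> = H a * of_real (\<integral>x. 1 / (x^2 + t^2) \<partial>lborel)"
    by (simp only: integral_mult_right_zero integral_complex_of_real)
  also have "(\<integral>x. 1 / (x^2 + t^2) \<partial>lborel) = pi / t" using Ck by (simp add: has_bochner_integral_iff)
  finally show ?thesis using iH by (simp add: has_bochner_integral_iff a_def mult.commute)
qed

lemma nn_integral_Poisson_Re:
  assumes H: "has_bochner_integral lborel (\<lambda>x. H (of_real x) / of_real (x^2 + t^2)) (of_real (pi / t) * of_real c)"
    and g: "\<And>x. Re (H (of_real x)) = g x" and g0: "\<And>x. g x \<ge> 0"
  shows "(\<integral>\<^sup>+x. ennreal (g x / (x^2 + t^2)) \<partial>lborel) = ennreal (pi / t * c)"
proof -
  have "has_bochner_integral lborel (\<lambda>x. Re (H (of_real x) / of_real (x^2 + t^2))) (Re (of_real (pi / t) * of_real c))"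
    by (rule has_bochner_integral_Re[OF H])
  then have "has_bochner_integral lborel (\<lambda>x. g x / (x^2 + t^2)) (pi / t * c)"
    by (simp add: g del: of_real_add of_real_power of_real_divide)
  then show ?thesis using g0 by (simp add: has_bochner_integral_iff nn_integral_eq_integral)
qed

lemma norm_exp_2pi_upper: "cmod (exp (2 * pi * \<i> * z)) \<le> 1" if "Im z \<ge> 0"
  using that by (simp add: norm_exp_eq_Re)

text \<open>cos^2 \<pi>x is the real part of (1 + exp(2\<pi>ix))/2, which is bounded on the upper half plane. The case of sin^2 differs by a sign.\<close>

lemma nn_integral_cos_squared:
  assumes t: "t > 0"
  shows "(\<integral>\<^sup>+x. ennreal ((cos (pi * x))^2 / (x^2 + t^2)) \<partial>lborel) = ennreal (pi / t * ((1 + exp (- 2 * pi * t)) / 2))"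
proof (rule nn_integral_Poisson_Re[where H="\<lambda>z. (1 + exp (2 * pi * \<i> * z)) / 2"])
  have "has_bochner_integral lborel (\<lambda>x. (1 + exp (2 * pi * \<i> * of_real x)) / 2 / of_real (x^2 + t^2)) (of_real (pi / t) * ((1 + exp (2 * pi * \<i> * (\<i> * of_real t))) / 2))"
  proof (rule upper_half_plane_Poisson[where \<delta>=1 and B=1 and H="\<lambda>z. (1 + exp (2 * pi * \<i> * z)) / 2", OF _ _ _ t])
    show "cmod ((1 + exp (2 * pi * \<i> * z)) / 2) \<le> 1" if "Im z \<ge> 0" for z
    proof -
      have "cmod (1 + exp (2 * pi * \<i> * z)) \<le> 2"
        using norm_triangle_ineq[of 1 "exp (2 * pi * \<i> * z)"] norm_exp_2pi_upper[OF that] unfolding norm_one by linarith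
      then show ?thesis by (simp add: norm_divide)
    qed
  qed (auto intro!: holomorphic_intros)
  moreover have "(1 + exp (2 * pi * \<i> * (\<i> * of_real t))) / 2 = of_real ((1 + exp (- 2 * pi * t)) / 2)"
  proof -
    have "2 * pi * \<i> * (\<i> * of_real t) = complex_of_real (- 2 * pi * t)" by (simp add: mult.assoc[symmetric])
    then show ?thesis by (simp only: exp_of_real) simp
  qed
  ultimately show "has_bochner_integral lborel (\<lambda>x. (1 + exp (2 * pi * \<i> * of_real x)) / 2 / of_real (x^2 + t^2)) (of_real (pi / t) * of_real ((1 + exp (- 2 * pi * t)) / 2))"
    by (simp only:)
  show "Re ((1 + exp (2 * pi * \<i> * of_real x)) / 2) = (cos (pi * x))^2" for x
    using cos_double_cos[of "pi * x"] by (simp add: Re_exp mult_ac)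
qed simp

lemma nn_integral_sin_squared:
  assumes t: "t > 0"
  shows "(\<integral>\<^sup>+x. ennreal ((sin (pi * x))^2 / (x^2 + t^2)) \<partial>lborel) = ennreal (pi / t * ((1 - exp (- 2 * pi * t)) / 2))"
proof (rule nn_integral_Poisson_Re[where H="\<lambda>z. (1 - exp (2 * pi * \<i> * z)) / 2"])
  have "has_bochner_integral lborel (\<lambda>x. (1 - exp (2 * pi * \<i> * of_real x)) / 2 / of_real (x^2 + t^2)) (of_real (pi / t) * ((1 - exp (2 * pi * \<i> * (\<i> * of_real t))) / 2))"
  proof (rule upper_half_plane_Poisson[where \<delta>=1 and B=1 and H="\<lambda>z. (1 - exp (2 * pi * \<i> * z)) / 2", OF _ _ _ t])
    show "cmod ((1 - exp (2 * pi * \<i> * z)) / 2) \<le> 1" if "Im z \<ge> 0" for z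
    proof -
      have "cmod (1 - exp (2 * pi * \<i> * z)) \<le> 2"
        using norm_triangle_ineq4[of 1 "exp (2 * pi * \<i> * z)"] norm_exp_2pi_upper[OF that] unfolding norm_one by linarith
      then show ?thesis by (simp add: norm_divide)
    qed
  qed (auto intro!: holomorphic_intros)
  moreover have "(1 - exp (2 * pi * \<i> * (\<i> * of_real t))) / 2 = of_real ((1 - exp (- 2 * pi * t)) / 2)"
  proof -
    have "2 * pi * \<i> * (\<i> * of_real t) = complex_of_real (- 2 * pi * t)" by (simp add: mult.assoc[symmetric])
    then show ?thesis by (simp only: exp_of_real) simp
  qed
  ultimately show "has_bochner_integral lborel (\<lambda>x. (1 - exp (2 * pi * \<i> * of_real x)) / 2 / of_real (x^2 + t^2)) (of_real (pi / t) * of_real ((1 - exp (- 2 * pi * t)) / 2))"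
    by (simp only:)
  show "Re ((1 - exp (2 * pi * \<i> * of_real x)) / 2) = (sin (pi * x))^2" for x
    using cos_double_sin[of "pi * x"] by (simp add: Re_exp mult_ac)
qed simp

text \<open>On the unit circle (1 - iz)/(1 + iz) is purely imaginary, so its argument is \<plusminus>\<pi>/2 according to the sign of cos \<theta>. This is
the classical sum of the series cos \<theta> - cos(3\<theta>)/3 + cos(5\<theta>)/5 - ..., the square wave.\<close>

lemma Re_Arctan_unit_circle:
  assumes "cos \<theta> \<noteq> 0"
  shows "Re (Arctan (exp (\<i> * of_real \<theta>))) = pi / 4 * sgn (cos \<theta>)"
proof -
  define z where "z = exp (\<i> * complex_of_real \<theta>)"
  have z: "Re z = cos \<theta>" "Im z = sin \<theta>" by (simp_all add: z_def Re_exp Im_exp)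
  have s: "1 - sin \<theta> > 0"
  proof -
    have "sin \<theta> \<noteq> 1"
    proof
      assume "sin \<theta> = 1"
      then have "(cos \<theta>)^2 = 0" using sin_cos_squared_add[of \<theta>] by simp
      then show False using assms by simp
    qed
    then show ?thesis using sin_le_one[of \<theta>] by linarith
  qed
  define v where "v = - cos \<theta> / (1 - sin \<theta>)"
  have "1 - \<i> * z = (\<i> * of_real v) * (1 + \<i> * z)"
  proof (rule complex_eqI)
    have "v * (1 - sin \<theta>) = - cos \<theta>" using s by (simp add: v_def)
    then show "Im (1 - \<i> * z) = Im (\<i> * of_real v * (1 + \<i> * z))" by (simp add: z)
    have "cos \<theta> * cos \<theta> = (1 - sin \<theta>) * (1 + sin \<theta>)"
      using sin_cos_squared_add[of \<theta>] by (simp add: power2_eq_square algebra_simps)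
    then have "- (v * cos \<theta>) = 1 + sin \<theta>" using s by (simp add: v_def field_simps)
    then show "Re (1 - \<i> * z) = Re (\<i> * of_real v * (1 + \<i> * z))" by (simp add: z)
  qed
  moreover have "1 + \<i> * z \<noteq> 0"
  proof
    assume "1 + \<i> * z = 0"
    then have "Re (1 + \<i> * z) = 0" by simp
    then show False using s by (simp add: z)
  qed
  ultimately have w: "(1 - \<i> * z) / (1 + \<i> * z) = \<i> * of_real v" by (simp add: field_simps)
  have v0: "v \<noteq> 0" using assms s by (simp add: v_def)
  have "Re (Arctan z) = - Im (Ln (\<i> * of_real v)) / 2" unfolding Arctan_def w by simp
  also have "\<dots> = pi / 4 * sgn (cos \<theta>)"
  proof (cases "cos \<theta> > 0")
    case True
    then have "v < 0" using s by (simp add: v_def divide_neg_pos)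
    then have "Im (Ln (\<i> * of_real v)) = - (pi / 2)" using Im_Ln_eq_pi_half[of "\<i> * of_real v"] v0 by auto
    then show ?thesis using True by simp
  next
    case False
    then have c: "cos \<theta> < 0" using assms by simp
    then have "v > 0" using s by (simp add: v_def divide_neg_pos)
    then have "Im (Ln (\<i> * of_real v)) = pi / 2" using Im_Ln_eq_pi_half[of "\<i> * of_real v"] v0 by auto
    then show ?thesis using c by simp
  qed
  finally show ?thesis by (simp add: z_def)
qed

lemma Arctan_holomorphic_ball: "Arctan holomorphic_on ball 0 1"
  and norm_Arctan_le: "\<lbrakk>cmod q \<le> r; r < 1\<rbrakk> \<Longrightarrow> cmod (Arctan q) \<le> cmod q / (1 - r^2)"
proof -
  have d: "(Arctan has_field_derivative inverse (1 + z^2)) (at z within A)" if "cmod z < 1" for z A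
  proof (rule has_field_derivative_at_within, rule has_field_derivative_Arctan)
    assume "Re z = 0"
    then show "\<bar>Im z\<bar> < 1" using abs_Im_le_cmod[of z] that by linarith
  qed
  show "Arctan holomorphic_on ball 0 1"
    unfolding holomorphic_on_def field_differentiable_def
  proof
    fix z :: complex assume "z \<in> ball 0 1"
    then have "cmod z < 1" by simp
    from d[OF this] show "\<exists>f'. (Arctan has_field_derivative f') (at z within ball 0 1)" by blast
  qed
  assume q: "cmod q \<le> r" "r < 1"
  have r0: "r \<ge> 0" using q norm_ge_zero order_trans by blast
  have r2: "r^2 < 1" using q r0 by (simp add: abs_square_less_1)
  have "cmod (Arctan q - Arctan 0) \<le> (1 / (1 - r^2)) * cmod (q - 0)"
  proof (rule field_differentiable_bound[where S="cball 0 r" and f'="\<lambda>z. inverse (1 + z^2)"])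
    fix z :: complex assume z: "z \<in> cball 0 r"
    then have zr: "cmod z \<le> r" by simp
    show "(Arctan has_field_derivative inverse (1 + z^2)) (at z within cball 0 r)" using d[of z] zr q by simp
    have "cmod z ^ 2 \<le> r^2" using zr by (intro power_mono) auto
    then have "1 - r^2 \<le> cmod 1 - cmod (- (z^2))" by (simp add: norm_power)
    also have "\<dots> \<le> cmod (1 - - (z^2))" by (rule norm_triangle_ineq2)
    finally have "1 - r^2 \<le> cmod (1 + z^2)" by simp
    then have "1 / cmod (1 + z^2) \<le> 1 / (1 - r^2)" using r2 by (intro frac_le) auto
    then show "cmod (inverse (1 + z^2)) \<le> 1 / (1 - r^2)" by (simp only: norm_inverse inverse_eq_divide[of "cmod (1 + z^2)"])
  qed (use q r0 in auto)
  then show "cmod (Arctan q) \<le> cmod q / (1 - r^2)" by simp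
qed

lemma cos_sin_imaginary:
  "cos (of_real pi * (\<i> * of_real t)) = complex_of_real (cosh (pi * t))"
  "sin (of_real pi * (\<i> * of_real t)) = \<i> * complex_of_real (sinh (pi * t))"
proof -
  have 1: "\<i> * (of_real pi * (\<i> * of_real t)) = complex_of_real (- (pi * t))" by (simp add: complex_eq_iff)
  have 2: "- (complex_of_real (- (pi * t))) = complex_of_real (pi * t)" by simp
  have "cos (of_real pi * (\<i> * of_real t)) = (complex_of_real (exp (- (pi * t))) + complex_of_real (exp (pi * t))) / 2"
    unfolding cos_exp_eq 1 2 exp_of_real ..
  then show "cos (of_real pi * (\<i> * of_real t)) = complex_of_real (cosh (pi * t))" by (simp add: cosh_def add.commute)
  have "sin (of_real pi * (\<i> * of_real t)) = (complex_of_real (exp (- (pi * t))) - complex_of_real (exp (pi * t))) / (2 * \<i>)"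
    unfolding sin_exp_eq 1 2 exp_of_real ..
  also have "\<dots> = \<i> * complex_of_real (sinh (pi * t))"
    by (simp add: sinh_def complex_eq_iff Re_divide Im_divide field_simps)
  finally show "sin (of_real pi * (\<i> * of_real t)) = \<i> * complex_of_real (sinh (pi * t))" .
qed

text \<open>By the square wave formula |cos \<pi>x| is the boundary value of the real part of (4/\<pi>) cos(\<pi>z) Arctan(exp(i\<pi>z)), which is bounded
on the upper half plane: the exponential growth of the cosine is cancelled by |Arctan q| = O(|q|). Since Arctan is singular on the
unit circle, its argument is first moved up by d and then d \<rightarrow> 0.\<close>

lemma nn_integral_abs_cos:
  assumes t: "t > 0"
  shows "(\<integral>\<^sup>+x. ennreal (\<bar>cos (pi * x)\<bar> / (x^2 + t^2)) \<partial>lborel) = ennreal (4 / t * cosh (pi * t) * arctan (exp (- pi * t)))"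
proof -
  define A where "A = (\<lambda>d z. of_real (4 / pi) * cos (of_real pi * z) * Arctan (exp (\<i> * of_real pi * (z + \<i> * of_real d))))"
  have q: "cmod (exp (\<i> * of_real pi * (z + \<i> * of_real d))) = exp (- pi * (Im z + d))" for z d
    by (simp add: norm_exp_eq_Re distrib_left)
  have P: "has_bochner_integral lborel (\<lambda>x. A d (of_real x) / of_real (x^2 + t^2)) (of_real (pi / t) * A d (\<i> * of_real t))" if d: "d > 0" for d
  proof (rule upper_half_plane_Poisson[OF _ d _ t])
    have "(\<lambda>z. Arctan (exp (\<i> * of_real pi * (z + \<i> * of_real d)))) holomorphic_on {z. - d < Im z}"
    proof (rule holomorphic_on_compose_gen[OF _ Arctan_holomorphic_ball, unfolded o_def])
      show "(\<lambda>z. exp (\<i> * of_real pi * (z + \<i> * of_real d))) holomorphic_on {z. - d < Im z}" by (intro holomorphic_intros)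
      show "(\<lambda>z. exp (\<i> * of_real pi * (z + \<i> * of_real d))) ` {z. - d < Im z} \<subseteq> ball 0 1"
        by (auto simp: q dist_norm mult_neg_pos)
    qed
    then show "A d holomorphic_on {z. - d < Im z}" unfolding A_def by (intro holomorphic_intros)
    define r where "r = exp (- pi * d)"
    have r: "r < 1" "r > 0" using d by (auto simp: r_def)
    fix z assume z: "Im z \<ge> 0"
    define p where "p = exp (\<i> * of_real pi * (z + \<i> * of_real d))"
    have "cmod p \<le> r" unfolding p_def q r_def using z by simp
    then have ap: "cmod (Arctan p) \<le> cmod p / (1 - r^2)" by (rule norm_Arctan_le[OF _ r(1)])
    have r2: "1 - r^2 > 0" using r by (simp add: abs_square_less_1)
    have "cmod (cos (of_real pi * z)) \<le> exp (pi * Im z)" using norm_sin_cos_le_exp(2)[of "of_real pi * z"] z by simp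
    then have "cmod (A d z) \<le> (4 / pi) * exp (pi * Im z) * (cmod p / (1 - r^2))"
      unfolding A_def norm_mult norm_of_real p_def[symmetric] using ap r2 by (intro mult_mono) auto
    also have "\<dots> = (4 / pi) * (exp (pi * Im z) * cmod p) / (1 - r^2)" by simp
    also have "exp (pi * Im z) * cmod p = r" unfolding p_def q r_def by (simp add: exp_add[symmetric] algebra_simps)
    finally show "cmod (A d z) \<le> (4 / pi) * r / (1 - r^2)" .
  qed
  have ReA: "Re (A d (of_real x)) = 4 / pi * cos (pi * x) * Re (Arctan (exp (\<i> * of_real pi * (of_real x + \<i> * of_real d))))" for d x
  proof -
    have "A d (of_real x) = of_real (4 / pi * cos (pi * x)) * Arctan (exp (\<i> * of_real pi * (of_real x + \<i> * of_real d)))"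
      unfolding A_def by (simp add: cos_of_real[symmetric] del: cos_of_real)
    then show ?thesis by (simp del: of_real_mult)
  qed
  have At: "A d (\<i> * of_real t) = of_real (4 / pi * cosh (pi * t) * arctan (exp (- pi * (t + d))))" for d
  proof -
    have e1: "\<i> * of_real pi * (\<i> * of_real t + \<i> * of_real d) = of_real (- pi * (t + d))"
      by (simp add: algebra_simps)
    show ?thesis unfolding A_def e1 cos_sin_imaginary(1) exp_of_real Arctan_of_real by simp
  qed
  define d where "d = (\<lambda>n::nat. 1 / (real n + 1))"
  have d0: "d n > 0" for n by (simp add: d_def)
  have dlim: "d \<longlonglongrightarrow> 0" unfolding d_def by real_asymp
  have hb: "has_bochner_integral lborel (\<lambda>x. Re (A (d n) (of_real x)) / (x^2 + t^2)) (4 / t * cosh (pi * t) * arctan (exp (- pi * (t + d n))))" for n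
  proof -
    have "has_bochner_integral lborel (\<lambda>x. Re (A (d n) (of_real x) / of_real (x^2 + t^2))) (Re (of_real (pi / t) * A (d n) (\<i> * of_real t)))"
      by (rule has_bochner_integral_Re[OF P[OF d0]])
    then show ?thesis unfolding At using t by (simp add: Re_divide_of_real del: of_real_add of_real_power of_real_mult of_real_divide)
  qed
  have Ck: "integrable lborel (\<lambda>x. 1 / (x^2 + t^2))" using has_bochner_integral_Cauchy_kernel[OF t] by (simp add: has_bochner_integral_iff)
  have pos: "x^2 + t^2 > 0" for x using t by (simp add: add_nonneg_pos)
  have lim1: "(\<lambda>n. \<integral>x. Re (A (d n) (of_real x)) / (x^2 + t^2) \<partial>lborel) \<longlonglongrightarrow> (\<integral>x. \<bar>cos (pi * x)\<bar> / (x^2 + t^2) \<partial>lborel)"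
  proof (rule integral_dominated_convergence[where w="\<lambda>x. 2 * (1 / (x^2 + t^2))"])
    show "integrable lborel (\<lambda>x. 2 * (1 / (x^2 + t^2)))" by (rule integrable_mult_right[OF Ck])
    show "(\<lambda>x. Re (A (d n) (of_real x)) / (x^2 + t^2)) \<in> borel_measurable lborel" for n
      by (rule borel_measurable_integrable, rule has_bochner_integral_iff[THEN iffD1, THEN conjunct1, OF hb])
    show "AE x in lborel. (\<lambda>n. Re (A (d n) (of_real x)) / (x^2 + t^2)) \<longlonglongrightarrow> \<bar>cos (pi * x)\<bar> / (x^2 + t^2)"
    proof (rule AE_I2, rule tendsto_divide)
      fix x :: real
      show "(\<lambda>n. Re (A (d n) (of_real x))) \<longlonglongrightarrow> \<bar>cos (pi * x)\<bar>"
      proof (cases "cos (pi * x) = 0")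
        case False
        define e where "e = exp (\<i> * of_real (pi * x))"
        have "Re e \<noteq> 0" using False by (simp add: e_def Re_exp)
        then have "(Arctan has_field_derivative inverse (1 + e^2)) (at e)" by (intro has_field_derivative_Arctan) auto
        then have "isCont Arctan e" by (rule DERIV_isCont)
        moreover have "(\<lambda>n. exp (\<i> * of_real pi * (of_real x + \<i> * of_real (d n)))) \<longlonglongrightarrow> exp (\<i> * of_real pi * (of_real x + \<i> * of_real 0))"
          by (intro tendsto_intros dlim)
        then have "(\<lambda>n. exp (\<i> * of_real pi * (of_real x + \<i> * of_real (d n)))) \<longlonglongrightarrow> e" by (simp add: e_def mult.assoc)
        ultimately have "(\<lambda>n. Arctan (exp (\<i> * of_real pi * (of_real x + \<i> * of_real (d n))))) \<longlonglongrightarrow> Arctan e"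
          by (rule isCont_tendsto_compose)
        then have "(\<lambda>n. Re (A (d n) (of_real x))) \<longlonglongrightarrow> 4 / pi * cos (pi * x) * Re (Arctan e)"
          unfolding ReA by (intro tendsto_intros)
        also have "Re (Arctan e) = pi / 4 * sgn (cos (pi * x))" unfolding e_def by (rule Re_Arctan_unit_circle[OF False])
        also have "4 / pi * cos (pi * x) * (pi / 4 * sgn (cos (pi * x))) = \<bar>cos (pi * x)\<bar>" by (simp add: abs_sgn)
        finally show ?thesis .
      qed (simp add: ReA)
      show "x^2 + t^2 \<noteq> 0" using pos[of x] by linarith
    qed simp
    show "AE x in lborel. norm (Re (A (d n) (of_real x)) / (x^2 + t^2)) \<le> 2 * (1 / (x^2 + t^2))" for n
    proof (rule AE_I2)
      fix x :: real
      define p where "p = exp (\<i> * of_real pi * (of_real x + \<i> * of_real (d n)))"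
      have "cmod p < 1" unfolding p_def q using d0[of n] by simp
      then have "\<bar>Re (Arctan p)\<bar> < pi / 2" using abs_Im_le_cmod[of p] by (intro Re_Arctan_bounds) linarith
      then have "\<bar>cos (pi * x)\<bar> * \<bar>Re (Arctan p)\<bar> \<le> 1 * (pi / 2)" by (intro mult_mono) auto
      then have "4 / pi * (\<bar>cos (pi * x)\<bar> * \<bar>Re (Arctan p)\<bar>) \<le> 4 / pi * (1 * (pi / 2))" by (intro mult_left_mono) auto
      then have "\<bar>Re (A (d n) (of_real x))\<bar> \<le> 2" unfolding ReA p_def[symmetric] by (simp add: abs_mult)
      then have "\<bar>Re (A (d n) (of_real x))\<bar> / (x^2 + t^2) \<le> 2 / (x^2 + t^2)" using pos[of x] by (intro divide_right_mono) auto
      then show "norm (Re (A (d n) (of_real x)) / (x^2 + t^2)) \<le> 2 * (1 / (x^2 + t^2))" using pos[of x] by (simp add: abs_divide)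
    qed
  qed measurable
  have "(\<lambda>n. 4 / t * cosh (pi * t) * arctan (exp (- pi * (t + d n)))) \<longlonglongrightarrow> 4 / t * cosh (pi * t) * arctan (exp (- pi * (t + 0)))"
    by (intro tendsto_intros dlim)
  then have "(\<lambda>n. \<integral>x. Re (A (d n) (of_real x)) / (x^2 + t^2) \<partial>lborel) \<longlonglongrightarrow> 4 / t * cosh (pi * t) * arctan (exp (- pi * t))"
    using hb by (simp add: has_bochner_integral_iff)
  then have I: "(\<integral>x. \<bar>cos (pi * x)\<bar> / (x^2 + t^2) \<partial>lborel) = 4 / t * cosh (pi * t) * arctan (exp (- pi * t))"
    using lim1 LIMSEQ_unique by blast
  have "integrable lborel (\<lambda>x. \<bar>cos (pi * x)\<bar> / (x^2 + t^2))"
    by (rule Bochner_Integration.integrable_bound[OF Ck])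
       (use pos in \<open>auto intro!: AE_I2 divide_right_mono simp: abs_divide less_imp_le\<close>)
  then show ?thesis unfolding I[symmetric] using pos by (intro nn_integral_eq_integral) (auto simp: less_imp_le)
qed

section \<open>The zeta function on the positive half-line and Mellin transforms\<close>

text \<open>The n-th term of the Dirichlet series minus the integral of y^(-s) over [n+1, n+2].\<close>

definition zeta_term :: "nat \<Rightarrow> complex \<Rightarrow> complex" where
  "zeta_term n s = of_nat (Suc n) powr (- s) - (of_nat (Suc (Suc n)) powr (1 - s) - of_nat (Suc n) powr (1 - s)) / (1 - s)"

text \<open>The analytic continuation of \<zeta> to Re s > 0; the pole at 1 comes from the integral of y^(-s) over [1, \<infinity>).\<close>

definition zeta_cont :: "complex \<Rightarrow> complex" where
  "zeta_cont s = (\<Sum>n. zeta_term n s) + 1 / (s - 1)"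

lemma norm_of_real_powr: "x > 0 \<Longrightarrow> cmod (of_real x powr s) = x powr Re s"
  by (simp add: norm_powr_real_powr)

text \<open>Both the variation of y^(-s) on a unit interval and, after one more application of the mean value inequality, its difference from the
integral are controlled by the derivative at the left end point.\<close>

lemma norm_zeta_term_le:
  assumes s: "Re s > 0" "s \<noteq> 1"
  shows "cmod (zeta_term n s) \<le> cmod s * real (Suc n) powr (- Re s - 1)"
proof -
  define N where "N = real (Suc n)"
  have N: "N > 0" by (simp add: N_def)
  have powr_deriv: "((\<lambda>z. z powr a) has_field_derivative a * of_real x powr (a - 1)) (at (of_real x) within A)"
    if "x > 0" for x a and A :: "complex set"
    by (rule has_field_derivative_at_within) (use has_field_derivative_powr[of "of_real x" a] that in \<open>simp add: complex_nonpos_Reals_iff\<close>)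
  have step1: "cmod (of_real N powr (- s) - of_real x powr (- s)) \<le> cmod s * N powr (- Re s - 1)" if x: "x \<in> {N..N + 1}" for x
  proof -
    have "cmod (of_real x powr (- s) - of_real N powr (- s)) \<le> (cmod s * N powr (- Re s - 1)) * cmod (of_real x - of_real N :: complex)"
    proof (rule field_differentiable_bound[where S="closed_segment (of_real N) (of_real x)" and f="\<lambda>z. z powr (- s)" and f'="\<lambda>z. (- s) * z powr (- s - 1)"])
      fix z assume "z \<in> closed_segment (complex_of_real N) (of_real x)"
      then obtain y where y: "z = of_real y" "y \<in> closed_segment N x" by (auto simp: closed_segment_of_real)
      then have yN: "y \<ge> N" using x by (auto simp: closed_segment_eq_real_ivl split: if_splits)
      then have y0: "y > 0" using N by linarith
      show "((\<lambda>z. z powr (- s)) has_field_derivative (- s) * z powr (- s - 1)) (at z within closed_segment (of_real N) (of_real x))"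
        unfolding y(1) by (rule powr_deriv[OF y0])
      have "cmod ((- s) * z powr (- s - 1)) = cmod s * y powr (- Re s - 1)"
        unfolding y(1) by (simp add: norm_mult norm_of_real_powr[OF y0])
      also have "\<dots> \<le> cmod s * N powr (- Re s - 1)"
        using yN N s by (intro mult_left_mono powr_mono2') auto
      finally show "cmod ((- s) * z powr (- s - 1)) \<le> cmod s * N powr (- Re s - 1)" .
    qed auto
    also have "\<dots> \<le> (cmod s * N powr (- Re s - 1)) * 1"
    proof (rule mult_left_mono)
      have "cmod (of_real x - of_real N :: complex) = \<bar>x - N\<bar>" by (metis norm_of_real of_real_diff)
      then show "cmod (of_real x - of_real N :: complex) \<le> 1" using x by simp
    qed simp
    finally show ?thesis by (simp add: norm_minus_commute)
  qed
  define \<phi> where "\<phi> = (\<lambda>z. of_real N powr (- s) * z - z powr (1 - s) / (1 - s))"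
  have "cmod (\<phi> (of_real (N + 1)) - \<phi> (of_real N)) \<le> (cmod s * N powr (- Re s - 1)) * cmod (of_real (N + 1) - of_real N :: complex)"
  proof (rule field_differentiable_bound[where S="closed_segment (of_real N) (of_real (N + 1))" and f'="\<lambda>z. of_real N powr (- s) - z powr (- s)"])
    fix z assume "z \<in> closed_segment (complex_of_real N) (of_real (N + 1))"
    then obtain y where y: "z = of_real y" "y \<in> closed_segment N (N + 1)" by (auto simp del: of_real_add simp: closed_segment_of_real)
    then have yN: "y \<in> {N..N + 1}" by (simp add: closed_segment_eq_real_ivl)
    then have y0: "y > 0" using N by simp
    have "((\<lambda>z. z powr (1 - s)) has_field_derivative (1 - s) * of_real y powr (1 - s - 1)) (at z within closed_segment (of_real N) (of_real (N + 1)))"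
      unfolding y(1) by (rule powr_deriv[OF y0])
    then have "((\<lambda>z. z powr (1 - s) / (1 - s)) has_field_derivative ((1 - s) * of_real y powr (1 - s - 1)) / (1 - s)) (at z within closed_segment (of_real N) (of_real (N + 1)))"
      by (rule DERIV_cdivide)
    moreover have "((1 - s) * of_real y powr (1 - s - 1)) / (1 - s) = of_real y powr (- s)" using s by simp
    ultimately have "((\<lambda>z. z powr (1 - s) / (1 - s)) has_field_derivative of_real y powr (- s)) (at z within closed_segment (of_real N) (of_real (N + 1)))"
      by (simp only:)
    then have "((\<lambda>z. of_real N powr (- s) * z - z powr (1 - s) / (1 - s)) has_field_derivative of_real N powr (- s) * 1 - of_real y powr (- s)) (at z within closed_segment (of_real N) (of_real (N + 1)))"
      by (intro DERIV_diff DERIV_cmult DERIV_ident)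
    then show "(\<phi> has_field_derivative of_real N powr (- s) - z powr (- s)) (at z within closed_segment (of_real N) (of_real (N + 1)))"
      by (simp add: \<phi>_def y(1))
    show "cmod (of_real N powr (- s) - z powr (- s)) \<le> cmod s * N powr (- Re s - 1)"
      unfolding y(1) by (rule step1[OF yN])
  qed auto
  moreover have "\<phi> (of_real (N + 1)) - \<phi> (of_real N) = zeta_term n s"
    by (simp add: \<phi>_def zeta_term_def N_def algebra_simps diff_divide_distrib add_divide_distrib)
  ultimately show ?thesis by (simp add: N_def)
qed

lemma summable_powr_Suc: "a < -1 \<Longrightarrow> summable (\<lambda>n. real (Suc n) powr a)"
  using summable_real_powr_iff[of a] summable_Suc_iff[of "\<lambda>n. real n powr a"] by simp

lemma zeta_term_summable:
  assumes s: "Re s > 0" "s \<noteq> 1"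
  shows "summable (\<lambda>n. zeta_term n s)"
proof (rule summable_comparison_test'[where N=0])
  show "summable (\<lambda>n. cmod s * real (Suc n) powr (- Re s - 1))"
    using s by (intro summable_mult summable_powr_Suc) simp
qed (rule norm_zeta_term_le[OF s])

lemma zeta_cont_holomorphic: "zeta_cont holomorphic_on {z. Re z > 0} - {1}"
proof -
  define A where "A = {z. Re z > 0} - {1::complex}"
  have opA: "open A" unfolding A_def by (intro open_delete open_halfspace_Re_gt)
  have "(\<lambda>s. \<Sum>n. zeta_term n s) holomorphic_on A"
  proof (rule holomorphic_uniform_sequence[OF opA, where f="\<lambda>N s. \<Sum>n<N. zeta_term n s"])
    show "(\<lambda>s. \<Sum>n<N. zeta_term n s) holomorphic_on A" for N
      unfolding zeta_term_def A_def by (intro holomorphic_intros) auto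
    fix x assume x: "x \<in> A"
    then obtain d0 where d0: "d0 > 0" "cball x d0 \<subseteq> A" using opA open_contains_cball by blast
    define d where "d = min d0 (Re x / 2)"
    have d: "d > 0" "cball x d \<subseteq> A" using d0 x by (auto simp: d_def A_def)
    have "uniform_limit (cball x d) (\<lambda>N s. \<Sum>n<N. zeta_term n s) (\<lambda>s. \<Sum>n. zeta_term n s) sequentially"
    proof (rule Weierstrass_m_test)
      fix n s assume s: "s \<in> cball x d"
      then have "s \<in> A" using d by blast
      then have s': "Re s > 0" "s \<noteq> 1" by (auto simp: A_def)
      have "\<bar>Re (x - s)\<bar> \<le> d" using s abs_Re_le_cmod[of "x - s"] by (simp add: dist_norm)
      then have "Re x - Re s \<le> d" by simp
      also have "d \<le> Re x / 2" by (simp add: d_def)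
      finally have "Re x - Re s \<le> Re x / 2" .
      then have Re: "Re s \<ge> Re x / 2" by simp
      have cs: "cmod s \<le> cmod x + d" using s norm_triangle_ineq2[of s x] by (simp add: dist_norm norm_minus_commute)
      have "cmod (zeta_term n s) \<le> cmod s * real (Suc n) powr (- Re s - 1)" by (rule norm_zeta_term_le[OF s'])
      also have "\<dots> \<le> (cmod x + d) * real (Suc n) powr (- (Re x / 2) - 1)"
        using Re cs d by (intro mult_mono powr_mono) auto
      finally show "cmod (zeta_term n s) \<le> (cmod x + d) * real (Suc n) powr (- (Re x / 2) - 1)" .
    next
      show "summable (\<lambda>n. (cmod x + d) * real (Suc n) powr (- (Re x / 2) - 1))"
        using x by (intro summable_mult summable_powr_Suc) (auto simp: A_def)
    qed
    then show "\<exists>d>0. cball x d \<subseteq> A \<and> uniform_limit (cball x d) (\<lambda>N s. \<Sum>n<N. zeta_term n s) (\<lambda>s. \<Sum>n. zeta_term n s) sequentially"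
      using d by blast
  qed
  then show ?thesis unfolding zeta_cont_def[abs_def] A_def[symmetric]
    by (intro holomorphic_intros) (auto simp: A_def)
qed

lemma sum_zeta_term:
  "(\<Sum>n<N. zeta_term n s) = (\<Sum>n<N. of_nat (Suc n) powr (- s)) - (of_nat (Suc N) powr (1 - s) - 1) / (1 - s)"
proof -
  have "(\<Sum>n<N. zeta_term n s) = (\<Sum>n<N. of_nat (Suc n) powr (- s)) - (\<Sum>n<N. of_nat (Suc (Suc n)) powr (1 - s) - of_nat (Suc n) powr (1 - s)) / (1 - s)"
    unfolding zeta_term_def sum_subtractf sum_divide_distrib[symmetric] ..
  also have "(\<Sum>n<N. of_nat (Suc (Suc n)) powr (1 - s) - of_nat (Suc n) powr (1 - s)) = of_nat (Suc N) powr (1 - s) - (1::complex)"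
    using sum_lessThan_telescope[of "\<lambda>n. of_nat (Suc n) powr (1 - s)" N] by simp
  finally show ?thesis .
qed

text \<open>Throughout Re s > 0 the partial sums of the Dirichlet series converge to \<zeta> after subtraction of an explicit divergent term. In
this form the value for real s between 0 and 1 can be compared with the alternating series.\<close>

lemma partial_zeta_tendsto:
  assumes s: "Re s > 0" "s \<noteq> 1"
  shows "(\<lambda>N. (\<Sum>n<N. of_nat (Suc n) powr (- s)) - of_nat (Suc N) powr (1 - s) / (1 - s)) \<longlonglongrightarrow> zeta_cont s"
proof -
  have "(\<lambda>N. (\<Sum>n<N. zeta_term n s) + 1 / (s - 1)) \<longlonglongrightarrow> zeta_cont s"
    unfolding zeta_cont_def using summable_LIMSEQ[OF zeta_term_summable[OF s]] by (intro tendsto_add tendsto_const)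
  moreover have "(\<Sum>n<N. zeta_term n s) + 1 / (s - 1) = (\<Sum>n<N. of_nat (Suc n) powr (- s)) - of_nat (Suc N) powr (1 - s) / (1 - s)" for N
  proof -
    have "1 / (s - 1) = - (1 / (1 - s))" using s by (simp add: field_simps)
    then show ?thesis unfolding sum_zeta_term by (simp add: diff_divide_distrib)
  qed
  ultimately show ?thesis by simp
qed

lemma zeta_cont_sums:
  assumes s: "Re s > 1"
  shows "(\<lambda>n. of_nat (Suc n) powr (- s)) sums zeta_cont s"
proof -
  have s': "Re s > 0" "s \<noteq> 1" using s by auto
  have "(\<lambda>N. of_nat (Suc N) powr (1 - s) / (1 - s)) \<longlonglongrightarrow> 0"
  proof (rule tendsto_norm_zero_cancel)
    have "filterlim (\<lambda>N. real (Suc N)) at_top sequentially"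
      by (rule filterlim_compose[OF filterlim_real_sequentially filterlim_Suc])
    then have "(\<lambda>N. real (Suc N) powr (1 - Re s)) \<longlonglongrightarrow> 0"
      by (rule tendsto_neg_powr[rotated]) (use s in simp)
    then have "(\<lambda>N. real (Suc N) powr (1 - Re s) / cmod (1 - s)) \<longlonglongrightarrow> 0 / cmod (1 - s)"
      using s' by (intro tendsto_divide) auto
    moreover have "cmod (of_nat (Suc N) powr (1 - s) / (1 - s)) = real (Suc N) powr (1 - Re s) / cmod (1 - s)" for N
      using norm_of_real_powr[of "real (Suc N)" "1 - s"] by (simp add: norm_divide)
    ultimately show "(\<lambda>N. cmod (of_nat (Suc N) powr (1 - s) / (1 - s))) \<longlonglongrightarrow> 0" by simp
  qed
  from tendsto_add[OF partial_zeta_tendsto[OF s'] this] show ?thesis by (simp add: sums_def)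
qed

lemma riemann_zeta_eq_zeta_cont:
  assumes "Re s > 0" "s \<noteq> 1"
  shows "riemann_zeta s = zeta_cont s"
  by (rule riemann_zeta_eqI[OF assms(1) zeta_cont_holomorphic zeta_cont_sums assms(2)])

lemma riemann_zeta_real_gt_1:
  assumes s: "s > 1"
  shows "riemann_zeta (of_real s) = of_real (\<Sum>n. real (Suc n) powr (- s))"
proof -
  have "(\<lambda>n. of_nat (Suc n) powr (- (of_real s))) sums riemann_zeta (of_real s)"
    using zeta_cont_sums[of "of_real s"] riemann_zeta_eq_zeta_cont[of "of_real s"] s by simp
  moreover have "of_nat (Suc n) powr (- (of_real s)) = complex_of_real (real (Suc n) powr (- s))" for n
    using powr_of_real[of "real (Suc n)" "- s"] by simp
  ultimately have 1: "(\<lambda>n. complex_of_real (real (Suc n) powr (- s))) sums riemann_zeta (of_real s)" by simp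
  have "(\<lambda>n. real (Suc n) powr (- s)) sums (\<Sum>n. real (Suc n) powr (- s))"
    using summable_powr_Suc[of "- s"] s by (intro summable_sums) simp
  then have "(\<lambda>n. complex_of_real (real (Suc n) powr (- s))) sums of_real (\<Sum>n. real (Suc n) powr (- s))"
    by (rule sums_of_real)
  with 1 show ?thesis by (rule sums_unique2)
qed

text \<open>Subtracting twice the even-indexed terms from the partial sum of length 2N gives the alternating sum, so it equals
f(2N) - 2^(1-s) f(N) up to the difference of the correction terms, which tends to 0.\<close>

lemma eta_riemann_zeta:
  assumes s: "s > 0" "s \<noteq> 1" and eta: "(\<lambda>n. (-1) ^ n * real (Suc n) powr (- s)) sums E"
  shows "of_real E = of_real (1 - 2 powr (1 - s)) * riemann_zeta (of_real s)"
proof -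
  define a where "a = (\<lambda>n. real (Suc n) powr (- s))"
  define c where "c = 2 powr (1 - s)"
  have split: "(\<Sum>n<2 * N. (-1) ^ n * a n) = (\<Sum>n<2 * N. a n) - c * (\<Sum>n<N. a n)" for N
  proof (induction N)
    case (Suc N)
    have "a (Suc (2 * N)) = 2 powr (- s) * a N"
    proof -
      have "real (Suc (Suc (2 * N))) = 2 * real (Suc N)" by simp
      then show ?thesis unfolding a_def by (simp only: powr_mult)
    qed
    moreover have "c = 2 * 2 powr (- s)" by (simp add: c_def powr_diff powr_minus field_simps)
    ultimately have "c * a N = 2 * a (Suc (2 * N))" by simp
    then show ?case using Suc by (simp add: algebra_simps)
  qed simp
  define f where "f = (\<lambda>N. (\<Sum>n<N. a n) - real (Suc N) powr (1 - s) / (1 - s))"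
  have "(\<lambda>N. (\<Sum>n<N. of_nat (Suc n) powr (- (of_real s))) - of_nat (Suc N) powr (1 - of_real s) / (1 - of_real s)) \<longlonglongrightarrow> zeta_cont (of_real s)"
    by (rule partial_zeta_tendsto) (use s in auto)
  moreover have "(\<Sum>n<N. of_nat (Suc n) powr (- (of_real s))) - of_nat (Suc N) powr (1 - of_real s) / (1 - of_real s) = complex_of_real (f N)" for N
  proof -
    have "of_nat (Suc n) powr (of_real b) = complex_of_real (real (Suc n) powr b)" for n b
      using powr_of_real[of "real (Suc n)" b] by simp
    from this[of _ "- s"] this[of _ "1 - s"] show ?thesis by (simp add: f_def a_def)
  qed
  ultimately have fl: "(\<lambda>N. complex_of_real (f N)) \<longlonglongrightarrow> zeta_cont (of_real s)" by simp
  have sub: "filterlim (\<lambda>N::nat. 2 * N) sequentially sequentially"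
    by (rule filterlim_subseq) (simp add: strict_mono_def)
  define r where "r = (\<lambda>N. (real (Suc (2 * N)) powr (1 - s) - c * real (Suc N) powr (1 - s)) / (1 - s))"
  have r0: "r \<longlonglongrightarrow> 0"
  proof -
    have e: "c * real (Suc N) powr (1 - s) = real (2 * N + 2) powr (1 - s)" for N
    proof -
      have "real (2 * N + 2) = 2 * real (Suc N)" by simp
      then show ?thesis unfolding c_def by (simp only: powr_mult)
    qed
    have "(\<lambda>N. real (2 * N + 1) powr (1 - s) - real (2 * N + 2) powr (1 - s)) \<longlonglongrightarrow> 0"
    proof (rule Lim_null_comparison)
      show "eventually (\<lambda>N. norm (real (2 * N + 1) powr (1 - s) - real (2 * N + 2) powr (1 - s)) \<le> \<bar>1 - s\<bar> * real (2 * N + 1) powr (- s)) sequentially"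
      proof (intro always_eventually allI)
        fix N
        define x where "x = real (2 * N + 1)"
        have x: "x > 0" by (simp add: x_def)
        have "norm ((x + 1) powr (1 - s) - x powr (1 - s)) \<le> (\<bar>1 - s\<bar> * x powr (- s)) * norm ((x + 1) - x)"
        proof (rule field_differentiable_bound[where S="{x..x + 1}" and f="\<lambda>y. y powr (1 - s)" and f'="\<lambda>y. (1 - s) * y powr (- s)"])
          fix y assume y: "y \<in> {x..x + 1}"
          then have "y > 0" using x by simp
          then show "((\<lambda>y. y powr (1 - s)) has_field_derivative (1 - s) * y powr (- s)) (at y within {x..x + 1})"
            using has_field_derivative_at_within[OF has_real_derivative_powr[of y "1 - s"]] by simp
          have "y powr (- s) \<le> x powr (- s)" using y x s by (intro powr_mono2') auto
          then show "norm ((1 - s) * y powr (- s)) \<le> \<bar>1 - s\<bar> * x powr (- s)" by (simp add: abs_mult mult_left_mono)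
        qed auto
        moreover have "x + 1 = real (2 * N + 2)" by (simp add: x_def)
        ultimately show "norm (real (2 * N + 1) powr (1 - s) - real (2 * N + 2) powr (1 - s)) \<le> \<bar>1 - s\<bar> * real (2 * N + 1) powr (- s)"
          by (simp add: x_def abs_minus_commute)
      qed
      have "filterlim (\<lambda>N. real (2 * N + 1)) at_top sequentially" by real_asymp
      then have "(\<lambda>N. real (2 * N + 1) powr (- s)) \<longlonglongrightarrow> 0" by (rule tendsto_neg_powr[rotated]) (use s in simp)
      from tendsto_mult_left[OF this, of "\<bar>1 - s\<bar>"] show "(\<lambda>N. \<bar>1 - s\<bar> * real (2 * N + 1) powr (- s)) \<longlonglongrightarrow> 0" by simp
    qed
    from tendsto_divide[OF this tendsto_const[of "1 - s"]] s
    show ?thesis unfolding r_def e by simp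
  qed
  have eq: "(\<Sum>n<2 * N. (-1) ^ n * a n) = f (2 * N) - c * f N + r N" for N
    unfolding split f_def r_def by (simp add: right_diff_distrib diff_divide_distrib)
  have "(\<lambda>N. complex_of_real (f (2 * N)) - of_real c * of_real (f N) + of_real (r N)) \<longlonglongrightarrow> zeta_cont (of_real s) - of_real c * zeta_cont (of_real s) + of_real 0"
    by (intro tendsto_add tendsto_diff tendsto_mult tendsto_const fl filterlim_compose[OF fl sub] tendsto_of_real r0)
  then have 1: "(\<lambda>N. complex_of_real (\<Sum>n<2 * N. (-1) ^ n * a n)) \<longlonglongrightarrow> of_real (1 - c) * zeta_cont (of_real s)"
    unfolding eq by (simp add: left_diff_distrib)
  have "(\<lambda>N. \<Sum>n<N. (-1) ^ n * a n) \<longlonglongrightarrow> E" using eta by (simp add: sums_def a_def)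
  then have "(\<lambda>N. complex_of_real (\<Sum>n<2 * N. (-1) ^ n * a n)) \<longlonglongrightarrow> of_real E"
    by (intro tendsto_of_real filterlim_compose[OF _ sub])
  with 1 have "of_real E = of_real (1 - c) * zeta_cont (of_real s)" using LIMSEQ_unique by blast
  then show ?thesis using riemann_zeta_eq_zeta_cont[of "of_real s"] s by (simp add: c_def)
qed

lemma has_bochner_integral_Gamma_scaled:
  fixes b y :: real
  assumes b: "b > -1" and y: "y > 0"
  shows "has_bochner_integral lborel (\<lambda>t. indicator {0<..} t *\<^sub>R (t powr b * exp (- y * t))) (Gamma (b + 1) * y powr (- (b + 1)))"
proof (rule has_bochner_integral_nn_integral)
  have "(\<integral>\<^sup>+t. ennreal (indicator {0<..} t *\<^sub>R (t powr b * exp (- y * t))) \<partial>lborel) = (\<integral>\<^sup>+v. ennreal (v powr ((b + 1) - 1) * exp (- y * v)) * indicator {0<..} v \<partial>lborel)"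
    by (intro nn_integral_cong) (auto simp: indicator_def)
  also have "\<dots> = ennreal (Gamma (b + 1) * y powr (- (b + 1)))" by (rule nn_integral_Gamma_scaled) (use b y in auto)
  finally show "(\<integral>\<^sup>+t. ennreal (indicator {0<..} t *\<^sub>R (t powr b * exp (- y * t))) \<partial>lborel) = ennreal (Gamma (b + 1) * y powr (- (b + 1)))" .
qed (use b in \<open>auto simp: indicator_def intro!: mult_nonneg_nonneg Gamma_real_nonneg\<close>)

lemma exp_neg_mult_Suc: "exp (- (a * real (Suc n)) * t) = exp (- a * t) ^ (Suc n)"
proof -
  have "- (a * real (Suc n)) * t = real (Suc n) * (- a * t)" by (simp add: algebra_simps)
  then show ?thesis by (simp only: exp_of_nat_mult)
qed

text \<open>For -1 < b \<le> 0 the series of absolute values diverges, so the termwise integration of the geometric series uses that its partial sums,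
being alternating, are dominated by twice the first term.\<close>

lemma Mellin_alternating:
  fixes a b :: real
  assumes b: "b > -1" and a: "a > 0"
  shows "integrable lborel (\<lambda>t. indicator {0<..} t *\<^sub>R (t powr b * (exp (- a * t) / (1 + exp (- a * t)))))"
    and "(\<lambda>n. (-1) ^ n * real (Suc n) powr (- (b + 1))) sums
      ((\<integral>t. indicator {0<..} t *\<^sub>R (t powr b * (exp (- a * t) / (1 + exp (- a * t)))) \<partial>lborel) / (Gamma (b + 1) * a powr (- (b + 1))))"
proof -
  define q where "q = (\<lambda>t. exp (- a * t))"
  define F where "F = (\<lambda>t. indicator {0<..} t *\<^sub>R (t powr b * (q t / (1 + q t))))"
  define s where "s = (\<lambda>N t. \<Sum>n<N. (-1) ^ n * (indicator {0<..} t *\<^sub>R (t powr b * exp (- (a * real (Suc n)) * t))))"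
  define G where "G = Gamma (b + 1) * a powr (- (b + 1))"
  have G: "G > 0" unfolding G_def using a b by (intro mult_pos_pos Gamma_real_pos) auto
  have hb: "has_bochner_integral lborel (\<lambda>t. indicator {0<..} t *\<^sub>R (t powr b * exp (- (a * real (Suc n)) * t))) (G * real (Suc n) powr (- (b + 1)))" for n
  proof -
    have "a * real (Suc n) > 0" using a by simp
    from has_bochner_integral_Gamma_scaled[OF b this]
    show ?thesis unfolding G_def using a by (simp add: powr_mult mult.assoc del: of_nat_Suc)
  qed
  have sint: "has_bochner_integral lborel (s N) (\<Sum>n<N. (-1) ^ n * (G * real (Suc n) powr (- (b + 1))))" for N
    unfolding s_def by (intro has_bochner_integral_sum has_bochner_integral_mult_right hb)
  have dom: "integrable lborel (\<lambda>t. 2 * (indicator {0<..} t *\<^sub>R (t powr b * exp (- a * t))))"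
    using has_bochner_integral_Gamma_scaled[OF b a] by (intro integrable_mult_right) (auto simp: has_bochner_integral_iff)
  have q: "0 < q t" "t > 0 \<Longrightarrow> q t < 1" for t using a by (auto simp: q_def)
  have q': "exp (- a * t) = q t" for t by (simp add: q_def)
  have s_eq: "s N t = t powr b * (q t * ((1 - (- q t) ^ N) / (1 + q t)))" if t: "t > 0" for N t
  proof -
    have "s N t = t powr b * (q t * (\<Sum>n<N. (- q t) ^ n))"
      unfolding s_def sum_distrib_left exp_neg_mult_Suc q'
    proof (intro sum.cong refl)
      fix n
      have "(-1) ^ n * (1 *\<^sub>R (t powr b * q t ^ Suc n)) = t powr b * (q t * (- q t) ^ n)"
        by (simp add: power_minus[of "q t"] mult_ac)
      then show "(-1) ^ n * (indicator {0<..} t *\<^sub>R (t powr b * q t ^ Suc n)) = t powr b * (q t * (- q t) ^ n)"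
        using t by simp
    qed
    also have "(\<Sum>n<N. (- q t) ^ n) = (1 - (- q t) ^ N) / (1 + q t)"
      using q(1)[of t] by (subst sum_gp_strict) auto
    finally show ?thesis .
  qed
  have abs_pow: "\<bar>(- q t) ^ N\<bar> \<le> 1" if "t > 0" for t N
    using q[of t] that by (simp add: power_abs power_le_one)
  have F_le: "norm (F t) \<le> norm (2 * (indicator {0<..} t *\<^sub>R (t powr b * exp (- a * t))))" for t
  proof (cases "t > 0")
    case True
    have "q t / (1 + q t) \<le> 2 * q t" using q(1)[of t] by (simp add: divide_le_eq algebra_simps)
    then have "t powr b * (q t / (1 + q t)) \<le> t powr b * (2 * q t)" by (intro mult_left_mono) auto
    moreover have "t powr b * (2 * q t) = 2 * (indicator {0<..} t *\<^sub>R (t powr b * exp (- a * t)))"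
      using True by (simp add: q_def)
    moreover have "F t = t powr b * (q t / (1 + q t))" using True by (simp add: F_def)
    moreover have "0 \<le> t powr b * (q t / (1 + q t))" using q(1)[of t] by simp
    ultimately show ?thesis unfolding real_norm_def by linarith
  qed (simp add: F_def)
  have mF [measurable]: "F \<in> borel_measurable lborel" unfolding F_def q_def by measurable
  have iF: "integrable lborel F"
    by (rule Bochner_Integration.integrable_bound[OF dom mF]) (use F_le in auto)
  have "(\<lambda>N. \<integral>t. s N t \<partial>lborel) \<longlonglongrightarrow> (\<integral>t. F t \<partial>lborel)"
  proof (rule integral_dominated_convergence[OF mF _ dom])
    show "s N \<in> borel_measurable lborel" for N
      using sint[of N] has_bochner_integral_iff borel_measurable_integrable by blast
    show "AE t in lborel. (\<lambda>N. s N t) \<longlonglongrightarrow> F t"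
    proof (rule AE_I2)
      fix t :: real
      show "(\<lambda>N. s N t) \<longlonglongrightarrow> F t"
      proof (cases "t > 0")
        case True
        have "norm (- q t) < 1" using q(1)[of t] q(2)[OF True] by simp
        then have L: "(\<lambda>N. (- q t) ^ N) \<longlonglongrightarrow> 0" by (rule LIMSEQ_power_zero)
        have "(\<lambda>N. t powr b * (q t * ((1 - (- q t) ^ N) / (1 + q t)))) \<longlonglongrightarrow> t powr b * (q t * ((1 - 0) / (1 + q t)))"
          by (intro tendsto_mult tendsto_divide tendsto_diff tendsto_const L) (use q(1)[of t] in auto)
        then show ?thesis using True by (simp add: s_eq F_def)
      qed (simp add: s_def F_def)
    qed
    show "AE t in lborel. norm (s N t) \<le> 2 * (indicator {0<..} t *\<^sub>R (t powr b * exp (- a * t)))" for N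
    proof (rule AE_I2)
      fix t :: real
      show "norm (s N t) \<le> 2 * (indicator {0<..} t *\<^sub>R (t powr b * exp (- a * t)))"
      proof (cases "t > 0")
        case True
        have "\<bar>(1 - (- q t) ^ N) / (1 + q t)\<bar> \<le> 2 / 1"
          unfolding abs_divide
        proof (intro frac_le)
          show "\<bar>1 - (- q t) ^ N\<bar> \<le> 2" using abs_pow[OF True, of N] by linarith
        qed (use q(1)[of t] in auto)
        then have "\<bar>t powr b * (q t * ((1 - (- q t) ^ N) / (1 + q t)))\<bar> \<le> t powr b * (q t * 2)"
          using q(1)[of t] unfolding abs_mult by (intro mult_mono) auto
        moreover have "t powr b * (q t * 2) = 2 * (indicator {0<..} t *\<^sub>R (t powr b * exp (- a * t)))"
          using True by (simp add: q_def)
        ultimately show ?thesis unfolding s_eq[OF True] real_norm_def by linarith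
      qed (simp add: s_def)
    qed
  qed
  moreover have "(\<integral>t. s N t \<partial>lborel) = (\<Sum>n<N. (-1) ^ n * (G * real (Suc n) powr (- (b + 1))))" for N
    using sint[of N] by (simp add: has_bochner_integral_iff)
  ultimately have "(\<lambda>n. (-1) ^ n * (G * real (Suc n) powr (- (b + 1)))) sums (\<integral>t. F t \<partial>lborel)" by (simp add: sums_def)
  then have "(\<lambda>n. (-1) ^ n * (G * real (Suc n) powr (- (b + 1))) / G) sums ((\<integral>t. F t \<partial>lborel) / G)" by (rule sums_divide)
  moreover have "(-1) ^ n * (G * real (Suc n) powr (- (b + 1))) / G = (-1) ^ n * real (Suc n) powr (- (b + 1))" for n
    using G by simp
  ultimately have "(\<lambda>n. (-1) ^ n * real (Suc n) powr (- (b + 1))) sums ((\<integral>t. F t \<partial>lborel) / G)" by (simp only:)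
  then show "(\<lambda>n. (-1) ^ n * real (Suc n) powr (- (b + 1))) sums
      ((\<integral>t. indicator {0<..} t *\<^sub>R (t powr b * (exp (- a * t) / (1 + exp (- a * t)))) \<partial>lborel) / (Gamma (b + 1) * a powr (- (b + 1))))"
    unfolding F_def q_def G_def .
  show "integrable lborel (\<lambda>t. indicator {0<..} t *\<^sub>R (t powr b * (exp (- a * t) / (1 + exp (- a * t)))))"
    using iF by (simp add: F_def q_def)
qed

lemma Mellin_series:
  fixes b :: real and c r :: "nat \<Rightarrow> real" and f :: "real \<Rightarrow> real"
  assumes b: "b > -1" and r: "\<And>n. r n > 0" and f: "\<And>t. t > 0 \<Longrightarrow> (\<lambda>n. c n * exp (- r n * t)) sums f t"
    and abs: "\<And>t. t > 0 \<Longrightarrow> summable (\<lambda>n. \<bar>c n\<bar> * exp (- r n * t))"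
    and sm: "summable (\<lambda>n. \<bar>c n\<bar> * r n powr (- (b + 1)))"
  shows "has_bochner_integral lborel (\<lambda>t. indicator {0<..} t *\<^sub>R (t powr b * f t)) (Gamma (b + 1) * (\<Sum>n. c n * r n powr (- (b + 1))))"
proof -
  define g where "g = (\<lambda>n t. c n * (indicator {0<..} t *\<^sub>R (t powr b * exp (- r n * t))))"
  have hb: "has_bochner_integral lborel (g n) (c n * (Gamma (b + 1) * r n powr (- (b + 1))))" for n
    unfolding g_def by (intro has_bochner_integral_mult_right has_bochner_integral_Gamma_scaled b r)
  have ng: "norm (g n t) = \<bar>c n\<bar> * (indicator {0<..} t *\<^sub>R (t powr b * exp (- r n * t)))" for n t
    by (simp add: g_def abs_mult indicator_def)
  have hbn: "has_bochner_integral lborel (\<lambda>t. norm (g n t)) (\<bar>c n\<bar> * (Gamma (b + 1) * r n powr (- (b + 1))))" for n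
    unfolding ng by (intro has_bochner_integral_mult_right has_bochner_integral_Gamma_scaled b r)
  have i: "integrable lborel (g n)" for n using hb[of n] by (simp add: has_bochner_integral_iff)
  have s1: "AE t in lborel. summable (\<lambda>n. norm (g n t))"
  proof (rule AE_I2)
    fix t :: real
    show "summable (\<lambda>n. norm (g n t))"
    proof (cases "t > 0")
      case True
      then show ?thesis using summable_mult[OF abs[OF True], of "t powr b"] unfolding ng by (simp add: mult_ac)
    next
      case False
      then show ?thesis unfolding ng by simp
    qed
  qed
  have s2: "summable (\<lambda>n. \<integral>t. norm (g n t) \<partial>lborel)"
    using summable_mult[OF sm, of "Gamma (b + 1)"] hbn by (simp add: has_bochner_integral_iff mult_ac)
  have ae: "(\<Sum>n. g n t) = indicator {0<..} t *\<^sub>R (t powr b * f t)" for t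
  proof (cases "t > 0")
    case True
    have "(\<lambda>n. t powr b * (c n * exp (- r n * t))) sums (t powr b * f t)" using f[OF True] by (rule sums_mult)
    then show ?thesis using True by (simp add: g_def sums_iff mult_ac)
  qed (simp add: g_def)
  have "integrable lborel (\<lambda>t. \<Sum>n. g n t)" by (rule integrable_suminf[OF i s1 s2])
  moreover have "(\<integral>t. (\<Sum>n. g n t) \<partial>lborel) = (\<Sum>n. \<integral>t. g n t \<partial>lborel)" by (rule integral_suminf[OF i s1 s2])
  moreover have "(\<integral>t. g n t \<partial>lborel) = Gamma (b + 1) * (c n * r n powr (- (b + 1)))" for n
    using hb[of n] by (simp add: has_bochner_integral_iff mult_ac)
  moreover have "summable (\<lambda>n. c n * r n powr (- (b + 1)))"
    by (rule summable_norm_cancel) (use sm in \<open>simp add: abs_mult\<close>)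
  then have "(\<Sum>n. Gamma (b + 1) * (c n * r n powr (- (b + 1)))) = Gamma (b + 1) * (\<Sum>n. c n * r n powr (- (b + 1)))"
    by (rule suminf_mult)
  ultimately show ?thesis unfolding ae by (simp add: has_bochner_integral_iff)
qed

section \<open>Abstract extremality criteria\<close>

lemma ex_point_AE:
  assumes "AE x in lborel. P (x::real)" "a < b"
  shows "\<exists>x\<in>{a<..<b}. P x"
proof (rule ccontr)
  assume "\<not> ?thesis"
  then have *: "\<And>x. x \<in> {a<..<b} \<Longrightarrow> \<not> P x" by blast
  have "AE x in lborel. x \<notin> {a<..<b}"
    using assms(1) by eventually_elim (use * in blast)
  then have "emeasure lborel {a<..<b} = 0" by (subst (asm) AE_iff_measurable[of "{a<..<b}"]) auto
  then show False using assms(2) by (simp add: emeasure_lborel_Ioo)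
qed

text \<open>For \<epsilon> = 1 this is the minorant problem with interpolation nodes \<theta> + k, for \<epsilon> = -1 the majorant problem. The difference
D = \<epsilon>(G - F) is integrable if the distance of G is finite; its nodal values are nonpositive because F interpolates, so its integral is nonpositive by
quadrature, which is the optimality of F.

In the equality case D vanishes at the nodes. At the nodes with k \<noteq> 0 the function D is at most the gap of F, which is
O((x - node)^2), so D' = 0 as well. Excluding k = 0 lets the node 0 of the majorant be the singular point of |x|^\<sigma>.\<close>

lemma one_sided_extremal:
  fixes gr :: "real \<Rightarrow> real"
  assumes F: "exp_type_le F (2 * pi)" "real_on_reals F"
    and eps: "\<epsilon> = 1 \<or> \<epsilon> = (-1::real)" and V0: "V \<ge> 0"
    and gm: "gr \<in> borel_measurable borel"
    and hb: "has_bochner_integral lborel (\<lambda>x. \<epsilon> * (gr x - Re (F (of_real x)))) V"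
    and interp: "\<And>k::int. gr (\<theta> + of_int k) = Re (F (of_real (\<theta> + of_int k)))"
    and quad: "\<And>k::int. k \<noteq> 0 \<Longrightarrow> \<exists>B. eventually (\<lambda>x. x \<noteq> 0 \<and> \<epsilon> * (gr x - Re (F (of_real x))) \<le> B * (x - (\<theta> + of_int k))^2) (at (\<theta> + of_int k))"
    and G: "exp_type_le G (2 * pi)" "real_on_reals G"
    and side: "\<And>x. x \<noteq> 0 \<Longrightarrow> 0 \<le> \<epsilon> * (gr x - Re (G (of_real x)))"
    and side': "\<And>k::int. 0 \<le> \<epsilon> * (gr (\<theta> + of_int k) - Re (G (of_real (\<theta> + of_int k))))"
  shows "ennreal V \<le> (\<integral>\<^sup>+x. ennreal (cmod (of_real (gr x) - G (of_real x))) \<partial>lborel)"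
    and "(\<integral>\<^sup>+x. ennreal (cmod (of_real (gr x) - G (of_real x))) \<partial>lborel) = ennreal V \<Longrightarrow> G = F"
proof -
  note [measurable] = exp_type_le_borel_measurable[OF F(1)] exp_type_le_borel_measurable[OF G(1)] gm
  have Fr: "F (of_real x) = of_real (Re (F (of_real x)))" for x
    using F(2) unfolding real_on_reals_def by (metis of_real_Re)
  have Gr: "G (of_real x) = of_real (Re (G (of_real x)))" for x
    using G(2) unfolding real_on_reals_def by (metis of_real_Re)
  define D where "D = (\<lambda>z. of_real \<epsilon> * (G z - F z))"
  define E where "E = (\<lambda>z. D (1 * z + of_real \<theta>))"
  define L where "L = (\<integral>\<^sup>+x. ennreal (cmod (of_real (gr x) - G (of_real x))) \<partial>lborel)"
  have dist: "cmod (of_real (gr x) - G (of_real x)) = \<bar>gr x - Re (G (of_real x))\<bar>" for x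
    by (subst Gr) (metis norm_of_real of_real_diff)
  have D: "exp_type_le D (2 * pi)"
  proof -
    have "exp_type_le (\<lambda>z. G z - F z) (2 * pi)" by (rule exp_type_le_diff[OF G(1) F(1)])
    moreover have "exp_type_le (\<lambda>z. F z - G z) (2 * pi)" by (rule exp_type_le_diff[OF F(1) G(1)])
    ultimately show ?thesis unfolding D_def using eps by auto
  qed
  have Dr: "D (of_real x) = of_real (\<epsilon> * (gr x - Re (F (of_real x))) - \<epsilon> * (gr x - Re (G (of_real x))))" for x
    unfolding D_def by (subst Gr, subst Fr) (simp add: algebra_simps)
  have main: "V + (- Re (\<integral>x. D (of_real x) \<partial>lborel)) = enn2real L \<and> (\<forall>k::int. Re (\<integral>x. D (of_real x) \<partial>lborel) \<le> Re (D (of_real (\<theta> + of_int k))))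
      \<and> L = ennreal (enn2real L) \<and> integrable lborel (\<lambda>x. D (of_real x))" if fin: "L < \<infinity>"
  proof -
    have iG: "integrable lborel (\<lambda>x. gr x - Re (G (of_real x)))"
    proof (rule integrableI_bounded)
      show "(\<integral>\<^sup>+x. ennreal (norm (gr x - Re (G (of_real x)))) \<partial>lborel) < \<infinity>" using fin unfolding L_def dist by simp
    qed measurable
    have iF: "integrable lborel (\<lambda>x. \<epsilon> * (gr x - Re (F (of_real x))))" "(\<integral>x. \<epsilon> * (gr x - Re (F (of_real x))) \<partial>lborel) = V"
      using hb by (auto simp: has_bochner_integral_iff)
    have iD: "integrable lborel (\<lambda>x. D (of_real x))"
      unfolding Dr by (intro integrable_of_real Bochner_Integration.integrable_diff iF integrable_mult_right iG)
    have ID: "Re (\<integral>x. D (of_real x) \<partial>lborel) = V - (\<integral>x. \<epsilon> * (gr x - Re (G (of_real x))) \<partial>lborel)"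
      unfolding Dr using iF iG by (subst integral_complex_of_real) (simp add: Bochner_Integration.integral_diff)
    have "L = (\<integral>\<^sup>+x. ennreal (\<epsilon> * (gr x - Re (G (of_real x)))) \<partial>lborel)" unfolding L_def
    proof (rule nn_integral_cong_AE)
      have "AE x in lborel. x \<noteq> (0::real)" by (rule AE_lborel_singleton)
      then show "AE x in lborel. ennreal (cmod (of_real (gr x) - G (of_real x))) = ennreal (\<epsilon> * (gr x - Re (G (of_real x))))"
      proof eventually_elim
        case (elim x)
        show ?case unfolding dist using side[OF elim] eps by auto
      qed
    qed
    also have "\<dots> = ennreal (\<integral>x. \<epsilon> * (gr x - Re (G (of_real x))) \<partial>lborel)"
    proof (rule nn_integral_eq_integral)
      show "integrable lborel (\<lambda>x. \<epsilon> * (gr x - Re (G (of_real x))))" by (rule integrable_mult_right[OF iG])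
      have "AE x in lborel. x \<noteq> (0::real)" by (rule AE_lborel_singleton)
      then show "AE x in lborel. 0 \<le> \<epsilon> * (gr x - Re (G (of_real x)))" by eventually_elim (rule side)
    qed
    finally have L: "L = ennreal (\<integral>x. \<epsilon> * (gr x - Re (G (of_real x))) \<partial>lborel)" .
    have I0: "0 \<le> (\<integral>x. \<epsilon> * (gr x - Re (G (of_real x))) \<partial>lborel)"
    proof (rule integral_nonneg_AE)
      have "AE x in lborel. x \<noteq> (0::real)" by (rule AE_lborel_singleton)
      then show "AE x in lborel. 0 \<le> \<epsilon> * (gr x - Re (G (of_real x)))" by eventually_elim (rule side)
    qed
    have np: "Re (D (of_real \<theta> + of_int k)) \<le> 0" for k
    proof -
      have "D (of_real \<theta> + of_int k) = of_real (\<epsilon> * (gr (\<theta> + of_int k) - Re (F (of_real (\<theta> + of_int k)))) - \<epsilon> * (gr (\<theta> + of_int k) - Re (G (of_real (\<theta> + of_int k)))))"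
        using Dr[of "\<theta> + of_int k"] by simp
      then show ?thesis using interp[of k] side'[of k] by simp
    qed
    have "Re (\<integral>x. D (of_real x) \<partial>lborel) \<le> Re (D (of_real (\<theta> + of_int k)))" for k
      using quadrature_nonpos_integral[OF D iD np, of k] by simp
    moreover have "enn2real L = (\<integral>x. \<epsilon> * (gr x - Re (G (of_real x))) \<partial>lborel)" using L I0 by simp
    ultimately show ?thesis using ID L iD by simp
  qed
  have npr: "Re (D (of_real (\<theta> + of_int k))) \<le> 0" for k
    using Dr[of "\<theta> + of_int k"] interp[of k] side'[of k] by simp
  show "ennreal V \<le> (\<integral>\<^sup>+x. ennreal (cmod (of_real (gr x) - G (of_real x))) \<partial>lborel)"
  proof (cases "L < \<infinity>")
    case True
    have "Re (\<integral>x. D (of_real x) \<partial>lborel) \<le> 0" using main[OF True] npr[of 0] by (meson order_trans)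
    then have "V \<le> enn2real L" using main[OF True] by linarith
    then have "ennreal V \<le> ennreal (enn2real L)" by (rule ennreal_leI)
    then show ?thesis using main[OF True] unfolding L_def[symmetric] by simp
  next
    case False
    then have "L = \<infinity>" by (metis infinity_ennreal_def top.not_eq_extremum)
    then show ?thesis unfolding L_def[symmetric] by simp
  qed
  assume "(\<integral>\<^sup>+x. ennreal (cmod (of_real (gr x) - G (of_real x))) \<partial>lborel) = ennreal V"
  then have LV: "L = ennreal V" by (simp add: L_def)
  then have fin: "L < \<infinity>" by simp
  have zero: "D (of_real (\<theta> + of_int k)) = 0" for k
  proof -
    have "enn2real L = V" using LV V0 by simp
    then have "Re (D (of_real (\<theta> + of_int k))) \<ge> 0" using main[OF fin] by (metis add_cancel_right_right neg_equal_0_iff_equal)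
    then have "Re (D (of_real (\<theta> + of_int k))) = 0" using npr[of k] by simp
    then show ?thesis using Dr[of "\<theta> + of_int k"] by (metis Re_complex_of_real of_real_0)
  qed
  have dzero: "deriv D (of_real (\<theta> + of_int k)) = 0" if k: "k \<noteq> 0" for k
  proof -
    define \<xi> where "\<xi> = \<theta> + of_int k"
    define r where "r = (\<lambda>x. Re (D (of_real x)))"
    have Drr: "D (of_real x) = of_real (r x)" for x using Dr[of x] by (metis r_def Re_complex_of_real)
    have dD: "(D has_field_derivative deriv D (of_real \<xi>)) (at (of_real \<xi>))"
      by (rule holomorphic_derivI[OF exp_type_le_holomorphic[OF D, of UNIV] open_UNIV UNIV_I])
    have lim: "((\<lambda>y. (D (of_real y) - D (of_real \<xi>)) / of_real (y - \<xi>)) \<longlongrightarrow> deriv D (of_real \<xi>)) (at \<xi>)"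
    proof -
      have l: "((\<lambda>z. (D z - D (of_real \<xi>)) / (z - of_real \<xi>)) \<longlongrightarrow> deriv D (of_real \<xi>)) (at (of_real \<xi>))"
        using dD by (simp add: has_field_derivative_iff)
      have "filterlim (\<lambda>y. complex_of_real y) (at (of_real \<xi>)) (at \<xi>)"
        unfolding filterlim_at
      proof
        show "((\<lambda>y. complex_of_real y) \<longlongrightarrow> of_real \<xi>) (at \<xi>)" by (rule tendsto_of_real[OF tendsto_ident_at])
        show "\<forall>\<^sub>F y in at \<xi>. complex_of_real y \<in> UNIV \<and> complex_of_real y \<noteq> of_real \<xi>" by (simp add: eventually_at_filter)
      qed
      from filterlim_compose[OF l this] show ?thesis by simp
    qed
    have q: "(D (of_real y) - D (of_real \<xi>)) / of_real (y - \<xi>) = of_real (r y / (y - \<xi>))" for y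
      using zero[of k] by (simp add: Drr \<xi>_def del: of_real_diff of_real_add)
    have lim': "((\<lambda>y. complex_of_real (r y / (y - \<xi>))) \<longlongrightarrow> deriv D (of_real \<xi>)) (at \<xi>)"
      using lim unfolding q .
    have limR: "((\<lambda>y. r y / (y - \<xi>)) \<longlongrightarrow> Re (deriv D (of_real \<xi>))) (at \<xi>)"
      using tendsto_Re[OF lim'] by simp
    have limI: "Im (deriv D (of_real \<xi>)) = 0"
    proof -
      have "((\<lambda>y. 0) \<longlongrightarrow> Im (deriv D (of_real \<xi>))) (at \<xi>)" using tendsto_Im[OF lim'] by simp
      then show ?thesis by (simp add: tendsto_const_iff)
    qed
    obtain B where B: "eventually (\<lambda>x. x \<noteq> 0 \<and> \<epsilon> * (gr x - Re (F (of_real x))) \<le> B * (x - \<xi>)^2) (at \<xi>)"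
      using quad[OF k] unfolding \<xi>_def by blast
    have up: "eventually (\<lambda>y. r y \<le> B * (y - \<xi>)^2) (at \<xi>)"
      using B
    proof eventually_elim
      case (elim y)
      have "r y = \<epsilon> * (gr y - Re (F (of_real y))) - \<epsilon> * (gr y - Re (G (of_real y)))"
        using Dr[of y] by (metis r_def Re_complex_of_real)
      then show ?case using elim side[of y] by linarith
    qed
    have t0: "((\<lambda>y. B * (y - \<xi>)) \<longlongrightarrow> B * (\<xi> - \<xi>)) (at \<xi> within A)" for A by (intro tendsto_intros)
    (* The upper bound r y \<le> B (y - \<xi>)^2 bounds the difference quotient from above on the right of the node
       and from below on the left. *)
    have "Re (deriv D (of_real \<xi>)) \<le> B * (\<xi> - \<xi>)"
    proof (rule tendsto_le[OF _ t0 filterlim_mono[OF limR order_refl at_le]])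
      show "\<not> trivial_limit (at_right \<xi>)" by simp
      have "eventually (\<lambda>y. r y \<le> B * (y - \<xi>)^2) (at_right \<xi>)" using up by (rule filter_leD[OF at_le[OF subset_UNIV]])
      then show "eventually (\<lambda>y. r y / (y - \<xi>) \<le> B * (y - \<xi>)) (at_right \<xi>)"
        using eventually_at_right_less[of \<xi>]
      proof eventually_elim
        case (elim y)
        then show ?case by (simp add: divide_le_eq power2_eq_square mult.assoc)
      qed
    qed simp
    moreover have "B * (\<xi> - \<xi>) \<le> Re (deriv D (of_real \<xi>))"
    proof (rule tendsto_le[OF _ filterlim_mono[OF limR order_refl at_le] t0])
      show "\<not> trivial_limit (at_left \<xi>)" by simp
      have "eventually (\<lambda>y. r y \<le> B * (y - \<xi>)^2) (at_left \<xi>)" using up by (rule filter_leD[OF at_le[OF subset_UNIV]])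
      moreover have "eventually (\<lambda>y. y < \<xi>) (at_left \<xi>)" by (auto simp: eventually_at_filter)
      ultimately show "eventually (\<lambda>y. B * (y - \<xi>) \<le> r y / (y - \<xi>)) (at_left \<xi>)"
      proof eventually_elim
        case (elim y)
        then show ?case by (simp add: neg_le_divide_eq power2_eq_square mult.assoc)
      qed
    qed simp
    ultimately have "Re (deriv D (of_real \<xi>)) = 0" by simp
    then show ?thesis using limI unfolding \<xi>_def by (simp add: complex_eq_iff)
  qed
  have E: "exp_type_le E (2 * pi)"
    using exp_type_le_compose_linear[OF D, of 1 "of_real \<theta>"] by (simp add: E_def)
  have iE: "integrable lborel (\<lambda>x. E (of_real x))"
  proof -
    have "integrable lborel (\<lambda>x. D (of_real x))" using main[OF fin] by blast
    from lborel_integrable_real_affine[OF this, of 1 \<theta>] show ?thesis by (simp add: E_def add.commute)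
  qed
  have "E z = 0" for z
  proof (rule exp_type_L1_double_zeros_eq_0[OF E iE])
    show "E (of_int n) = 0" for n using zero[of n] by (simp add: E_def add.commute)
    fix n :: int assume n: "n \<noteq> 0"
    have "(D has_field_derivative 0) (at (of_int n + of_real \<theta>))"
      using holomorphic_derivI[OF exp_type_le_holomorphic[OF D, of UNIV] open_UNIV, of "of_real (\<theta> + of_int n)" UNIV] dzero[OF n]
      by (simp add: add.commute)
    then have "((\<lambda>z. D (z + of_real \<theta>)) has_field_derivative 0) (at (of_int n))"
      by (simp add: DERIV_shift)
    then show "deriv E (of_int n) = 0" by (intro DERIV_imp_deriv) (simp add: E_def[abs_def])
  qed
  from this[of "z - of_real \<theta>" for z] have "D z = 0" for z by (simp add: E_def)
  then have "G z = F z" for z using eps unfolding D_def by (metis eq_iff_diff_eq_0 mult_eq_0_iff of_real_eq_0_iff zero_neq_one neg_equal_0_iff_equal)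
  then show "G = F" by blast
qed

text \<open>Since sgn(cos \<pi>x) is orthogonal to F - G, the integral of sgn(cos \<pi>x) (g - G) equals that of
sgn(cos \<pi>x) (g - F) = |g - F|, and it is at most the integral of |g - G|. Here G may be complex on the real axis.

In the equality case sgn(cos \<pi>x) (g - G) = |g - G| almost everywhere. By continuity this holds at each half-integer with both one-sided
values of the sign, so g - G vanishes there and F - G has simple zeros at all half-integers.\<close>

lemma sgn_cos_extremal:
  fixes gr :: "real \<Rightarrow> real"
  assumes F: "exp_type_le F pi" "real_on_reals F"
    and gm: "gr \<in> borel_measurable borel" and gc: "\<And>x. x \<noteq> 0 \<Longrightarrow> isCont gr x"
    and side: "\<And>x. x \<noteq> 0 \<Longrightarrow> 0 \<le> sgn (cos (pi * x)) * (gr x - Re (F (of_real x)))"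
    and hb: "has_bochner_integral lborel (\<lambda>x. \<bar>gr x - Re (F (of_real x))\<bar>) V"
    and interp: "\<And>k::int. gr (of_int k + 1/2) = Re (F (of_real (of_int k + 1/2)))"
    and G: "exp_type_le G pi"
  shows "ennreal V \<le> (\<integral>\<^sup>+x. ennreal (cmod (of_real (gr x) - G (of_real x))) \<partial>lborel)"
    and "(\<integral>\<^sup>+x. ennreal (cmod (of_real (gr x) - G (of_real x))) \<partial>lborel) = ennreal V \<Longrightarrow> G = F"
proof -
  note [measurable] = exp_type_le_borel_measurable[OF F(1)] exp_type_le_borel_measurable[OF G] gm
  have Fr: "F (of_real x) = of_real (Re (F (of_real x)))" for x
    using F(2) unfolding real_on_reals_def by (metis of_real_Re)
  define s where "s = (\<lambda>x. sgn (cos (pi * x)))"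
  have [measurable]: "s \<in> borel_measurable borel" unfolding s_def by measurable
  have s1: "\<bar>s x\<bar> \<le> 1" for x by (simp add: s_def sgn_if)
  define D where "D = (\<lambda>z. F z - G z)"
  define f where "f = (\<lambda>x. of_real (gr x) - G (of_real x))"
  define L where "L = (\<integral>\<^sup>+x. ennreal (cmod (f x)) \<partial>lborel)"
  have [measurable]: "f \<in> borel_measurable borel" unfolding f_def by measurable
  have D: "exp_type_le D pi" unfolding D_def by (rule exp_type_le_diff[OF F(1) G])
  have iA: "integrable lborel (\<lambda>x. gr x - Re (F (of_real x)))"
  proof (rule Bochner_Integration.integrable_bound)
    show "integrable lborel (\<lambda>x. \<bar>gr x - Re (F (of_real x))\<bar>)" using hb by (simp add: has_bochner_integral_iff)
  qed auto
  have fD: "f x = of_real (gr x - Re (F (of_real x))) + D (of_real x)" for x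
    unfolding f_def D_def using Fr[of x] by simp
  have main: "integrable lborel f \<and> integrable lborel (\<lambda>x. D (of_real x)) \<and> L = ennreal (\<integral>x. cmod (f x) \<partial>lborel) \<and> (\<integral>x. of_real (s x) * f x \<partial>lborel) = of_real V" if fin: "L < \<infinity>"
  proof -
    have i_f: "integrable lborel f" by (rule integrableI_bounded) (use fin in \<open>simp_all add: L_def\<close>)
    have iD: "integrable lborel (\<lambda>x. D (of_real x))"
    proof -
      have "integrable lborel (\<lambda>x. f x - of_real (gr x - Re (F (of_real x))))"
        by (intro Bochner_Integration.integrable_diff i_f integrable_of_real iA)
      then show ?thesis unfolding fD by simp
    qed
    have L: "L = ennreal (\<integral>x. cmod (f x) \<partial>lborel)"
      unfolding L_def by (intro nn_integral_eq_integral integrable_norm i_f) auto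
    have isA: "has_bochner_integral lborel (\<lambda>x. s x * (gr x - Re (F (of_real x)))) V"
    proof (rule has_bochner_integralI_AE[OF hb])
      have "AE x in lborel. x \<noteq> (0::real)" by (rule AE_lborel_singleton)
      moreover have "AE x in lborel. x \<notin> range (\<lambda>k::int. of_int k + (1/2::real))"
        by (rule AE_not_in, rule countable_imp_null_set_lborel) simp
      ultimately show "AE x in lborel. \<bar>gr x - Re (F (of_real x))\<bar> = s x * (gr x - Re (F (of_real x)))"
      proof eventually_elim
        case (elim x)
        have "cos (pi * x) \<noteq> 0"
        proof
          assume "cos (pi * x) = 0"
          then obtain i where i: "odd i" "pi * x = of_int i * (pi / 2)" using cos_zero_iff_int by metis
          then obtain k where "i = 2 * k + 1" by (auto elim: oddE)
          then have "pi * x = pi * (of_int k + 1/2)" using i(2) by (simp add: algebra_simps add_divide_distrib)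
          then have "x = of_int k + 1/2" by simp
          then show False using elim by blast
        qed
        then show ?case using side[OF elim(1)] unfolding s_def by (auto simp: sgn_if abs_if)
      qed
    qed measurable
    have isD: "integrable lborel (\<lambda>x. of_real (s x) * D (of_real x))"
    proof (rule Bochner_Integration.integrable_bound[OF iD])
      show "(\<lambda>x. of_real (s x) * D (of_real x)) \<in> borel_measurable lborel"
        using exp_type_le_borel_measurable[OF D] by measurable
      show "AE x in lborel. norm (of_real (s x) * D (of_real x)) \<le> norm (D (of_real x))"
        using s1 by (intro AE_I2) (simp add: norm_mult mult_left_le_one_le)
    qed
    have "(\<integral>x. of_real (s x) * f x \<partial>lborel) = (\<integral>x. of_real (s x * (gr x - Re (F (of_real x)))) + of_real (s x) * D (of_real x) \<partial>lborel)"
      by (intro Bochner_Integration.integral_cong) (auto simp: fD distrib_left)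
    also have "\<dots> = (\<integral>x. of_real (s x * (gr x - Re (F (of_real x)))) \<partial>lborel) + (\<integral>x. of_real (s x) * D (of_real x) \<partial>lborel)"
      using isA by (intro Bochner_Integration.integral_add isD integrable_of_real) (simp add: has_bochner_integral_iff)
    also have "(\<integral>x. of_real (s x) * D (of_real x) \<partial>lborel) = 0" unfolding s_def by (rule integral_sgn_cos_exp_type_pi[OF D iD])
    also have "(\<integral>x. complex_of_real (s x * (gr x - Re (F (of_real x)))) \<partial>lborel) = of_real V"
      using isA by (subst integral_complex_of_real) (simp add: has_bochner_integral_iff)
    finally show ?thesis using i_f iD L by simp
  qed
  have V0: "V \<ge> 0" using hb by (auto simp: has_bochner_integral_iff intro!: Bochner_Integration.integral_nonneg)
  have isf: "integrable lborel (\<lambda>x. of_real (s x) * f x)" if "integrable lborel f"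
    by (rule Bochner_Integration.integrable_bound[OF that]) (use s1 in \<open>auto simp: norm_mult mult_left_le_one_le\<close>)
  show "ennreal V \<le> (\<integral>\<^sup>+x. ennreal (cmod (of_real (gr x) - G (of_real x))) \<partial>lborel)"
  proof (cases "L < \<infinity>")
    case True
    note m = main[OF True]
    have "V = cmod (\<integral>x. of_real (s x) * f x \<partial>lborel)" using m V0 by simp
    also have "\<dots> \<le> (\<integral>x. cmod (of_real (s x) * f x) \<partial>lborel)" by (rule integral_norm_bound)
    also have "\<dots> \<le> (\<integral>x. cmod (f x) \<partial>lborel)"
      using m by (intro integral_mono integrable_norm isf) (auto simp: norm_mult mult_left_le_one_le s1)
    finally have "ennreal V \<le> L" using m by (simp add: ennreal_leI)
    then show ?thesis by (simp add: L_def f_def)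
  next
    case False
    then have "L = \<infinity>" by (metis infinity_ennreal_def top.not_eq_extremum)
    then show ?thesis by (simp add: L_def f_def)
  qed
  assume "(\<integral>\<^sup>+x. ennreal (cmod (of_real (gr x) - G (of_real x))) \<partial>lborel) = ennreal V"
  then have LV: "L = ennreal V" by (simp add: L_def f_def)
  then have fin: "L < \<infinity>" by simp
  note m = main[OF fin]
  have nI: "(\<integral>x. cmod (f x) \<partial>lborel) = V"
  proof -
    have "ennreal (\<integral>x. cmod (f x) \<partial>lborel) = ennreal V" using m LV by simp
    moreover have "0 \<le> (\<integral>x. cmod (f x) \<partial>lborel)" by (rule Bochner_Integration.integral_nonneg) simp
    ultimately show ?thesis using V0 by simp
  qed
  have "AE x in lborel. cmod (f x) - Re (of_real (s x) * f x) = 0"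
  proof (rule integral_nonneg_eq_0_iff_AE[THEN iffD1])
    show "integrable lborel (\<lambda>x. cmod (f x) - Re (of_real (s x) * f x))"
      using m isf by (intro Bochner_Integration.integrable_diff integrable_norm integrable_Re) auto
    have le: "Re (of_real (s x) * f x) \<le> cmod (f x)" for x
    proof -
      have "Re (of_real (s x) * f x) \<le> cmod (of_real (s x) * f x)" by (rule complex_Re_le_cmod)
      also have "\<dots> \<le> cmod (f x)" using s1[of x] by (simp add: norm_mult mult_left_le_one_le)
      finally show ?thesis .
    qed
    show "AE x in lborel. 0 \<le> cmod (f x) - Re (of_real (s x) * f x)" using le by simp
    have "(\<integral>x. cmod (f x) - Re (of_real (s x) * f x) \<partial>lborel) = V - Re (\<integral>x. of_real (s x) * f x \<partial>lborel)"
    proof -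
      have i: "integrable lborel (\<lambda>x. of_real (s x) * f x)" using m isf by blast
      have "(\<integral>x. Re (of_real (s x) * f x) \<partial>lborel) = Re (\<integral>x. of_real (s x) * f x \<partial>lborel)"
        by (rule integral_Re[OF i])
      then show ?thesis using Bochner_Integration.integral_diff[OF integrable_norm integrable_Re[OF i], of f] m nI by simp
    qed
    then show "(\<integral>x. cmod (f x) - Re (of_real (s x) * f x) \<partial>lborel) = 0" using m by simp
  qed
  then have ae: "AE x in lborel. of_real (s x) * f x = of_real (cmod (f x))"
  proof eventually_elim
    case (elim x)
    define v where "v = of_real (s x) * f x"
    have "cmod v \<le> cmod (f x)" using s1[of x] by (simp add: v_def norm_mult mult_left_le_one_le)
    moreover have R: "Re v = cmod (f x)" using elim by (simp add: v_def)
    ultimately have "Im v = 0" using cmod_power2[of v] power_mono[of "cmod v" "cmod (f x)" 2] by simp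
    then show ?case using R by (simp add: v_def[symmetric] complex_eq_iff)
  qed
  have zero: "D (of_int n + 1/2) = 0" for n
  proof -
    define \<xi> where "\<xi> = real_of_int n + 1/2"
    have \<xi>0: "\<xi> \<noteq> 0"
    proof
      assume "\<xi> = 0"
      then have "2 * real_of_int n = - 1" by (simp add: \<xi>_def)
      then have "2 * n = - 1" by (metis of_int_1 of_int_eq_iff of_int_minus of_int_mult of_int_numeral)
      then show False by presburger
    qed
    define c where "c = cos (pi * of_int n)"
    have s0: "sin (pi * of_int n) = 0" unfolding sin_zero_iff_int2 by (metis mult.commute)
    have c2: "c = 1 \<or> c = -1" using s0 sin_cos_squared_add[of "pi * of_int n"] by (simp add: c_def power2_eq_1_iff)
    have cosx: "cos (pi * x) = - c * sin (pi * (x - \<xi>))" for x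
    proof -
      have "cos (pi * x) = cos (pi * (x - \<xi>) + (pi * of_int n + pi/2))" by (simp add: \<xi>_def algebra_simps)
      also have "\<dots> = - c * sin (pi * (x - \<xi>))" by (simp add: cos_add sin_add s0 c_def)
      finally show ?thesis .
    qed
    have sl: "s x = c" if "x \<in> {\<xi> - 1<..<\<xi>}" for x
    proof -
      have "sin (pi * (\<xi> - x)) > 0" using that by (intro sin_gt_zero) auto
      moreover have "sin (pi * (x - \<xi>)) = - sin (pi * (\<xi> - x))" by (metis minus_diff_eq mult_minus_right sin_minus)
      ultimately show ?thesis using c2 unfolding s_def cosx by auto
    qed
    have sr: "s x = - c" if "x \<in> {\<xi><..<\<xi> + 1}" for x
    proof -
      have "sin (pi * (x - \<xi>)) > 0" using that by (intro sin_gt_zero) auto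
      then show ?thesis using c2 unfolding s_def cosx by auto
    qed
    have cf: "isCont f \<xi>" unfolding f_def
      by (intro continuous_intros gc[OF \<xi>0] isCont_o2[OF _ exp_type_le_isCont[OF G]])
    (* The almost everywhere identity passes to the limit along points on one side, where the sign is constant. *)
    have key: "of_real b * f \<xi> = of_real (cmod (f \<xi>))"
      if ex: "\<And>d. d > 0 \<Longrightarrow> \<exists>x. \<bar>x - \<xi>\<bar> < d \<and> of_real b * f x = of_real (cmod (f x))" for b :: real
    proof (rule ccontr)
      define h where "h = (\<lambda>x. of_real b * f x - of_real (cmod (f x)))"
      assume "\<not> ?thesis"
      then have hne: "h \<xi> \<noteq> 0" by (simp add: h_def)
      have "isCont h \<xi>" unfolding h_def by (intro continuous_intros cf)
      then obtain d where d: "d > 0" "\<And>x. dist x \<xi> < d \<Longrightarrow> dist (h x) (h \<xi>) < cmod (h \<xi>)"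
        using hne unfolding continuous_at_eps_delta by (metis zero_less_norm_iff)
      obtain x where "\<bar>x - \<xi>\<bar> < d" "of_real b * f x = of_real (cmod (f x))" using ex[OF d(1)] by blast
      then have "h x = 0" "dist (h x) (h \<xi>) < cmod (h \<xi>)" using d(2)[of x] by (auto simp: h_def dist_real_def)
      then show False by (simp add: dist_norm)
    qed
    have k1: "of_real c * f \<xi> = of_real (cmod (f \<xi>))"
    proof (rule key)
      fix d :: real assume d: "d > 0"
      obtain x where x: "x \<in> {\<xi> - min d 1<..<\<xi>}" "of_real (s x) * f x = of_real (cmod (f x))"
        using ex_point_AE[OF ae, of "\<xi> - min d 1" \<xi>] d by auto
      then have "s x = c" by (intro sl) auto
      then show "\<exists>x. \<bar>x - \<xi>\<bar> < d \<and> of_real c * f x = of_real (cmod (f x))" using x by (intro exI[of _ x]) auto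
    qed
    have k2: "of_real (- c) * f \<xi> = of_real (cmod (f \<xi>))"
    proof (rule key)
      fix d :: real assume d: "d > 0"
      obtain x where x: "x \<in> {\<xi><..<\<xi> + min d 1}" "of_real (s x) * f x = of_real (cmod (f x))"
        using ex_point_AE[OF ae, of \<xi> "\<xi> + min d 1"] d by auto
      then have "s x = - c" by (intro sr) auto
      then show "\<exists>x. \<bar>x - \<xi>\<bar> < d \<and> of_real (- c) * f x = of_real (cmod (f x))" using x by (intro exI[of _ x]) auto
    qed
    have "complex_of_real (cmod (f \<xi>)) = of_real (- c) * f \<xi>" by (rule k2[symmetric])
    also have "\<dots> = - (of_real c * f \<xi>)" by simp
    also have "\<dots> = of_real (- cmod (f \<xi>))" unfolding k1 by (rule of_real_minus[symmetric])
    finally have "cmod (f \<xi>) = - cmod (f \<xi>)" by (simp only: of_real_eq_iff)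
    then have "f \<xi> = 0" by simp
    then show ?thesis using fD[of \<xi>] interp[of n] by (simp add: \<xi>_def)
  qed
  have "D z = 0" for z
    by (rule exp_type_L1_simple_zeros_eq_0[OF D _ zero]) (use m in blast)
  then show "G = F" unfolding D_def by (intro ext) (metis eq_iff_diff_eq_0)
qed

section \<open>The three sign patterns and their constants\<close>

lemma exists_even_interval:
  assumes "\<sigma> > -1" "\<forall>n::nat. \<sigma> \<noteq> 2 * real n"
  obtains m :: nat where "2 * real m - 2 < \<sigma>" "\<sigma> < 2 * real m" "\<sigma> > 0 \<Longrightarrow> m > 0"
proof
  define m where "m = nat \<lceil>\<sigma> / 2\<rceil>"
  have c: "\<lceil>\<sigma> / 2\<rceil> \<ge> 0" using assms(1) by (simp add: le_ceiling_iff)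
  have m: "real m = of_int \<lceil>\<sigma> / 2\<rceil>" using c by (simp add: m_def)
  show "2 * real m - 2 < \<sigma>" unfolding m using ceiling_correct[of "\<sigma> / 2"] by linarith
  have "\<sigma> \<le> 2 * real m" unfolding m using ceiling_correct[of "\<sigma> / 2"] by linarith
  then show "\<sigma> < 2 * real m" using assms(2) by (simp add: order_less_le)
  then show "m > 0" if "\<sigma> > 0" using that by (cases m) auto
qed

lemma norm_power2_sin_cos_le:
  "cmod (cos (of_real pi * z) ^ 2) \<le> 1 * exp (2 * pi * cmod z)"
  "cmod (sin (of_real pi * z) ^ 2) \<le> 1 * exp (2 * pi * cmod z)"
  "cmod (cos (of_real pi * z)) \<le> 1 * exp (pi * cmod z)"
proof -
  have i: "\<bar>Im (of_real pi * z)\<bar> \<le> pi * cmod z" using abs_Im_le_cmod[of z] by (simp add: abs_mult)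
  have c: "cmod (cos (of_real pi * z)) \<le> exp (pi * cmod z)" "cmod (sin (of_real pi * z)) \<le> exp (pi * cmod z)"
    using norm_sin_cos_le_exp[of "of_real pi * z"] i by (meson exp_le_cancel_iff order_trans)+
  have e: "exp (pi * cmod z) ^ 2 = exp (2 * pi * cmod z)" by (simp add: exp_double[symmetric] mult.assoc)
  show "cmod (cos (of_real pi * z) ^ 2) \<le> 1 * exp (2 * pi * cmod z)" "cmod (sin (of_real pi * z) ^ 2) \<le> 1 * exp (2 * pi * cmod z)"
    unfolding norm_power mult_1_left e[symmetric] by (intro power_mono c; simp)+
  show "cmod (cos (of_real pi * z)) \<le> 1 * exp (pi * cmod z)" using c by simp
qed

lemma cosh_sinh_via_exp:
  fixes t :: real
  defines "q \<equiv> exp (- pi * t)"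
  shows "cosh (pi * t) = (1 + q^2) / (2 * q)" "sinh (pi * t) = (1 - q^2) / (2 * q)" "exp (- 2 * pi * t) = q^2" "exp (- (2 * pi) * t) = q^2"
proof -
  have q: "q > 0" by (simp add: q_def)
  have e: "exp (pi * t) = 1 / q" by (simp add: q_def exp_minus field_simps)
  have e': "exp (- (pi * t)) = q" by (simp add: q_def)
  show "cosh (pi * t) = (1 + q^2) / (2 * q)" unfolding cosh_def e e' using q by (simp add: field_simps power2_eq_square)
  show "sinh (pi * t) = (1 - q^2) / (2 * q)" unfolding sinh_def e e' using q by (simp add: field_simps power2_eq_square)
  show "exp (- 2 * pi * t) = q^2" "exp (- (2 * pi) * t) = q^2" unfolding q_def by (simp_all add: exp_double[symmetric] mult.assoc)
qed

lemma integrable_powr_exp: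
  fixes b y :: real
  assumes "b > -1" "y > 0"
  shows "integrable lborel (\<lambda>t. indicator {0<..} t *\<^sub>R (t powr b * exp (- y * t)))"
  using has_bochner_integral_Gamma_scaled[OF assms] by (simp add: has_bochner_integral_iff)

lemma sign_pattern_cos_squared:
  assumes "2 * real m - 2 < \<sigma>" "\<sigma> < 2 * real m" "\<sigma> > -1"
  shows "sign_pattern (\<lambda>z. cos (of_real pi * z) ^ 2) (2 * pi) 1 1 (\<lambda>t. cosh (pi * t) ^ 2) \<sigma> m"
proof
  show "cmod (cos (of_real pi * z) ^ 2) \<le> 1 * exp (2 * pi * cmod z)" for z by (rule norm_power2_sin_cos_le)
  show "cos (of_real pi * of_real x) ^ 2 \<in> \<real>" for x
    by (metis Reals_of_real Reals_power cos_of_real of_real_mult)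
  show "(\<lambda>t::real. cosh (pi * t) ^ 2) \<in> borel_measurable borel"
    by (intro borel_measurable_continuous_onI continuous_intros)
  show "integrable lborel (\<lambda>t. indicator {0<..} t *\<^sub>R (t powr (\<sigma> + 1) / cosh (pi * t) ^ 2))"
  proof (rule Bochner_Integration.integrable_bound)
    show "integrable lborel (\<lambda>t. 4 * (indicator {0<..} t *\<^sub>R (t powr (\<sigma> + 1) * exp (- (2 * pi) * t))))"
      by (intro integrable_mult_right integrable_powr_exp) (use assms in auto)
    have "(\<lambda>t::real. cosh (pi * t)) \<in> borel_measurable borel"
      by (intro borel_measurable_continuous_onI continuous_intros)
    then show "(\<lambda>t. indicator {0<..} t *\<^sub>R (t powr (\<sigma> + 1) / cosh (pi * t) ^ 2)) \<in> borel_measurable lborel" by measurable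
    show "AE t in lborel. norm (indicator {0<..} t *\<^sub>R (t powr (\<sigma> + 1) / cosh (pi * t) ^ 2)) \<le> norm (4 * (indicator {0<..} t *\<^sub>R (t powr (\<sigma> + 1) * exp (- (2 * pi) * t))))"
    proof (rule AE_I2)
      fix t :: real
      define q where "q = exp (- pi * t)"
      have q: "q > 0" by (simp add: q_def)
      have "1 / cosh (pi * t) ^ 2 = 4 * q^2 * (1 / (1 + q^2)^2)"
        unfolding cosh_sinh_via_exp q_def[symmetric] using q by (simp add: power_divide power_mult_distrib)
      also have "\<dots> \<le> 4 * q^2 * 1"
      proof (rule mult_left_mono)
        have "1 \<le> (1 + q^2)^2" by (rule one_le_power) simp
        from frac_le[OF _ order_refl _ this, of 1] show "1 / (1 + q^2)^2 \<le> 1" by simp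
      qed (use q in simp)
      finally have le: "1 / cosh (pi * t) ^ 2 \<le> 4 * exp (- (2 * pi) * t)" unfolding cosh_sinh_via_exp(4) q_def[symmetric] by simp
      have "t powr (\<sigma> + 1) * (1 / cosh (pi * t) ^ 2) \<le> t powr (\<sigma> + 1) * (4 * exp (- (2 * pi) * t))"
        by (rule mult_left_mono[OF le]) simp
      then show "norm (indicator {0<..} t *\<^sub>R (t powr (\<sigma> + 1) / cosh (pi * t) ^ 2)) \<le> norm (4 * (indicator {0<..} t *\<^sub>R (t powr (\<sigma> + 1) * exp (- (2 * pi) * t))))"
        by (simp add: indicator_def abs_mult)
    qed
  qed
qed (use assms cos_sin_imaginary(1) in \<open>auto intro!: holomorphic_intros simp: cosh_real_pos\<close>)

lemma sign_pattern_cos: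
  assumes "2 * real m - 2 < \<sigma>" "\<sigma> < 2 * real m" "\<sigma> > -1"
  shows "sign_pattern (\<lambda>z. cos (of_real pi * z)) pi 1 1 (\<lambda>t. cosh (pi * t)) \<sigma> m"
proof
  show "cmod (cos (of_real pi * z)) \<le> 1 * exp (pi * cmod z)" for z by (rule norm_power2_sin_cos_le)
  show "cos (of_real pi * of_real x) \<in> \<real>" for x
    by (metis Reals_of_real cos_of_real of_real_mult)
  show m: "(\<lambda>t::real. cosh (pi * t)) \<in> borel_measurable borel"
    by (intro borel_measurable_continuous_onI continuous_intros)
  show "integrable lborel (\<lambda>t. indicator {0<..} t *\<^sub>R (t powr (\<sigma> + 1) / cosh (pi * t)))"
  proof (rule Bochner_Integration.integrable_bound)
    show "integrable lborel (\<lambda>t. 2 * (indicator {0<..} t *\<^sub>R (t powr (\<sigma> + 1) * exp (- pi * t))))"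
      by (intro integrable_mult_right integrable_powr_exp) (use assms in auto)
    show "(\<lambda>t. indicator {0<..} t *\<^sub>R (t powr (\<sigma> + 1) / cosh (pi * t))) \<in> borel_measurable lborel" using m by measurable
    show "AE t in lborel. norm (indicator {0<..} t *\<^sub>R (t powr (\<sigma> + 1) / cosh (pi * t))) \<le> norm (2 * (indicator {0<..} t *\<^sub>R (t powr (\<sigma> + 1) * exp (- pi * t))))"
    proof (rule AE_I2)
      fix t :: real
      define q where "q = exp (- pi * t)"
      have q: "q > 0" by (simp add: q_def)
      have "1 / cosh (pi * t) = 2 * q * (1 / (1 + q^2))"
        unfolding cosh_sinh_via_exp q_def[symmetric] using q by simp
      also have "\<dots> \<le> 2 * q * 1" using q frac_le[of 1 1 1 "1 + q^2"] by (intro mult_left_mono) auto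
      finally have le: "1 / cosh (pi * t) \<le> 2 * exp (- pi * t)" unfolding q_def by simp
      have "t powr (\<sigma> + 1) * (1 / cosh (pi * t)) \<le> t powr (\<sigma> + 1) * (2 * exp (- pi * t))"
        by (rule mult_left_mono[OF le]) simp
      then show "norm (indicator {0<..} t *\<^sub>R (t powr (\<sigma> + 1) / cosh (pi * t))) \<le> norm (2 * (indicator {0<..} t *\<^sub>R (t powr (\<sigma> + 1) * exp (- pi * t))))"
        by (simp add: indicator_def abs_mult)
    qed
  qed
qed (use assms cos_sin_imaginary(1) in \<open>auto intro!: holomorphic_intros simp: cosh_real_pos\<close>)

text \<open>For small t, sinh^2 \<pi>t behaves like \<pi>^2 t^2, so the integrability near 0 is where \<sigma> > 0 enters. The estimate used is
1/(1 - exp(-y)) \<le> (1 + y)/y.\<close>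

lemma sign_pattern_sin_squared:
  assumes "2 * real m - 2 < \<sigma>" "\<sigma> < 2 * real m" "\<sigma> > 0"
  shows "sign_pattern (\<lambda>z. sin (of_real pi * z) ^ 2) (2 * pi) 1 (-1) (\<lambda>t. sinh (pi * t) ^ 2) \<sigma> m"
proof
  show "cmod (sin (of_real pi * z) ^ 2) \<le> 1 * exp (2 * pi * cmod z)" for z by (rule norm_power2_sin_cos_le)
  show "sin (of_real pi * of_real x) ^ 2 \<in> \<real>" for x
    by (metis Reals_of_real Reals_power sin_of_real of_real_mult)
  show "(\<lambda>t::real. sinh (pi * t) ^ 2) \<in> borel_measurable borel"
    by (intro borel_measurable_continuous_onI continuous_intros)
  show "integrable lborel (\<lambda>t. indicator {0<..} t *\<^sub>R (t powr (\<sigma> + 1) / sinh (pi * t) ^ 2))"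
  proof (rule Bochner_Integration.integrable_bound)
    let ?J = "\<lambda>b t. indicator {0<..} t *\<^sub>R (t powr b * exp (- (2 * pi) * t))"
    show "integrable lborel (\<lambda>t. (1 / pi^2) * ?J (\<sigma> - 1) t + ((4 / pi) * ?J \<sigma> t + 4 * ?J (\<sigma> + 1) t))"
      by (intro Bochner_Integration.integrable_add integrable_mult_right integrable_powr_exp) (use assms in auto)
    have "(\<lambda>t::real. sinh (pi * t)) \<in> borel_measurable borel"
      by (intro borel_measurable_continuous_onI continuous_intros)
    then show "(\<lambda>t. indicator {0<..} t *\<^sub>R (t powr (\<sigma> + 1) / sinh (pi * t) ^ 2)) \<in> borel_measurable lborel" by measurable
    show "AE t in lborel. norm (indicator {0<..} t *\<^sub>R (t powr (\<sigma> + 1) / sinh (pi * t) ^ 2)) \<le> norm ((1 / pi^2) * ?J (\<sigma> - 1) t + ((4 / pi) * ?J \<sigma> t + 4 * ?J (\<sigma> + 1) t))"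
    proof (rule AE_I2)
      fix t :: real
      show "norm (indicator {0<..} t *\<^sub>R (t powr (\<sigma> + 1) / sinh (pi * t) ^ 2)) \<le> norm ((1 / pi^2) * ?J (\<sigma> - 1) t + ((4 / pi) * ?J \<sigma> t + 4 * ?J (\<sigma> + 1) t))"
      proof (cases "t > 0")
        case True
        define q where "q = exp (- pi * t)"
        define y where "y = 2 * pi * t"
        have q: "q > 0" by (simp add: q_def)
        have y: "y > 0" using True by (simp add: y_def)
        have qy: "q^2 = exp (- y)" unfolding q_def y_def using cosh_sinh_via_exp(3)[of t] by simp
        have "1 + y \<le> exp y" by (rule exp_ge_add_one_self)
        then have "exp (- y) \<le> 1 / (1 + y)" using y by (simp add: exp_minus field_simps)
        then have "y / (1 + y) \<le> 1 - q^2" unfolding qy using y by (simp add: field_simps)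
        moreover have y': "y / (1 + y) > 0" using y by simp
        ultimately have "(y / (1 + y))^2 \<le> (1 - q^2)^2" by (intro power_mono) auto
        from frac_le[OF _ order_refl zero_less_power[OF y'] this, of 1] have "1 / (1 - q^2)^2 \<le> 1 / (y / (1 + y))^2" by simp
        also have "\<dots> = (1 + y)^2 / y^2" by (simp add: power_divide)
        finally have B: "1 / (1 - q^2)^2 \<le> (1 + y)^2 / y^2" .
        have "1 / sinh (pi * t) ^ 2 = 4 * q^2 * (1 / (1 - q^2)^2)"
          unfolding cosh_sinh_via_exp q_def[symmetric] using q by (simp add: power_divide power_mult_distrib)
        also have "\<dots> \<le> 4 * q^2 * ((1 + y)^2 / y^2)" by (intro mult_left_mono B) simp
        finally have le: "t powr (\<sigma> + 1) * (1 / sinh (pi * t) ^ 2) \<le> t powr (\<sigma> + 1) * (4 * q^2 * ((1 + y)^2 / y^2))"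
          by (rule mult_left_mono) simp
        have p1: "t powr (\<sigma> + 1) = t powr (\<sigma> - 1) * t^2" "t powr \<sigma> = t powr (\<sigma> - 1) * t"
        proof -
          have "t powr (\<sigma> + 1) = t powr (\<sigma> - 1 + 2)" "t powr \<sigma> = t powr (\<sigma> - 1 + 1)" by (simp_all add: add.commute)
          then show "t powr (\<sigma> + 1) = t powr (\<sigma> - 1) * t^2" "t powr \<sigma> = t powr (\<sigma> - 1) * t" using True by (simp_all only: powr_add) (simp_all)
        qed
        have "t powr (\<sigma> + 1) * (4 * q^2 * ((1 + y)^2 / y^2)) = (1 / pi^2) * (t powr (\<sigma> - 1) * q^2) + ((4 / pi) * (t powr \<sigma> * q^2) + 4 * (t powr (\<sigma> + 1) * q^2))"
          unfolding p1 y_def using True by (simp add: field_simps power2_eq_square)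
        moreover have "0 \<le> t powr (\<sigma> + 1) * (1 / sinh (pi * t) ^ 2)" by simp
        ultimately have "\<bar>t powr (\<sigma> + 1) * (1 / sinh (pi * t) ^ 2)\<bar> \<le> \<bar>(1 / pi^2) * (t powr (\<sigma> - 1) * q^2) + ((4 / pi) * (t powr \<sigma> * q^2) + 4 * (t powr (\<sigma> + 1) * q^2))\<bar>"
          using le by linarith
        then show ?thesis using True unfolding cosh_sinh_via_exp(4) q_def[symmetric] by simp
      qed simp
    qed
  qed
qed (use assms cos_sin_imaginary(2) in \<open>auto intro!: holomorphic_intros simp: power_mult_distrib\<close>)

lemma Gamma_duplication_real:
  assumes s: "s > (0::real)"
  shows "Gamma s = 2 powr (s - 1) / sqrt pi * (Gamma (s / 2) * Gamma ((s + 1) / 2))"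
proof -
  define z where "z = complex_of_real (s / 2)"
  have "z \<notin> \<int>\<^sub>\<le>\<^sub>0" "z + 1/2 \<notin> \<int>\<^sub>\<le>\<^sub>0"
  proof -
    have *: "v \<notin> \<int>\<^sub>\<le>\<^sub>0" if "Re v > 0" for v
      using that by (auto elim!: nonpos_Ints_cases)
    have "Re z > 0" "Re (z + 1/2) > 0" using s by (simp_all add: z_def)
    then show "z \<notin> \<int>\<^sub>\<le>\<^sub>0" "z + 1/2 \<notin> \<int>\<^sub>\<le>\<^sub>0" by (auto intro!: *)
  qed
  from Gamma_legendre_duplication[OF this]
  have "Gamma z * Gamma (z + 1/2) = exp ((1 - 2 * z) * of_real (ln 2)) * of_real (sqrt pi) * Gamma (2 * z)" .
  moreover have "z + 1/2 = of_real ((s + 1) / 2)" "2 * z = of_real s" by (simp_all add: z_def add_divide_distrib)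
  moreover have "exp ((1 - of_real s) * of_real (ln 2)) = complex_of_real (2 powr (1 - s))"
    by (simp add: powr_def exp_of_real[symmetric])
  ultimately have "complex_of_real (Gamma (s / 2) * Gamma ((s + 1) / 2)) = of_real (2 powr (1 - s) * sqrt pi * Gamma s)"
    by (simp add: z_def Gamma_complex_of_real del: of_real_divide)
  then have "Gamma (s / 2) * Gamma ((s + 1) / 2) = 2 powr (1 - s) * sqrt pi * Gamma s" by (simp only: of_real_eq_iff)
  moreover have "2 powr (s - 1) * 2 powr (1 - s) = (1::real)" by (simp flip: powr_add)
  ultimately show ?thesis by (simp add: field_simps)
qed

context sign_pattern
begin

text \<open>By Legendre duplication the factor \<Gamma>(1 + \<sigma>/2) in \<kappa> cancels; the values of the three integrals then only involve
\<Gamma>((1+\<sigma>)/2).\<close>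

lemma kappa_Gamma:
  "kappa * Gamma (\<sigma> + 1) = 2 * pi powr (\<sigma> / 2) * (2 powr \<sigma> / sqrt pi * Gamma ((1 + \<sigma>) / 2))"
proof -
  have "Gamma (1 + \<sigma> / 2) > 0" using \<sigma> by (intro Gamma_real_pos) auto
  moreover have e: "(\<sigma> + 1 + 1) / 2 = 1 + \<sigma> / 2" by (simp add: field_simps)
  have "Gamma (\<sigma> + 1) = 2 powr \<sigma> / sqrt pi * (Gamma ((1 + \<sigma>) / 2) * Gamma (1 + \<sigma> / 2))"
    using Gamma_duplication_real[of "\<sigma> + 1"] \<sigma> unfolding e by (simp add: add.commute)
  ultimately show ?thesis by (simp add: kappa_def)
qed

lemma kappa_Gamma_2pi: "2 * pi * kappa * (Gamma (\<sigma> + 1) * (2 * pi) powr (- (\<sigma> + 1))) = 2 * gamma_factor (1 + \<sigma>)"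
proof -
  have "2 * pi * kappa * (Gamma (\<sigma> + 1) * (2 * pi) powr (- (\<sigma> + 1))) = (kappa * Gamma (\<sigma> + 1)) * ((2 * pi) * (2 * pi) powr (- (\<sigma> + 1)))" by simp
  also have "(2 * pi) * (2 * pi) powr (- (\<sigma> + 1)) = (2 * pi) powr (- \<sigma>)" by (simp add: powr_diff powr_minus field_simps)
  also have "\<dots> = 2 powr (- \<sigma>) * pi powr (- \<sigma>)" by (simp add: powr_mult)
  also have "kappa * Gamma (\<sigma> + 1) * (2 powr (- \<sigma>) * pi powr (- \<sigma>)) = 2 * (2 powr \<sigma> * 2 powr (- \<sigma>)) * (pi powr (\<sigma> / 2) * pi powr (- \<sigma>) / sqrt pi) * Gamma ((1 + \<sigma>) / 2)"
    unfolding kappa_Gamma by simp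
  also have "2 powr \<sigma> * 2 powr (- \<sigma>) = (1::real)" by (simp flip: powr_add)
  also have "pi powr (\<sigma> / 2) * pi powr (- \<sigma>) / sqrt pi = pi powr (- (1 + \<sigma>) / 2)"
  proof -
    have "sqrt pi = pi powr (1/2)" by (simp add: powr_half_sqrt)
    then have "pi powr (\<sigma> / 2) * pi powr (- \<sigma>) / sqrt pi = pi powr (\<sigma> / 2 + - \<sigma> - 1/2)" by (simp only: powr_add powr_diff)
    also have "\<sigma> / 2 + - \<sigma> - 1/2 = - (1 + \<sigma>) / 2" by (simp add: field_simps)
    finally show ?thesis .
  qed
  finally show ?thesis by (simp add: gamma_factor_def)
qed

lemma kappa_Gamma_pi: "4 * kappa * Gamma (\<sigma> + 1) * pi powr (- (\<sigma> + 1)) = (4 / pi) powr ((3 + \<sigma>) / 2) * Gamma ((1 + \<sigma>) / 2)"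
proof -
  have p: "(4::real) powr ((3 + \<sigma>) / 2) = 2 powr (3 + \<sigma>)"
  proof -
    have "(4::real) = 2 powr 2" by simp
    then have "(4::real) powr ((3 + \<sigma>) / 2) = 2 powr (2 * ((3 + \<sigma>) / 2))" by (metis powr_powr)
    then show ?thesis by simp
  qed
  have "4 * kappa * Gamma (\<sigma> + 1) * pi powr (- (\<sigma> + 1)) = 4 * (kappa * Gamma (\<sigma> + 1)) * pi powr (- (\<sigma> + 1))" by simp
  also have "\<dots> = (8 * 2 powr \<sigma>) * (pi powr (\<sigma> / 2) * pi powr (- (\<sigma> + 1)) / sqrt pi) * Gamma ((1 + \<sigma>) / 2)"
    unfolding kappa_Gamma by simp
  also have "pi powr (\<sigma> / 2) * pi powr (- (\<sigma> + 1)) / sqrt pi = pi powr (- ((3 + \<sigma>) / 2))"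
  proof -
    have "sqrt pi = pi powr (1/2)" by (simp add: powr_half_sqrt)
    then have "pi powr (\<sigma> / 2) * pi powr (- (\<sigma> + 1)) / sqrt pi = pi powr (\<sigma> / 2 + - (\<sigma> + 1) - 1/2)" by (simp only: powr_add powr_diff)
    also have "\<sigma> / 2 + - (\<sigma> + 1) - 1/2 = - ((3 + \<sigma>) / 2)" by (simp add: field_simps)
    finally show ?thesis .
  qed
  also have "8 * 2 powr \<sigma> = 4 powr ((3 + \<sigma>) / 2)" unfolding p by (simp add: powr_add powr_numeral)
  also have "4 powr ((3 + \<sigma>) / 2) * pi powr (- ((3 + \<sigma>) / 2)) = (4 / pi) powr ((3 + \<sigma>) / 2)"
    by (simp add: powr_divide powr_minus field_simps)
  finally show ?thesis .
qed

text \<open>J is the Poisson integral of |S| and f the function whose integral remains after the exchange of integrals.\<close>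

lemma gap_has_integral:
  assumes J: "\<And>t. t > 0 \<Longrightarrow> (\<integral>\<^sup>+x. ennreal (\<bar>Re (S (of_real x))\<bar> / (x^2 + t^2)) \<partial>lborel) = ennreal (J t)"
    and hb: "has_bochner_integral lborel (\<lambda>t. indicator {0<..} t *\<^sub>R f t) I"
    and f: "\<And>t. t > 0 \<Longrightarrow> t powr (\<sigma> + 1) / w t * J t = f t" and J0: "\<And>t. t > 0 \<Longrightarrow> J t \<ge> 0"
  shows "has_bochner_integral lborel (\<lambda>x. \<bar>gamma_factor (- \<sigma>) * \<bar>x\<bar> powr \<sigma> - Re (entire_part (of_real x))\<bar>) (kappa * I)"
    and "I \<ge> 0"
proof -
  have f0: "f t \<ge> 0" if "t > 0" for t
    unfolding f[OF that, symmetric] using J0[OF that] w_pos[OF that] by simp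
  have if0: "indicator {0<..} t *\<^sub>R f t \<ge> 0" for t using f0[of t] by (auto simp: indicator_def)
  show I0: "I \<ge> 0" using hb if0 by (auto simp: has_bochner_integral_iff intro!: Bochner_Integration.integral_nonneg)
  show "has_bochner_integral lborel (\<lambda>x. \<bar>gamma_factor (- \<sigma>) * \<bar>x\<bar> powr \<sigma> - Re (entire_part (of_real x))\<bar>) (kappa * I)"
  proof (rule has_bochner_integral_nn_integral)
    note [measurable] = exp_type_le_borel_measurable[OF entire_part_exp_type]
    show "(\<lambda>x. \<bar>gamma_factor (- \<sigma>) * \<bar>x\<bar> powr \<sigma> - Re (entire_part (of_real x))\<bar>) \<in> borel_measurable lborel" by measurable
    show "0 \<le> kappa * I" using kappa_pos I0 by simp
    have "(\<integral>\<^sup>+x. ennreal \<bar>gamma_factor (- \<sigma>) * \<bar>x\<bar> powr \<sigma> - Re (entire_part (of_real x))\<bar> \<partial>lborel) = (\<integral>\<^sup>+x. ennreal \<bar>kappa * \<epsilon> * Re (S (of_real x)) * potential x\<bar> \<partial>lborel)"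
    proof (rule nn_integral_cong_AE)
      have "AE x in lborel. x \<noteq> (0::real)" by (rule AE_lborel_singleton)
      then show "AE x in lborel. ennreal \<bar>gamma_factor (- \<sigma>) * \<bar>x\<bar> powr \<sigma> - Re (entire_part (of_real x))\<bar> = ennreal \<bar>kappa * \<epsilon> * Re (S (of_real x)) * potential x\<bar>"
        by eventually_elim (simp add: entire_part_real del: of_real_diff)
    qed
    also have "\<dots> = (\<integral>\<^sup>+t. ennreal (kappa * (t powr (\<sigma> + 1) / w t)) * (\<integral>\<^sup>+x. ennreal (\<bar>Re (S (of_real x))\<bar> / (x^2 + t^2)) \<partial>lborel) * indicator {0<..} t \<partial>lborel)"
      by (rule gap_nn_integral)
    also have "\<dots> = (\<integral>\<^sup>+t. ennreal (kappa * (indicator {0<..} t *\<^sub>R f t)) \<partial>lborel)"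
    proof (rule nn_integral_cong)
      fix t :: real
      show "ennreal (kappa * (t powr (\<sigma> + 1) / w t)) * (\<integral>\<^sup>+x. ennreal (\<bar>Re (S (of_real x))\<bar> / (x^2 + t^2)) \<partial>lborel) * indicator {0<..} t = ennreal (kappa * (indicator {0<..} t *\<^sub>R f t))"
      proof (cases "t > 0")
        case True
        have "kappa * (t powr (\<sigma> + 1) / w t) * J t = kappa * f t" using f[OF True] by (simp only: mult.assoc)
        moreover have "0 \<le> kappa * (t powr (\<sigma> + 1) / w t)" using kappa_pos w_pos[OF True] by simp
        ultimately show ?thesis using True J[OF True] J0[OF True] by (simp add: ennreal_mult[symmetric] del: ennreal_mult)
      qed simp
    qed
    also have "\<dots> = ennreal (kappa * I)"
      using has_bochner_integral_mult_right[OF hb, of kappa] if0 kappa_pos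
      by (subst nn_integral_eq_integral) (auto simp: has_bochner_integral_iff)
    finally show "(\<integral>\<^sup>+x. ennreal \<bar>gamma_factor (- \<sigma>) * \<bar>x\<bar> powr \<sigma> - Re (entire_part (of_real x))\<bar> \<partial>lborel) = ennreal (kappa * I)" .
  qed simp
qed

lemma gap_real: "x \<noteq> 0 \<Longrightarrow> gamma_factor (- \<sigma>) * \<bar>x\<bar> powr \<sigma> - Re (entire_part (of_real x)) = kappa * \<epsilon> * Re (S (of_real x)) * potential x"
  by (simp add: entire_part_real del: of_real_diff)

text \<open>At 0 the gap formula says nothing, so the reality of F(0) is obtained by continuity.\<close>

lemma entire_part_real_on_reals: "real_on_reals entire_part"
  unfolding real_on_reals_def
proof
  fix x :: real
  show "entire_part (of_real x) \<in> \<real>"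
  proof (cases "x = 0")
    case False
    show ?thesis unfolding entire_part_real[OF False] by (rule Reals_of_real)
  next
    case True
    have "((\<lambda>y::real. Im (entire_part (of_real y))) \<longlongrightarrow> Im (entire_part (of_real 0))) (at 0)"
    proof (rule tendsto_Im)
      have "isCont (\<lambda>y::real. entire_part (of_real y)) 0"
        by (rule isCont_o2[OF _ exp_type_le_isCont[OF entire_part_exp_type]]) (intro continuous_intros)
      then show "((\<lambda>y::real. entire_part (of_real y)) \<longlongrightarrow> entire_part (of_real 0)) (at 0)" by (simp add: isCont_def)
    qed
    moreover have "eventually (\<lambda>y::real. Im (entire_part (of_real y)) = 0) (at 0)"
      unfolding eventually_at_filter
    proof (intro always_eventually allI impI)
      fix y :: real assume "y \<noteq> 0"
      show "Im (entire_part (of_real y)) = 0" unfolding entire_part_real[OF \<open>y \<noteq> 0\<close>] by (rule Im_complex_of_real)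
    qed
    then have "((\<lambda>y::real. Im (entire_part (of_real y))) \<longlongrightarrow> 0) (at 0)" by (rule tendsto_eventually)
    ultimately have "Im (entire_part (of_real 0)) = 0" by (intro tendsto_unique[of "at (0::real)"]) auto
    then show ?thesis using True by (simp add: complex_is_Real_iff)
  qed
qed

text \<open>The potential is bounded near \<xi>, so a double zero of S at \<xi> is inherited by the gap.\<close>

lemma gap_quadratic:
  assumes \<xi>: "\<xi> \<noteq> 0" and S: "\<And>x. \<bar>Re (S (of_real x))\<bar> \<le> C * (x - \<xi>)^2"
  shows "\<exists>B. eventually (\<lambda>x. x \<noteq> 0 \<and> \<bar>gamma_factor (- \<sigma>) * \<bar>x\<bar> powr \<sigma> - Re (entire_part (of_real x))\<bar> \<le> B * (x - \<xi>)^2) (at \<xi>)"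
proof -
  define W where "W = (\<integral>t. indicator {0<..} t *\<^sub>R (t powr (\<sigma> + 1) / w t) \<partial>lborel)"
  have C0: "C \<ge> 0" using S[of "\<xi> + 1"] abs_ge_zero[of "Re (S (of_real (\<xi> + 1)))"] by (simp del: of_real_add)
  have W0: "W \<ge> 0" using order_trans[OF potential_integrable(2)[OF \<xi>] potential_integrable(3)[OF \<xi>]] \<xi> unfolding W_def
    by (simp add: zero_le_divide_iff)
  have "eventually (\<lambda>x. dist x \<xi> < \<bar>\<xi>\<bar> / 2) (at \<xi>)"
    using \<xi> by (auto simp: eventually_at intro!: exI[of _ "\<bar>\<xi>\<bar> / 2"])
  then have "eventually (\<lambda>x. x \<noteq> 0 \<and> \<bar>gamma_factor (- \<sigma>) * \<bar>x\<bar> powr \<sigma> - Re (entire_part (of_real x))\<bar> \<le> (kappa * C * (4 * W / \<xi>^2)) * (x - \<xi>)^2) (at \<xi>)"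
  proof eventually_elim
    case (elim x)
    have x: "\<bar>x\<bar> \<ge> \<bar>\<xi>\<bar> / 2" using elim by (auto simp: dist_real_def abs_if split: if_splits)
    then have x0: "x \<noteq> 0" using \<xi> by auto
    have "(\<bar>\<xi>\<bar> / 2)^2 \<le> \<bar>x\<bar>^2" using x by (intro power_mono) auto
    then have "W / x^2 \<le> W / ((\<bar>\<xi>\<bar> / 2)^2)" using W0 \<xi> x0 by (intro divide_left_mono mult_pos_pos) auto
    also have "W / ((\<bar>\<xi>\<bar> / 2)^2) = 4 * W / \<xi>^2" by (simp add: power_divide)
    finally have p: "potential x \<le> 4 * W / \<xi>^2" using potential_integrable(3)[OF x0] unfolding W_def by linarith
    have "\<bar>kappa * \<epsilon> * Re (S (of_real x)) * potential x\<bar> = kappa * \<bar>Re (S (of_real x))\<bar> * potential x"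
      using kappa_pos eps potential_integrable(2)[OF x0] by (auto simp: abs_mult)
    also have "\<dots> \<le> kappa * (C * (x - \<xi>)^2) * (4 * W / \<xi>^2)"
      using kappa_pos S[of x] p potential_integrable(2)[OF x0] C0 by (intro mult_mono mult_left_mono mult_nonneg_nonneg) auto
    also have "\<dots> = (kappa * C * (4 * W / \<xi>^2)) * (x - \<xi>)^2" by simp
    finally show ?case using x0 gap_real[OF x0] by simp
  qed
  then show ?thesis by blast
qed

end

section \<open>The extremal functions for powers of |x|\<close>

text \<open>The target as a real function. At 0 its value is 0, which is the value of real_of_ereal at infinity when \<sigma> < 0.\<close>

definition even_pow :: "real \<Rightarrow> real \<Rightarrow> real" where
  "even_pow \<sigma> x = gamma_factor (- \<sigma>) * \<bar>x\<bar> powr \<sigma>"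

lemma g_pow_eq_even_pow: "x \<noteq> 0 \<or> \<sigma> \<ge> 0 \<Longrightarrow> g_pow \<sigma> x = ereal (even_pow \<sigma> x)"
  by (auto simp: g_pow_def even_pow_def)

lemma real_of_g_pow [simp]: "real_of_ereal (g_pow \<sigma> x) = even_pow \<sigma> x"
  by (auto simp: g_pow_def even_pow_def)

lemma even_pow_measurable [measurable]: "even_pow \<sigma> \<in> borel_measurable borel"
  unfolding even_pow_def[abs_def] by measurable

text \<open>The possibly infinite value at 0 is on a null set.\<close>

lemma L1_distance_g_pow:
  "L1_distance (g_pow \<sigma>) F = (\<integral>\<^sup>+x. ennreal (cmod (of_real (even_pow \<sigma> x) - F (of_real x))) \<partial>lborel)"
  unfolding L1_distance_def
proof (rule nn_integral_cong_AE)
  have "AE x in lborel. x \<noteq> (0::real)" by (rule AE_lborel_singleton)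
  then show "AE x in lborel. (if \<bar>g_pow \<sigma> x\<bar> = \<infinity> then \<infinity> else ennreal (cmod (of_real (real_of_ereal (g_pow \<sigma> x)) - F (of_real x)))) = ennreal (cmod (of_real (even_pow \<sigma> x) - F (of_real x)))"
    by eventually_elim (simp add: g_pow_eq_even_pow)
qed

lemma unique_minimizer_iff:
  fixes \<Lambda> :: "'a \<Rightarrow> 'b::order"
  assumes "P F" "\<Lambda> F = v" "\<And>G. P G \<Longrightarrow> v \<le> \<Lambda> G" "\<And>G. P G \<Longrightarrow> \<Lambda> G = v \<Longrightarrow> G = F"
  shows "P l \<and> (\<forall>G. P G \<longrightarrow> \<Lambda> l \<le> \<Lambda> G) \<longleftrightarrow> l = F"
  using assms by (metis order_antisym)

lemma sin_cos_pi_of_real: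
  "cos (of_real pi * of_real x) = complex_of_real (cos (pi * x))"
  "sin (of_real pi * of_real x) = complex_of_real (sin (pi * x))"
  by (simp_all flip: of_real_mult add: cos_of_real sin_of_real)

lemma sin_pi_of_int: "sin (pi * of_int k) = 0" for k :: int
  unfolding sin_zero_iff_int2 by (metis mult.commute)

lemma cos_pi_half_integer: "cos (pi * (1/2 + of_int k)) = 0" for k :: int
  by (simp add: distrib_left cos_add sin_pi_of_int)

lemma sin_cos_squared_quadratic_bound:
  "cos (pi * \<xi>) = 0 \<Longrightarrow> cos (pi * x) ^ 2 \<le> pi^2 * (x - \<xi>)^2"
  "sin (pi * \<xi>) = 0 \<Longrightarrow> sin (pi * x) ^ 2 \<le> pi^2 * (x - \<xi>)^2"
proof -
  have s: "sin (pi * (x - \<xi>)) ^ 2 \<le> pi^2 * (x - \<xi>)^2"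
    using power_mono[OF abs_sin_x_le_abs_x[of "pi * (x - \<xi>)"], of 2] by (simp add: power_mult_distrib abs_mult)
  have e: "pi * x = pi * (x - \<xi>) + pi * \<xi>" by (simp add: algebra_simps)
  show "cos (pi * x) ^ 2 \<le> pi^2 * (x - \<xi>)^2" if h: "cos (pi * \<xi>) = 0"
  proof -
    have "sin (pi * \<xi>) ^ 2 = 1" using sin_cos_squared_add[of "pi * \<xi>"] h by simp
    moreover have "cos (pi * x) = - (sin (pi * (x - \<xi>)) * sin (pi * \<xi>))" unfolding e cos_add h by simp
    ultimately show ?thesis using s by (simp add: power_mult_distrib)
  qed
  show "sin (pi * x) ^ 2 \<le> pi^2 * (x - \<xi>)^2" if h: "sin (pi * \<xi>) = 0"
  proof -
    have "cos (pi * \<xi>) ^ 2 = 1" using sin_cos_squared_add[of "pi * \<xi>"] h by simp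
    moreover have "sin (pi * x) = sin (pi * (x - \<xi>)) * cos (pi * \<xi>)" unfolding e sin_add h by simp
    ultimately show ?thesis using s by (simp add: power_mult_distrib)
  qed
qed

lemma has_bochner_integral_signed_gap:
  assumes F: "exp_type_le F \<tau>" "real_on_reals F"
    and hb: "has_bochner_integral lborel (\<lambda>x. \<bar>even_pow \<sigma> x - Re (F (of_real x))\<bar>) V"
    and s: "\<And>x. x \<noteq> 0 \<Longrightarrow> 0 \<le> \<epsilon> * (even_pow \<sigma> x - Re (F (of_real x)))" and eps: "\<epsilon> = 1 \<or> \<epsilon> = (-1::real)"
  shows "has_bochner_integral lborel (\<lambda>x. \<epsilon> * (even_pow \<sigma> x - Re (F (of_real x)))) V"
    and "has_bochner_integral lborel (\<lambda>x. of_real \<epsilon> * (of_real (even_pow \<sigma> x) - F (of_real x))) (of_real V)"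
proof -
  note [measurable] = exp_type_le_borel_measurable[OF F(1)]
  show *: "has_bochner_integral lborel (\<lambda>x. \<epsilon> * (even_pow \<sigma> x - Re (F (of_real x)))) V"
  proof (rule has_bochner_integral_cong_AE[THEN iffD1, OF _ _ _ hb])
    have "AE x in lborel. x \<noteq> (0::real)" by (rule AE_lborel_singleton)
    then show "AE x in lborel. \<bar>even_pow \<sigma> x - Re (F (of_real x))\<bar> = \<epsilon> * (even_pow \<sigma> x - Re (F (of_real x)))"
    proof eventually_elim
      case (elim x)
      then show ?case using s[OF elim] eps by auto
    qed
  qed measurable
  have Fr: "F (of_real x) = of_real (Re (F (of_real x)))" for x
    using F(2) unfolding real_on_reals_def by (metis of_real_Re)
  show "has_bochner_integral lborel (\<lambda>x. of_real \<epsilon> * (of_real (even_pow \<sigma> x) - F (of_real x))) (of_real V)"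
  proof -
    have "of_real (\<epsilon> * (even_pow \<sigma> x - Re (F (of_real x)))) = of_real \<epsilon> * (of_real (even_pow \<sigma> x) - F (of_real x))" for x
      by (subst (2) Fr) (simp only: of_real_mult of_real_diff)
    with has_bochner_integral_of_real[OF *, where 'a=complex] show ?thesis by (simp only:)
  qed
qed

lemma nn_integral_gap_eq:
  assumes F: "real_on_reals F" and hb: "has_bochner_integral lborel (\<lambda>x. \<bar>even_pow \<sigma> x - Re (F (of_real x))\<bar>) V"
  shows "L1_distance (g_pow \<sigma>) F = ennreal V"
    and "has_bochner_integral lborel (\<lambda>x. complex_of_real (cmod (of_real (even_pow \<sigma> x) - F (of_real x)))) (of_real V)"
proof -
  have Fr: "F (of_real x) = of_real (Re (F (of_real x)))" for x
    using F unfolding real_on_reals_def by (metis of_real_Re)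
  have d: "cmod (of_real (even_pow \<sigma> x) - F (of_real x)) = \<bar>even_pow \<sigma> x - Re (F (of_real x))\<bar>" for x
    by (subst Fr) (metis norm_of_real of_real_diff)
  show "L1_distance (g_pow \<sigma>) F = ennreal V"
    unfolding L1_distance_g_pow d using hb by (subst nn_integral_eq_integral) (auto simp: has_bochner_integral_iff)
  show "has_bochner_integral lborel (\<lambda>x. complex_of_real (cmod (of_real (even_pow \<sigma> x) - F (of_real x)))) (of_real V)"
    unfolding d by (rule has_bochner_integral_of_real[OF hb])
qed

text \<open>The pattern cos^2 \<pi>z. The nodes are the half-integers, so the point 0 only matters for the inequality F(0) \<le> g(0).\<close>

lemma extremal_minorant_characterization:
  assumes sig: "\<sigma> > -1" "\<forall>n::nat. \<sigma> \<noteq> 2 * real n"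
  obtains F where "\<forall>l. extremal_minorant (2 * pi) (g_pow \<sigma>) l \<longleftrightarrow> l = F"
    and "interpolates_on F (g_pow \<sigma>) half_integers"
    and "has_bochner_integral lborel (\<lambda>x. of_real (even_pow \<sigma> x) - F (of_real x))
           (of_real ((2 - 2 powr (1 - \<sigma>)) * gamma_factor (1 + \<sigma>)) * riemann_zeta (of_real (1 + \<sigma>)))"
proof -
  obtain m where m: "2 * real m - 2 < \<sigma>" "\<sigma> < 2 * real m" "\<sigma> > 0 \<Longrightarrow> m > 0" using exists_even_interval[OF sig] by metis
  let ?S = "\<lambda>z. cos (of_real pi * z) ^ 2"
  interpret sign_pattern ?S "2 * pi" 1 1 "\<lambda>t. cosh (pi * t) ^ 2" \<sigma> m
    by (rule sign_pattern_cos_squared[OF m(1,2) sig(1)])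
  note T = entire_part_exp_type and R = entire_part_real_on_reals
  define F where "F = entire_part"
  have S: "Re (?S (of_real x)) = cos (pi * x) ^ 2" for x
    unfolding sin_cos_pi_of_real by (simp flip: of_real_power)
  have gap: "even_pow \<sigma> x - Re (F (of_real x)) = kappa * cos (pi * x) ^ 2 * potential x" if "x \<noteq> 0" for x
    using gap_real[OF that] unfolding S by (simp add: F_def even_pow_def)
  have gap0: "0 \<le> 1 * (even_pow \<sigma> x - Re (F (of_real x)))" if "x \<noteq> 0" for x
    unfolding gap[OF that] using kappa_pos potential_integrable(2)[OF that] by simp
  define I where "I = (\<integral>t. indicator {0<..} t *\<^sub>R (t powr \<sigma> * (exp (- (2 * pi) * t) / (1 + exp (- (2 * pi) * t)))) \<partial>lborel)"
  note M = Mellin_alternating[OF sig(1), of "2 * pi"]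
  define V where "V = kappa * (2 * pi * I)"
  have hb1: "has_bochner_integral lborel (\<lambda>t. indicator {0<..} t *\<^sub>R (2 * pi * (t powr \<sigma> * (exp (- (2 * pi) * t) / (1 + exp (- (2 * pi) * t)))))) (2 * pi * I)"
    using has_bochner_integral_mult_right[of "2 * pi" lborel _ I, OF has_bochner_integral_integrable[OF M(1), folded I_def]]
    by (simp add: mult_ac)
  have J: "(\<integral>\<^sup>+x. ennreal (\<bar>Re (?S (of_real x))\<bar> / (x^2 + t^2)) \<partial>lborel) = ennreal (pi / t * ((1 + exp (- 2 * pi * t)) / 2))" if "t > 0" for t
    unfolding S using nn_integral_cos_squared[OF that] by simp
  have f: "t powr (\<sigma> + 1) / cosh (pi * t) ^ 2 * (pi / t * ((1 + exp (- 2 * pi * t)) / 2)) = 2 * pi * (t powr \<sigma> * (exp (- (2 * pi) * t) / (1 + exp (- (2 * pi) * t))))" if "t > 0" for t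
  proof -
    define q where "q = exp (- pi * t)"
    have q: "q > 0" by (simp add: q_def)
    have p: "t powr (\<sigma> + 1) = t powr \<sigma> * t" using that by (simp add: powr_add)
    define u where "u = 1 + q^2"
    have u: "u > 0" unfolding u_def by (intro add_pos_nonneg) auto
    show ?thesis unfolding cosh_sinh_via_exp q_def[symmetric] u_def[symmetric] p using q u that
      by (simp add: field_simps power2_eq_square)
  qed
  have J0: "0 \<le> pi / t * ((1 + exp (- 2 * pi * t)) / 2)" if "t > 0" for t
    using that by (simp add: add_nonneg_nonneg)
  have hb: "has_bochner_integral lborel (\<lambda>x. \<bar>even_pow \<sigma> x - Re (F (of_real x))\<bar>) V"
    unfolding even_pow_def F_def V_def by (rule gap_has_integral(1)[OF J hb1 f J0])
  have I0: "2 * pi * I \<ge> 0" by (rule gap_has_integral(2)[OF J hb1 f J0])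
  have V0: "V \<ge> 0" unfolding V_def using I0 kappa_pos by simp
  (* For \<sigma> < 0 the factor 1 - 2^(-\<sigma>) and \<zeta>(1+\<sigma>) are both negative, and the series behind the product is
     the alternating one. *)
  have Vv: "of_real V = of_real ((2 - 2 powr (1 - \<sigma>)) * gamma_factor (1 + \<sigma>)) * riemann_zeta (of_real (1 + \<sigma>))"
  proof -
    define A where "A = Gamma (\<sigma> + 1) * (2 * pi) powr (- (\<sigma> + 1))"
    have A: "A > 0" using sig by (simp add: A_def Gamma_real_pos)
    have "(\<lambda>n. (-1) ^ n * real (Suc n) powr (- (1 + \<sigma>))) sums (I / A)" using M(2) unfolding A_def I_def by (simp add: add.commute)
    moreover have "1 + \<sigma> \<noteq> 1" using sig(2)[rule_format, of 0] by simp
    ultimately have e: "of_real (I / A) = of_real (1 - 2 powr (1 - (1 + \<sigma>))) * riemann_zeta (of_real (1 + \<sigma>))"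
      using sig(1) by (intro eta_riemann_zeta) auto
    have "V = (2 * pi * kappa * A) * (I / A)" using A by (simp add: V_def)
    also have "2 * pi * kappa * A = 2 * gamma_factor (1 + \<sigma>)" unfolding A_def by (rule kappa_Gamma_2pi)
    finally have "complex_of_real V = of_real (2 * gamma_factor (1 + \<sigma>)) * of_real (I / A)" by (simp only: of_real_mult)
    also have "\<dots> = of_real (2 * gamma_factor (1 + \<sigma>) * (1 - 2 powr (1 - (1 + \<sigma>)))) * riemann_zeta (of_real (1 + \<sigma>))"
      unfolding e by (simp only: of_real_mult mult.assoc)
    also have "2 * gamma_factor (1 + \<sigma>) * (1 - 2 powr (1 - (1 + \<sigma>))) = (2 - 2 powr (1 - \<sigma>)) * gamma_factor (1 + \<sigma>)"
      by (simp add: powr_diff powr_minus field_simps)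
    finally show ?thesis .
  qed
  have T': "exp_type_le F (2 * pi)" and R': "real_on_reals F" unfolding F_def by (rule T, rule R)
  have hne: "1/2 + of_int k \<noteq> (0::real)" for k :: int
  proof
    assume "1/2 + of_int k = (0::real)"
    then have "cos (pi * (1/2 + of_int k)) = 1" by (simp only:) simp
    then show False unfolding cos_pi_half_integer by simp
  qed
  have interp: "even_pow \<sigma> (1/2 + of_int k) = Re (F (of_real (1/2 + of_int k)))" for k :: int
    using gap[OF hne[of k]] unfolding cos_pi_half_integer by simp
  have quad: "\<exists>B. eventually (\<lambda>x. x \<noteq> 0 \<and> 1 * (even_pow \<sigma> x - Re (F (of_real x))) \<le> B * (x - (1/2 + of_int k))^2) (at (1/2 + of_int k))" for k :: int
  proof -
    have "\<bar>Re (?S (of_real x))\<bar> \<le> pi^2 * (x - (1/2 + of_int k))^2" for x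
      unfolding S using sin_cos_squared_quadratic_bound(1)[OF cos_pi_half_integer] by simp
    from gap_quadratic[OF hne this] obtain B where
      "eventually (\<lambda>x. x \<noteq> 0 \<and> \<bar>even_pow \<sigma> x - Re (F (of_real x))\<bar> \<le> B * (x - (1/2 + of_int k))^2) (at (1/2 + of_int k))"
      unfolding even_pow_def F_def by blast
    then have "eventually (\<lambda>x. x \<noteq> 0 \<and> 1 * (even_pow \<sigma> x - Re (F (of_real x))) \<le> B * (x - (1/2 + of_int k))^2) (at (1/2 + of_int k))"
      by eventually_elim auto
    then show ?thesis by blast
  qed
  have minF: "minorant (2 * pi) (g_pow \<sigma>) F"
    unfolding minorant_def
  proof (intro conjI allI T' R')
    fix x :: real
    show "ereal (Re (F (of_real x))) \<le> g_pow \<sigma> x"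
    proof (cases "x = 0")
      case False
      then show ?thesis using gap0[OF False] by (simp add: g_pow_eq_even_pow)
    next
      case x0: True
      show ?thesis
      proof (cases "\<sigma> < 0")
        case True
        then show ?thesis using x0 by (simp add: g_pow_def)
      next
        case False
        moreover have "\<sigma> \<noteq> 0" using sig(2)[rule_format, of 0] by simp
        ultimately have p: "\<sigma> > 0" by simp
        obtain c where "c \<ge> 0" "entire_part 0 = of_real (- (1 * Re (?S 0) * c))" using entire_part_0[OF m(3)[OF p]] by blast
        then show ?thesis using x0 p by (simp add: F_def g_pow_eq_even_pow even_pow_def)
      qed
    qed
  qed
  have other: "ennreal V \<le> L1_distance (g_pow \<sigma>) G" "L1_distance (g_pow \<sigma>) G = ennreal V \<Longrightarrow> G = F"
    if G: "minorant (2 * pi) (g_pow \<sigma>) G" for G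
  proof -
    have side: "0 \<le> 1 * (even_pow \<sigma> x - Re (G (of_real x)))" if "x \<noteq> 0" for x
    proof -
      have "ereal (Re (G (of_real x))) \<le> g_pow \<sigma> x" using G by (simp add: minorant_def)
      then show ?thesis using that by (simp add: g_pow_eq_even_pow)
    qed
    have GT: "exp_type_le G (2 * pi)" "real_on_reals G" using G by (auto simp: minorant_def)
    note X = one_sided_extremal[OF T' R' _ V0 even_pow_measurable has_bochner_integral_signed_gap(1)[OF T' R' hb gap0] interp quad GT side side[OF hne], simplified]
    show "ennreal V \<le> L1_distance (g_pow \<sigma>) G" "L1_distance (g_pow \<sigma>) G = ennreal V \<Longrightarrow> G = F"
      unfolding L1_distance_g_pow using X by simp_all
  qed
  show ?thesis
  proof
    show "\<forall>l. extremal_minorant (2 * pi) (g_pow \<sigma>) l \<longleftrightarrow> l = F"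
      unfolding extremal_minorant_def
      by (intro allI) (rule unique_minimizer_iff[where P="minorant (2 * pi) (g_pow \<sigma>)" and \<Lambda>="L1_distance (g_pow \<sigma>)", OF minF nn_integral_gap_eq(1)[OF R' hb] other])
    show "interpolates_on F (g_pow \<sigma>) half_integers"
      unfolding interpolates_on_def half_integers_def
    proof safe
      fix n :: int
      have e: "of_int n + 1 / 2 = 1 / 2 + (of_int n :: real)" by simp
      have "F (of_real (1 / 2 + of_int n)) = of_real (even_pow \<sigma> (1 / 2 + of_int n))"
        unfolding interp using R' by (metis of_real_Re real_on_reals_def)
      moreover have "g_pow \<sigma> (1 / 2 + of_int n) = ereal (even_pow \<sigma> (1 / 2 + of_int n))"
        by (intro g_pow_eq_even_pow disjI1 hne)
      ultimately show "\<exists>y. F (of_real (of_int n + 1 / 2)) = of_real y \<and> g_pow \<sigma> (of_int n + 1 / 2) = ereal y" unfolding e by blast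
    qed
    show "has_bochner_integral lborel (\<lambda>x. of_real (even_pow \<sigma> x) - F (of_real x))
           (of_real ((2 - 2 powr (1 - \<sigma>)) * gamma_factor (1 + \<sigma>)) * riemann_zeta (of_real (1 + \<sigma>)))"
      using has_bochner_integral_signed_gap(2)[OF T' R' hb gap0] unfolding Vv by simp
  qed
qed

text \<open>The pattern sin^2 \<pi>z. The nodes are the integers; at the node 0 the target is 0 and F(0) = 0 because S(0) = 0.\<close>

lemma extremal_majorant_characterization:
  assumes sig: "\<sigma> > 0" "\<forall>n::nat. \<sigma> \<noteq> 2 * real n"
  obtains F where "\<forall>l. extremal_majorant (2 * pi) (g_pow \<sigma>) l \<longleftrightarrow> l = F"
    and "interpolates_on F (g_pow \<sigma>) \<int>"
    and "has_bochner_integral lborel (\<lambda>x. F (of_real x) - of_real (even_pow \<sigma> x))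
           (of_real (2 * gamma_factor (1 + \<sigma>)) * riemann_zeta (of_real (1 + \<sigma>)))"
proof -
  have sig': "\<sigma> > -1" using sig(1) by simp
  obtain m where m: "2 * real m - 2 < \<sigma>" "\<sigma> < 2 * real m" "\<sigma> > 0 \<Longrightarrow> m > 0" using exists_even_interval[OF sig' sig(2)] by metis
  let ?S = "\<lambda>z. sin (of_real pi * z) ^ 2"
  interpret sign_pattern ?S "2 * pi" 1 "-1" "\<lambda>t. sinh (pi * t) ^ 2" \<sigma> m
    by (rule sign_pattern_sin_squared[OF m(1,2) sig(1)])
  define F where "F = entire_part"
  have T': "exp_type_le F (2 * pi)" and R': "real_on_reals F"
    unfolding F_def by (rule entire_part_exp_type, rule entire_part_real_on_reals)
  have S: "Re (?S (of_real x)) = sin (pi * x) ^ 2" for x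
    unfolding sin_cos_pi_of_real by (simp flip: of_real_power)
  have gap: "even_pow \<sigma> x - Re (F (of_real x)) = - (kappa * sin (pi * x) ^ 2 * potential x)" if "x \<noteq> 0" for x
    using gap_real[OF that] unfolding S by (simp add: F_def even_pow_def)
  have gap0: "0 \<le> (-1) * (even_pow \<sigma> x - Re (F (of_real x)))" if "x \<noteq> 0" for x
    unfolding gap[OF that] using kappa_pos potential_integrable(2)[OF that] by simp
  have F0: "F 0 = 0"
  proof -
    obtain c where "entire_part 0 = of_real (- (- 1 * Re (?S 0) * c))" using entire_part_0[OF m(3)[OF sig(1)]] by blast
    then show ?thesis by (simp add: F_def)
  qed
  have gr0: "even_pow \<sigma> 0 = 0" by (simp add: even_pow_def)
  define Z where "Z = (\<Sum>n. real (Suc n) powr (- (1 + \<sigma>)))"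
  define A where "A = Gamma (\<sigma> + 1) * (2 * pi) powr (- (\<sigma> + 1))"
  define V where "V = kappa * (2 * pi * (A * Z))"
  have hb1: "has_bochner_integral lborel (\<lambda>t. indicator {0<..} t *\<^sub>R (2 * pi * (t powr \<sigma> * (exp (- (2 * pi) * t) / (1 - exp (- (2 * pi) * t)))))) (2 * pi * (A * Z))"
  proof -
    have sm: "summable (\<lambda>n. real (Suc n) powr (- (1 + \<sigma>)))" by (rule summable_powr_Suc) (use sig in simp)
    have sp: "(2 * pi * real (Suc n)) powr (- (\<sigma> + 1)) = (2 * pi) powr (- (\<sigma> + 1)) * real (Suc n) powr (- (1 + \<sigma>))" for n
      by (subst powr_mult) (simp_all add: add.commute)
    have gs: "(\<lambda>n. exp (- (2 * pi * real (Suc n)) * t)) sums (exp (- (2 * pi) * t) / (1 - exp (- (2 * pi) * t)))" if "t > 0" for t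
    proof -
      define q where "q = exp (- (2 * pi) * t)"
      have "\<bar>q\<bar> < 1" using that by (simp add: q_def)
      then have "(\<lambda>n. q * q ^ n) sums (q * (1 / (1 - q)))" by (intro sums_mult geometric_sums) simp
      then show ?thesis unfolding exp_neg_mult_Suc q_def[symmetric] by simp
    qed
    have "has_bochner_integral lborel (\<lambda>t. indicator {0<..} t *\<^sub>R (t powr \<sigma> * (exp (- (2 * pi) * t) / (1 - exp (- (2 * pi) * t)))))
        (Gamma (\<sigma> + 1) * (\<Sum>n. 1 * (2 * pi * real (Suc n)) powr (- (\<sigma> + 1))))"
    proof (rule Mellin_series[OF sig'])
      show "0 < 2 * pi * real (Suc n)" for n by simp
      show "(\<lambda>n. 1 * exp (- (2 * pi * real (Suc n)) * t)) sums (exp (- (2 * pi) * t) / (1 - exp (- (2 * pi) * t)))" if "t > 0" for t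
        using gs[OF that] by simp
      show "summable (\<lambda>n. \<bar>1\<bar> * exp (- (2 * pi * real (Suc n)) * t))" if "t > 0" for t
        using gs[OF that] by (simp add: sums_iff)
      show "summable (\<lambda>n. \<bar>1\<bar> * (2 * pi * real (Suc n)) powr (- (\<sigma> + 1)))" unfolding sp using sm by (simp add: summable_mult del: of_nat_Suc)
    qed
    also have "Gamma (\<sigma> + 1) * (\<Sum>n. 1 * (2 * pi * real (Suc n)) powr (- (\<sigma> + 1))) = A * Z"
      unfolding sp Z_def A_def using suminf_mult[OF sm, of "(2 * pi) powr (- (\<sigma> + 1))"] by (simp del: of_nat_Suc)
    finally have "has_bochner_integral lborel (\<lambda>t. indicator {0<..} t *\<^sub>R (t powr \<sigma> * (exp (- (2 * pi) * t) / (1 - exp (- (2 * pi) * t))))) (A * Z)" .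
    from has_bochner_integral_mult_right[OF this, of "2 * pi"] show ?thesis
      by (simp only: real_scaleR_def mult.assoc mult.left_commute)
  qed
  have J: "(\<integral>\<^sup>+x. ennreal (\<bar>Re (?S (of_real x))\<bar> / (x^2 + t^2)) \<partial>lborel) = ennreal (pi / t * ((1 - exp (- 2 * pi * t)) / 2))" if "t > 0" for t
    unfolding S using nn_integral_sin_squared[OF that] by simp
  have f: "t powr (\<sigma> + 1) / sinh (pi * t) ^ 2 * (pi / t * ((1 - exp (- 2 * pi * t)) / 2)) = 2 * pi * (t powr \<sigma> * (exp (- (2 * pi) * t) / (1 - exp (- (2 * pi) * t))))" if "t > 0" for t
  proof -
    define q where "q = exp (- pi * t)"
    have q: "q > 0" by (simp add: q_def)
    have p: "t powr (\<sigma> + 1) = t powr \<sigma> * t" using that by (simp add: powr_add)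
    define u where "u = 1 - q^2"
    have "q^2 < 1" unfolding q_def cosh_sinh_via_exp(3)[symmetric] using that by simp
    then have u: "u > 0" by (simp add: u_def)
    show ?thesis unfolding cosh_sinh_via_exp q_def[symmetric] u_def[symmetric] p using q u that
      by (simp add: field_simps power2_eq_square)
  qed
  have J0: "0 \<le> pi / t * ((1 - exp (- 2 * pi * t)) / 2)" if "t > 0" for t
    using that by simp
  have hb: "has_bochner_integral lborel (\<lambda>x. \<bar>even_pow \<sigma> x - Re (F (of_real x))\<bar>) V"
    unfolding even_pow_def F_def V_def by (rule gap_has_integral(1)[OF J hb1 f J0])
  have I0: "2 * pi * (A * Z) \<ge> 0" by (rule gap_has_integral(2)[OF J hb1 f J0])
  have V0: "V \<ge> 0" unfolding V_def using I0 kappa_pos by simp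
  have Vv: "of_real V = of_real (2 * gamma_factor (1 + \<sigma>)) * riemann_zeta (of_real (1 + \<sigma>))"
  proof -
    have z: "riemann_zeta (of_real (1 + \<sigma>)) = of_real Z" unfolding Z_def by (rule riemann_zeta_real_gt_1) (use sig in simp)
    have "V = (2 * pi * kappa * A) * Z" by (simp add: V_def)
    also have "2 * pi * kappa * A = 2 * gamma_factor (1 + \<sigma>)" unfolding A_def by (rule kappa_Gamma_2pi)
    finally show ?thesis unfolding z by (simp only: of_real_mult)
  qed
  have interp: "even_pow \<sigma> (of_int k) = Re (F (of_real (of_int k)))" for k :: int
  proof (cases "k = 0")
    case True
    then show ?thesis by (simp add: F0 gr0)
  next
    case False
    then have "even_pow \<sigma> (of_int k) - Re (F (of_real (of_int k))) = 0" using gap[of "of_int k"] by (simp add: sin_pi_of_int)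
    then show ?thesis by simp
  qed
  have quad: "\<exists>B. eventually (\<lambda>x. x \<noteq> 0 \<and> (-1) * (even_pow \<sigma> x - Re (F (of_real x))) \<le> B * (x - of_int k)^2) (at (of_int k))" if k: "k \<noteq> 0" for k :: int
  proof -
    have "\<bar>Re (?S (of_real x))\<bar> \<le> pi^2 * (x - of_int k)^2" for x
      unfolding S using sin_cos_squared_quadratic_bound(2)[OF sin_pi_of_int] by simp
    from gap_quadratic[OF _ this] k obtain B where
      "eventually (\<lambda>x. x \<noteq> 0 \<and> \<bar>even_pow \<sigma> x - Re (F (of_real x))\<bar> \<le> B * (x - of_int k)^2) (at (of_int k))"
      unfolding even_pow_def F_def by auto
    then have "eventually (\<lambda>x. x \<noteq> 0 \<and> (-1) * (even_pow \<sigma> x - Re (F (of_real x))) \<le> B * (x - of_int k)^2) (at (of_int k))"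
      by eventually_elim auto
    then show ?thesis by blast
  qed
  have majF: "majorant (2 * pi) (g_pow \<sigma>) F"
    unfolding majorant_def
  proof (intro conjI allI T' R')
    fix x :: real
    show "g_pow \<sigma> x \<le> ereal (Re (F (of_real x)))"
    proof (cases "x = 0")
      case False
      then show ?thesis using gap0[OF False] by (simp add: g_pow_eq_even_pow)
    next
      case True
      then show ?thesis using sig by (simp add: g_pow_eq_even_pow F0 gr0)
    qed
  qed
  have other: "ennreal V \<le> L1_distance (g_pow \<sigma>) G" "L1_distance (g_pow \<sigma>) G = ennreal V \<Longrightarrow> G = F"
    if G: "majorant (2 * pi) (g_pow \<sigma>) G" for G
  proof -
    have side: "0 \<le> (-1) * (even_pow \<sigma> x - Re (G (of_real x)))" for x
    proof -
      have "g_pow \<sigma> x \<le> ereal (Re (G (of_real x)))" using G by (simp add: majorant_def)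
      then show ?thesis using sig by (simp add: g_pow_eq_even_pow)
    qed
    have GT: "exp_type_le G (2 * pi)" "real_on_reals G" using G by (auto simp: majorant_def)
    have e: "(-1::real) = 1 \<or> (-1::real) = -1" by simp
    note X = one_sided_extremal[where \<theta>=0, unfolded add_0, OF T' R' e V0 even_pow_measurable has_bochner_integral_signed_gap(1)[OF T' R' hb gap0 e] interp quad GT side side]
    show "ennreal V \<le> L1_distance (g_pow \<sigma>) G"
      unfolding L1_distance_g_pow by (rule X(1))
    show "L1_distance (g_pow \<sigma>) G = ennreal V \<Longrightarrow> G = F"
      unfolding L1_distance_g_pow by (rule X(2))
  qed
  show ?thesis
  proof
    show "\<forall>l. extremal_majorant (2 * pi) (g_pow \<sigma>) l \<longleftrightarrow> l = F"
      unfolding extremal_majorant_def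
      by (intro allI) (rule unique_minimizer_iff[where P="majorant (2 * pi) (g_pow \<sigma>)" and \<Lambda>="L1_distance (g_pow \<sigma>)", OF majF nn_integral_gap_eq(1)[OF R' hb] other])
    show "interpolates_on F (g_pow \<sigma>) \<int>"
      unfolding interpolates_on_def Ints_def
    proof safe
      fix n :: int
      have "F (of_real (of_int n)) = of_real (even_pow \<sigma> (of_int n))"
        unfolding interp using R' by (metis of_real_Re real_on_reals_def)
      moreover have "g_pow \<sigma> (of_int n) = ereal (even_pow \<sigma> (of_int n))"
        using sig by (intro g_pow_eq_even_pow) simp
      ultimately show "\<exists>y. F (of_real (of_int n)) = of_real y \<and> g_pow \<sigma> (of_int n) = ereal y" by blast
    qed
    show "has_bochner_integral lborel (\<lambda>x. F (of_real x) - of_real (even_pow \<sigma> x))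
           (of_real (2 * gamma_factor (1 + \<sigma>)) * riemann_zeta (of_real (1 + \<sigma>)))"
      using has_bochner_integral_signed_gap(2)[OF T' R' hb gap0] unfolding Vv by simp
  qed
qed

lemma suminf_L_chi4:
  assumes s: "s > (1::real)"
  shows "summable (\<lambda>n. real (2 * n + 1) powr (- s))"
    and "L_chi4 (of_real s) = of_real (\<Sum>n. (-1) ^ n * real (2 * n + 1) powr (- s))"
proof -
  show *: "summable (\<lambda>n. real (2 * n + 1) powr (- s))"
  proof (rule summable_comparison_test')
    show "summable (\<lambda>n. real (Suc n) powr (- s))" using s by (intro summable_powr_Suc) simp
    show "norm (real (2 * n + 1) powr (- s)) \<le> real (Suc n) powr (- s)" if "n \<ge> 0" for n
      using s by (simp add: powr_mono2')
  qed
  have "summable (\<lambda>n. (-1) ^ n * real (2 * n + 1) powr (- s))"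
    by (rule summable_rabs_cancel) (use * in \<open>simp add: abs_mult power_abs\<close>)
  then have "complex_of_real (\<Sum>n. (-1) ^ n * real (2 * n + 1) powr (- s)) = (\<Sum>n. complex_of_real ((-1) ^ n * real (2 * n + 1) powr (- s)))"
    by (rule suminf_of_real)
  also have "(\<lambda>n. complex_of_real ((-1) ^ n * real (2 * n + 1) powr (- s))) = (\<lambda>n. (- 1) ^ n * of_nat (2 * n + 1) powr (- of_real s))"
  proof
    fix n :: nat
    have "(of_nat (2 * n + 1) :: complex) powr (- of_real s) = of_real (real (2 * n + 1)) powr of_real (- s)" by (simp only: of_real_of_nat_eq of_real_minus)
    also have "\<dots> = of_real (real (2 * n + 1) powr (- s))" by (rule powr_of_real) simp
    finally show "complex_of_real ((-1) ^ n * real (2 * n + 1) powr (- s)) = (- 1) ^ n * of_nat (2 * n + 1) powr (- of_real s)" by simp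
  qed
  finally show "L_chi4 (of_real s) = of_real (\<Sum>n. (-1) ^ n * real (2 * n + 1) powr (- s))" unfolding L_chi4_def by simp
qed

text \<open>The pattern cos \<pi>z. The value of the gap integral is \<kappa> times the Mellin transform of 4 arctan(exp(-\<pi>t)), expanded in the
arctangent series.\<close>

lemma best_approximation_characterization:
  assumes sig: "\<sigma> > -1" "\<forall>n::nat. \<sigma> \<noteq> 2 * real n"
  obtains F where "\<forall>l. best_approximation pi (g_pow \<sigma>) l \<longleftrightarrow> l = F"
    and "interpolates_on F (g_pow \<sigma>) half_integers" and "real_on_reals F"
    and "\<forall>x. 0 \<le> ereal (sgn (cos (pi * x))) * (g_pow \<sigma> x - ereal (Re (F (of_real x))))"
    and "has_bochner_integral lborel (\<lambda>x. complex_of_real (cmod (of_real (even_pow \<sigma> x) - F (of_real x))))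
           (of_real ((4 / pi) powr ((3 + \<sigma>) / 2) * Gamma ((1 + \<sigma>) / 2)) * L_chi4 (of_real (2 + \<sigma>)))"
proof -
  obtain m where m: "2 * real m - 2 < \<sigma>" "\<sigma> < 2 * real m" "\<sigma> > 0 \<Longrightarrow> m > 0" using exists_even_interval[OF sig] by metis
  let ?S = "\<lambda>z. cos (of_real pi * z)"
  interpret sign_pattern ?S pi 1 1 "\<lambda>t. cosh (pi * t)" \<sigma> m
    by (rule sign_pattern_cos[OF m(1,2) sig(1)])
  define F where "F = entire_part"
  have T': "exp_type_le F pi" and R': "real_on_reals F"
    unfolding F_def by (rule entire_part_exp_type, rule entire_part_real_on_reals)
  have S: "Re (?S (of_real x)) = cos (pi * x)" for x unfolding sin_cos_pi_of_real by simp
  have gap: "even_pow \<sigma> x - Re (F (of_real x)) = kappa * cos (pi * x) * potential x" if "x \<noteq> 0" for x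
    using gap_real[OF that] unfolding S by (simp add: F_def even_pow_def)
  have gap0: "0 \<le> sgn (cos (pi * x)) * (even_pow \<sigma> x - Re (F (of_real x)))" if "x \<noteq> 0" for x
  proof -
    have "sgn (cos (pi * x)) * (even_pow \<sigma> x - Re (F (of_real x))) = kappa * \<bar>cos (pi * x)\<bar> * potential x"
      unfolding gap[OF that] by (simp add: abs_sgn mult_ac)
    then show ?thesis using kappa_pos potential_integrable(2)[OF that] by simp
  qed
  define Z where "Z = (\<Sum>n. (-1) ^ n * real (2 * n + 1) powr (- (2 + \<sigma>)))"
  define A where "A = Gamma (\<sigma> + 1) * pi powr (- (\<sigma> + 1))"
  define V where "V = kappa * (4 * (A * Z))"
  have hb1: "has_bochner_integral lborel (\<lambda>t. indicator {0<..} t *\<^sub>R (4 * (t powr \<sigma> * arctan (exp (- pi * t))))) (4 * (A * Z))"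
  proof -
    have "2 + \<sigma> > 1" using sig by simp
    note sm = suminf_L_chi4(1)[OF this]
    have sma: "summable (\<lambda>n. (-1) ^ n * real (2 * n + 1) powr (- (2 + \<sigma>)))"
      by (rule summable_rabs_cancel) (use sm in \<open>simp add: abs_mult power_abs\<close>)
    have sp: "1 / real (2 * n + 1) * (pi * real (2 * n + 1)) powr (- (\<sigma> + 1)) = pi powr (- (\<sigma> + 1)) * real (2 * n + 1) powr (- (2 + \<sigma>))" for n
    proof -
      have "real (2 * n + 1) powr (- (2 + \<sigma>)) = real (2 * n + 1) powr (- (\<sigma> + 1) - 1)" by (simp add: algebra_simps)
      also have "\<dots> = real (2 * n + 1) powr (- (\<sigma> + 1)) / real (2 * n + 1)" unfolding powr_diff by simp
      finally show ?thesis by (subst powr_mult) simp_all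
    qed
    have ex: "exp (- (pi * real (2 * n + 1)) * t) = exp (- pi * t) ^ (n * 2 + 1)" for n t
    proof -
      have "- (pi * real (2 * n + 1)) * t = real (n * 2 + 1) * (- pi * t)" by (simp add: algebra_simps)
      then show ?thesis by (simp only: exp_of_nat_mult)
    qed
    have "has_bochner_integral lborel (\<lambda>t. indicator {0<..} t *\<^sub>R (t powr \<sigma> * arctan (exp (- pi * t))))
        (Gamma (\<sigma> + 1) * (\<Sum>n. ((-1) ^ n * (1 / real (2 * n + 1))) * (pi * real (2 * n + 1)) powr (- (\<sigma> + 1))))"
    proof (rule Mellin_series[OF sig(1)])
      show "0 < pi * real (2 * n + 1)" for n by simp
      fix t :: real assume t: "t > 0"
      have q: "\<bar>exp (- pi * t)\<bar> \<le> 1" using t by simp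
      have "(\<lambda>n. (-1) ^ n * (1 / real (n * 2 + 1) * exp (- pi * t) ^ (n * 2 + 1))) sums arctan (exp (- pi * t))"
        unfolding arctan_series[OF q] by (rule summable_sums[OF summable_arctan_series[OF q]])
      then show "(\<lambda>n. ((-1) ^ n * (1 / real (2 * n + 1))) * exp (- (pi * real (2 * n + 1)) * t)) sums arctan (exp (- pi * t))"
        unfolding ex by (simp only: mult.assoc mult.commute[of 2])
      show "summable (\<lambda>n. \<bar>(-1) ^ n * (1 / real (2 * n + 1))\<bar> * exp (- (pi * real (2 * n + 1)) * t))"
      proof (rule summable_comparison_test')
        define r where "r = exp (- pi * t)"
        have r: "r > 0" "r < 1" using t by (simp_all add: r_def)
        show "summable (\<lambda>n. r ^ n)" using r by (intro summable_geometric) simp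
        show "norm (\<bar>(-1) ^ n * (1 / real (2 * n + 1))\<bar> * exp (- (pi * real (2 * n + 1)) * t)) \<le> r ^ n" if "n \<ge> 0" for n
        proof -
          have "1 / real (2 * n + 1) * r ^ (n * 2 + 1) \<le> 1 * r ^ n"
            using r by (intro mult_mono power_decreasing) auto
          then show ?thesis unfolding ex r_def[symmetric] using r by (simp add: abs_mult power_abs)
        qed
      qed
    next
      have "summable (\<lambda>n. pi powr (- (\<sigma> + 1)) * real (2 * n + 1) powr (- (2 + \<sigma>)))" by (rule summable_mult[OF sm])
      then show "summable (\<lambda>n. \<bar>(-1) ^ n * (1 / real (2 * n + 1))\<bar> * (pi * real (2 * n + 1)) powr (- (\<sigma> + 1)))"
        unfolding sp[symmetric] by (simp add: abs_mult power_abs)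
    qed
    also have "(\<Sum>n. ((-1) ^ n * (1 / real (2 * n + 1))) * (pi * real (2 * n + 1)) powr (- (\<sigma> + 1))) = (\<Sum>n. pi powr (- (\<sigma> + 1)) * ((-1) ^ n * real (2 * n + 1) powr (- (2 + \<sigma>))))"
      by (rule suminf_cong) (simp only: mult.assoc sp mult.left_commute)
    also have "\<dots> = pi powr (- (\<sigma> + 1)) * Z" unfolding Z_def by (rule suminf_mult[OF sma])
    also have "Gamma (\<sigma> + 1) * (pi powr (- (\<sigma> + 1)) * Z) = A * Z" by (simp add: A_def)
    finally have "has_bochner_integral lborel (\<lambda>t. indicator {0<..} t *\<^sub>R (t powr \<sigma> * arctan (exp (- pi * t)))) (A * Z)" .
    from has_bochner_integral_mult_right[OF this, of 4] show ?thesis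
      by (simp only: real_scaleR_def mult.assoc mult.left_commute)
  qed
  have J: "(\<integral>\<^sup>+x. ennreal (\<bar>Re (?S (of_real x))\<bar> / (x^2 + t^2)) \<partial>lborel) = ennreal (4 / t * cosh (pi * t) * arctan (exp (- pi * t)))" if "t > 0" for t
    unfolding S by (rule nn_integral_abs_cos[OF that])
  have f: "t powr (\<sigma> + 1) / cosh (pi * t) * (4 / t * cosh (pi * t) * arctan (exp (- pi * t))) = 4 * (t powr \<sigma> * arctan (exp (- pi * t)))" if "t > 0" for t
  proof -
    have "t powr (\<sigma> + 1) = t powr \<sigma> * t" using that by (simp add: powr_add)
    moreover have "cosh (pi * t) > 0" by (rule cosh_real_pos)
    ultimately show ?thesis using that by (simp add: field_simps)
  qed
  have J0: "0 \<le> 4 / t * cosh (pi * t) * arctan (exp (- pi * t))" if "t > 0" for t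
    using that cosh_real_pos[of "pi * t"] by simp
  have hb: "has_bochner_integral lborel (\<lambda>x. \<bar>even_pow \<sigma> x - Re (F (of_real x))\<bar>) V"
    unfolding even_pow_def F_def V_def by (rule gap_has_integral(1)[OF J hb1 f J0])
  have Vv: "of_real V = of_real ((4 / pi) powr ((3 + \<sigma>) / 2) * Gamma ((1 + \<sigma>) / 2)) * L_chi4 (of_real (2 + \<sigma>))"
  proof -
    have z: "L_chi4 (of_real (2 + \<sigma>)) = of_real Z" unfolding Z_def by (rule suminf_L_chi4(2)) (use sig in simp)
    have "V = (4 * kappa * Gamma (\<sigma> + 1) * pi powr (- (\<sigma> + 1))) * Z" by (simp add: V_def A_def)
    also have "4 * kappa * Gamma (\<sigma> + 1) * pi powr (- (\<sigma> + 1)) = (4 / pi) powr ((3 + \<sigma>) / 2) * Gamma ((1 + \<sigma>) / 2)" by (rule kappa_Gamma_pi)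
    finally show ?thesis unfolding z by (simp only: of_real_mult)
  qed
  have ch: "cos (pi * (of_int k + 1/2)) = 0" for k :: int using cos_pi_half_integer[of k] by (simp only: add.commute)
  have hne: "of_int k + 1/2 \<noteq> (0::real)" for k :: int
  proof
    assume "of_int k + 1/2 = (0::real)"
    then have "cos (pi * (of_int k + 1/2)) = 1" by (simp only:) simp
    then show False unfolding ch by simp
  qed
  have interp: "even_pow \<sigma> (of_int k + 1/2) = Re (F (of_real (of_int k + 1/2)))" for k :: int
    using gap[OF hne[of k]] unfolding ch by simp
  have cont: "isCont (even_pow \<sigma>) x" if "x \<noteq> 0" for x
    unfolding even_pow_def[abs_def] using that by (intro continuous_intros) auto
  have other: "ennreal V \<le> L1_distance (g_pow \<sigma>) G" "L1_distance (g_pow \<sigma>) G = ennreal V \<Longrightarrow> G = F"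
    if G: "exp_type_le G pi" for G
  proof -
    note X = sgn_cos_extremal[OF T' R' even_pow_measurable cont gap0 hb interp G]
    show "ennreal V \<le> L1_distance (g_pow \<sigma>) G"
      unfolding L1_distance_g_pow by (rule X(1))
    show "L1_distance (g_pow \<sigma>) G = ennreal V \<Longrightarrow> G = F"
      unfolding L1_distance_g_pow by (rule X(2))
  qed
  show ?thesis
  proof
    show "\<forall>l. best_approximation pi (g_pow \<sigma>) l \<longleftrightarrow> l = F"
      unfolding best_approximation_def
      by (intro allI) (rule unique_minimizer_iff[where P="\<lambda>G. exp_type_le G pi" and \<Lambda>="L1_distance (g_pow \<sigma>)", OF T' nn_integral_gap_eq(1)[OF R' hb] other])
    show "interpolates_on F (g_pow \<sigma>) half_integers"
      unfolding interpolates_on_def half_integers_def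
    proof safe
      fix n :: int
      have "F (of_real (of_int n + 1 / 2)) = of_real (even_pow \<sigma> (of_int n + 1 / 2))"
        unfolding interp using R' by (metis of_real_Re real_on_reals_def)
      moreover have "g_pow \<sigma> (of_int n + 1 / 2) = ereal (even_pow \<sigma> (of_int n + 1 / 2))"
        by (intro g_pow_eq_even_pow disjI1 hne)
      ultimately show "\<exists>y. F (of_real (of_int n + 1 / 2)) = of_real y \<and> g_pow \<sigma> (of_int n + 1 / 2) = ereal y" by blast
    qed
    show "real_on_reals F" by (rule R')
    show "\<forall>x. 0 \<le> ereal (sgn (cos (pi * x))) * (g_pow \<sigma> x - ereal (Re (F (of_real x))))"
    proof
      fix x :: real
      show "0 \<le> ereal (sgn (cos (pi * x))) * (g_pow \<sigma> x - ereal (Re (F (of_real x))))"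
      proof (cases "x = 0")
        case False
        then show ?thesis using gap0[OF False] by (simp add: g_pow_eq_even_pow)
      next
        case x0: True
        show ?thesis
        proof (cases "\<sigma> < 0")
          case True
          then show ?thesis using x0 by (simp add: g_pow_def)
        next
          case False
          moreover have "\<sigma> \<noteq> 0" using sig(2)[rule_format, of 0] by simp
          ultimately have p: "\<sigma> > 0" by simp
          obtain c where "c \<ge> 0" "entire_part 0 = of_real (- (1 * Re (?S 0) * c))" using entire_part_0[OF m(3)[OF p]] by blast
          then show ?thesis using x0 p by (simp add: F_def g_pow_eq_even_pow even_pow_def)
        qed
      qed
    qed
    show "has_bochner_integral lborel (\<lambda>x. complex_of_real (cmod (of_real (even_pow \<sigma> x) - F (of_real x))))
           (of_real ((4 / pi) powr ((3 + \<sigma>) / 2) * Gamma ((1 + \<sigma>) / 2)) * L_chi4 (of_real (2 + \<sigma>)))"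
      using nn_integral_gap_eq(2)[OF R' hb] unfolding Vv .
  qed
qed

theorem corollary21:
  fixes \<sigma> :: real
  assumes "\<sigma> > -1" and "\<forall>n::nat. \<sigma> \<noteq> 2 * real n"
  shows "((\<exists>!l. extremal_minorant (2 * pi) (g_pow \<sigma>) l) \<and>
      (\<forall>l. extremal_minorant (2 * pi) (g_pow \<sigma>) l \<longrightarrow>
         interpolates_on l (g_pow \<sigma>) half_integers \<and>
         has_bochner_integral lborel
           (\<lambda>x. of_real (real_of_ereal (g_pow \<sigma> x)) - l (of_real x))
           (of_real ((2 - 2 powr (1 - \<sigma>)) * gamma_factor (1 + \<sigma>)) *
            riemann_zeta (of_real (1 + \<sigma>)))))
    \<and> (0 < \<sigma> \<longrightarrow>
      (\<exists>!m. extremal_majorant (2 * pi) (g_pow \<sigma>) m) \<and>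
      (\<forall>m. extremal_majorant (2 * pi) (g_pow \<sigma>) m \<longrightarrow>
         interpolates_on m (g_pow \<sigma>) \<int> \<and>
         has_bochner_integral lborel
           (\<lambda>x. m (of_real x) - of_real (real_of_ereal (g_pow \<sigma> x)))
           (of_real (2 * gamma_factor (1 + \<sigma>)) * riemann_zeta (of_real (1 + \<sigma>)))))
    \<and> ((\<exists>!k. best_approximation pi (g_pow \<sigma>) k) \<and>
      (\<forall>k. best_approximation pi (g_pow \<sigma>) k \<longrightarrow>
         interpolates_on k (g_pow \<sigma>) half_integers \<and>
         real_on_reals k \<and>
         (\<forall>x. 0 \<le> ereal (sgn (cos (pi * x))) * (g_pow \<sigma> x - ereal (Re (k (of_real x))))) \<and>
         has_bochner_integral lborel
           (\<lambda>x. of_real (cmod (of_real (real_of_ereal (g_pow \<sigma> x)) - k (of_real x))))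
           (of_real ((4 / pi) powr ((3 + \<sigma>) / 2) * Gamma ((1 + \<sigma>) / 2)) *
            L_chi4 (of_real (2 + \<sigma>)))))"
  unfolding real_of_g_pow
proof (intro conjI impI)
  obtain F where F: "\<forall>l. extremal_minorant (2 * pi) (g_pow \<sigma>) l \<longleftrightarrow> l = F"
    "interpolates_on F (g_pow \<sigma>) half_integers"
    "has_bochner_integral lborel (\<lambda>x. of_real (even_pow \<sigma> x) - F (of_real x))
           (of_real ((2 - 2 powr (1 - \<sigma>)) * gamma_factor (1 + \<sigma>)) * riemann_zeta (of_real (1 + \<sigma>)))"
    by (rule extremal_minorant_characterization[OF assms]) (rule that)
  show "\<exists>!l. extremal_minorant (2 * pi) (g_pow \<sigma>) l" unfolding F(1)[rule_format] by simp
  show "\<forall>l. extremal_minorant (2 * pi) (g_pow \<sigma>) l \<longrightarrow>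
         interpolates_on l (g_pow \<sigma>) half_integers \<and>
         has_bochner_integral lborel (\<lambda>x. of_real (even_pow \<sigma> x) - l (of_real x))
           (of_real ((2 - 2 powr (1 - \<sigma>)) * gamma_factor (1 + \<sigma>)) * riemann_zeta (of_real (1 + \<sigma>)))"
    unfolding F(1)[rule_format] using F(2,3) by blast
next
  assume "0 < \<sigma>"
  then obtain F where F: "\<forall>l. extremal_majorant (2 * pi) (g_pow \<sigma>) l \<longleftrightarrow> l = F"
    "interpolates_on F (g_pow \<sigma>) \<int>"
    "has_bochner_integral lborel (\<lambda>x. F (of_real x) - of_real (even_pow \<sigma> x))
           (of_real (2 * gamma_factor (1 + \<sigma>)) * riemann_zeta (of_real (1 + \<sigma>)))"
    by (rule extremal_majorant_characterization[OF _ assms(2)]) (rule that)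
  show "\<exists>!m. extremal_majorant (2 * pi) (g_pow \<sigma>) m" unfolding F(1)[rule_format] by simp
  show "\<forall>m. extremal_majorant (2 * pi) (g_pow \<sigma>) m \<longrightarrow>
         interpolates_on m (g_pow \<sigma>) \<int> \<and>
         has_bochner_integral lborel (\<lambda>x. m (of_real x) - of_real (even_pow \<sigma> x))
           (of_real (2 * gamma_factor (1 + \<sigma>)) * riemann_zeta (of_real (1 + \<sigma>)))"
    unfolding F(1)[rule_format] using F(2,3) by blast
next
  obtain F where F: "\<forall>l. best_approximation pi (g_pow \<sigma>) l \<longleftrightarrow> l = F"
    "interpolates_on F (g_pow \<sigma>) half_integers" "real_on_reals F"
    "\<forall>x. 0 \<le> ereal (sgn (cos (pi * x))) * (g_pow \<sigma> x - ereal (Re (F (of_real x))))"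
    "has_bochner_integral lborel (\<lambda>x. complex_of_real (cmod (of_real (even_pow \<sigma> x) - F (of_real x))))
           (of_real ((4 / pi) powr ((3 + \<sigma>) / 2) * Gamma ((1 + \<sigma>) / 2)) * L_chi4 (of_real (2 + \<sigma>)))"
    by (rule best_approximation_characterization[OF assms]) (rule that)
  show "\<exists>!k. best_approximation pi (g_pow \<sigma>) k" unfolding F(1)[rule_format] by simp
  show "\<forall>k. best_approximation pi (g_pow \<sigma>) k \<longrightarrow>
         interpolates_on k (g_pow \<sigma>) half_integers \<and>
         real_on_reals k \<and>
         (\<forall>x. 0 \<le> ereal (sgn (cos (pi * x))) * (g_pow \<sigma> x - ereal (Re (k (of_real x))))) \<and>
         has_bochner_integral lborel (\<lambda>x. complex_of_real (cmod (of_real (even_pow \<sigma> x) - k (of_real x))))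
           (of_real ((4 / pi) powr ((3 + \<sigma>) / 2) * Gamma ((1 + \<sigma>) / 2)) * L_chi4 (of_real (2 + \<sigma>)))"
    unfolding F(1)[rule_format] using F(2-5) by blast
qed

end
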